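(* There is a centralized local computation algorithm ($\mathsf{LCA}$) that solves the $(\Delta+1)$-list coloring problem on $n$-vertex graphs of maximum degree $\Delta$ with query complexity $\Delta^{O(1)} \cdot O(\log n)$, with success probability $1 - 1/\mathrm{poly}(n)$.
   Context: The $(\Delta+1)$-list coloring problem: given a graph $G=(V,E)$ with maximum degree $\Delta$, where each vertex $v$ has a list $\Psi(v)$ of colors with $|\Psi(v)| = \Delta+1$, find a proper coloring assigning each $v$ a color in $\Psi(v)$ with adjacent vertices colored differently. Centralized local computation model: the algorithm has oracle access to $G$ via degree queries (given $\mathrm{ID}(v)$, return $\deg(v)$) and neighbor queries (given $\mathrm{ID}(v)$ and index $i\in[1,\Delta]$, return the ID of the $i$-th neighbor of $v$, or $\bot$ if none); it can also access, given $\mathrm{ID}(v)$, the input list $\Psi(v)$ and an infinite random bit string associated with $v$. Given $\mathrm{ID}(v)$, the algorithm must return the output (color) of $v$, and the outputs returned for all vertices must be consistent with a single legal solution. The complexity measure is the number of queries made per output computed. *)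

theory Defs
  imports "HOL-Probability.Probability"
begin

text \<open>
  Vertices are identified with their IDs, which are arbitrary distinct natural numbers (they need
  not come from a range known to the algorithm). The list \<^verbatim>\<open>nbrs v\<close> fixes the order that gives
  meaning to ``the i-th neighbor of v''.
\<close>

record input =
  verts :: "nat set"
  adj :: "nat \<Rightarrow> nat \<Rightarrow> bool"
  nbrs :: "nat \<Rightarrow> nat list"
  palette :: "nat \<Rightarrow> nat set"

definition simple_graph :: "input \<Rightarrow> bool" where
  "simple_graph I \<longleftrightarrow>
     finite (verts I) \<and> verts I \<noteq> {} \<and>
     (\<forall>u v. adj I u v \<longrightarrow> u \<in> verts I \<and> v \<in> verts I \<and> u \<noteq> v \<and> adj I v u)"

definition degree :: "input \<Rightarrow> nat \<Rightarrow> nat" where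
  "degree I v = card {u \<in> verts I. adj I v u}"

definition max_degree :: "input \<Rightarrow> nat" where
  "max_degree I = Max (degree I ` verts I)"

definition list_coloring_input :: "input \<Rightarrow> bool" where
  "list_coloring_input I \<longleftrightarrow>
     simple_graph I \<and>
     (\<forall>v \<in> verts I. distinct (nbrs I v) \<and> set (nbrs I v) = {u \<in> verts I. adj I v u}) \<and>
     (\<forall>v \<in> verts I. card (palette I v) = max_degree I + 1)"

definition proper_list_coloring :: "input \<Rightarrow> (nat \<Rightarrow> nat) \<Rightarrow> bool" where
  "proper_list_coloring I col \<longleftrightarrow>
     (\<forall>v \<in> verts I. col v \<in> palette I v) \<and>
     (\<forall>u \<in> verts I. \<forall>v \<in> verts I. adj I u v \<longrightarrow> col u \<noteq> col v)"

text \<open>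
  The computation on one given ID, as an adaptive decision tree: each inner node names an oracle
  call, and its continuation receives the answer. The first argument of every call is the ID the
  call is about; random strings are read bit by bit.
\<close>

datatype lca =
    Output nat
  | Degree_Query nat "nat \<Rightarrow> lca"
  | Neighbor_Query nat nat "nat option \<Rightarrow> lca"
  | Read_List nat "nat set \<Rightarrow> lca"
  | Read_Bit nat nat "bool \<Rightarrow> lca"

text \<open>The index i is counted from 1; \<^verbatim>\<open>None\<close> is the answer written as bottom.\<close>

definition neighbor_answer :: "input \<Rightarrow> nat \<Rightarrow> nat \<Rightarrow> nat option" where
  "neighbor_answer I v i =
     (if 1 \<le> i \<and> i \<le> length (nbrs I v) then Some (nbrs I v ! (i - 1)) else None)"

text \<open>In the following, \<^verbatim>\<open>r v j\<close> is the j-th bit of the random string of the vertex v.\<close>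

primrec run :: "input \<Rightarrow> (nat \<Rightarrow> nat \<Rightarrow> bool) \<Rightarrow> lca \<Rightarrow> nat" where
  "run I r (Output c) = c"
| "run I r (Degree_Query v f) = run I r (f (degree I v))"
| "run I r (Neighbor_Query v i f) = run I r (f (neighbor_answer I v i))"
| "run I r (Read_List v f) = run I r (f (palette I v))"
| "run I r (Read_Bit v j f) = run I r (f (r v j))"

text \<open>Only degree and neighbor queries are charged.\<close>

primrec queries :: "input \<Rightarrow> (nat \<Rightarrow> nat \<Rightarrow> bool) \<Rightarrow> lca \<Rightarrow> nat" where
  "queries I r (Output c) = 0"
| "queries I r (Degree_Query v f) = Suc (queries I r (f (degree I v)))"
| "queries I r (Neighbor_Query v i f) = Suc (queries I r (f (neighbor_answer I v i)))"
| "queries I r (Read_List v f) = queries I r (f (palette I v))"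
| "queries I r (Read_Bit v j f) = queries I r (f (r v j))"

text \<open>
  The oracle is only specified for IDs of actual vertices and neighbor indices between 1 and the
  maximum degree; a legal run never leaves this domain. In particular, the unspecified values
  of \<^verbatim>\<open>palette\<close> and r outside the vertex set play no role.
\<close>

primrec legal_run :: "input \<Rightarrow> (nat \<Rightarrow> nat \<Rightarrow> bool) \<Rightarrow> lca \<Rightarrow> bool" where
  "legal_run I r (Output c) \<longleftrightarrow> True"
| "legal_run I r (Degree_Query v f) \<longleftrightarrow>
     v \<in> verts I \<and> legal_run I r (f (degree I v))"
| "legal_run I r (Neighbor_Query v i f) \<longleftrightarrow>
     v \<in> verts I \<and> 1 \<le> i \<and> i \<le> max_degree I \<and> legal_run I r (f (neighbor_answer I v i))"
| "legal_run I r (Read_List v f) \<longleftrightarrow>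
     v \<in> verts I \<and> legal_run I r (f (palette I v))"
| "legal_run I r (Read_Bit v j f) \<longleftrightarrow>
     v \<in> verts I \<and> legal_run I r (f (r v j))"

definition random_strings :: "input \<Rightarrow> (nat \<Rightarrow> nat \<Rightarrow> bool) measure" where
  "random_strings I =
     (\<Pi>\<^sub>M v\<in>verts I. \<Pi>\<^sub>M j\<in>(UNIV :: nat set). measure_pmf (bernoulli_pmf (1 / 2)))"

end

theory Submission
  imports Defs "HOL-Real_Asymp.Real_Asymp"
begin

text \<open>
  The vertices are colored in randomized stages, whose outcome at \<open>v\<close> only depends on the
  surroundings of \<open>v\<close>; the few vertices that all stages miss are colored greedily by ID. For a
  bounded maximum degree \<open>D\<close>, the first two stages are skipped.

  Stage one is a single random color trial. It leaves a vertex whose neighborhood is far from a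
  clique with the same palette (\<open>spars\<close> large) with many more available colors than uncolored
  neighbors. The remaining vertices form clusters that are almost cliques; in stage two the leader
  of each cluster hands out distinct colors at random to its members, except for a few members that
  are put aside and provide the slack for the others. After this, except with probability
  \<open>exp (- \<Omega>(D\<^bsup>1/4\<^esup>))\<close>, a vertex is colored, put aside, or active, which means that a constant
  fraction of its available colors is not threatened by uncolored neighbors. Active vertices succeed
  with constant probability in each of \<open>O(log D)\<close> further trials, so a vertex is left over with
  probability below any chosen power of \<open>1/D\<close>, independently for vertices whose balls of constant
  radius are disjoint. Hence with high probability the left-over vertices form components of size
  \<open>D\<^bsup>O(1)\<^esup> log n\<close>: a larger one would contain a long walk through many separated left-over
  vertices, and there are too few walks for that.

  The late trials would depend on a ball of radius \<open>O(log D)\<close>, which is too large to read. But a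
  trial of \<open>u\<close> only depends on the neighbors that try the same color, so the number of trials that
  have to be looked at is multiplied by a constant per round; an exponential moment bounds the number
  for a whole component. The algorithm explores exactly the vertices that all inputs compatible with
  the answers so far require.
\<close>

section \<open>Finite uniform product spaces\<close>

text \<open>The exponent 1/4 balances two sources of slack. Put L = D^(1/4). If
  \<open>spars g v\<close> exceeds D L, the first trial or the missing degree gives \<open>v\<close>
  slack of order \<open>spars g v / D\<close> > L, which matches the number of its competitors.
  Below this threshold that slack may vanish although up to O(L) cluster members fail; there the
  vertices put aside take over. A cluster can put members aside with probability of order 1 / sqrt D
  without disturbing other clusters, and this yields order sqrt D = L^2 of them. The coloring is
  proper for every outcome of the random bits. Chance only decides how many vertices have to be
  read, so failure means exceeding a budget computed from n and D, and the query bound holds in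
  every run. The budget stays polynomial in D because each of the O(log D) rounds costs a constant
  factor. Slack is not a sum of independent variables: whether a try is useful depends on earlier
  ones. Therefore seeds are revealed one by one, and all tail bounds of the first stage are
  exponential supermartingales on finite uniform spaces; the infinite product measure enters only
  through the bits that are read.\<close>

definition avg :: "nat \<Rightarrow> 'i set \<Rightarrow> (('i \<Rightarrow> nat) \<Rightarrow> real) \<Rightarrow> real" where
  "avg B J f = (\<Sum>s\<in>PiE J (\<lambda>_. {..<B}). f s) / real B ^ card J"

abbreviation prb :: "nat \<Rightarrow> 'i set \<Rightarrow> (('i \<Rightarrow> nat) \<Rightarrow> bool) \<Rightarrow> real" where
  "prb B J P \<equiv> avg B J (\<lambda>s. of_bool (P s))"

text \<open>Quantifies over all functions, not only those of the product space, so that updated or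
  overridden seeds need no domain conditions.\<close>

definition dep :: "(('i \<Rightarrow> nat) \<Rightarrow> 'a) \<Rightarrow> 'i set \<Rightarrow> bool" where
  "dep f A \<longleftrightarrow> (\<forall>s t. (\<forall>i\<in>A. s i = t i) \<longrightarrow> f s = f t)"

lemma depD: "dep f A \<Longrightarrow> (\<And>i. i \<in> A \<Longrightarrow> s i = t i) \<Longrightarrow> f s = f t"
  unfolding dep_def by blast

lemma avg_add: "avg B J (\<lambda>s. f s + g s) = avg B J f + avg B J g"
  by (simp add: avg_def sum.distrib add_divide_distrib)

lemma avg_cmult: "avg B J (\<lambda>s. c * f s) = c * avg B J f"
  by (simp add: avg_def sum_distrib_left)

lemma avg_sum: "avg B J (\<lambda>s. \<Sum>x\<in>A. f x s) = (\<Sum>x\<in>A. avg B J (f x))"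
  unfolding avg_def by (subst sum.swap) (simp add: sum_divide_distrib)

lemma avg_mono:
  assumes "\<And>s. s \<in> PiE J (\<lambda>_. {..<B}) \<Longrightarrow> f s \<le> g s"
  shows "avg B J f \<le> avg B J g"
  unfolding avg_def by (intro divide_right_mono sum_mono assms) auto

lemma avg_cong:
  assumes "\<And>s. s \<in> PiE J (\<lambda>_. {..<B}) \<Longrightarrow> f s = g s"
  shows "avg B J f = avg B J g"
  unfolding avg_def by (simp add: assms cong: sum.cong)

lemma avg_const:
  assumes "finite J" "B > 0"
  shows "avg B J (\<lambda>_. c) = c"
  using assms by (simp add: avg_def card_PiE)

lemma avg_nonneg: "(\<And>s. s \<in> PiE J (\<lambda>_. {..<B}) \<Longrightarrow> 0 \<le> f s) \<Longrightarrow> 0 \<le> avg B J f"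
  unfolding avg_def by (intro divide_nonneg_nonneg sum_nonneg) auto

lemma avg_insert:
  assumes "finite J" "j \<notin> J"
  shows "avg B (insert j J) f = avg B J (\<lambda>s. (\<Sum>x<B. f (s(j := x))) / real B)"
proof -
  have "(\<Sum>s\<in>PiE (insert j J) (\<lambda>_. {..<B}). f s) =
        (\<Sum>(x, s)\<in>{..<B} \<times> PiE J (\<lambda>_. {..<B}). f (s(j := x)))"
    unfolding PiE_insert_eq
    by (subst sum.reindex[OF inj_combinator[OF assms(2)]]) (simp add: case_prod_unfold)
  also have "\<dots> = (\<Sum>x<B. \<Sum>s\<in>PiE J (\<lambda>_. {..<B}). f (s(j := x)))"
    by (subst sum.cartesian_product) simp
  also have "\<dots> = (\<Sum>s\<in>PiE J (\<lambda>_. {..<B}). \<Sum>x<B. f (s(j := x)))"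
    by (rule sum.swap)
  finally show ?thesis
    using assms by (simp add: avg_def sum_divide_distrib)
qed

text \<open>Fubini for two blocks of coordinates; used later to condition on the stages that are
  already revealed.\<close>

lemma avg_union:
  assumes "finite A" "finite C" "A \<inter> C = {}"
  shows "avg B (A \<union> C) f = avg B A (\<lambda>s. avg B C (\<lambda>t. f (override_on s t C)))"
  using assms(2,3)
proof (induction C arbitrary: f rule: finite_induct)
  case empty
  have "avg B {} g = g (\<lambda>_. undefined)" for g :: "('a \<Rightarrow> nat) \<Rightarrow> real"
    by (simp add: avg_def)
  then show ?case by simp
next
  case (insert c C)
  have "avg B (A \<union> insert c C) f = avg B (A \<union> C) (\<lambda>s. (\<Sum>x<B. f (s(c := x))) / real B)"
    using insert assms(1) by (simp add: avg_insert)
  also have "\<dots> = avg B A (\<lambda>s. avg B C (\<lambda>t. (\<Sum>x<B. f ((override_on s t C)(c := x))) / real B))"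
    using insert by simp
  also have "\<dots> = avg B A (\<lambda>s. avg B (insert c C) (\<lambda>t. f (override_on s t (insert c C))))"
  proof -
    have *: "(override_on s t C)(c := x) = override_on s (t(c := x)) (insert c C)" for s t :: "'a \<Rightarrow> nat" and x
      using insert(2) by (auto simp: override_on_def)
    show ?thesis using insert(1,2) by (simp add: avg_insert *)
  qed
  finally show ?case .
qed

lemma avg_marginal:
  assumes "finite J" "A \<subseteq> J" "B > 0" "dep f A"
  shows "avg B J f = avg B A f"
proof -
  have fin: "finite A" "finite (J - A)" using assms finite_subset by auto
  have "avg B (A \<union> (J - A)) f = avg B A (\<lambda>s. avg B (J - A) (\<lambda>t. f (override_on s t (J - A))))"
    using fin by (intro avg_union) auto
  also have "\<dots> = avg B A f"
  proof (rule avg_cong)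
    fix s
    have "f (override_on s t (J - A)) = f s" for t
      by (rule depD[OF assms(4)]) (auto simp: override_on_def)
    then show "avg B (J - A) (\<lambda>t. f (override_on s t (J - A))) = f s"
      using fin assms(3) by (simp add: avg_const)
  qed
  finally show ?thesis using assms(2) by (simp add: Un_absorb1)
qed

lemma avg_indep2:
  assumes "finite J" "B > 0" "dep f A" "dep g C" "A \<inter> C = {}" "A \<subseteq> J" "C \<subseteq> J"
  shows "avg B J (\<lambda>s. f s * g s) = avg B J f * avg B J g"
proof -
  have fin: "finite A" "finite C" using assms(1,6,7) by (auto intro: finite_subset)
  have "dep (\<lambda>s. f s * g s) (A \<union> C)"
    using assms(3,4) unfolding dep_def by (metis UnCI)
  then have "avg B J (\<lambda>s. f s * g s) = avg B (A \<union> C) (\<lambda>s. f s * g s)"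
    using assms by (intro avg_marginal) auto
  also have "\<dots> = avg B A (\<lambda>s. avg B C (\<lambda>t. f (override_on s t C) * g (override_on s t C)))"
    using fin assms by (intro avg_union)
  also have "\<dots> = avg B A (\<lambda>s. avg B C (\<lambda>t. f s * g t))"
  proof (intro avg_cong)
    fix s t
    have "f (override_on s t C) = f s"
      using assms(5) by (intro depD[OF assms(3)]) (auto simp: override_on_def)
    moreover have "g (override_on s t C) = g t"
      by (intro depD[OF assms(4)]) (auto simp: override_on_def)
    ultimately show "f (override_on s t C) * g (override_on s t C) = f s * g t" by simp
  qed
  also have "\<dots> = avg B C g * avg B A f"
    using avg_cmult[of B A "avg B C g" f] by (simp add: avg_cmult mult.commute)
  also have "\<dots> = avg B J f * avg B J g"
    using assms avg_marginal[of J A B f] avg_marginal[of J C B g] by simp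
  finally show ?thesis .
qed

lemma avg_indep:
  assumes "finite J" "B > 0" "finite S"
    and "\<And>v. v \<in> S \<Longrightarrow> dep (f v) (K v)" "\<And>v. v \<in> S \<Longrightarrow> K v \<subseteq> J"
    and "\<And>v w. v \<in> S \<Longrightarrow> w \<in> S \<Longrightarrow> v \<noteq> w \<Longrightarrow> K v \<inter> K w = {}"
  shows "avg B J (\<lambda>s. \<Prod>v\<in>S. f v s) = (\<Prod>v\<in>S. avg B J (f v))"
  using assms(3-)
proof (induction S rule: finite_induct)
  case empty
  show ?case using assms by (simp add: avg_const)
next
  case (insert x S)
  have "dep (\<lambda>s. \<Prod>v\<in>S. f v s) (\<Union>(K ` S))"
    unfolding dep_def
  proof (intro allI impI prod.cong refl)
    fix s t :: "'a \<Rightarrow> nat" and v assume "\<forall>i\<in>\<Union>(K ` S). s i = t i" "v \<in> S"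
    then show "f v s = f v t" using insert(4)[of v] by (auto intro: depD)
  qed
  moreover have "K x \<inter> \<Union>(K ` S) = {}"
    using insert.prems(3)[of x] insert.hyps by blast
  ultimately have "avg B J (\<lambda>s. f x s * (\<Prod>v\<in>S. f v s)) = avg B J (f x) * avg B J (\<lambda>s. \<Prod>v\<in>S. f v s)"
    using assms(1,2) insert by (intro avg_indep2[where A = "K x" and C = "\<Union>(K ` S)"]) auto
  then show ?case using insert by simp
qed

text \<open>The coordinate with the largest key is averaged out: all other exponents ignore it, and
  its own factor has mean at most 1 whatever the rest. This is the bound for an exponential
  supermartingale, with \<open>key\<close> as the order of revelation.\<close>

lemma avg_exp_seq:
  fixes key :: "'i \<Rightarrow> nat"
  assumes "finite J" "inj_on key J" "B > 0"
    and "\<And>j. j \<in> J \<Longrightarrow> dep (\<phi> j) {i\<in>J. key i \<le> key j}"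
    and "\<And>j s. j \<in> J \<Longrightarrow> (\<Sum>x<B. exp (\<phi> j (s(j := x)))) / real B \<le> 1"
  shows "avg B J (\<lambda>s. exp (\<Sum>j\<in>J. \<phi> j s)) \<le> 1"
  using assms(1,2,4,5)
proof (induction "card J" arbitrary: J)
  case 0
  then show ?case using assms(3) by (simp add: avg_const)
next
  case (Suc n)
  then have ne: "J \<noteq> {}" by auto
  define j where "j = arg_max_on key J"
  have j: "j \<in> J" "\<And>i. i \<in> J \<Longrightarrow> key i \<le> key j"
  proof -
    have "Max (key ` J) \<in> key ` J" using Suc ne by (intro Max_in) auto
    then obtain m where m: "m \<in> J" "key m = Max (key ` J)" by auto
    then have "\<exists>m. m \<in> J \<and> (\<forall>i\<in>J. key i \<le> key m)" using Suc by (auto intro!: exI[of _ m])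
    then have "is_arg_max key (\<lambda>x. x \<in> J) j"
      unfolding j_def arg_max_on_def arg_max_def
      by (intro someI_ex[of "is_arg_max key (\<lambda>x. x \<in> J)"]) (auto simp: is_arg_max_def linorder_not_less)
    then show "j \<in> J" "\<And>i. i \<in> J \<Longrightarrow> key i \<le> key j"
      by (auto simp: is_arg_max_def linorder_not_less)
  qed
  define J' where "J' = J - {j}"
  have J': "J = insert j J'" "j \<notin> J'" "finite J'" using j Suc by (auto simp: J'_def)
  have less: "\<not> key j \<le> key i" if "i \<in> J'" for i
    using j(2)[of i] that Suc.prems(2) J' by (auto simp: inj_on_def)
  have dep': "dep (\<phi> i) {i'\<in>J'. key i' \<le> key i}" if "i \<in> J'" for i
  proof -
    have "{i'\<in>J. key i' \<le> key i} = {i'\<in>J'. key i' \<le> key i}" using less[OF that] J' by auto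
    then show ?thesis using Suc.prems(3)[of i] that J' by auto
  qed
  have upd: "\<phi> i (s(j := x)) = \<phi> i s" if "i \<in> J'" for i s x
    using J'(2) by (intro depD[OF dep'[OF that]]) auto
  have "avg B J (\<lambda>s. exp (\<Sum>j\<in>J. \<phi> j s)) =
      avg B J' (\<lambda>s. (\<Sum>x<B. exp (\<phi> j (s(j := x)) + (\<Sum>i\<in>J'. \<phi> i s))) / real B)"
    unfolding J'(1) using J'(2,3) upd by (simp add: avg_insert)
  also have "\<dots> = avg B J' (\<lambda>s. exp (\<Sum>i\<in>J'. \<phi> i s) * ((\<Sum>x<B. exp (\<phi> j (s(j := x)))) / real B))"
    by (simp add: exp_add sum_distrib_left mult.commute)
  also have "\<dots> \<le> avg B J' (\<lambda>s. exp (\<Sum>i\<in>J'. \<phi> i s) * 1)"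
    using Suc.prems(4)[OF j(1)] by (intro avg_mono mult_left_mono) auto
  also have "\<dots> \<le> 1"
  proof -
    have "inj_on key J'" using Suc.prems(2) J' by (auto simp: inj_on_def)
    moreover have "n = card J'" using Suc.hyps(2) J' by simp
    ultimately have "avg B J' (\<lambda>s. exp (\<Sum>i\<in>J'. \<phi> i s)) \<le> 1"
      using Suc.hyps(1)[of J'] J' dep' Suc.prems(4) by auto
    then show ?thesis by simp
  qed
  finally show ?case .
qed

lemma prb_mono: "(\<And>s. s \<in> PiE J (\<lambda>_. {..<B}) \<Longrightarrow> P s \<Longrightarrow> Q s) \<Longrightarrow> prb B J P \<le> prb B J Q"
  by (rule avg_mono) auto

lemma prb_union_bound:
  assumes "\<And>s. s \<in> PiE J (\<lambda>_. {..<B}) \<Longrightarrow> P s \<Longrightarrow> \<exists>x\<in>A. Q x s" "finite A"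
  shows "prb B J P \<le> (\<Sum>x\<in>A. prb B J (Q x))"
proof -
  have "prb B J P \<le> avg B J (\<lambda>s. \<Sum>x\<in>A. of_bool (Q x s))"
  proof (rule avg_mono)
    fix s assume s: "s \<in> PiE J (\<lambda>_. {..<B})"
    show "of_bool (P s) \<le> (\<Sum>x\<in>A. of_bool (Q x s) :: real)"
    proof (cases "P s")
      case True
      then obtain x where "x \<in> A" "Q x s" using assms s by blast
      then have "of_bool (Q x s) \<le> (\<Sum>x\<in>A. of_bool (Q x s) :: real)"
        using assms(2) by (intro member_le_sum) auto
      then show ?thesis using \<open>Q x s\<close> by (simp add: of_bool_def)
    qed (simp add: sum_nonneg)
  qed
  then show ?thesis by (simp add: avg_sum)
qed

lemma prb_disj:
  assumes "\<And>s. s \<in> PiE J (\<lambda>_. {..<B}) \<Longrightarrow> P s \<Longrightarrow> Q s \<or> R s"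
  shows "prb B J P \<le> prb B J Q + prb B J R"
proof -
  have "prb B J P \<le> avg B J (\<lambda>s. of_bool (Q s) + of_bool (R s))"
    using assms by (intro avg_mono) (auto split: if_splits)
  then show ?thesis by (simp add: avg_add)
qed

text \<open>Markov's inequality for \<open>exp X\<close>.\<close>

lemma prb_exp_le:
  assumes "avg B J (\<lambda>s. exp (X s)) \<le> 1"
    and "\<And>s. s \<in> PiE J (\<lambda>_. {..<B}) \<Longrightarrow> P s \<Longrightarrow> a \<le> X s"
  shows "prb B J P \<le> exp (- a)"
proof -
  have "prb B J P \<le> avg B J (\<lambda>s. exp (- a) * exp (X s))"
  proof (rule avg_mono)
    fix s assume "s \<in> PiE J (\<lambda>_. {..<B})"
    then show "of_bool (P s) \<le> exp (- a) * exp (X s)"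
      using assms(2)[of s] by (auto simp flip: exp_add)
  qed
  also have "\<dots> = exp (- a) * avg B J (\<lambda>s. exp (X s))" by (rule avg_cmult)
  also have "\<dots> \<le> exp (- a) * 1" using assms(1) by (intro mult_left_mono) auto
  finally show ?thesis by simp
qed

text \<open>The residue of a uniform number of b bits is uniform: one more bit adds a second block
  with the same residues.\<close>

lemma sum_mod_pow2:
  fixes F :: "nat \<Rightarrow> real"
  assumes "k \<le> b"
  shows "(\<Sum>x<2^b. F (x mod 2^k)) / 2^b = (\<Sum>i<2^k. F i) / 2^k"
  using assms
proof (induction b rule: dec_induct)
  case base
  show ?case by simp
next
  case (step b)
  have "(\<Sum>x<2^Suc b. F (x mod 2^k)) = (\<Sum>x<2^b. F (x mod 2^k)) + (\<Sum>x=2^b..<2^b+2^b. F (x mod 2^k))"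
    by (simp add: lessThan_atLeast0 sum.atLeastLessThan_concat flip: mult_2)
  also have "(\<Sum>x=2^b..<2^b+2^b. F (x mod 2^k)) = (\<Sum>x<2^b. F ((x + 2^b) mod 2^k))"
    using sum.shift_bounds_nat_ivl[of "\<lambda>x. F (x mod 2^k)" 0 "2^b" "2^b"] by (simp add: lessThan_atLeast0)
  also have "\<dots> = (\<Sum>x<2^b. F (x mod 2^k))"
  proof -
    have "2^k dvd (2^b :: nat)" using step by (simp add: le_imp_power_dvd)
    then have "(x + 2^b) mod 2^k = x mod 2^k" for x :: nat
      by (metis mod_add_right_eq dvd_eq_mod_eq_0 add_0_right)
    then show ?thesis by simp
  qed
  finally show ?case using step by (simp add: field_simps)
qed

section \<open>The coloring procedure\<close>

text \<open>\<open>dg\<close> is the maximum degree, \<open>hh\<close> the constant in the definition of active vertices; the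
  first two stages only color vertices if \<open>big\<close> holds. The seed of \<open>(u, c)\<close> is the random
  number that \<open>u\<close> uses in stage \<open>c\<close>: the color trial (0), being put aside (1), the assignment
  within a cluster (2), and the later rounds (from 3 on).\<close>

record gr =
  nb :: "nat \<Rightarrow> nat set"
  pal :: "nat \<Rightarrow> nat set"
  dg :: nat
  hh :: nat
  big :: bool

type_synonym seeds = "nat \<times> nat \<Rightarrow> nat"

definition kk :: "nat \<Rightarrow> nat" where
  "kk m = (LEAST k. m \<le> 2 ^ k)"

text \<open>Since seeds are uniform below a power of two, \<open>pick\<close> selects each element of \<open>A\<close> with
  probability exactly \<open>1 / 2 ^ k\<close>, and nothing otherwise.\<close>

definition pick :: "nat set \<Rightarrow> nat \<Rightarrow> nat \<Rightarrow> nat option" where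
  "pick A k i = (if i mod 2 ^ k < card A then Some (sorted_list_of_set A ! (i mod 2 ^ k)) else None)"

text \<open>The factor 2048 bounds the probability that a vertex tries any color by 1/2048. Later
  tries then destroy only a small part of what earlier ones gain.\<close>

definition att :: "gr \<Rightarrow> seeds \<Rightarrow> nat \<Rightarrow> nat option" where
  "att g w u = (if big g then pick (pal g u) (kk (2048 * (dg g + 1))) (w (u, 0)) else None)"

text \<open>A smaller ID blocks even if it fails to keep the color itself. The outcome at
  \<open>u\<close> thus depends only on attempts of IDs up to \<open>u\<close>, which the revelation
  in the order of the IDs relies on. Equal \<open>None\<close> values do no harm, the result being
  \<open>None\<close> in either case.\<close>

definition col1 :: "gr \<Rightarrow> seeds \<Rightarrow> nat \<Rightarrow> nat option" where
  "col1 g w u = (if \<exists>z\<in>nb g u. z < u \<and> att g w z = att g w u then None else att g w u)"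

definition av1 :: "gr \<Rightarrow> seeds \<Rightarrow> nat \<Rightarrow> nat set" where
  "av1 g w u = {x \<in> pal g u. \<forall>z\<in>nb g u. col1 g w z \<noteq> Some x}"

definition codeg :: "gr \<Rightarrow> nat \<Rightarrow> nat \<Rightarrow> nat" where
  "codeg g u v = card (nb g u \<inter> nb g v)"

definition nonadj :: "gr \<Rightarrow> nat \<Rightarrow> nat" where
  "nonadj g v = (\<Sum>u\<in>nb g v. card {z \<in> nb g v. z \<noteq> u \<and> z \<notin> nb g u})"

definition mism :: "gr \<Rightarrow> nat \<Rightarrow> nat" where
  "mism g v = (\<Sum>u\<in>nb g v. card (pal g u - pal g v))"

text \<open>Divided by \<open>dg\<close>, this bounds below (up to a constant) the number of excess colors that
  \<open>v\<close> gains in the first color trial, and bounds above how far \<open>v\<close> is from an isolated clique.\<close>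

definition spars :: "gr \<Rightarrow> nat \<Rightarrow> nat" where
  "spars g v = mism g v + nonadj g v + dg g * (dg g - card (nb g v))"

definition dense :: "gr \<Rightarrow> nat \<Rightarrow> bool" where
  "dense g v \<longleftrightarrow> 99 * dg g \<le> 100 * card {u \<in> nb g v. 99 * dg g \<le> 100 * codeg g u v}"

text \<open>Searching only two steps away keeps the definition local. For positive
  \<open>dg g\<close> nothing is lost, as a vertex with the required codegree has a common neighbor
  with \<open>v\<close> (\<open>cls_iff\<close>).\<close>

definition cls :: "gr \<Rightarrow> nat \<Rightarrow> nat set" where
  "cls g v = {z \<in> \<Union>(nb g ` nb g v). dense g z \<and> dg g \<le> 2 * codeg g v z}"

definition leader :: "gr \<Rightarrow> nat \<Rightarrow> bool" where
  "leader g r \<longleftrightarrow> big g \<and> dense g r \<and>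
     (\<forall>z\<in>cls g r. spars g r < spars g z \<or> spars g r = spars g z \<and> r \<le> z)"

text \<open>The threshold 9/10 keeps clusters disjoint: two leaders with a common member share at
  least 8/10 of \<open>dg g\<close> neighbors, so each lies in the class of the other, where both
  are minimal. The set is empty if \<open>r\<close> is no leader.\<close>

definition clu :: "gr \<Rightarrow> nat \<Rightarrow> nat set" where
  "clu g r = {u \<in> insert r (nb g r). leader g r \<and> 9 * dg g \<le> 10 * codeg g u r}"

text \<open>For positive \<open>dg g\<close> and the least \<open>j\<close> with
  \<open>dg g \<le> 4 ^ j\<close>, the number \<open>2 ^ j\<close> lies between the square root of
  \<open>dg g\<close> and twice that root. So this is a coin of probability of order 1 / sqrt (dg
  g).\<close>

definition smp :: "gr \<Rightarrow> seeds \<Rightarrow> nat \<Rightarrow> bool" where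
  "smp g w z \<longleftrightarrow> w (z, 1) mod 2 ^ (LEAST j. dg g \<le> 4 ^ j) = 0"

text \<open>The squared bound leaves a candidate at most sqrt (dg g) neighbors outside its cluster,
  and so at most that many members of another cluster that it can keep from being put aside.\<close>

definition cand :: "gr \<Rightarrow> seeds \<Rightarrow> nat \<Rightarrow> nat \<Rightarrow> bool" where
  "cand g w r z \<longleftrightarrow> z \<in> clu g r \<and> att g w z = None \<and> (card (nb g z - clu g r))\<^sup>2 \<le> dg g \<and> smp g w z"

definition qs :: "gr \<Rightarrow> seeds \<Rightarrow> nat \<Rightarrow> bool" where
  "qs g w z \<longleftrightarrow> (\<exists>r\<in>insert z (nb g z). cand g w r z)"

text \<open>The vertices that are put aside: they stay uncolored until the very end, and those of
  different clusters are not adjacent.\<close>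

definition ps :: "gr \<Rightarrow> seeds \<Rightarrow> nat \<Rightarrow> bool" where
  "ps g w u \<longleftrightarrow> (\<exists>r\<in>insert u (nb g u). cand g w r u \<and> (\<forall>z\<in>nb g u - clu g r. \<not> qs g w z))"

definition mem :: "gr \<Rightarrow> seeds \<Rightarrow> nat \<Rightarrow> nat set" where
  "mem g w r = {u \<in> clu g r. col1 g w u = None \<and> \<not> ps g w u}"

definition injs :: "nat set \<Rightarrow> nat set \<Rightarrow> (nat \<Rightarrow> nat) set" where
  "injs A P = {f \<in> A \<rightarrow>\<^sub>E P. inj_on f A}"

definition sct :: "gr \<Rightarrow> seeds \<Rightarrow> nat \<Rightarrow> nat \<Rightarrow> nat" where
  "sct g w r = from_nat_into (injs (mem g w r) (av1 g w r))
     (w (r, 2) mod card (injs (mem g w r) (av1 g w r)))"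

definition asg :: "gr \<Rightarrow> seeds \<Rightarrow> nat \<Rightarrow> nat option" where
  "asg g w u = (if \<exists>r\<in>insert u (nb g u). u \<in> mem g w r
     then Some (sct g w (SOME r. r \<in> insert u (nb g u) \<and> u \<in> mem g w r) u) else None)"

definition col2 :: "gr \<Rightarrow> seeds \<Rightarrow> nat \<Rightarrow> nat option" where
  "col2 g w u = (case col1 g w u of Some x \<Rightarrow> Some x | None \<Rightarrow>
     (case asg g w u of None \<Rightarrow> None | Some x \<Rightarrow>
       (if x \<in> av1 g w u \<and> (\<forall>z\<in>nb g u. asg g w z \<noteq> Some x) then Some x else None)))"

definition av2 :: "gr \<Rightarrow> seeds \<Rightarrow> nat \<Rightarrow> nat set" where
  "av2 g w u = {x \<in> pal g u. \<forall>z\<in>nb g u. col2 g w z \<noteq> Some x}"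

definition unc :: "gr \<Rightarrow> seeds \<Rightarrow> nat \<Rightarrow> nat set" where
  "unc g w u = {z \<in> nb g u. col2 g w z = None \<and> \<not> ps g w z}"

text \<open>Vertices put aside are no competitors: they are left out of \<open>unc\<close> and never
  join the later rounds. Requiring an available color excludes the vacuous inequality
  \<open>0 \<le> 0\<close>, so that truncated subtraction forces \<open>unc\<close> to be strictly
  smaller than \<open>av2\<close>.\<close>

definition act :: "gr \<Rightarrow> seeds \<Rightarrow> nat \<Rightarrow> bool" where
  "act g w u \<longleftrightarrow> col2 g w u = None \<and> \<not> ps g w u \<and> 0 < card (av2 g w u) \<and>
     card (av2 g w u) \<le> hh g * (card (av2 g w u) - card (unc g w u))"

text \<open>Draws from the colors available after stage two, not from those still free in round
  \<open>i\<close>. Attempts therefore depend on a constant radius only and use a separate seed in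
  each round; the rounds interact only through \<open>chi\<close>.\<close>

definition att3 :: "gr \<Rightarrow> seeds \<Rightarrow> nat \<Rightarrow> nat \<Rightarrow> nat option" where
  "att3 g w i u = (if act g w u
     then pick (av2 g w u) (kk (2 * hh g * card (av2 g w u))) (w (u, 3 + i)) else None)"

primrec chi :: "gr \<Rightarrow> seeds \<Rightarrow> nat \<Rightarrow> nat \<Rightarrow> nat option" where
  "chi g w 0 u = None"
| "chi g w (Suc i) u = (case chi g w i u of Some x \<Rightarrow> Some x | None \<Rightarrow>
     (case att3 g w i u of None \<Rightarrow> None | Some y \<Rightarrow>
       (if \<exists>z\<in>nb g u. chi g w i z = Some y \<or> att3 g w i z = Some y then None else Some y)))"

definition tot :: "gr \<Rightarrow> seeds \<Rightarrow> nat \<Rightarrow> nat \<Rightarrow> nat option" where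
  "tot g w T u = (case col2 g w u of Some x \<Rightarrow> Some x | None \<Rightarrow> chi g w T u)"

function final :: "gr \<Rightarrow> seeds \<Rightarrow> nat \<Rightarrow> nat \<Rightarrow> nat" where
  "final g w T u = (case tot g w T u of Some x \<Rightarrow> x | None \<Rightarrow>
     (LEAST x. x \<in> pal g u \<and> (\<forall>z\<in>nb g u. tot g w T z \<noteq> Some x) \<and>
        x \<notin> (\<lambda>z. final g w T z) ` {z \<in> nb g u. z < u \<and> tot g w T z = None}))"
  by auto
termination by (relation "Wellfounded.measure (\<lambda>(g, w, T, u). u)") auto

declare final.simps [simp del]

section \<open>Locality\<close>

definition same :: "gr \<Rightarrow> seeds \<Rightarrow> gr \<Rightarrow> seeds \<Rightarrow> nat \<Rightarrow> bool" where
  "same g w g' w' u \<longleftrightarrow> nb g u = nb g' u \<and> pal g u = pal g' u \<and> (\<forall>c. w (u, c) = w' (u, c)) \<and>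
     dg g = dg g' \<and> hh g = hh g' \<and> big g = big g'"

text \<open>Locality is a relation between two inputs, since the algorithm compares all inputs
  consistent with its knowledge. Neighbor sets are taken from the first input; wherever they are
  followed, they agree with those of the second.\<close>

primrec agr :: "nat \<Rightarrow> gr \<Rightarrow> seeds \<Rightarrow> gr \<Rightarrow> seeds \<Rightarrow> nat \<Rightarrow> bool" where
  "agr 0 g w g' w' u = same g w g' w' u"
| "agr (Suc k) g w g' w' u = (same g w g' w' u \<and> (\<forall>z\<in>nb g u. agr k g w g' w' z))"

primrec bll :: "gr \<Rightarrow> nat \<Rightarrow> nat \<Rightarrow> nat set" where
  "bll g 0 u = {u}"
| "bll g (Suc k) u = insert u (\<Union>z\<in>nb g u. bll g k z)"

lemma agr_same: "agr k g w g' w' u \<Longrightarrow> same g w g' w' u"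
  by (cases k) auto

lemma agr_Suc: "agr (Suc k) g w g' w' u \<Longrightarrow> agr k g w g' w' u"
  by (induction k arbitrary: u) (auto simp: agr_same)

lemma agr_le: "agr k g w g' w' u \<Longrightarrow> j \<le> k \<Longrightarrow> agr j g w g' w' u"
proof (induction k)
  case (Suc k)
  then show ?case by (metis agr_Suc le_SucE)
qed auto

lemma agr_nb: "agr (Suc k) g w g' w' u \<Longrightarrow> z \<in> insert u (nb g u) \<Longrightarrow> agr k g w g' w' z"
  using agr_Suc by auto

lemma self_in_bll [simp]: "u \<in> bll g k u"
  by (cases k) auto

lemma agr_bll: "(\<And>z. z \<in> bll g k u \<Longrightarrow> same g w g' w' z) \<Longrightarrow> agr k g w g' w' u"
proof (induction k arbitrary: u)
  case (Suc k)
  then have "agr k g w g' w' z" if "z \<in> nb g u" for z using that by (intro Suc.IH) auto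
  then show ?case using Suc.prems by auto
qed auto

declare agr.simps [simp del]

lemmas sameD = agr_same[unfolded same_def, THEN conjunct1]
  agr_same[unfolded same_def, THEN conjunct2, THEN conjunct1]

lemma same_par:
  "agr k g w g' w' u \<Longrightarrow> w (u, c) = w' (u, c)" "agr k g w g' w' u \<Longrightarrow> dg g = dg g'"
  "agr k g w g' w' u \<Longrightarrow> hh g = hh g'" "agr k g w g' w' u \<Longrightarrow> big g = big g'"
  using agr_same[of k g w g' w' u] by (auto simp: same_def)

lemma att_loc: "agr k g w g' w' u \<Longrightarrow> att g w u = att g' w' u"
  by (simp add: att_def sameD same_par)

lemma col1_loc: "agr (Suc 0) g w g' w' u \<Longrightarrow> col1 g w u = col1 g' w' u"
proof -
  assume a: "agr (Suc 0) g w g' w' u"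
  have "att g w z = att g' w' z" if "z \<in> insert u (nb g u)" for z
    using agr_nb[OF a that] by (rule att_loc)
  then have "(\<exists>z\<in>nb g u. z < u \<and> att g w z = att g w u) = (\<exists>z\<in>nb g' u. z < u \<and> att g' w' z = att g' w' u)"
    using sameD(1)[OF a] by (intro bex_cong) auto
  then show ?thesis unfolding col1_def by (simp only: att_loc[OF a])
qed

lemma av1_loc:
  assumes "agr (Suc (Suc 0)) g w g' w' u"
  shows "av1 g w u = av1 g' w' u"
proof -
  have "col1 g w z = col1 g' w' z" if "z \<in> nb g u" for z
    using assms that by (intro col1_loc agr_nb[OF assms]) auto
  then show ?thesis unfolding av1_def using sameD[OF assms] by auto
qed

lemma codeg_loc: "agr k g w g' w' u \<Longrightarrow> agr j g w g' w' v \<Longrightarrow> codeg g u v = codeg g' u v"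
  by (simp add: codeg_def sameD)

lemma spars_loc:
  assumes "agr (Suc 0) g w g' w' u"
  shows "spars g u = spars g' u"
proof -
  have z: "nb g z = nb g' z" "pal g z = pal g' z" if "z \<in> nb g u" for z
    using agr_nb[OF assms, of z] that sameD[of 0 g w g' w' z] by auto
  have "nonadj g u = nonadj g' u"
    unfolding nonadj_def sameD(1)[OF assms, symmetric]
    by (intro sum.cong refl arg_cong[where f = card]) (use z in auto)
  moreover have "mism g u = mism g' u"
    unfolding mism_def sameD[OF assms, symmetric]
    by (intro sum.cong refl arg_cong[where f = card]) (use z in auto)
  ultimately show ?thesis using sameD[OF assms] same_par[OF assms] by (simp add: spars_def)
qed

lemma dense_loc:
  assumes "agr (Suc 0) g w g' w' u"
  shows "dense g u = dense g' u"
proof -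
  have "codeg g z u = codeg g' z u" if "z \<in> nb g u" for z
    using agr_nb[OF assms] that assms by (intro codeg_loc) auto
  then have "{z \<in> nb g u. 99 * dg g \<le> 100 * codeg g z u} = {z \<in> nb g' u. 99 * dg g' \<le> 100 * codeg g' z u}"
    using sameD[OF assms] same_par[OF assms] by auto
  then show ?thesis using same_par[OF assms] by (simp add: dense_def)
qed

lemma cls_loc:
  assumes "agr 3 g w g' w' u"
  shows "cls g u = cls g' u" and "z \<in> cls g u \<Longrightarrow> agr (Suc 0) g w g' w' z"
proof -
  have 3: "agr (Suc (Suc (Suc 0))) g w g' w' u" using assms by (simp add: eval_nat_numeral)
  have z2: "agr (Suc 0) g w g' w' z" if "y \<in> nb g u" "z \<in> nb g y" for y z
    using that agr_nb[OF 3, of y] by (auto intro: agr_nb)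
  then show "z \<in> cls g u \<Longrightarrow> agr (Suc 0) g w g' w' z" by (auto simp: cls_def)
  have un: "\<Union>(nb g ` nb g u) = \<Union>(nb g' ` nb g' u)"
    using sameD[OF 3] agr_nb[OF 3] sameD(1) by (metis (no_types, lifting) SUP_cong insertCI)
  have "dense g z = dense g' z \<and> codeg g u z = codeg g' u z" if "z \<in> \<Union>(nb g ` nb g u)" for z
    using that z2 assms by (auto intro!: dense_loc intro: codeg_loc)
  then show "cls g u = cls g' u" unfolding cls_def un[symmetric] same_par(2)[OF assms, symmetric]
    by (intro Collect_cong) metis
qed

lemma leader_loc:
  assumes "agr 3 g w g' w' u"
  shows "leader g u = leader g' u"
proof -
  have "spars g z = spars g' z" if "z \<in> cls g u" for z
    using cls_loc(2)[OF assms that] by (rule spars_loc)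
  moreover have "agr (Suc 0) g w g' w' u" using agr_le[OF assms] by simp
  ultimately show ?thesis
    unfolding leader_def cls_loc(1)[OF assms, symmetric] same_par(4)[OF assms, symmetric]
    using dense_loc[of g w g' w' u] spars_loc[of g w g' w' u] by simp
qed

lemma clu_loc:
  assumes "agr 3 g w g' w' r"
  shows "clu g r = clu g' r"
proof -
  have "agr 2 g w g' w' u" if "u \<in> insert r (nb g r)" for u
    using agr_nb[of 2 g w g' w' r u] that assms by (simp add: eval_nat_numeral)
  then have "codeg g u r = codeg g' u r" if "u \<in> insert r (nb g r)" for u
    using codeg_loc[OF _ assms] that by blast
  then show ?thesis unfolding clu_def using leader_loc[OF assms] sameD[OF assms] same_par[OF assms] by auto
qed

lemma cand_loc:
  assumes "agr 4 g w g' w' z" "r \<in> insert z (nb g z)"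
  shows "cand g w r z = cand g' w' r z"
proof -
  have "agr 3 g w g' w' r" using agr_nb[of 3] assms by (simp add: eval_nat_numeral)
  then have "clu g r = clu g' r" by (rule clu_loc)
  then show ?thesis
    using sameD[OF assms(1)] same_par[OF assms(1)] att_loc[OF assms(1)] by (simp add: cand_def smp_def)
qed

lemma qs_loc: "agr 4 g w g' w' z \<Longrightarrow> qs g w z = qs g' w' z"
  unfolding qs_def using cand_loc[of g w g' w' z] sameD(1)[of 4 g w g' w' z] by (intro bex_cong) auto

lemma ps_loc:
  assumes "agr 5 g w g' w' u"
  shows "ps g w u = ps g' w' u"
proof -
  have nb4: "agr 4 g w g' w' z" if "z \<in> insert u (nb g u)" for z
    using agr_nb[of 4 g w g' w' u z] that assms by (simp add: eval_nat_numeral)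
  have "clu g r = clu g' r" if "r \<in> insert u (nb g u)" for r
    using clu_loc agr_le[OF nb4[OF that], of 3] by simp
  moreover have "qs g w z = qs g' w' z" if "z \<in> nb g u" for z using qs_loc nb4 that by blast
  moreover have "cand g w r u = cand g' w' r u" if "r \<in> insert u (nb g u)" for r
    using cand_loc nb4 that by blast
  ultimately show ?thesis unfolding ps_def using sameD(1)[OF assms] by (intro bex_cong) auto
qed

lemma mem_loc:
  assumes "agr 6 g w g' w' r"
  shows "mem g w r = mem g' w' r"
proof -
  have nb5: "agr 5 g w g' w' z" if "z \<in> insert r (nb g r)" for z
    using agr_nb[of 5 g w g' w' r z] that assms by (simp add: eval_nat_numeral)
  have "clu g r = clu g' r" using clu_loc agr_le[OF assms, of 3] by simp
  moreover have "col1 g w u = col1 g' w' u \<and> ps g w u = ps g' w' u" if "u \<in> clu g r" for u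
  proof -
    have "u \<in> insert r (nb g r)" using that by (auto simp: clu_def)
    note u = nb5[OF this]
    show ?thesis using ps_loc[OF u] col1_loc agr_le[OF u, of "Suc 0"] by simp
  qed
  ultimately show ?thesis unfolding mem_def by auto
qed

lemma sct_loc:
  assumes "agr 6 g w g' w' r"
  shows "sct g w r = sct g' w' r"
  using mem_loc[OF assms] av1_loc[of g w g' w' r] agr_le[OF assms, of "Suc (Suc 0)"] same_par(1)[OF assms, of 2]
  by (simp add: sct_def)

lemma asg_loc:
  assumes "agr 7 g w g' w' u"
  shows "asg g w u = asg g' w' u"
proof -
  have nb6: "agr 6 g w g' w' z" if "z \<in> insert u (nb g u)" for z
    using agr_nb[of 6 g w g' w' u z] that assms by (simp add: eval_nat_numeral)
  then have eq: "(r \<in> insert u (nb g u) \<and> u \<in> mem g w r) = (r \<in> insert u (nb g' u) \<and> u \<in> mem g' w' r)" for r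
    using sameD(1)[OF assms] mem_loc[of g w g' w' r] by auto
  have ex: "(\<exists>r\<in>insert u (nb g u). u \<in> mem g w r) = (\<exists>r\<in>insert u (nb g' u). u \<in> mem g' w' r)"
    using eq by blast
  define r where "r = (SOME r. r \<in> insert u (nb g u) \<and> u \<in> mem g w r)"
  have "sct g w r = sct g' w' r" if "\<exists>r\<in>insert u (nb g u). u \<in> mem g w r"
  proof -
    have "r \<in> insert u (nb g u) \<and> u \<in> mem g w r"
      unfolding r_def by (rule someI_ex) (use that in blast)
    then show ?thesis using nb6 sct_loc by blast
  qed
  moreover have "(SOME r. r \<in> insert u (nb g' u) \<and> u \<in> mem g' w' r) = r" unfolding r_def eq ..
  ultimately show ?thesis unfolding asg_def ex[symmetric] r_def[symmetric] by simp
qed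

lemma col2_loc:
  assumes "agr 8 g w g' w' u"
  shows "col2 g w u = col2 g' w' u"
proof -
  have nb7: "agr 7 g w g' w' z" if "z \<in> insert u (nb g u)" for z
    using agr_nb[of 7 g w g' w' u z] that assms by (simp add: eval_nat_numeral)
  have "asg g w z = asg g' w' z" if "z \<in> insert u (nb g u)" for z using nb7 asg_loc that by blast
  moreover have "col1 g w u = col1 g' w' u" using col1_loc agr_le[OF assms, of "Suc 0"] by simp
  moreover have "av1 g w u = av1 g' w' u" using av1_loc agr_le[OF assms, of "Suc (Suc 0)"] by simp
  ultimately show ?thesis using sameD(1)[OF assms] by (auto simp: col2_def split: option.splits)
qed

text \<open>The radii are 3 for leaders and clusters, 4 for candidates, 5 for vertices put aside, 6
  for members, 7 for assignments and 8 for the colors of stage two, hence 9 here. Radius 10 in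
  \<open>need\<close> also covers the attempts of the neighbors of an item.\<close>

lemma act_loc:
  assumes "agr 9 g w g' w' u"
  shows "act g w u = act g' w' u" "av2 g w u = av2 g' w' u" "unc g w u = unc g' w' u"
proof -
  have nb8: "agr 8 g w g' w' z" if "z \<in> insert u (nb g u)" for z
    using agr_nb[of 8 g w g' w' u z] that assms by (simp add: eval_nat_numeral)
  have c: "col2 g w z = col2 g' w' z" if "z \<in> insert u (nb g u)" for z using nb8 col2_loc that by blast
  have p: "ps g w z = ps g' w' z" if "z \<in> insert u (nb g u)" for z
    using agr_le[OF nb8[OF that], of 5] ps_loc by simp
  show "av2 g w u = av2 g' w' u" unfolding av2_def using sameD[OF assms] c by auto
  moreover show "unc g w u = unc g' w' u" unfolding unc_def using sameD[OF assms] c p by auto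
  ultimately show "act g w u = act g' w' u" unfolding act_def using c p same_par[OF assms] by auto
qed

lemma att3_loc: "agr 9 g w g' w' u \<Longrightarrow> att3 g w i u = att3 g' w' i u"
  by (simp add: att3_def act_loc same_par)

section \<open>The first color trial\<close>

lemma kk_ge: "m \<le> 2 ^ kk m"
  unfolding kk_def by (rule LeastI[of _ m]) (simp add: less_imp_le)

lemma kk_less: "0 < m \<Longrightarrow> 2 ^ kk m < 2 * m"
proof (cases "kk m")
  case (Suc j)
  then have "\<not> m \<le> 2 ^ j" unfolding kk_def by (intro not_less_Least) auto
  then show ?thesis using Suc by simp
qed auto

lemma kk_le: "kk m \<le> m"
  unfolding kk_def by (rule Least_le) (simp add: less_imp_le)

lemma pick_in: "finite A \<Longrightarrow> pick A k i = Some x \<Longrightarrow> x \<in> A"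
  unfolding pick_def by (auto split: if_splits) (metis nth_mem sorted_list_of_set.length_sorted_key_list_of_set sorted_list_of_set.set_sorted_key_list_of_set)

lemma sum_pick:
  fixes F :: "nat option \<Rightarrow> real"
  assumes "finite A" "card A \<le> 2 ^ k" "k \<le> b"
  shows "(\<Sum>x<2 ^ b. F (pick A k x)) / 2 ^ b = ((\<Sum>c\<in>A. F (Some c)) + (2 ^ k - real (card A)) * F None) / 2 ^ k"
proof -
  let ?f = "\<lambda>i. F (if i < card A then Some (sorted_list_of_set A ! i) else None)"
  have "(\<Sum>x<2 ^ b. F (pick A k x)) / 2 ^ b = (\<Sum>i<2 ^ k. ?f i) / 2 ^ k"
    unfolding pick_def by (rule sum_mod_pow2[OF assms(3), of ?f])
  also have "(\<Sum>i<2 ^ k. ?f i) = (\<Sum>i<card A. ?f i) + (\<Sum>i=card A..<2 ^ k. ?f i)"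
    using sum.atLeastLessThan_concat[of 0 "card A" "2 ^ k" ?f] assms(2) by (simp add: lessThan_atLeast0)
  also have "(\<Sum>i<card A. ?f i) = (\<Sum>c\<in>A. F (Some c))"
  proof -
    have "bij_betw (\<lambda>i. sorted_list_of_set A ! i) {..<card A} A"
      using bij_betw_nth[of "sorted_list_of_set A" "{..<card A}" A] assms(1) by simp
    from sum.reindex_bij_betw[OF this, of "\<lambda>c. F (Some c)"] show ?thesis by simp
  qed
  also have "(\<Sum>i=card A..<2 ^ k. ?f i) = (2 ^ k - real (card A)) * F None"
    using assms(2) by (simp add: of_nat_diff)
  finally show ?thesis .
qed

lemma exp_le_1_2: "0 \<le> (h :: real) \<Longrightarrow> h \<le> 1 \<Longrightarrow> exp h - 1 \<le> 2 * h"
  using exp_bound[of h] mult_left_le[of h h] by (simp add: power2_eq_square)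

lemma exp_minus_le: "0 \<le> (y :: real) \<Longrightarrow> y \<le> 1 \<Longrightarrow> exp (- y) - 1 \<le> - y / 2"
proof -
  assume y: "0 \<le> y" "y \<le> 1"
  have "1 + y \<le> exp y" by (rule exp_ge_add_one_self)
  then have "exp (- y) \<le> 1 / (1 + y)" using y by (simp add: exp_minus field_simps)
  also have "\<dots> \<le> 1 - y / 2"
  proof -
    have "0 \<le> y * (1 - y)" using y by (intro mult_nonneg_nonneg) auto
    then show ?thesis using y by (simp add: field_simps)
  qed
  finally show ?thesis by simp
qed

locale gph =
  fixes g :: gr and V :: "nat set"
  assumes finV: "finite V"
    and nbV: "u \<in> V \<Longrightarrow> nb g u \<subseteq> V"
    and nb_sym: "u \<in> V \<Longrightarrow> z \<in> nb g u \<Longrightarrow> u \<in> nb g z"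
    and nb_irr: "u \<in> V \<Longrightarrow> u \<notin> nb g u"
    and nb_deg: "u \<in> V \<Longrightarrow> card (nb g u) \<le> dg g"
    and pal_card: "u \<in> V \<Longrightarrow> card (pal g u) = Suc (dg g)"
begin

lemma nb_fin [simp]: "u \<in> V \<Longrightarrow> finite (nb g u)"
  using nbV finV finite_subset by blast

lemma pal_fin [simp]: "u \<in> V \<Longrightarrow> finite (pal g u)"
  using pal_card card.infinite by fastforce

lemma nb_in [simp]: "u \<in> V \<Longrightarrow> z \<in> nb g u \<Longrightarrow> z \<in> V"
  using nbV by blast

lemma att_pal: "u \<in> V \<Longrightarrow> att g s u = Some x \<Longrightarrow> x \<in> pal g u"
  unfolding att_def by (auto split: if_splits intro: pick_in)

end

locale gph_big = gph +
  fixes b :: nat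
  assumes big: "big g" and dg_pos: "1 \<le> dg g" and b_ge: "kk (2048 * (dg g + 1)) \<le> b"
begin

definition \<tau> :: real where "\<tau> = 1 / 2 ^ kk (2048 * (dg g + 1))"

lemma \<tau>_le: "\<tau> \<le> 1 / (2048 * (real (dg g) + 1))"
proof -
  have "real (2048 * (dg g + 1)) \<le> real (2 ^ kk (2048 * (dg g + 1)))"
    using kk_ge of_nat_le_iff by blast
  then show ?thesis unfolding \<tau>_def by (intro divide_left_mono) auto
qed

lemma \<tau>_ge: "1 / (8192 * real (dg g)) \<le> \<tau>"
proof -
  have "real (2 ^ kk (2048 * (dg g + 1))) \<le> real (2 * (2048 * (dg g + 1)))"
    using kk_less[of "2048 * (dg g + 1)"] of_nat_le_iff by (intro of_nat_mono less_imp_le) simp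
  also have "\<dots> \<le> 8192 * real (dg g)" using dg_pos by simp
  finally show ?thesis unfolding \<tau>_def using dg_pos by (intro divide_left_mono) auto
qed

lemma \<tau>_pos: "0 < \<tau>" by (simp add: \<tau>_def)

abbreviation J0 :: "(nat \<times> nat) set" where "J0 \<equiv> V \<times> {0}"

lemma att_step:
  assumes "u \<in> V"
  shows "(\<Sum>x<2 ^ b. exp (case att g (s((u, 0) := x)) u of None \<Rightarrow> 0 | Some c \<Rightarrow> h c)) / 2 ^ b
    \<le> exp (\<tau> * (\<Sum>c\<in>pal g u. exp (h c) - 1))"
proof -
  let ?k = "kk (2048 * (dg g + 1))"
  have "card (pal g u) \<le> 2 ^ ?k" using kk_ge[of "2048 * (dg g + 1)"] pal_card[OF assms] by simp
  from sum_pick[OF _ this b_ge, of "\<lambda>a. exp (case a of None \<Rightarrow> 0 | Some c \<Rightarrow> h c)"]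
  have "(\<Sum>x<2 ^ b. exp (case att g (s((u, 0) := x)) u of None \<Rightarrow> 0 | Some c \<Rightarrow> h c)) / 2 ^ b
    = ((\<Sum>c\<in>pal g u. exp (h c)) + (2 ^ ?k - real (card (pal g u)))) / 2 ^ ?k"
    using assms big by (simp add: att_def)
  also have "\<dots> = 1 + \<tau> * (\<Sum>c\<in>pal g u. exp (h c) - 1)"
    by (simp add: sum_subtractf \<tau>_def field_simps)
  also have "\<dots> \<le> exp (\<tau> * (\<Sum>c\<in>pal g u. exp (h c) - 1))"
    by (rule exp_ge_add_one_self)
  finally show ?thesis .
qed

definition ev :: "seeds \<Rightarrow> (nat \<Rightarrow> seeds \<Rightarrow> nat \<Rightarrow> real) \<Rightarrow> real" where
  "ev s h = (\<Sum>u\<in>V. case att g s u of None \<Rightarrow> 0 | Some c \<Rightarrow> h u s c)"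

text \<open>Revealing the attempts in the order of the IDs turns \<open>ev s h\<close>, minus its compensator, into
  an exponential supermartingale.\<close>

lemma trial_exp:
  assumes d: "\<And>u c. u \<in> V \<Longrightarrow> dep (\<lambda>s. h u s c) {j \<in> J0. fst j < u}"
    and c: "\<And>u c s. u \<in> V \<Longrightarrow> c \<in> pal g u \<Longrightarrow> exp (h u s c) - 1 \<le> k * h u s c"
  shows "avg (2 ^ b) J0 (\<lambda>s. exp (ev s h - \<tau> * k * (\<Sum>u\<in>V. \<Sum>c\<in>pal g u. h u s c))) \<le> 1"
proof -
  define \<phi> where "\<phi> j s = (case att g s (fst j) of None \<Rightarrow> 0 | Some c \<Rightarrow> h (fst j) s c)
    - \<tau> * k * (\<Sum>c\<in>pal g (fst j). h (fst j) s c)" for j :: "nat \<times> nat" and s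
  have sum: "(\<Sum>j\<in>J0. \<phi> j s) = ev s h - \<tau> * k * (\<Sum>u\<in>V. \<Sum>c\<in>pal g u. h u s c)" for s
  proof -
    have "(\<Sum>j\<in>J0. \<phi> j s) = (\<Sum>u\<in>V. \<phi> (u, 0) s)"
      by (rule sum.reindex_bij_witness[of _ "\<lambda>u. (u, 0)" fst]) auto
    then show ?thesis by (simp only: \<phi>_def fst_conv ev_def sum_subtractf sum_distrib_left)
  qed
  have hupd: "h u (s((u, 0) := x)) c = h u s c" if "u \<in> V" for u s x c
    by (rule depD[OF d[OF that]]) auto
  have "avg (2 ^ b) J0 (\<lambda>s. exp (\<Sum>j\<in>J0. \<phi> j s)) \<le> 1"
  proof (rule avg_exp_seq[where key = fst])
    show "dep (\<phi> j) {i \<in> J0. fst i \<le> fst j}" if "j \<in> J0" for j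
      unfolding dep_def
    proof (intro allI impI)
      fix s t :: seeds assume st: "\<forall>i\<in>{i \<in> J0. fst i \<le> fst j}. s i = t i"
      have "h (fst j) s c = h (fst j) t c" for c
        using that st by (intro depD[OF d]) auto
      moreover have "att g s (fst j) = att g t (fst j)" using that st by (auto simp: att_def)
      ultimately show "\<phi> j s = \<phi> j t" by (simp add: \<phi>_def cong: option.case_cong)
    qed
    show "(\<Sum>x<2 ^ b. exp (\<phi> j (s(j := x)))) / real (2 ^ b) \<le> 1" if j: "j \<in> J0" for j s
    proof -
      obtain u where u: "j = (u, 0)" "u \<in> V" using j by auto
      let ?C = "\<tau> * k * (\<Sum>c\<in>pal g u. h u s c)"
      have "(\<Sum>x<2 ^ b. exp (\<phi> j (s(j := x)))) / real (2 ^ b) =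
        exp (- ?C) * ((\<Sum>x<2 ^ b. exp (case att g (s((u, 0) := x)) u of None \<Rightarrow> 0 | Some c \<Rightarrow> h u s c)) / 2 ^ b)"
        unfolding u \<phi>_def fst_conv hupd[OF u(2)] diff_conv_add_uminus exp_add
        by (simp add: sum_distrib_left mult.commute)
      also have "\<dots> \<le> exp (- ?C) * exp (\<tau> * (\<Sum>c\<in>pal g u. exp (h u s c) - 1))"
        by (intro mult_left_mono att_step u) auto
      also have "\<dots> \<le> exp (- ?C) * exp ?C"
        unfolding mult.assoc sum_distrib_left
        using \<tau>_pos c[OF u(2)] by (intro mult_left_mono exp_le_cancel_iff[THEN iffD2] sum_mono) auto
      also have "\<dots> = 1" by (simp flip: exp_add)
      finally show ?thesis .
    qed
  qed (use finV in \<open>auto simp: inj_on_def\<close>)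
  then show ?thesis by (simp add: sum)
qed

text \<open>On [0, 1], \<open>exp h - 1\<close> is at most 2 h and \<open>exp (- h) - 1\<close> at
  most - h / 2. So \<open>ev\<close> is bounded above by twice its compensator here, and below by
  half of it in the next lemma, up to an exponential tail.\<close>

lemma trial_up:
  assumes "\<And>u c. u \<in> V \<Longrightarrow> dep (\<lambda>s. h u s c) {j \<in> J0. fst j < u}"
    and "\<And>u c s. u \<in> V \<Longrightarrow> 0 \<le> h u s c \<and> h u s c \<le> 1"
  shows "avg (2 ^ b) J0 (\<lambda>s. exp (ev s h - 2 * \<tau> * (\<Sum>u\<in>V. \<Sum>c\<in>pal g u. h u s c))) \<le> 1"
  using trial_exp[of h 2] assms exp_le_1_2 by (simp add: mult_ac)

lemma trial_low:
  assumes "\<And>u c. u \<in> V \<Longrightarrow> dep (\<lambda>s. h u s c) {j \<in> J0. fst j < u}"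
    and "\<And>u c s. u \<in> V \<Longrightarrow> 0 \<le> h u s c \<and> h u s c \<le> 1"
  shows "avg (2 ^ b) J0 (\<lambda>s. exp (\<tau> / 2 * (\<Sum>u\<in>V. \<Sum>c\<in>pal g u. h u s c) - ev s h)) \<le> 1"
proof -
  have "dep (\<lambda>s. - h u s c) {j \<in> J0. fst j < u}" if "u \<in> V" for u c
    using assms(1)[OF that, of c] by (auto simp: dep_def)
  moreover have "exp (- h u s c) - 1 \<le> (1/2) * (- h u s c)" if "u \<in> V" for u s c
    using exp_minus_le[of "h u s c"] assms(2)[OF that] by simp
  ultimately have "avg (2 ^ b) J0 (\<lambda>s. exp (ev s (\<lambda>u s c. - h u s c)
      - \<tau> * (1/2) * (\<Sum>u\<in>V. \<Sum>c\<in>pal g u. - h u s c))) \<le> 1"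
    by (intro trial_exp) auto
  moreover have "ev s (\<lambda>u s c. - h u s c) = - ev s h" for s
    by (simp add: ev_def sum_negf[symmetric] option.case_eq_if)
      (intro sum.cong, auto)
  ultimately show ?thesis by (simp add: sum_negf algebra_simps)
qed

definition actn :: "seeds \<Rightarrow> nat \<Rightarrow> nat" where
  "actn s y = card {z \<in> nb g y. att g s z \<noteq> None}"

lemma actn_tail:
  assumes y: "y \<in> V"
  shows "prb (2 ^ b) J0 (\<lambda>s. 8 * actn s y > dg g) \<le> exp (- real (dg g) / 16)"
proof -
  let ?h = "\<lambda>u (s :: seeds) (c :: nat). of_bool (u \<in> nb g y) :: real"
  have ev: "ev s ?h = real (actn s y)" for s
  proof -
    have "ev s ?h = (\<Sum>u\<in>V. of_bool (u \<in> {z \<in> nb g y. att g s z \<noteq> None}))"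
      unfolding ev_def by (intro sum.cong) (auto split: option.splits)
    also have "\<dots> = real (actn s y)"
      unfolding actn_def using finV y nb_in[OF y] by (simp add: of_bool_def sum.If_cases Int_def) (metis (no_types, lifting) Collect_cong nb_in y)
    finally show ?thesis .
  qed
  have "(\<Sum>u\<in>V. \<Sum>c\<in>pal g u. ?h u s c) = real (card (nb g y)) * (real (dg g) + 1)" for s :: seeds
  proof -
    have "(\<Sum>u\<in>V. \<Sum>c\<in>pal g u. ?h u s c) = (\<Sum>u\<in>V. of_bool (u \<in> nb g y) * (real (dg g) + 1))"
      by (intro sum.cong) (auto simp: pal_card)
    also have "\<dots> = (\<Sum>u\<in>nb g y. real (dg g) + 1)"
      using finV nbV[OF y] by (simp add: of_bool_def if_distrib[of "\<lambda>x. x * _"] sum.If_cases Int_absorb1)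
    finally show ?thesis by simp
  qed
  then have "avg (2 ^ b) J0 (\<lambda>s. exp (real (actn s y) - 2 * \<tau> * (real (card (nb g y)) * (real (dg g) + 1)))) \<le> 1"
    using trial_up[of ?h] by (simp add: ev dep_def)
  then have "prb (2 ^ b) J0 (\<lambda>s. 8 * actn s y > dg g) \<le> exp (- (real (dg g) / 16))"
  proof (rule prb_exp_le)
    fix s assume "8 * actn s y > dg g"
    then have a: "real (actn s y) > real (dg g) / 8" by linarith
    \<comment> \<open>Twice the mean is at most D / 1024, and D / 8 - D / 1024 exceeds D /
      16.\<close>
    have "2 * \<tau> * (real (card (nb g y)) * (real (dg g) + 1)) \<le>
      2 * (1 / (2048 * (real (dg g) + 1))) * (real (dg g) * (real (dg g) + 1))"
      using \<tau>_le \<tau>_pos nb_deg[OF y] by (intro mult_mono) auto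
    also have "\<dots> = real (dg g) / 1024" by (simp add: field_simps)
    finally show "real (dg g) / 16 \<le> real (actn s y) - 2 * \<tau> * (real (card (nb g y)) * (real (dg g) + 1))"
      using a by linarith
  qed
  then show ?thesis by simp
qed

end

lemma card_filter_sum: "finite A \<Longrightarrow> (\<Sum>x\<in>A. of_bool (P x)) = real (card {x \<in> A. P x})"
  by (simp add: of_bool_def sum.If_cases Int_def)

section \<open>Excess colors gained in the first trial\<close>

context gph_big
begin

text \<open>Colors whose choice by \<open>x\<close> raises the number of excess colors of \<open>v\<close>.\<close>

definition gset :: "seeds \<Rightarrow> nat \<Rightarrow> nat \<Rightarrow> nat set" where
  "gset s v x = {c \<in> pal g x. (\<forall>z\<in>nb g x. z < x \<longrightarrow> att g s z \<noteq> Some c) \<and>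
     (c \<notin> pal g v \<or> (\<exists>u\<in>nb g v. u < x \<and> col1 g s u = Some c))}"

definition gain :: "seeds \<Rightarrow> nat \<Rightarrow> nat" where
  "gain s v = card {x \<in> nb g v. \<exists>c. att g s x = Some c \<and> c \<in> gset s v x}"

lemma att_dep:
  assumes "z \<in> V" "z < u" "\<forall>i\<in>{j \<in> J0. fst j < u}. s i = t i"
  shows "att g s z = att g t z"
  using assms by (simp add: att_def)

lemma col1_dep:
  assumes "z \<in> V" "z < u" "\<forall>i\<in>{j \<in> J0. fst j < u}. s i = t i"
  shows "col1 g s z = col1 g t z"
proof -
  have "att g s y = att g t y" if "y \<in> nb g z \<and> y < z \<or> y = z" for y
    using that assms nb_in[of z y] by (intro att_dep[OF _ _ assms(3)]) auto
  then show ?thesis unfolding col1_def by (metis (mono_tags, lifting))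
qed

lemma gset_dep:
  assumes "x \<in> V" "v \<in> V" "\<forall>i\<in>{j \<in> J0. fst j < x}. s i = t i"
  shows "gset s v x = gset t v x"
proof -
  have "att g s z = att g t z" if "z \<in> nb g x" "z < x" for z
    using that assms by (intro att_dep[OF _ _ assms(3)]) auto
  moreover have "col1 g s z = col1 g t z" if "z \<in> nb g v" "z < x" for z
    using that assms by (intro col1_dep[OF _ _ assms(3)]) auto
  ultimately show ?thesis unfolding gset_def
    by (intro Collect_cong conj_cong disj_cong refl ball_cong bex_cong) auto
qed

lemma gset_fin: "x \<in> V \<Longrightarrow> finite (gset s v x)"
  unfolding gset_def by simp

lemma gain_col1:
  assumes "x \<in> V" "att g s x = Some c" "c \<in> gset s v x"
  shows "col1 g s x = Some c"
  using assms by (auto simp: col1_def gset_def)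

text \<open>Every lost palette color is charged to the least neighbor \<open>m x\<close> that holds
  it. A neighbor counted in \<open>gain\<close> is never charged, for its color is outside the
  palette or already held by a smaller neighbor. So colored neighbors outnumber lost colors by at
  least the gain.\<close>

lemma gain_slack:
  assumes v: "v \<in> V"
  shows "dg g + 1 + gain s v \<le> card (av1 g s v) + card {z \<in> nb g v. col1 g s z \<noteq> None}"
proof -
  let ?C = "{z \<in> nb g v. col1 g s z \<noteq> None}"
  let ?U = "{x \<in> pal g v. \<exists>z\<in>nb g v. col1 g s z = Some x}"
  let ?G = "{x \<in> nb g v. \<exists>c. att g s x = Some c \<and> c \<in> gset s v x}"
  define m where "m x = (LEAST z. z \<in> nb g v \<and> col1 g s z = Some x)" for x
  have m: "m x \<in> nb g v \<and> col1 g s (m x) = Some x" if "x \<in> ?U" for x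
    unfolding m_def by (rule LeastI_ex) (use that in auto)
  have "m x \<notin> ?G" if x: "x \<in> ?U" for x
  proof
    assume "m x \<in> ?G"
    then obtain c where c: "att g s (m x) = Some c" "c \<in> gset s v (m x)" by auto
    moreover have "m x \<in> V" using m[OF x] v by auto
    ultimately have "c = x" using gain_col1[of "m x" s c v] m[OF x] by simp
    then obtain u where "u \<in> nb g v" "u < m x" "col1 g s u = Some x"
      using c(2) x by (auto simp: gset_def)
    then show False using not_less_Least[of u "\<lambda>z. z \<in> nb g v \<and> col1 g s z = Some x"]
      by (simp add: m_def)
  qed
  note notG = this
  have sub: "m ` ?U \<subseteq> ?C - ?G"
  proof (rule image_subsetI)
    fix x assume x: "x \<in> ?U"
    have "m x \<in> ?C" using m[OF x] by simp
    with notG[OF x] show "m x \<in> ?C - ?G" by (rule DiffI[rotated])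
  qed
  have "inj_on m ?U"
  proof (rule inj_onI)
    fix x y assume x: "x \<in> ?U" and y: "y \<in> ?U" and e: "m x = m y"
    have "Some x = col1 g s (m x)" using m[OF x] by (rule conjunct2[THEN sym])
    also have "\<dots> = Some y" unfolding e using m[OF y] by (rule conjunct2)
    finally show "x = y" by simp
  qed
  then have "card ?U = card (m ` ?U)" by (rule card_image[symmetric])
  also have "\<dots> \<le> card (?C - ?G)"
    using v by (intro card_mono[OF _ sub]) auto
  finally have "card ?U \<le> card (?C - ?G)" .
  moreover have "?G \<subseteq> ?C"
  proof
    fix x assume "x \<in> ?G"
    then obtain c where c: "x \<in> nb g v" "att g s x = Some c" "c \<in> gset s v x" by auto
    then show "x \<in> ?C" using gain_col1[of x s c v] v by simp
  qed
  then have "card (?C - ?G) = card ?C - card ?G" "card ?G \<le> card ?C"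
    using v by (simp_all add: card_Diff_subset card_mono)
  moreover have "av1 g s v = pal g v - ?U" by (auto simp: av1_def)
  then have "card (av1 g s v) = dg g + 1 - card ?U"
    using v pal_card by (simp add: card_Diff_subset)
  moreover have "card ?U \<le> card (pal g v)" using v by (intro card_mono) auto
  ultimately show ?thesis using pal_card[OF v] by (simp add: gain_def)
qed

lemma gain_low:
  assumes v: "v \<in> V"
  shows "avg (2 ^ b) J0 (\<lambda>s. exp (\<tau> / 2 * (\<Sum>x\<in>nb g v. real (card (gset s v x))) - real (gain s v))) \<le> 1"
proof -
  define h where "h u s c = (of_bool (u \<in> nb g v \<and> c \<in> gset s v u) :: real)" for u s c
  have "ev s h = real (gain s v)" for s
  proof -
    have "ev s h = (\<Sum>x\<in>V. of_bool (x \<in> nb g v \<and> (\<exists>c. att g s x = Some c \<and> c \<in> gset s v x)))"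
      unfolding ev_def h_def by (intro sum.cong) (auto split: option.splits)
    also have "\<dots> = real (card {x \<in> V. x \<in> nb g v \<and> (\<exists>c. att g s x = Some c \<and> c \<in> gset s v x)})"
      by (rule card_filter_sum[OF finV])
    also have "{x \<in> V. x \<in> nb g v \<and> (\<exists>c. att g s x = Some c \<and> c \<in> gset s v x)}
      = {x \<in> nb g v. \<exists>c. att g s x = Some c \<and> c \<in> gset s v x}" using v by auto
    finally show ?thesis by (simp add: gain_def)
  qed
  moreover have "(\<Sum>u\<in>V. \<Sum>c\<in>pal g u. h u s c) = (\<Sum>x\<in>nb g v. real (card (gset s v x)))" for s
  proof -
    have "(\<Sum>c\<in>pal g u. h u s c) = (if u \<in> nb g v then real (card (gset s v u)) else 0)" if "u \<in> V" for u
      unfolding h_def card_filter_sum[OF pal_fin[OF that]]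
      by (auto intro!: arg_cong[where f = card] simp: gset_def)
    then have "(\<Sum>u\<in>V. \<Sum>c\<in>pal g u. h u s c) = (\<Sum>u\<in>V. if u \<in> nb g v then real (card (gset s v u)) else 0)"
      by simp
    also have "\<dots> = (\<Sum>x\<in>nb g v. real (card (gset s v x)))"
      using finV nbV[OF v] by (simp add: sum.If_cases Int_absorb1)
    finally show ?thesis .
  qed
  moreover have "avg (2 ^ b) J0 (\<lambda>s. exp (\<tau> / 2 * (\<Sum>u\<in>V. \<Sum>c\<in>pal g u. h u s c) - ev s h)) \<le> 1"
  proof (rule trial_low)
    show "dep (\<lambda>s. h u s c) {j \<in> J0. fst j < u}" if "u \<in> V" for u c
      unfolding dep_def
    proof (intro allI impI)
      fix s t :: seeds assume "\<forall>i\<in>{j \<in> J0. fst j < u}. s i = t i"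
      from gset_dep[OF that v this] show "h u s c = h u t c" by (simp add: h_def)
    qed
  qed (auto simp: h_def)
  ultimately show ?thesis by simp
qed

text \<open>A color of \<open>x\<close> outside the palette of \<open>v\<close> can only be missing
  from \<open>gset\<close> if some neighbor of \<open>x\<close> tries it. With scores divided by
  \<open>dg g\<close> to fit into [0, 1], \<open>trial_up\<close> bounds these losses, whose mean is
  a small fraction of \<open>mism g v\<close>.\<close>

lemma mism_case:
  assumes v: "v \<in> V"
  shows "prb (2 ^ b) J0 (\<lambda>s. (\<Sum>x\<in>nb g v. real (card (gset s v x))) < real (mism g v) / 2)
    \<le> exp (- real (mism g v) / (4 * real (dg g)))"
proof -
  let ?D = "real (dg g)"
  define R where "R z c = {x \<in> nb g v. z \<in> nb g x \<and> c \<in> pal g x - pal g v}" for z c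
  define h where "h z s c = real (card (R z c)) / ?D" for z and s :: seeds and c
  have finR: "finite (R z c)" for z c using v by (auto simp: R_def)
  have R_le: "card (R z c) \<le> dg g" for z c
    using card_mono[of "nb g v" "R z c"] nb_deg[OF v] v by (fastforce simp: R_def)
  have "(\<Sum>z\<in>V. \<Sum>c\<in>pal g z. h z s c) \<le> real (mism g v)" for s
  proof -
    have "(\<Sum>z\<in>V. \<Sum>c\<in>pal g z. real (card (R z c))) =
      (\<Sum>z\<in>V. \<Sum>c\<in>pal g z. \<Sum>x\<in>nb g v. of_bool (z \<in> nb g x \<and> c \<in> pal g x - pal g v))"
      using v by (simp only: card_filter_sum nb_fin R_def)
    also have "\<dots> = (\<Sum>z\<in>V. \<Sum>x\<in>nb g v. \<Sum>c\<in>pal g z. of_bool (z \<in> nb g x \<and> c \<in> pal g x - pal g v))"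
      by (intro sum.cong refl sum.swap)
    also have "\<dots> = (\<Sum>x\<in>nb g v. \<Sum>z\<in>V. \<Sum>c\<in>pal g z. of_bool (z \<in> nb g x \<and> c \<in> pal g x - pal g v))"
      by (rule sum.swap)
    also have "\<dots> \<le> (\<Sum>x\<in>nb g v. \<Sum>z\<in>V. of_bool (z \<in> nb g x) * real (card (pal g x - pal g v)))"
    proof (intro sum_mono)
      fix x z assume x: "x \<in> nb g v" and z: "z \<in> V"
      have "real (card {c \<in> pal g z. z \<in> nb g x \<and> c \<in> pal g x - pal g v})
        \<le> of_bool (z \<in> nb g x) * real (card (pal g x - pal g v))"
        using x v by (auto intro!: card_mono)
      then show "(\<Sum>c\<in>pal g z. of_bool (z \<in> nb g x \<and> c \<in> pal g x - pal g v))
        \<le> of_bool (z \<in> nb g x) * real (card (pal g x - pal g v))"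
        unfolding card_filter_sum[OF pal_fin[OF z]] .
    qed
    also have "\<dots> = (\<Sum>x\<in>nb g v. real (card {z \<in> V. z \<in> nb g x}) * real (card (pal g x - pal g v)))"
      by (simp add: card_filter_sum[OF finV] sum_distrib_right[symmetric])
    also have "\<dots> \<le> (\<Sum>x\<in>nb g v. ?D * real (card (pal g x - pal g v)))"
    proof (intro sum_mono mult_right_mono)
      fix x assume "x \<in> nb g v"
      then have x: "x \<in> V" using v by simp
      have "card {z \<in> V. z \<in> nb g x} \<le> card (nb g x)" using x by (intro card_mono) auto
      then show "real (card {z \<in> V. z \<in> nb g x}) \<le> ?D" using nb_deg[OF x] by simp
    qed auto
    finally have "(\<Sum>z\<in>V. \<Sum>c\<in>pal g z. real (card (R z c))) \<le> ?D * real (mism g v)"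
      by (simp add: mism_def sum_distrib_left)
    then have "(\<Sum>z\<in>V. \<Sum>c\<in>pal g z. real (card (R z c))) / ?D \<le> real (mism g v)"
      using dg_pos by (simp add: field_simps)
    then show ?thesis by (simp add: h_def sum_divide_distrib)
  qed
  note total = this
  have loss: "real (mism g v) \<le> (\<Sum>x\<in>nb g v. real (card (gset s v x))) + ?D * ev s h" for s
  proof -
    have "real (card (pal g x - pal g v)) \<le> real (card (gset s v x)) +
        (\<Sum>z\<in>V. of_bool (z \<in> nb g x \<and> (\<exists>c. att g s z = Some c \<and> c \<in> pal g x - pal g v)))"
      if x: "x \<in> nb g v" for x
    proof -
      have xV: "x \<in> V" using x v by simp
      let ?Z = "{z \<in> V. z \<in> nb g x \<and> (\<exists>c. att g s z = Some c \<and> c \<in> pal g x - pal g v)}"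
      have "pal g x - pal g v \<subseteq> gset s v x \<union> (\<lambda>z. the (att g s z)) ` ?Z"
      proof
        fix c assume c: "c \<in> pal g x - pal g v"
        show "c \<in> gset s v x \<union> (\<lambda>z. the (att g s z)) ` ?Z"
        proof (cases "c \<in> gset s v x")
          case False
          then obtain z where "z \<in> nb g x" "att g s z = Some c" using c by (auto simp: gset_def)
          then show ?thesis using c xV by (intro UnI2 rev_image_eqI[of z]) auto
        qed simp
      qed
      then have "card (pal g x - pal g v) \<le> card (gset s v x \<union> (\<lambda>z. the (att g s z)) ` ?Z)"
        using xV finV by (intro card_mono finite_UnI gset_fin) auto
      also have "\<dots> \<le> card (gset s v x) + card ?Z"
        using finV by (intro card_Un_le[THEN order_trans] add_mono card_image_le) auto
      finally show ?thesis by (simp add: card_filter_sum[OF finV])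
    qed
    then have "real (mism g v) \<le> (\<Sum>x\<in>nb g v. real (card (gset s v x)) +
        (\<Sum>z\<in>V. of_bool (z \<in> nb g x \<and> (\<exists>c. att g s z = Some c \<and> c \<in> pal g x - pal g v))))"
      unfolding mism_def of_nat_sum by (rule sum_mono)
    also have "\<dots> = (\<Sum>x\<in>nb g v. real (card (gset s v x))) +
        (\<Sum>z\<in>V. \<Sum>x\<in>nb g v. of_bool (z \<in> nb g x \<and> (\<exists>c. att g s z = Some c \<and> c \<in> pal g x - pal g v)))"
      by (simp add: sum.distrib sum.swap[of _ V])
    also have "(\<Sum>z\<in>V. \<Sum>x\<in>nb g v. of_bool (z \<in> nb g x \<and> (\<exists>c. att g s z = Some c \<and> c \<in> pal g x - pal g v)))
      = ?D * ev s h"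
      unfolding ev_def sum_distrib_left
    proof (intro sum.cong refl)
      fix z
      show "(\<Sum>x\<in>nb g v. of_bool (z \<in> nb g x \<and> (\<exists>c. att g s z = Some c \<and> c \<in> pal g x - pal g v)))
        = ?D * (case att g s z of None \<Rightarrow> 0 | Some x \<Rightarrow> h z s x)"
        using dg_pos v by (auto simp: card_filter_sum h_def R_def Int_def split: option.splits)
    qed
    finally show ?thesis .
  qed
  have "avg (2 ^ b) J0 (\<lambda>s. exp (ev s h - 2 * \<tau> * (\<Sum>u\<in>V. \<Sum>c\<in>pal g u. h u s c))) \<le> 1"
    using R_le dg_pos by (intro trial_up) (auto simp: h_def dep_def)
  then have "prb (2 ^ b) J0 (\<lambda>s. (\<Sum>x\<in>nb g v. real (card (gset s v x))) < real (mism g v) / 2)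
    \<le> exp (- (real (mism g v) / (4 * ?D)))"
  proof (rule prb_exp_le)
    fix s assume "(\<Sum>x\<in>nb g v. real (card (gset s v x))) < real (mism g v) / 2"
    then have "real (mism g v) / 2 \<le> ?D * ev s h" using loss[of s] by linarith
    then have 1: "real (mism g v) / (2 * ?D) \<le> ev s h" using dg_pos by (simp add: field_simps)
    have "2 * \<tau> * (\<Sum>u\<in>V. \<Sum>c\<in>pal g u. h u s c) \<le> 2 * (1 / (8 * ?D)) * real (mism g v)"
    proof (intro mult_mono total)
      have "1 / (2048 * (?D + 1)) \<le> 1 / (8 * ?D)" using dg_pos by (intro divide_left_mono) auto
      then show "\<tau> \<le> 1 / (8 * ?D)" using \<tau>_le by linarith
    qed (use \<tau>_pos in \<open>auto intro!: sum_nonneg simp: h_def\<close>)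
    then have "2 * \<tau> * (\<Sum>u\<in>V. \<Sum>c\<in>pal g u. h u s c) \<le> real (mism g v) / (4 * ?D)" by simp
    moreover have "real (mism g v) / (2 * ?D) = real (mism g v) / (4 * ?D) + real (mism g v) / (4 * ?D)"
      by simp
    ultimately show "real (mism g v) / (4 * ?D) \<le> ev s h - 2 * \<tau> * (\<Sum>u\<in>V. \<Sum>c\<in>pal g u. h u s c)"
      using 1 by linarith
  qed
  then show ?thesis by simp
qed

section \<open>Gain from pairs of non-adjacent neighbors\<close>

definition fut :: "nat \<Rightarrow> nat \<Rightarrow> nat set" where
  "fut v u = {x \<in> nb g v. u < x \<and> x \<notin> nb g u}"

definition ecnt :: "nat \<Rightarrow> nat" where
  "ecnt v = (\<Sum>u\<in>nb g v. card (fut v u))"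

text \<open>No earlier try of \<open>c\<close> next to \<open>u\<close> lets \<open>u\<close> keep
  \<open>c\<close>. No earlier try next to \<open>v\<close> gives different fresh neighbors of
  \<open>v\<close> different colors, so that \<open>gset_low\<close> can count colors instead of
  vertices.\<close>

definition fresh :: "seeds \<Rightarrow> nat \<Rightarrow> nat \<Rightarrow> nat \<Rightarrow> bool" where
  "fresh s v u c \<longleftrightarrow> (\<forall>z\<in>nb g u \<union> nb g v. z < u \<longrightarrow> att g s z \<noteq> Some c)"

text \<open>Judged when \<open>u\<close> acts: the later non-neighbors \<open>x\<close> that may
  profit from the color of \<open>u\<close>, because no neighbor of \<open>x\<close> has tried it so
  far.\<close>

definition recv :: "seeds \<Rightarrow> nat \<Rightarrow> nat \<Rightarrow> nat \<Rightarrow> nat set" where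
  "recv s v u c = {x \<in> fut v u. c \<in> pal g x \<and> (\<forall>z\<in>nb g x. z < u \<longrightarrow> att g s z \<noteq> Some c)}"

text \<open>A try of \<open>c\<close> by \<open>z\<close>, between \<open>u\<close> and
  \<open>x\<close> in the order of IDs, destroys the profit of \<open>x\<close>. Since
  \<open>u\<close> acts before \<open>z\<close>, the set is determined when \<open>z\<close> is
  revealed.\<close>

definition lost :: "seeds \<Rightarrow> nat \<Rightarrow> nat \<Rightarrow> nat \<Rightarrow> nat set" where
  "lost s v z c = {x \<in> nb g v. z \<in> nb g x \<and> z < x \<and>
     (\<exists>u\<in>nb g v. u < z \<and> att g s u = Some c \<and> fresh s v u c \<and> x \<in> recv s v u c)}"

definition quiet :: "seeds \<Rightarrow> nat \<Rightarrow> bool" where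
  "quiet s v \<longleftrightarrow> (\<forall>y\<in>insert v (nb g v). 8 * actn s y \<le> dg g)"

lemma fut_fin [simp]: "v \<in> V \<Longrightarrow> finite (fut v u)"
  by (simp add: fut_def)

lemma fut_card: "v \<in> V \<Longrightarrow> card (fut v u) \<le> dg g"
  using card_mono[of "nb g v" "fut v u"] nb_deg[of v] by (auto simp: fut_def)

lemma swap_fut:
  assumes v: "v \<in> V"
  shows "(\<Sum>u\<in>nb g v. \<Sum>x\<in>fut v u. f x u) = (\<Sum>x\<in>nb g v. \<Sum>u\<in>{u \<in> nb g v. u < x \<and> u \<notin> nb g x}. f x u :: real)"
proof -
  have "(\<Sum>u\<in>nb g v. \<Sum>x\<in>fut v u. f x u) = (\<Sum>u\<in>nb g v. \<Sum>x\<in>nb g v. if u < x \<and> x \<notin> nb g u then f x u else 0)"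
    unfolding fut_def using v by (intro sum.cong refl sum.inter_filter) auto
  also have "\<dots> = (\<Sum>x\<in>nb g v. \<Sum>u\<in>nb g v. if u < x \<and> x \<notin> nb g u then f x u else 0)"
    by (rule sum.swap)
  also have "\<dots> = (\<Sum>x\<in>nb g v. \<Sum>u\<in>{u \<in> nb g v. u < x \<and> x \<notin> nb g u}. f x u)"
    using v by (intro sum.cong refl sum.inter_filter[symmetric]) auto
  also have "\<dots> = (\<Sum>x\<in>nb g v. \<Sum>u\<in>{u \<in> nb g v. u < x \<and> u \<notin> nb g x}. f x u)"
  proof (intro sum.cong refl)
    fix x assume "x \<in> nb g v"
    then have "x \<in> V" using v by simp
    then show "{u \<in> nb g v. u < x \<and> x \<notin> nb g u} = {u \<in> nb g v. u < x \<and> u \<notin> nb g x}"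
      using nb_sym v nb_in by blast
  qed
  finally show ?thesis .
qed

lemma split_nonadj:
  assumes v: "v \<in> V" and u: "u \<in> nb g v"
  shows "card {z \<in> nb g v. z \<noteq> u \<and> z \<notin> nb g u} = card (fut v u) + card {z \<in> nb g v. z < u \<and> z \<notin> nb g u}"
proof -
  have "{z \<in> nb g v. z \<noteq> u \<and> z \<notin> nb g u} = fut v u \<union> {z \<in> nb g v. z < u \<and> z \<notin> nb g u}"
    by (auto simp: fut_def)
  moreover have "fut v u \<inter> {z \<in> nb g v. z < u \<and> z \<notin> nb g u} = {}" by (auto simp: fut_def)
  ultimately show ?thesis using v by (simp add: card_Un_disjoint)
qed

lemma nonadj_ecnt:
  assumes v: "v \<in> V"
  shows "nonadj g v = 2 * ecnt v"
proof -
  have "real (nonadj g v) = (\<Sum>u\<in>nb g v. real (card (fut v u))) + (\<Sum>u\<in>nb g v. real (card {z \<in> nb g v. z < u \<and> z \<notin> nb g u}))"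
    unfolding nonadj_def using split_nonadj[OF v] by (simp add: sum.distrib)
  also have "(\<Sum>u\<in>nb g v. real (card {z \<in> nb g v. z < u \<and> z \<notin> nb g u})) = (\<Sum>u\<in>nb g v. real (card (fut v u)))"
    using swap_fut[OF v, of "\<lambda>_ _. 1"] by simp
  finally have "real (nonadj g v) = real (2 * ecnt v)" by (simp add: ecnt_def)
  then show ?thesis by (simp only: of_nat_eq_iff)
qed

lemma fresh_dep:
  assumes "u \<in> V" "v \<in> V" "u \<le> k" "\<forall>i\<in>{j \<in> J0. fst j < k}. s i = t i"
  shows "fresh s v u c = fresh t v u c"
proof -
  have "att g s z = att g t z" if "z \<in> nb g u \<union> nb g v" "z < u" for z
    using that assms by (intro att_dep[OF _ _ assms(4)]) auto
  then show ?thesis unfolding fresh_def by (intro ball_cong refl) auto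
qed

lemma recv_dep:
  assumes "v \<in> V" "u \<le> k" "\<forall>i\<in>{j \<in> J0. fst j < k}. s i = t i"
  shows "recv s v u c = recv t v u c"
proof -
  have "att g s z = att g t z" if "x \<in> fut v u" "z \<in> nb g x" "z < u" for z x
    using that assms nb_in[of x z] nb_in[of v x] by (intro att_dep[OF _ _ assms(3)]) (auto simp: fut_def)
  then show ?thesis unfolding recv_def by (intro Collect_cong conj_cong refl ball_cong) auto
qed

definition hg :: "nat \<Rightarrow> nat \<Rightarrow> seeds \<Rightarrow> nat \<Rightarrow> real" where
  "hg v u s c = of_bool (u \<in> nb g v \<and> fresh s v u c) * real (card (recv s v u c)) / real (dg g)"

definition hl :: "nat \<Rightarrow> nat \<Rightarrow> seeds \<Rightarrow> nat \<Rightarrow> real" where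
  "hl v z s c = real (card (lost s v z c)) / real (dg g)"

lemma recv_sub: "recv s v u c \<subseteq> fut v u"
  by (auto simp: recv_def)

lemma recv_card: "v \<in> V \<Longrightarrow> card (recv s v u c) \<le> dg g"
  using card_mono[OF fut_fin recv_sub] fut_card order_trans by blast

lemma lost_card: "v \<in> V \<Longrightarrow> card (lost s v z c) \<le> dg g"
  using card_mono[of "nb g v" "lost s v z c"] nb_deg[of v] by (auto simp: lost_def)

lemma pal_inter:
  assumes "u \<in> V" "x \<in> V" "v \<in> V"
  shows "dg g + 1 \<le> card (pal g u \<inter> pal g x) + card (pal g u - pal g v) + card (pal g x - pal g v)"
proof -
  have "card (pal g x - pal g v) = card (pal g v - pal g x)"
    using assms pal_card card_Diff_subset_Int[of "pal g x" "pal g v"] card_Diff_subset_Int[of "pal g v" "pal g x"]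
    by (simp add: Int_commute)
  moreover have "pal g u \<subseteq> (pal g u \<inter> pal g x) \<union> (pal g u - pal g v) \<union> (pal g v - pal g x)" by blast
  then have "card (pal g u) \<le> card ((pal g u \<inter> pal g x) \<union> (pal g u - pal g v) \<union> (pal g v - pal g x))"
    using assms by (intro card_mono) auto
  then have "card (pal g u) \<le> card (pal g u \<inter> pal g x) + card (pal g u - pal g v) + card (pal g v - pal g x)"
    using card_Un_le[of "(pal g u \<inter> pal g x) \<union> (pal g u - pal g v)" "pal g v - pal g x"]
      card_Un_le[of "pal g u \<inter> pal g x" "pal g u - pal g v"] by linarith
  ultimately show ?thesis using pal_card[OF assms(1)] by simp
qed

lemma actn_colors:
  assumes "y \<in> V"
  shows "card {c. \<exists>z\<in>nb g y. att g s z = Some c} \<le> actn s y" "finite {c. \<exists>z\<in>nb g y. att g s z = Some c}"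
proof -
  have sub: "{c. \<exists>z\<in>nb g y. att g s z = Some c} \<subseteq> (\<lambda>z. the (att g s z)) ` {z \<in> nb g y. att g s z \<noteq> None}"
    by (force intro: rev_image_eqI)
  have fin: "finite {z \<in> nb g y. att g s z \<noteq> None}" using assms by simp
  show "finite {c. \<exists>z\<in>nb g y. att g s z = Some c}" by (rule finite_subset[OF sub finite_imageI[OF fin]])
  show "card {c. \<exists>z\<in>nb g y. att g s z = Some c} \<le> actn s y"
    unfolding actn_def by (rule surj_card_le[OF fin sub])
qed

text \<open>Two neighbors u and x of \<open>v\<close> have at least D common colors, up to those
  that either has outside the palette of \<open>v\<close>. Around a quiet vertex at most 3 D / 8 of
  them have been tried. This leaves 5/8 per pair, and the bound on \<open>mism g v\<close> keeps the
  correction below 1/8.\<close>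

lemma hg_total:
  assumes v: "v \<in> V" and q: "quiet s v" and m: "16 * mism g v \<le> nonadj g v"
  shows "real (ecnt v) / 2 \<le> (\<Sum>u\<in>V. \<Sum>c\<in>pal g u. hg v u s c)"
proof -
  let ?D = "real (dg g)"
  define d where "d u = real (card (pal g u - pal g v))" for u
  have row: "(\<Sum>x\<in>fut v u. 5 / 8 * ?D - d u - d x) \<le> (\<Sum>c\<in>pal g u. ?D * hg v u s c)" if u: "u \<in> nb g v" for u
  proof -
    have uV: "u \<in> V" using u v by simp
    have "(\<Sum>c\<in>pal g u. ?D * hg v u s c) = (\<Sum>c\<in>pal g u. \<Sum>x\<in>fut v u. of_bool (fresh s v u c \<and> x \<in> recv s v u c))"
    proof (intro sum.cong refl)
      fix c
      have "{x \<in> fut v u. x \<in> recv s v u c} = recv s v u c" by (auto simp: recv_def)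
      then show "?D * hg v u s c = (\<Sum>x\<in>fut v u. of_bool (fresh s v u c \<and> x \<in> recv s v u c))"
        unfolding card_filter_sum[OF fut_fin[OF v]] hg_def using u dg_pos by (cases "fresh s v u c") auto
    qed
    also have "\<dots> = (\<Sum>x\<in>fut v u. real (card {c \<in> pal g u. fresh s v u c \<and> x \<in> recv s v u c}))"
      by (subst sum.swap) (simp only: card_filter_sum[OF pal_fin[OF uV]])
    also have "\<dots> \<ge> (\<Sum>x\<in>fut v u. 5 / 8 * ?D - d u - d x)"
    proof (rule sum_mono)
      fix x assume x: "x \<in> fut v u"
      then have xN: "x \<in> nb g v" and xV: "x \<in> V" using v by (auto simp: fut_def)
      let ?T = "\<lambda>y. {c. \<exists>z\<in>nb g y. att g s z = Some c}"
      let ?S = "{c \<in> pal g u. fresh s v u c \<and> x \<in> recv s v u c}"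
      have "pal g u \<inter> pal g x \<subseteq> ?S \<union> ?T u \<union> ?T v \<union> ?T x"
        using x by (auto simp: fresh_def recv_def)
      then have "card (pal g u \<inter> pal g x) \<le> card (?S \<union> ?T u \<union> ?T v \<union> ?T x)"
        using uV xV v actn_colors(2) by (intro card_mono) auto
      also have "\<dots> \<le> card ?S + card (?T u) + card (?T v) + card (?T x)"
        using card_Un_le[of "?S \<union> ?T u \<union> ?T v" "?T x"] card_Un_le[of "?S \<union> ?T u" "?T v"]
          card_Un_le[of ?S "?T u"] by linarith
      also have "\<dots> \<le> card ?S + actn s u + actn s v + actn s x"
        using actn_colors(1)[OF uV] actn_colors(1)[OF v] actn_colors(1)[OF xV] by (intro add_mono) auto
      finally have "card (pal g u \<inter> pal g x) \<le> card ?S + actn s u + actn s v + actn s x" .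
      moreover have "8 * actn s u \<le> dg g" "8 * actn s v \<le> dg g" "8 * actn s x \<le> dg g"
        using q u xN by (auto simp: quiet_def)
      ultimately have "real (card (pal g u \<inter> pal g x)) \<le> real (card ?S) + 3 / 8 * ?D" by linarith
      moreover have "?D + 1 \<le> real (card (pal g u \<inter> pal g x)) + d u + d x"
        using pal_inter[OF uV xV v] by (simp add: d_def)
      ultimately show "5 / 8 * ?D - d u - d x \<le> real (card ?S)" by linarith
    qed
    finally show ?thesis .
  qed
  have "(\<Sum>u\<in>nb g v. \<Sum>x\<in>fut v u. 5 / 8 * ?D - d u - d x) =
    5 / 8 * ?D * real (ecnt v) - ((\<Sum>u\<in>nb g v. \<Sum>x\<in>fut v u. d u) + (\<Sum>u\<in>nb g v. \<Sum>x\<in>fut v u. d x))"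
    by (simp add: sum_subtractf ecnt_def sum_distrib_left sum_divide_distrib right_diff_distrib mult.commute)
  moreover have "(\<Sum>u\<in>nb g v. \<Sum>x\<in>fut v u. d u) + (\<Sum>u\<in>nb g v. \<Sum>x\<in>fut v u. d x) \<le> ?D * real (mism g v)"
  proof -
    have "(\<Sum>u\<in>nb g v. \<Sum>x\<in>fut v u. d u) + (\<Sum>u\<in>nb g v. \<Sum>x\<in>fut v u. d x) =
      (\<Sum>u\<in>nb g v. real (card {z \<in> nb g v. z \<noteq> u \<and> z \<notin> nb g u}) * d u)"
      unfolding swap_fut[OF v, of "\<lambda>x u. d x"] sum.distrib[symmetric]
      by (intro sum.cong refl) (simp add: split_nonadj[OF v] algebra_simps)
    also have "\<dots> \<le> (\<Sum>u\<in>nb g v. ?D * d u)"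
    proof (intro sum_mono mult_right_mono)
      fix u
      have "card {z \<in> nb g v. z \<noteq> u \<and> z \<notin> nb g u} \<le> card (nb g v)" using v by (intro card_mono) auto
      then show "real (card {z \<in> nb g v. z \<noteq> u \<and> z \<notin> nb g u}) \<le> ?D" using nb_deg[OF v] by simp
    qed (auto simp: d_def)
    finally show ?thesis by (simp add: mism_def d_def sum_distrib_left)
  qed
  moreover have "real (mism g v) \<le> real (ecnt v) / 8" using m nonadj_ecnt[OF v] by simp
  then have "?D * real (mism g v) \<le> ?D * (real (ecnt v) / 8)" by (rule mult_left_mono) auto
  ultimately have "?D * (real (ecnt v) / 2) \<le> (\<Sum>u\<in>nb g v. \<Sum>x\<in>fut v u. 5 / 8 * ?D - d u - d x)"
    by (simp add: field_simps)
  also have "\<dots> \<le> (\<Sum>u\<in>nb g v. \<Sum>c\<in>pal g u. ?D * hg v u s c)" by (intro sum_mono row)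
  also have "\<dots> \<le> (\<Sum>u\<in>V. \<Sum>c\<in>pal g u. ?D * hg v u s c)"
    using v finV nbV by (intro sum_mono2) (auto intro!: sum_nonneg simp: hg_def)
  finally have "?D * (real (ecnt v) / 2) \<le> ?D * (\<Sum>u\<in>V. \<Sum>c\<in>pal g u. hg v u s c)"
    by (simp add: sum_distrib_left)
  then show ?thesis using dg_pos by simp
qed

lemma hg_tail:
  assumes v: "v \<in> V" and m: "16 * mism g v \<le> nonadj g v"
  shows "prb (2 ^ b) J0 (\<lambda>s. quiet s v \<and> ev s (hg v) < \<tau> * real (ecnt v) / 8)
    \<le> exp (- (\<tau> * real (ecnt v) / 8))"
proof (rule prb_exp_le)
  show "avg (2 ^ b) J0 (\<lambda>s. exp (\<tau> / 2 * (\<Sum>u\<in>V. \<Sum>c\<in>pal g u. hg v u s c) - ev s (hg v))) \<le> 1"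
  proof (rule trial_low)
    show "dep (\<lambda>s. hg v u s c) {j \<in> J0. fst j < u}" if "u \<in> V" for u c
      unfolding dep_def
    proof (intro allI impI)
      fix s t :: seeds assume "\<forall>i\<in>{j \<in> J0. fst j < u}. s i = t i"
      from fresh_dep[OF that v order_refl this] recv_dep[OF v order_refl this]
      show "hg v u s c = hg v u t c" by (simp add: hg_def)
    qed
  qed (use recv_card[OF v] dg_pos in \<open>auto simp: hg_def\<close>)
  fix s assume s: "quiet s v \<and> ev s (hg v) < \<tau> * real (ecnt v) / 8"
  have "\<tau> / 2 * (real (ecnt v) / 2) \<le> \<tau> / 2 * (\<Sum>u\<in>V. \<Sum>c\<in>pal g u. hg v u s c)"
    using hg_total[OF v _ m, of s] s \<tau>_pos by (intro mult_left_mono) auto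
  then show "\<tau> * real (ecnt v) / 8 \<le> \<tau> / 2 * (\<Sum>u\<in>V. \<Sum>c\<in>pal g u. hg v u s c) - ev s (hg v)"
    using s by linarith
qed

text \<open>Counts the non-adjacent pairs whose earlier vertex tries some color. Only such pairs can
  be destroyed, and they are few, so that the losses are of second order compared to the
  gains.\<close>

definition actf :: "seeds \<Rightarrow> nat \<Rightarrow> real" where
  "actf s v = (\<Sum>u\<in>nb g v. if att g s u \<noteq> None then real (card (fut v u)) else 0)"

lemma actf_tail:
  assumes v: "v \<in> V"
  shows "prb (2 ^ b) J0 (\<lambda>s. actf s v > real (ecnt v) / 512) \<le> exp (- (real (ecnt v) / (1024 * real (dg g))))"
proof -
  let ?D = "real (dg g)"
  define h where "h u s c = of_bool (u \<in> nb g v) * real (card (fut v u)) / ?D" for u and s :: seeds and c :: nat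
  have ev: "ev s h = actf s v / ?D" for s
  proof -
    have "ev s h = (\<Sum>u\<in>V. if u \<in> nb g v then (if att g s u \<noteq> None then real (card (fut v u)) else 0) / ?D else 0)"
      unfolding ev_def h_def by (intro sum.cong) (auto split: option.splits)
    also have "\<dots> = actf s v / ?D"
      using finV nbV[OF v] by (simp add: sum.If_cases Int_absorb1 actf_def sum_divide_distrib)
    finally show ?thesis .
  qed
  have tot: "(\<Sum>u\<in>V. \<Sum>c\<in>pal g u. h u s c) = (?D + 1) * real (ecnt v) / ?D" for s
  proof -
    have "(\<Sum>u\<in>V. \<Sum>c\<in>pal g u. h u s c) = (\<Sum>u\<in>V. if u \<in> nb g v then (?D + 1) * real (card (fut v u)) / ?D else 0)"
      by (intro sum.cong) (auto simp: h_def pal_card)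
    also have "\<dots> = (?D + 1) * real (ecnt v) / ?D"
      using finV nbV[OF v] by (simp add: sum.If_cases Int_absorb1 ecnt_def sum_divide_distrib sum_distrib_left)
    finally show ?thesis .
  qed
  show ?thesis
  proof (rule prb_exp_le)
    show "avg (2 ^ b) J0 (\<lambda>s. exp (ev s h - 2 * \<tau> * (\<Sum>u\<in>V. \<Sum>c\<in>pal g u. h u s c))) \<le> 1"
      using fut_card[OF v] dg_pos by (intro trial_up) (auto simp: h_def dep_def)
    fix s assume "actf s v > real (ecnt v) / 512"
    then have 1: "real (ecnt v) / (512 * ?D) \<le> ev s h" unfolding ev using dg_pos by (simp add: field_simps)
    have "2 * \<tau> * ((?D + 1) * real (ecnt v) / ?D) \<le> 2 * (1 / (2048 * (?D + 1))) * ((?D + 1) * real (ecnt v) / ?D)"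
      using \<tau>_le by (intro mult_right_mono) auto
    moreover have "2 * (1 / (2048 * a)) * (a * e / d) = e / (1024 * d)" if "a > 0" for a e d :: real
      using that by simp
    from this[of "?D + 1"] have "2 * (1 / (2048 * (?D + 1))) * ((?D + 1) * real (ecnt v) / ?D) = real (ecnt v) / (1024 * ?D)"
      by (simp add: add_nonneg_pos)
    ultimately have "2 * \<tau> * ((?D + 1) * real (ecnt v) / ?D) \<le> real (ecnt v) / (1024 * ?D)"
      by linarith
    with 1 show "real (ecnt v) / (1024 * ?D) \<le> ev s h - 2 * \<tau> * (\<Sum>u\<in>V. \<Sum>c\<in>pal g u. h u s c)"
      unfolding tot by (simp add: field_simps)
  qed
qed

text \<open>A pair u, x with a try by u is exposed to at most \<open>dg g\<close> neighbors of x,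
  each only through the one color tried by u. The division by \<open>dg g\<close> in
  \<open>hl\<close> cancels this number.\<close>

lemma hl_total:
  assumes v: "v \<in> V"
  shows "(\<Sum>z\<in>V. \<Sum>c\<in>pal g z. hl v z s c) \<le> actf s v"
proof -
  let ?D = "real (dg g)"
  let ?I = "\<lambda>z c u x. of_bool (z \<in> nb g x) * of_bool (att g s u = Some c) :: real"
  have "(\<Sum>z\<in>V. \<Sum>c\<in>pal g z. real (card (lost s v z c))) \<le> (\<Sum>z\<in>V. \<Sum>c\<in>pal g z. \<Sum>u\<in>nb g v. \<Sum>x\<in>fut v u. ?I z c u x)"
  proof (intro sum_mono)
    fix z c
    have "lost s v z c \<subseteq> (\<Union>u\<in>nb g v. {x \<in> fut v u. z \<in> nb g x \<and> att g s u = Some c})"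
      by (auto simp: lost_def recv_def)
    then have "card (lost s v z c) \<le> card (\<Union>u\<in>nb g v. {x \<in> fut v u. z \<in> nb g x \<and> att g s u = Some c})"
      using v by (intro card_mono) auto
    also have "\<dots> \<le> (\<Sum>u\<in>nb g v. card {x \<in> fut v u. z \<in> nb g x \<and> att g s u = Some c})"
      using v by (intro card_UN_le) auto
    finally have "real (card (lost s v z c)) \<le> (\<Sum>u\<in>nb g v. real (card {x \<in> fut v u. z \<in> nb g x \<and> att g s u = Some c}))"
      using of_nat_mono[where 'a = real] by fastforce
    also have "\<dots> = (\<Sum>u\<in>nb g v. \<Sum>x\<in>fut v u. ?I z c u x)"
      unfolding card_filter_sum[OF fut_fin[OF v], symmetric] by (simp only: of_bool_conj)
    finally show "real (card (lost s v z c)) \<le> (\<Sum>u\<in>nb g v. \<Sum>x\<in>fut v u. ?I z c u x)" .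
  qed
  also have "\<dots> = (\<Sum>z\<in>V. \<Sum>u\<in>nb g v. \<Sum>c\<in>pal g z. \<Sum>x\<in>fut v u. ?I z c u x)"
    by (intro sum.cong refl sum.swap)
  also have "\<dots> = (\<Sum>u\<in>nb g v. \<Sum>z\<in>V. \<Sum>c\<in>pal g z. \<Sum>x\<in>fut v u. ?I z c u x)"
    by (rule sum.swap)
  also have "\<dots> = (\<Sum>u\<in>nb g v. \<Sum>z\<in>V. \<Sum>x\<in>fut v u. \<Sum>c\<in>pal g z. ?I z c u x)"
    by (intro sum.cong refl sum.swap)
  also have "\<dots> = (\<Sum>u\<in>nb g v. \<Sum>x\<in>fut v u. \<Sum>z\<in>V. \<Sum>c\<in>pal g z. ?I z c u x)"
    by (intro sum.cong refl sum.swap)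
  also have "\<dots> \<le> (\<Sum>u\<in>nb g v. \<Sum>x\<in>fut v u. ?D * of_bool (att g s u \<noteq> None))"
  proof (intro sum_mono)
    fix u x assume "u \<in> nb g v" "x \<in> fut v u"
    then have x: "x \<in> V" using v by (auto simp: fut_def)
    have "(\<Sum>z\<in>V. \<Sum>c\<in>pal g z. ?I z c u x) \<le> (\<Sum>z\<in>V. of_bool (z \<in> nb g x) * of_bool (att g s u \<noteq> None))"
    proof (rule sum_mono)
      fix z assume z: "z \<in> V"
      have "(\<Sum>c\<in>pal g z. of_bool (att g s u = Some c) :: real) \<le> of_bool (att g s u \<noteq> None)"
      proof (cases "att g s u")
        case (Some c0)
        have "card {c \<in> pal g z. c0 = c} \<le> card {c0}" by (intro card_mono) auto
        then show ?thesis using Some z by (simp add: card_filter_sum del: sum_of_bool_eq)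
      qed simp
      then have "of_bool (z \<in> nb g x) * (\<Sum>c\<in>pal g z. of_bool (att g s u = Some c) :: real)
        \<le> of_bool (z \<in> nb g x) * of_bool (att g s u \<noteq> None)" by (rule mult_left_mono) auto
      then show "(\<Sum>c\<in>pal g z. ?I z c u x) \<le> of_bool (z \<in> nb g x) * of_bool (att g s u \<noteq> None)"
        by (simp only: sum_distrib_left)
    qed
    also have "\<dots> = real (card {z \<in> V. z \<in> nb g x}) * of_bool (att g s u \<noteq> None)"
      by (simp only: sum_distrib_right[symmetric] card_filter_sum[OF finV])
    also have "\<dots> \<le> ?D * of_bool (att g s u \<noteq> None)"
    proof (rule mult_right_mono)
      have "card {z \<in> V. z \<in> nb g x} \<le> card (nb g x)" using x by (intro card_mono) auto
      then show "real (card {z \<in> V. z \<in> nb g x}) \<le> ?D" using nb_deg[OF x] by simp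
    qed auto
    finally show "(\<Sum>z\<in>V. \<Sum>c\<in>pal g z. ?I z c u x) \<le> ?D * of_bool (att g s u \<noteq> None)" .
  qed
  also have "\<dots> = ?D * actf s v"
    unfolding actf_def sum_distrib_left by (intro sum.cong refl) auto
  finally have "(\<Sum>z\<in>V. \<Sum>c\<in>pal g z. real (card (lost s v z c))) / ?D \<le> actf s v"
    using dg_pos by (simp add: field_simps)
  then show ?thesis by (simp add: hl_def sum_divide_distrib)
qed

lemma hl_tail:
  assumes v: "v \<in> V"
  shows "prb (2 ^ b) J0 (\<lambda>s. actf s v \<le> real (ecnt v) / 512 \<and> ev s (hl v) \<ge> \<tau> * real (ecnt v) / 16)
    \<le> exp (- (\<tau> * real (ecnt v) / 20))"
proof (rule prb_exp_le)
  show "avg (2 ^ b) J0 (\<lambda>s. exp (ev s (hl v) - 2 * \<tau> * (\<Sum>u\<in>V. \<Sum>c\<in>pal g u. hl v u s c))) \<le> 1"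
  proof (rule trial_up)
    show "dep (\<lambda>s. hl v z s c) {j \<in> J0. fst j < z}" if "z \<in> V" for z c
      unfolding dep_def
    proof (intro allI impI)
      fix s t :: seeds assume st: "\<forall>i\<in>{j \<in> J0. fst j < z}. s i = t i"
      have "(att g s u = Some c \<and> fresh s v u c \<and> x \<in> recv s v u c) = (att g t u = Some c \<and> fresh t v u c \<and> x \<in> recv t v u c)"
        if "u < z" "u \<in> nb g v" for u x
        using that(2,1) v att_dep[OF _ that(1) st] fresh_dep[OF _ v less_imp_le[OF that(1)] st]
          recv_dep[OF v less_imp_le[OF that(1)] st] by simp
      note eq = this
      have "(\<exists>u\<in>nb g v. u < z \<and> att g s u = Some c \<and> fresh s v u c \<and> x \<in> recv s v u c) =
        (\<exists>u\<in>nb g v. u < z \<and> att g t u = Some c \<and> fresh t v u c \<and> x \<in> recv t v u c)" for x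
        by (rule bex_cong[OF refl], rule conj_cong[OF refl], rule eq)
      then have "lost s v z c = lost t v z c" by (simp only: lost_def)
      then show "hl v z s c = hl v z t c" by (simp add: hl_def)
    qed
  qed (use lost_card[OF v] dg_pos in \<open>auto simp: hl_def\<close>)
  fix s assume s: "actf s v \<le> real (ecnt v) / 512 \<and> ev s (hl v) \<ge> \<tau> * real (ecnt v) / 16"
  have "2 * \<tau> * (\<Sum>u\<in>V. \<Sum>c\<in>pal g u. hl v u s c) \<le> 2 * \<tau> * (real (ecnt v) / 512)"
    using hl_total[OF v, of s] s \<tau>_pos by (intro mult_left_mono) auto
  moreover have "0 \<le> \<tau> * real (ecnt v)" using \<tau>_pos by simp
  ultimately show "\<tau> * real (ecnt v) / 20 \<le> ev s (hl v) - 2 * \<tau> * (\<Sum>u\<in>V. \<Sum>c\<in>pal g u. hl v u s c)"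
    using s by linarith
qed

text \<open>Each fresh u whose color \<open>x\<close> may receive puts a color into
  \<open>gset s v x\<close>, different for different u, unless a neighbor of \<open>x\<close> with
  ID between u and \<open>x\<close> tries it too. These exceptions are counted by
  \<open>hl\<close>.\<close>

lemma gset_low:
  assumes v: "v \<in> V"
  shows "real (dg g) * ev s (hg v) \<le> (\<Sum>x\<in>nb g v. real (card (gset s v x))) + real (dg g) * ev s (hl v)"
proof -
  let ?D = "real (dg g)"
  define Bx where "Bx x = {u \<in> nb g v. \<exists>c. att g s u = Some c \<and> fresh s v u c \<and> x \<in> recv s v u c}" for x
  define Lx where "Lx x = {z \<in> V. \<exists>c. att g s z = Some c \<and> x \<in> lost s v z c}" for x
  have "?D * ev s (hg v) = (\<Sum>u\<in>V. \<Sum>x\<in>nb g v. of_bool (u \<in> nb g v \<and> (\<exists>c. att g s u = Some c \<and> fresh s v u c \<and> x \<in> recv s v u c)))"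
    unfolding ev_def sum_distrib_left
  proof (intro sum.cong refl)
    fix u
    have "{x \<in> nb g v. x \<in> recv s v u c} = recv s v u c" for c by (auto simp: recv_def fut_def)
    then show "?D * (case att g s u of None \<Rightarrow> 0 | Some c \<Rightarrow> hg v u s c) =
      (\<Sum>x\<in>nb g v. of_bool (u \<in> nb g v \<and> (\<exists>c. att g s u = Some c \<and> fresh s v u c \<and> x \<in> recv s v u c)))"
      unfolding card_filter_sum[OF nb_fin[OF v]] hg_def using dg_pos
      by (cases "att g s u"; cases "u \<in> nb g v"; cases "fresh s v u (the (att g s u))") auto
  qed
  also have "\<dots> = (\<Sum>x\<in>nb g v. real (card (Bx x)))"
  proof (subst sum.swap, intro sum.cong refl)
    fix x
    have "{u \<in> V. u \<in> nb g v \<and> (\<exists>c. att g s u = Some c \<and> fresh s v u c \<and> x \<in> recv s v u c)} = Bx x"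
      using v by (auto simp: Bx_def)
    then show "(\<Sum>u\<in>V. of_bool (u \<in> nb g v \<and> (\<exists>c. att g s u = Some c \<and> fresh s v u c \<and> x \<in> recv s v u c))) = real (card (Bx x))"
      unfolding card_filter_sum[OF finV] by simp
  qed
  also have "\<dots> \<le> (\<Sum>x\<in>nb g v. real (card (gset s v x)) + real (card (Lx x)))"
  proof (rule sum_mono)
    fix x assume x: "x \<in> nb g v"
    have xV: "x \<in> V" using x v by simp
    have "inj_on (\<lambda>u. the (att g s u)) (Bx x)"
    proof (rule inj_onI)
      fix u u' assume u: "u \<in> Bx x" "u' \<in> Bx x" "the (att g s u) = the (att g s u')"
      show "u = u'"
      proof (rule ccontr)
        assume "u \<noteq> u'"
        then have "u < u' \<or> u' < u" by auto
        then show False using u by (auto simp: Bx_def fresh_def)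
      qed
    qed
    then have "card (Bx x) = card ((\<lambda>u. the (att g s u)) ` Bx x)" by (rule card_image[symmetric])
    also have "\<dots> \<le> card (gset s v x \<union> (\<lambda>z. the (att g s z)) ` Lx x)"
    proof (intro card_mono image_subsetI)
      show "finite (gset s v x \<union> (\<lambda>z. the (att g s z)) ` Lx x)"
        using gset_fin[OF xV] finV by (auto simp: Lx_def)
      fix u assume "u \<in> Bx x"
      then obtain c where c: "u \<in> nb g v" "att g s u = Some c" "fresh s v u c" "x \<in> recv s v u c"
        by (auto simp: Bx_def)
      then have ux: "u < x" "x \<notin> nb g u" "c \<in> pal g x" "\<And>z. z \<in> nb g x \<Longrightarrow> z < u \<Longrightarrow> att g s z \<noteq> Some c"
        by (auto simp: recv_def fut_def)
      have "u \<in> V" using c v by simp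
      have u1: "col1 g s u = Some c" using c(2,3) by (auto simp: col1_def fresh_def)
      show "the (att g s u) \<in> gset s v x \<union> (\<lambda>z. the (att g s z)) ` Lx x"
      proof (cases "c \<in> gset s v x")
        case False
        then obtain z where z: "z \<in> nb g x" "z < x" "att g s z = Some c"
          using ux u1 c(1) by (auto simp: gset_def)
        have "z \<noteq> u" using nb_sym[OF xV, of u] z ux by auto
        moreover have "\<not> z < u" using z ux by auto
        ultimately have "u < z" by simp
        then have "x \<in> lost s v z c" using z c x by (auto simp: lost_def)
        then have "z \<in> Lx x" using z xV by (auto simp: Lx_def)
        then show ?thesis using z c by (intro UnI2 rev_image_eqI[of z]) auto
      qed (use c in simp)
    qed
    also have "\<dots> \<le> card (gset s v x) + card (Lx x)"
      using finV by (intro card_Un_le[THEN order_trans] add_mono card_image_le) (auto simp: Lx_def)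
    finally show "real (card (Bx x)) \<le> real (card (gset s v x)) + real (card (Lx x))" by simp
  qed
  also have "\<dots> = (\<Sum>x\<in>nb g v. real (card (gset s v x))) + (\<Sum>x\<in>nb g v. real (card (Lx x)))"
    by (rule sum.distrib)
  also have "(\<Sum>x\<in>nb g v. real (card (Lx x))) = ?D * ev s (hl v)"
  proof -
    have "(\<Sum>x\<in>nb g v. real (card (Lx x))) = (\<Sum>x\<in>nb g v. \<Sum>z\<in>V. of_bool (\<exists>c. att g s z = Some c \<and> x \<in> lost s v z c))"
      by (simp only: Lx_def card_filter_sum[OF finV])
    also have "\<dots> = (\<Sum>z\<in>V. \<Sum>x\<in>nb g v. of_bool (\<exists>c. att g s z = Some c \<and> x \<in> lost s v z c))"
      by (rule sum.swap)
    also have "\<dots> = ?D * ev s (hl v)"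
      unfolding ev_def sum_distrib_left
    proof (intro sum.cong refl)
      fix z
      have "{x \<in> nb g v. x \<in> lost s v z c} = lost s v z c" for c by (auto simp: lost_def)
      then show "(\<Sum>x\<in>nb g v. of_bool (\<exists>c. att g s z = Some c \<and> x \<in> lost s v z c)) =
        ?D * (case att g s z of None \<Rightarrow> 0 | Some c \<Rightarrow> hl v z s c)"
        unfolding card_filter_sum[OF nb_fin[OF v]] hl_def using dg_pos by (cases "att g s z") auto
    qed
    finally show ?thesis .
  qed
  finally show ?thesis .
qed

lemma gain_given_gset:
  assumes "v \<in> V"
  shows "prb (2 ^ b) J0 (\<lambda>s. real (gain s v) \<le> \<gamma> \<and> (\<Sum>x\<in>nb g v. real (card (gset s v x))) \<ge> a)
    \<le> exp (- (\<tau> / 2 * a - \<gamma>))"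
proof (rule prb_exp_le[OF gain_low[OF assms]])
  fix s assume s: "real (gain s v) \<le> \<gamma> \<and> (\<Sum>x\<in>nb g v. real (card (gset s v x))) \<ge> a"
  have "\<tau> / 2 * a \<le> \<tau> / 2 * (\<Sum>x\<in>nb g v. real (card (gset s v x)))"
    using s \<tau>_pos by (intro mult_left_mono) auto
  then show "\<tau> / 2 * a - \<gamma> \<le> \<tau> / 2 * (\<Sum>x\<in>nb g v. real (card (gset s v x))) - real (gain s v)"
    using s by linarith
qed

text \<open>Depending on which part dominates, mismatched colors or non-adjacent pairs fill the sets
  \<open>gset\<close>, and \<open>gain_given_gset\<close> turns their total size into a gain. The
  second case needs two tries in a row and pays the factor 1/8192 from \<tau> twice, whence the
  constant 2^34.\<close>

lemma gain_tail:
  assumes v: "v \<in> V"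
  defines "W \<equiv> real (mism g v + nonadj g v) / (2 ^ 34 * real (dg g))"
  shows "prb (2 ^ b) J0 (\<lambda>s. quiet s v \<and> real (gain s v) \<le> W) \<le> 5 * exp (- W)"
proof (cases "nonadj g v < 16 * mism g v")
  case True
  let ?D = "real (dg g)" and ?M = "real (mism g v)"
  have D: "?D > 0" using dg_pos by simp
  have W: "W \<le> 17 * ?M / (2 ^ 34 * ?D)"
    unfolding W_def using True D by (intro divide_right_mono) auto
  have \<tau>M: "?M / (32768 * ?D) \<le> \<tau> / 2 * (?M / 2)"
    using mult_right_mono[OF \<tau>_ge, of "?M / 4"] by (simp add: mult_ac)
  have "prb (2 ^ b) J0 (\<lambda>s. quiet s v \<and> real (gain s v) \<le> W) \<le>
     prb (2 ^ b) J0 (\<lambda>s. (\<Sum>x\<in>nb g v. real (card (gset s v x))) < ?M / 2) +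
     prb (2 ^ b) J0 (\<lambda>s. real (gain s v) \<le> W \<and> (\<Sum>x\<in>nb g v. real (card (gset s v x))) \<ge> ?M / 2)"
    by (rule prb_disj) auto
  also have "\<dots> \<le> exp (- ?M / (4 * ?D)) + exp (- (\<tau> / 2 * (?M / 2) - W))"
    by (intro add_mono mism_case gain_given_gset v)
  also have "\<dots> \<le> exp (- W) + exp (- W)"
  proof (intro add_mono exp_le_cancel_iff[THEN iffD2])
    show "- ?M / (4 * ?D) \<le> - W" using W D by (simp add: field_simps)
    have "2 * (17 * ?M / (2 ^ 34 * ?D)) \<le> ?M / (32768 * ?D)" using D by (simp add: field_simps)
    then show "- (\<tau> / 2 * (?M / 2) - W) \<le> - W" using \<tau>M W by linarith
  qed
  also have "\<dots> \<le> 5 * exp (- W)" by simp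
  finally show ?thesis .
next
  case False
  let ?D = "real (dg g)" and ?E = "real (ecnt v)"
  let ?S = "\<lambda>s. \<Sum>x\<in>nb g v. real (card (gset s v x))"
  have D: "?D > 0" using dg_pos by simp
  have "real (mism g v + nonadj g v) \<le> 3 * ?E" using False nonadj_ecnt[OF v] by simp
  then have W: "W \<le> 3 * ?E / (2 ^ 34 * ?D)"
    unfolding W_def using D by (intro divide_right_mono) auto
  have \<tau>E: "?E / (8192 * ?D) \<le> \<tau> * ?E"
    using mult_right_mono[OF \<tau>_ge, of ?E] by simp
  have \<tau>D: "1 / 8192 \<le> \<tau> * ?D"
    using mult_right_mono[OF \<tau>_ge, of ?D] D by simp
  let ?A1 = "\<lambda>s. quiet s v \<and> real (gain s v) \<le> W \<and> \<not> ev s (hg v) < \<tau> * ?E / 8"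
  let ?A2 = "\<lambda>s. real (gain s v) \<le> W \<and> \<not> ev s (hg v) < \<tau> * ?E / 8 \<and> actf s v \<le> ?E / 512"
  have 1: "prb (2 ^ b) J0 (\<lambda>s. quiet s v \<and> real (gain s v) \<le> W) \<le>
     prb (2 ^ b) J0 (\<lambda>s. quiet s v \<and> ev s (hg v) < \<tau> * ?E / 8) + prb (2 ^ b) J0 ?A1"
    by (rule prb_disj) blast
  have 2: "prb (2 ^ b) J0 ?A1 \<le> prb (2 ^ b) J0 (\<lambda>s. actf s v > ?E / 512) + prb (2 ^ b) J0 ?A2"
    by (rule prb_disj) auto
  have 3: "prb (2 ^ b) J0 ?A2 \<le> prb (2 ^ b) J0 (\<lambda>s. actf s v \<le> ?E / 512 \<and> ev s (hl v) \<ge> \<tau> * ?E / 16) +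
     prb (2 ^ b) J0 (\<lambda>s. real (gain s v) \<le> W \<and> ?S s \<ge> ?D * (\<tau> * ?E / 16))"
  proof (rule prb_disj)
    fix s assume s: "?A2 s"
    show "(actf s v \<le> ?E / 512 \<and> ev s (hl v) \<ge> \<tau> * ?E / 16) \<or> (real (gain s v) \<le> W \<and> ?S s \<ge> ?D * (\<tau> * ?E / 16))"
    proof (cases "ev s (hl v) \<ge> \<tau> * ?E / 16")
      case False
      then have "\<tau> * ?E / 16 \<le> ev s (hg v) - ev s (hl v)" using s by linarith
      then have "?D * (\<tau> * ?E / 16) \<le> ?D * (ev s (hg v) - ev s (hl v))" using D by (intro mult_left_mono) auto
      then have "?D * (\<tau> * ?E / 16) \<le> ?S s" using gset_low[OF v, of s] by (simp add: right_diff_distrib)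
      then show ?thesis using s by simp
    qed (use s in auto)
  qed
  have "prb (2 ^ b) J0 (\<lambda>s. quiet s v \<and> real (gain s v) \<le> W) \<le>
     prb (2 ^ b) J0 (\<lambda>s. quiet s v \<and> ev s (hg v) < \<tau> * ?E / 8) +
     (prb (2 ^ b) J0 (\<lambda>s. actf s v > ?E / 512) +
     (prb (2 ^ b) J0 (\<lambda>s. actf s v \<le> ?E / 512 \<and> ev s (hl v) \<ge> \<tau> * ?E / 16) +
     prb (2 ^ b) J0 (\<lambda>s. real (gain s v) \<le> W \<and> ?S s \<ge> ?D * (\<tau> * ?E / 16))))"
    using 1 2 3 by linarith
  also have "\<dots> \<le> exp (- (\<tau> * ?E / 8)) + (exp (- (?E / (1024 * ?D))) + (exp (- (\<tau> * ?E / 20)) +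
      exp (- (\<tau> / 2 * (?D * (\<tau> * ?E / 16)) - W))))"
    using False by (intro add_mono hg_tail actf_tail hl_tail gain_given_gset v) auto
  also have "\<dots> \<le> exp (- W) + (exp (- W) + (exp (- W) + exp (- W)))"
  proof (intro add_mono exp_le_cancel_iff[THEN iffD2])
    \<comment> \<open>262144 = 32 * 8192: the factors 1/2 and 1/16 give 1/32, and \<tau> D is at
      least 1/8192. As 6 is at most 2^3, the exponent 34 = 13 + 18 + 3 suffices.\<close>
    have 1: "6 * ?E / (2 ^ 34 * ?D) \<le> ?E / (8192 * ?D) / 262144" using D by (simp add: field_simps)
    have 2: "?E / (8192 * ?D) / 262144 \<le> \<tau> * ?E / 262144" using \<tau>E by (intro divide_right_mono) auto
    have 3: "\<tau> * ?E / 262144 \<le> \<tau> / 2 * (?D * (\<tau> * ?E / 16))"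
      using mult_right_mono[OF \<tau>D, of "\<tau> * ?E / 32"] \<tau>_pos by (simp add: mult_ac)
    have 4: "2 * W \<le> \<tau> * ?E / 262144" using 1 2 W by linarith
    have 5: "0 \<le> \<tau> * ?E" using \<tau>_pos by simp
    have 6: "0 \<le> W" by (simp add: W_def)
    show "- (\<tau> * ?E / 8) \<le> - W" "- (\<tau> * ?E / 20) \<le> - W" using 4 5 6 by linarith+
    show "- (\<tau> / 2 * (?D * (\<tau> * ?E / 16)) - W) \<le> - W" using 3 4 by linarith
    have "3 * ?E / (2 ^ 34 * ?D) \<le> ?E / (1024 * ?D)" using D by (simp add: field_simps)
    then show "- (?E / (1024 * ?D)) \<le> - W" using W by linarith
  qed
  also have "\<dots> \<le> 5 * exp (- W)" by simp
  finally show ?thesis .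
qed

end

section \<open>Clusters\<close>

context gph
begin

lemma codeg_sym: "codeg g u v = codeg g v u"
  by (simp add: codeg_def Int_commute)

text \<open>Inclusion-exclusion inside \<open>nb g v\<close>. In other words, \<open>dg g\<close>
  minus the codegree obeys a triangle inequality.\<close>

lemma codeg_tri:
  assumes "u \<in> V" "v \<in> V" "x \<in> V"
  shows "codeg g u v + codeg g v x \<le> dg g + codeg g u x"
proof -
  let ?A = "nb g u \<inter> nb g v" and ?B = "nb g v \<inter> nb g x"
  have "card ?A + card ?B = card (?A \<union> ?B) + card (?A \<inter> ?B)"
    using assms by (intro card_Un_Int) auto
  moreover have "card (?A \<union> ?B) \<le> card (nb g v)" using assms by (intro card_mono) auto
  moreover have "card (?A \<inter> ?B) \<le> card (nb g u \<inter> nb g x)" using assms by (intro card_mono) auto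
  ultimately show ?thesis using nb_deg[OF assms(2)] by (simp add: codeg_def)
qed

lemma dense_deg:
  assumes "v \<in> V" "dense g v"
  shows "99 * dg g \<le> 100 * card (nb g v)"
proof -
  have "card {u \<in> nb g v. 99 * dg g \<le> 100 * codeg g u v} \<le> card (nb g v)"
    using assms by (intro card_mono) auto
  then show ?thesis using assms(2) by (simp add: dense_def)
qed

text \<open>Similarity of dense vertices has a gap. Sharing one half forces a common neighbor
  outside the exceptional ones, at most D / 100 at either end, and the triangle inequality through
  it yields 98/100. The gap makes similarity transitive (\<open>cls_trans\<close>).\<close>

lemma dense_sim:
  assumes "v \<in> V" "w \<in> V" "dense g v" "dense g w" "dg g \<le> 2 * codeg g v w" "1 \<le> dg g"
  shows "98 * dg g \<le> 100 * codeg g v w"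
proof -
  let ?F = "\<lambda>v. {u \<in> nb g v. 99 * dg g \<le> 100 * codeg g u v}"
  have c: "100 * card (nb g v - ?F v) \<le> dg g" if "v \<in> V" "dense g v" for v
  proof -
    have "card (nb g v - ?F v) = card (nb g v) - card (?F v)"
      using that by (intro card_Diff_subset) auto
    then show ?thesis using nb_deg[OF that(1)] that(2) by (simp add: dense_def)
  qed
  have "?F v \<inter> ?F w \<noteq> {}"
  proof
    assume "?F v \<inter> ?F w = {}"
    then have "nb g v \<inter> nb g w \<subseteq> (nb g v - ?F v) \<union> (nb g w - ?F w)" by blast
    then have "codeg g v w \<le> card ((nb g v - ?F v) \<union> (nb g w - ?F w))"
      unfolding codeg_def using assms by (intro card_mono) auto
    also have "\<dots> \<le> card (nb g v - ?F v) + card (nb g w - ?F w)" by (rule card_Un_le)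
    finally show False using c[OF assms(1,3)] c[OF assms(2,4)] assms(5,6) by linarith
  qed
  then obtain f where f: "f \<in> ?F v" "f \<in> ?F w" by blast
  then have "f \<in> V" using assms by auto
  from codeg_tri[OF assms(1) this assms(2)] f show ?thesis
    by (simp add: codeg_sym[of f])
qed

lemma cls_iff:
  assumes "v \<in> V" "1 \<le> dg g"
  shows "z \<in> cls g v \<longleftrightarrow> z \<in> V \<and> dense g z \<and> dg g \<le> 2 * codeg g v z"
proof
  assume "z \<in> cls g v"
  then show "z \<in> V \<and> dense g z \<and> dg g \<le> 2 * codeg g v z"
    using assms nb_in[of _ z] nb_in[of v] unfolding cls_def by blast
next
  assume z: "z \<in> V \<and> dense g z \<and> dg g \<le> 2 * codeg g v z"
  then have "codeg g v z \<noteq> 0" using assms by linarith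
  then obtain y where y: "y \<in> nb g v" "y \<in> nb g z" unfolding codeg_def by (metis card.empty disjoint_iff)
  then have "z \<in> nb g y" using z nb_sym by blast
  then show "z \<in> cls g v" using z y by (auto simp: cls_def)
qed

lemma cls_self: "v \<in> V \<Longrightarrow> 1 \<le> dg g \<Longrightarrow> dense g v \<Longrightarrow> v \<in> cls g v"
  using dense_deg[of v] by (auto simp: cls_iff codeg_def)

lemma cls_sim:
  assumes "v \<in> V" "1 \<le> dg g" "dense g v" "z \<in> cls g v"
  shows "98 * dg g \<le> 100 * codeg g v z"
  using assms dense_sim[of v z] by (auto simp: cls_iff)

lemma cls_trans:
  assumes "v \<in> V" "1 \<le> dg g" "dense g v" "w \<in> cls g v" "z \<in> cls g v"
  shows "z \<in> cls g w"
proof -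
  have "w \<in> V" "z \<in> V" "dense g z" using assms cls_iff by auto
  then show ?thesis
    using codeg_tri[OF _ assms(1), of w z] cls_sim[OF assms(1-4)] cls_sim[OF assms(1-3) assms(5)] assms(1,2)
    by (simp add: cls_iff codeg_sym[of w v])
qed

lemma leader_ex:
  assumes "v \<in> V" "1 \<le> dg g" "dense g v" "big g"
  obtains r where "r \<in> V" "r \<in> cls g v" "leader g r" "spars g r \<le> spars g v"
proof -
  have fin: "finite (cls g v)" using finV assms cls_iff by (auto intro: finite_subset[of _ V])
  define m where "m = Min (spars g ` cls g v)"
  define R where "R = {z \<in> cls g v. spars g z = m}"
  have ne: "cls g v \<noteq> {}" using cls_self assms by blast
  have "m \<in> spars g ` cls g v" unfolding m_def using fin ne by (intro Min_in) auto
  then have R: "R \<noteq> {}" "finite R" using fin by (auto simp: R_def)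
  define r where "r = Min R"
  have r: "r \<in> cls g v" "spars g r = m" using Min_in[OF R(2,1)] by (auto simp: r_def R_def)
  have rV: "r \<in> V" "dense g r" "dg g \<le> 2 * codeg g v r" using r assms cls_iff by auto
  have le: "m \<le> spars g z" if "z \<in> cls g v" for z unfolding m_def using fin that by simp
  have "leader g r"
    unfolding leader_def
  proof (intro conjI ballI)
    fix z assume "z \<in> cls g r"
    moreover have "v \<in> cls g r" using assms rV by (simp add: cls_iff codeg_sym)
    ultimately have z: "z \<in> cls g v" using cls_trans[of r v z] assms rV by blast
    show "spars g r < spars g z \<or> spars g r = spars g z \<and> r \<le> z"
    proof (cases "spars g z = m")
      case True
      then have "z \<in> R" using z by (simp add: R_def)
      then show ?thesis using R True r by (simp add: r_def)
    qed (use le[OF z] r in simp)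
  qed (use assms rV in auto)
  moreover have "spars g r \<le> spars g v" using le[OF cls_self] assms r by simp
  ultimately show thesis using that rV r by blast
qed

lemma clu_V: "r \<in> V \<Longrightarrow> clu g r \<subseteq> V"
  by (auto simp: clu_def)

lemma clu_unique:
  assumes "r \<in> V" "r' \<in> V" "u \<in> clu g r" "u \<in> clu g r'" "1 \<le> dg g"
  shows "r = r'"
proof -
  have u: "u \<in> V" "9 * dg g \<le> 10 * codeg g u r" "9 * dg g \<le> 10 * codeg g u r'" "leader g r" "leader g r'"
    using assms by (auto simp: clu_def)
  have "dg g \<le> 2 * codeg g r r'"
    using codeg_tri[OF assms(1) u(1) assms(2)] u by (simp add: codeg_sym[of r u])
  then have "r' \<in> cls g r" "r \<in> cls g r'"
    using assms u codeg_sym[of r r'] by (auto simp: cls_iff leader_def)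
  then show ?thesis using u by (fastforce simp: leader_def)
qed

lemma nb_split:
  assumes "v \<in> V" "u \<in> nb g v"
  shows "card (nb g v) = Suc (codeg g u v + card {z \<in> nb g v. z \<noteq> u \<and> z \<notin> nb g u})"
proof -
  have "nb g v = insert u ((nb g u \<inter> nb g v) \<union> {z \<in> nb g v. z \<noteq> u \<and> z \<notin> nb g u})" using assms by auto
  also have "card \<dots> = Suc (card ((nb g u \<inter> nb g v) \<union> {z \<in> nb g v. z \<noteq> u \<and> z \<notin> nb g u}))"
    using assms nb_irr[of u] by (intro card_insert_disjoint) auto
  also have "card ((nb g u \<inter> nb g v) \<union> {z \<in> nb g v. z \<noteq> u \<and> z \<notin> nb g u}) =
    card (nb g u \<inter> nb g v) + card {z \<in> nb g v. z \<noteq> u \<and> z \<notin> nb g u}"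
    using assms by (intro card_Un_disjoint) auto
  finally show ?thesis by (simp add: codeg_def)
qed

lemma out_split:
  assumes "r \<in> V" "x \<in> nb g r"
  shows "card (nb g x) = Suc (codeg g x r + card (nb g x - nb g r - {r}))"
proof -
  have x: "x \<in> V" "r \<in> nb g x" using assms nb_sym[OF assms] by auto
  have "nb g x = insert r ((nb g x \<inter> nb g r) \<union> (nb g x - nb g r - {r}))" using x by auto
  also have "card \<dots> = Suc (card ((nb g x \<inter> nb g r) \<union> (nb g x - nb g r - {r})))"
    using assms x nb_irr[of r] by (intro card_insert_disjoint) auto
  also have "card ((nb g x \<inter> nb g r) \<union> (nb g x - nb g r - {r})) = card (nb g x \<inter> nb g r) + card (nb g x - nb g r - {r})"
    using assms x by (intro card_Un_disjoint) auto
  finally show ?thesis by (simp add: codeg_def)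
qed

text \<open>\<open>nb g x\<close> and \<open>nb g r\<close> contain the same common part, so the
  edges leaving at \<open>x\<close> exceed the non-neighbors of \<open>x\<close> inside
  \<open>nb g r\<close> by at most the missing degree of \<open>r\<close>. Together with
  \<open>mism\<close> these are the terms of \<open>spars\<close>.\<close>

lemma out_sum:
  assumes "r \<in> V"
  shows "(\<Sum>x\<in>nb g r. card (nb g x - nb g r - {r})) + mism g r \<le> spars g r"
proof -
  have "(\<Sum>x\<in>nb g r. card (nb g x - nb g r - {r})) \<le>
    (\<Sum>x\<in>nb g r. (dg g - card (nb g r)) + card {z \<in> nb g r. z \<noteq> x \<and> z \<notin> nb g x})"
  proof (rule sum_mono)
    fix x assume x: "x \<in> nb g r"
    then have "x \<in> V" using assms by simp
    then show "card (nb g x - nb g r - {r}) \<le> (dg g - card (nb g r)) + card {z \<in> nb g r. z \<noteq> x \<and> z \<notin> nb g x}"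
      using out_split[OF assms x] nb_split[OF assms x] nb_deg[of x] nb_deg[OF assms] by linarith
  qed
  also have "\<dots> = card (nb g r) * (dg g - card (nb g r)) + nonadj g r"
    by (simp add: sum.distrib nonadj_def)
  also have "\<dots> \<le> dg g * (dg g - card (nb g r)) + nonadj g r"
    using nb_deg[OF assms] by simp
  finally show ?thesis by (simp add: spars_def)
qed

text \<open>Double counting: each of these vertices has 9/10 of \<open>dg g\<close> edges to
  \<open>nb g r\<close>, and all of them leave the closed neighborhood of \<open>r\<close>.\<close>

lemma far_count:
  assumes "r \<in> V"
  shows "9 * dg g * card {u \<in> V. u \<notin> insert r (nb g r) \<and> 9 * dg g \<le> 10 * codeg g u r} \<le> 10 * spars g r"
proof -
  let ?Y = "{u \<in> V. u \<notin> insert r (nb g r) \<and> 9 * dg g \<le> 10 * codeg g u r}"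
  have "9 * dg g * card ?Y = (\<Sum>u\<in>?Y. 9 * dg g)" by simp
  also have "\<dots> \<le> (\<Sum>u\<in>?Y. 10 * codeg g u r)" by (intro sum_mono) auto
  also have "\<dots> = 10 * (\<Sum>u\<in>?Y. card {x \<in> nb g r. x \<in> nb g u})"
    by (simp add: sum_distrib_left codeg_def Int_def conj_commute)
  also have "(\<Sum>u\<in>?Y. card {x \<in> nb g r. x \<in> nb g u}) = (\<Sum>x\<in>nb g r. card {u \<in> ?Y. x \<in> nb g u})"
    using finV assms by (intro sum_multicount_gen) auto
  also have "\<dots> \<le> (\<Sum>x\<in>nb g r. card (nb g x - nb g r - {r}))"
  proof (intro sum_mono card_mono)
    fix x assume "x \<in> nb g r"
    then show "finite (nb g x - nb g r - {r})" using assms by simp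
    show "{u \<in> ?Y. x \<in> nb g u} \<subseteq> nb g x - nb g r - {r}" using nb_sym by auto
  qed
  finally show ?thesis using out_sum[OF assms] by linarith
qed

text \<open>A neighbor of \<open>v\<close> outside the cluster is either dissimilar to
  \<open>r\<close>, hence to \<open>v\<close>, and then adds at least 6 D / 100 to
  \<open>nonadj g v\<close>; or it is similar to \<open>r\<close> but outside the closed
  neighborhood of \<open>r\<close>, and \<open>far_count\<close> applies. The comparison of
  \<open>spars g r\<close> with \<open>spars g v\<close> transfers that bound to
  \<open>v\<close>.\<close>

lemma nonclu:
  assumes v: "v \<in> V" "dense g v" and r: "r \<in> cls g v" "leader g r" "spars g r \<le> spars g v" and D: "100 \<le> dg g"
  shows "dg g * card (nb g v - clu g r) \<le> 20 * spars g v"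
proof -
  have rV: "r \<in> V" and vr: "98 * dg g \<le> 100 * codeg g v r"
    using cls_iff[of v r] cls_sim[of v r] v r D by auto
  let ?X1 = "{u \<in> nb g v. 10 * codeg g u r < 9 * dg g}"
  let ?Y = "{u \<in> V. u \<notin> insert r (nb g r) \<and> 9 * dg g \<le> 10 * codeg g u r}"
  have "nb g v - clu g r \<subseteq> ?X1 \<union> ?Y" using v(1) r(2) by (auto simp: clu_def)
  then have "card (nb g v - clu g r) \<le> card (?X1 \<union> ?Y)" using v finV by (intro card_mono) auto
  then have c: "card (nb g v - clu g r) \<le> card ?X1 + card ?Y" using card_Un_le order_trans by blast
  have "6 * dg g * card ?X1 = (\<Sum>u\<in>?X1. 6 * dg g)" by simp
  also have "\<dots> \<le> (\<Sum>u\<in>?X1. 100 * card {z \<in> nb g v. z \<noteq> u \<and> z \<notin> nb g u})"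
  proof (rule sum_mono)
    fix u assume u: "u \<in> ?X1"
    then have "u \<in> V" "u \<in> nb g v" using v by auto
    then show "6 * dg g \<le> 100 * card {z \<in> nb g v. z \<noteq> u \<and> z \<notin> nb g u}"
      using codeg_tri[of u v r] nb_split[OF v(1), of u] dense_deg[OF v] u rV v vr D by simp
  qed
  also have "\<dots> \<le> (\<Sum>u\<in>nb g v. 100 * card {z \<in> nb g v. z \<noteq> u \<and> z \<notin> nb g u})"
    using v by (intro sum_mono2) auto
  also have "\<dots> = 100 * nonadj g v" by (simp add: nonadj_def sum_distrib_left)
  also have "\<dots> \<le> 100 * spars g v" by (simp add: spars_def)
  finally have 1: "6 * (dg g * card ?X1) \<le> 100 * spars g v" by simp
  have 2: "9 * (dg g * card ?Y) \<le> 10 * spars g v" using far_count[OF rV] r(3) by simp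
  have "dg g * card (nb g v - clu g r) \<le> dg g * (card ?X1 + card ?Y)" using c by (rule mult_le_mono2)
  also have "\<dots> = dg g * card ?X1 + dg g * card ?Y" by (simp add: algebra_simps)
  finally show ?thesis using 1 2 by linarith
qed

text \<open>Either D / 200 of the degree is missing, or at least D / 200 neighbors have codegree
  below 99/100 of D and add 4 D / 1000 non-adjacent pairs each.\<close>

lemma nondense_spars:
  assumes v: "v \<in> V" "\<not> dense g v" and D: "1000 \<le> dg g"
  shows "dg g * dg g \<le> 50000 * spars g v"
proof (cases "1000 * card (nb g v) \<le> 995 * dg g")
  case True
  then have "dg g \<le> 200 * (dg g - card (nb g v))" by linarith
  then have "dg g * dg g \<le> dg g * (200 * (dg g - card (nb g v)))" by (rule mult_le_mono2)
  also have "\<dots> = 200 * (dg g * (dg g - card (nb g v)))" by (rule mult.left_commute)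
  also have "\<dots> \<le> 200 * spars g v" by (simp add: spars_def)
  finally show ?thesis by linarith
next
  case False
  let ?F = "{u \<in> nb g v. 99 * dg g \<le> 100 * codeg g u v}"
  let ?X = "{u \<in> nb g v. 100 * codeg g u v < 99 * dg g}"
  have "nb g v = ?F \<union> ?X" by auto
  moreover have "card (?F \<union> ?X) \<le> card ?F + card ?X" by (rule card_Un_le)
  ultimately have "card (nb g v) \<le> card ?F + card ?X" by simp
  then have X: "5 * dg g \<le> 1000 * card ?X" using False v(2) by (simp add: dense_def)
  have "4 * dg g * card ?X = (\<Sum>u\<in>?X. 4 * dg g)" by simp
  also have "\<dots> \<le> (\<Sum>u\<in>?X. 1000 * card {z \<in> nb g v. z \<noteq> u \<and> z \<notin> nb g u})"
  proof (rule sum_mono)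
    fix u assume "u \<in> ?X"
    then show "4 * dg g \<le> 1000 * card {z \<in> nb g v. z \<noteq> u \<and> z \<notin> nb g u}"
      using nb_split[OF v(1), of u] False D by simp
  qed
  also have "\<dots> \<le> (\<Sum>u\<in>nb g v. 1000 * card {z \<in> nb g v. z \<noteq> u \<and> z \<notin> nb g u})"
    using v by (intro sum_mono2) auto
  also have "\<dots> = 1000 * nonadj g v" by (simp add: nonadj_def sum_distrib_left)
  also have "\<dots> \<le> 1000 * spars g v" by (simp add: spars_def)
  finally have 1: "dg g * card ?X \<le> 250 * spars g v" by simp
  have "dg g \<le> 200 * card ?X" using X by linarith
  then have "dg g * dg g \<le> dg g * (200 * card ?X)" by (rule mult_le_mono2)
  also have "\<dots> = 200 * (dg g * card ?X)" by (rule mult.left_commute)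
  finally show ?thesis using 1 by linarith
qed

section \<open>Colors of a cluster that a member cannot use\<close>

definition bsum :: "seeds \<Rightarrow> nat \<Rightarrow> nat \<Rightarrow> nat" where
  "bsum w r u = card (av1 g w r - av1 g w u) + card (nb g u - clu g r)"

lemma av1_fin: "u \<in> V \<Longrightarrow> finite (av1 g w u)"
  by (simp add: av1_def)

lemma av1_diff:
  assumes "r \<in> V" "u \<in> V"
  shows "card (av1 g w r - av1 g w u) \<le> card (pal g u - pal g r) + card (nb g u - nb g r)"
proof -
  have "av1 g w r - av1 g w u \<subseteq> (pal g r - pal g u) \<union> (\<lambda>z. the (col1 g w z)) ` (nb g u - nb g r)"
  proof
    fix x assume x: "x \<in> av1 g w r - av1 g w u"
    show "x \<in> (pal g r - pal g u) \<union> (\<lambda>z. the (col1 g w z)) ` (nb g u - nb g r)"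
    proof (cases "x \<in> pal g u")
      case True
      then obtain z where "z \<in> nb g u" "col1 g w z = Some x" using x by (auto simp: av1_def)
      then show ?thesis using x by (intro UnI2 rev_image_eqI[of z]) (auto simp: av1_def)
    qed (use x in \<open>auto simp: av1_def\<close>)
  qed
  then have "card (av1 g w r - av1 g w u) \<le> card ((pal g r - pal g u) \<union> (\<lambda>z. the (col1 g w z)) ` (nb g u - nb g r))"
    using assms by (intro card_mono) auto
  also have "\<dots> \<le> card (pal g r - pal g u) + card (nb g u - nb g r)"
    using assms by (intro card_Un_le[THEN order_trans] add_mono card_image_le) auto
  also have "card (pal g r - pal g u) = card (pal g u - pal g r)"
    using assms pal_card card_Diff_subset_Int[of "pal g r" "pal g u"] card_Diff_subset_Int[of "pal g u" "pal g r"]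
    by (simp add: Int_commute)
  finally show ?thesis .
qed

lemma bsum_sum:
  assumes r: "r \<in> V" "leader g r" and D: "100 \<le> dg g"
  shows "(\<Sum>u\<in>clu g r. bsum w r u) \<le> 23 * spars g r + 3 * dg g"
proof -
  have dr: "dense g r" using r by (simp add: leader_def)
  let ?o = "\<lambda>u. card (nb g u - nb g r - {r})"
  have nc: "dg g * card (nb g r - clu g r) \<le> 20 * spars g r"
    using nonclu[OF r(1) dr] cls_self r D dr by simp
  have b: "bsum w r u \<le> card (pal g u - pal g r) + 2 * (?o u + 1) + card (nb g r - clu g r)" if u: "u \<in> nb g r" for u
  proof -
    have uV: "u \<in> V" using u r by simp
    have "card (nb g u - nb g r) \<le> card (insert r (nb g u - nb g r - {r}))" using uV by (intro card_mono) auto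
    also have "\<dots> \<le> ?o u + 1" using card_Un_le[of "{r}" "nb g u - nb g r - {r}"] by simp
    finally have 1: "card (nb g u - nb g r) \<le> ?o u + 1" .
    have "card (nb g u - clu g r) \<le> card ((nb g u - nb g r) \<union> (nb g r - clu g r))"
      using uV r by (intro card_mono) auto
    also have "\<dots> \<le> card (nb g u - nb g r) + card (nb g r - clu g r)" by (rule card_Un_le)
    finally show ?thesis using 1 av1_diff[OF r(1) uV, of w] by (simp add: bsum_def)
  qed
  have "(\<Sum>u\<in>clu g r. bsum w r u) \<le> (\<Sum>u\<in>insert r (nb g r). bsum w r u)"
    using r by (intro sum_mono2) (auto simp: clu_def)
  also have "\<dots> = bsum w r r + (\<Sum>u\<in>nb g r. bsum w r u)" using r nb_irr by simp
  also have "bsum w r r \<le> dg g"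
    using card_mono[of "nb g r" "nb g r - clu g r"] nb_deg[OF r(1)] r by (simp add: bsum_def)
  also have "(\<Sum>u\<in>nb g r. bsum w r u) \<le>
    (\<Sum>u\<in>nb g r. card (pal g u - pal g r) + 2 * (?o u + 1) + card (nb g r - clu g r))"
    by (intro sum_mono b)
  also have "\<dots> = mism g r + 2 * (\<Sum>u\<in>nb g r. ?o u) + 2 * card (nb g r) + card (nb g r) * card (nb g r - clu g r)"
    by (simp only: sum.distrib mism_def sum_distrib_left[symmetric] sum_constant distrib_left add.assoc mult_1_right)
      (simp add: algebra_simps)
  also have "\<dots> \<le> mism g r + 2 * (\<Sum>u\<in>nb g r. ?o u) + 2 * dg g + dg g * card (nb g r - clu g r)"
    using nb_deg[OF r(1)] by (intro add_mono mult_le_mono) auto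
  finally show ?thesis using out_sum[OF r(1)] nc by linarith
qed

lemma mem_clu: "mem g w r \<subseteq> clu g r"
  by (auto simp: mem_def)

text \<open>Ensures that an injection exists. A colored neighbor of the leader removes at most one
  of its \<open>dg g + 1\<close> colors, and in exchange is no member.\<close>

lemma mem_le_av1:
  assumes "r \<in> V"
  shows "card (mem g w r) \<le> card (av1 g w r)"
proof -
  let ?C = "{z \<in> nb g r. col1 g w z \<noteq> None}"
  have "mem g w r \<subseteq> insert r (nb g r - ?C)" by (auto simp: mem_def clu_def)
  then have "card (mem g w r) \<le> card (insert r (nb g r - ?C))" using assms by (intro card_mono) auto
  also have "\<dots> \<le> Suc (card (nb g r) - card ?C)"
    using assms by (simp add: card_insert_if card_Diff_subset)
  finally have 1: "card (mem g w r) \<le> Suc (card (nb g r) - card ?C)" .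
  have "pal g r - (\<lambda>z. the (col1 g w z)) ` ?C \<subseteq> av1 g w r"
    by (force simp: av1_def intro: rev_image_eqI)
  then have "card (pal g r - (\<lambda>z. the (col1 g w z)) ` ?C) \<le> card (av1 g w r)"
    using assms av1_fin by (intro card_mono) auto
  moreover have "card (pal g r) - card ((\<lambda>z. the (col1 g w z)) ` ?C) \<le> card (pal g r - (\<lambda>z. the (col1 g w z)) ` ?C)"
    using assms by (intro diff_card_le_card_Diff) auto
  moreover have "card ((\<lambda>z. the (col1 g w z)) ` ?C) \<le> card ?C" using assms by (intro card_image_le) auto
  moreover have "card ?C \<le> card (nb g r)" using assms by (intro card_mono) auto
  ultimately show ?thesis using 1 nb_deg[OF assms] pal_card[OF assms] by linarith
qed

lemma injs_ne:
  assumes "finite A" "finite P" "card A \<le> card P"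
  shows "injs A P \<noteq> {}" "finite (injs A P)"
proof -
  obtain f where f: "f ` A \<subseteq> P" "inj_on f A" using card_le_inj[OF assms] by blast
  then have "restrict f A \<in> injs A P" by (auto simp: injs_def inj_on_def)
  then show "injs A P \<noteq> {}" by blast
  show "finite (injs A P)"
    unfolding injs_def using assms finite_PiE[of A "\<lambda>_. P"] by (auto intro: finite_subset[of _ "A \<rightarrow>\<^sub>E P"])
qed

lemma mem_fin: "r \<in> V \<Longrightarrow> finite (mem g w r)"
  using mem_clu clu_V finV by (meson finite_subset)

lemma sct_injs:
  assumes "r \<in> V"
  shows "sct g w r \<in> injs (mem g w r) (av1 g w r)"
  unfolding sct_def
  using injs_ne[OF mem_fin[OF assms] av1_fin[OF assms] mem_le_av1[OF assms]] by (intro from_nat_into) auto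

lemma asg_eq:
  assumes "r \<in> V" "u \<in> mem g w r" "1 \<le> dg g"
  shows "asg g w u = Some (sct g w r u)"
proof -
  have u: "u \<in> clu g r" "u \<in> V" using assms clu_V mem_clu by blast+
  then have r: "r \<in> insert u (nb g u)" using nb_sym[OF assms(1)] by (auto simp: clu_def)
  have "(SOME r. r \<in> insert u (nb g u) \<and> u \<in> mem g w r) = r"
  proof (rule some_equality)
    fix r' assume r': "r' \<in> insert u (nb g u) \<and> u \<in> mem g w r'"
    then have "r' \<in> V" "u \<in> clu g r'" using u mem_clu by auto
    then show "r' = r" using clu_unique[of r' r u] assms u by blast
  qed (use r assms in blast)
  then show ?thesis using r assms by (auto simp: asg_def)
qed

lemma asg_SomeD:
  assumes "u \<in> V" "asg g w u = Some x" "1 \<le> dg g"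
  obtains r where "r \<in> V" "u \<in> mem g w r" "x = sct g w r u"
proof -
  obtain r where r: "r \<in> insert u (nb g u)" "u \<in> mem g w r"
    using assms by (auto simp: asg_def split: if_splits)
  then have "r \<in> V" using assms by auto
  then show thesis using that asg_eq[OF _ r(2)] r assms by auto
qed

definition badc :: "seeds \<Rightarrow> nat \<Rightarrow> nat \<Rightarrow> nat set" where
  "badc w r u = (av1 g w r - av1 g w u) \<union> {x. \<exists>z\<in>nb g u - clu g r. asg g w z = Some x}"

lemma badc_card:
  assumes "r \<in> V" "u \<in> V"
  shows "card (badc w r u) \<le> bsum w r u"
proof -
  have "{x. \<exists>z\<in>nb g u - clu g r. asg g w z = Some x} \<subseteq> (\<lambda>z. the (asg g w z)) ` (nb g u - clu g r)"
    by (force intro: rev_image_eqI)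
  then have "card {x. \<exists>z\<in>nb g u - clu g r. asg g w z = Some x} \<le> card (nb g u - clu g r)"
    using assms by (intro surj_card_le) auto
  then show ?thesis unfolding badc_def bsum_def
    using card_Un_le[of "av1 g w r - av1 g w u" "{x. \<exists>z\<in>nb g u - clu g r. asg g w z = Some x}"] by linarith
qed

lemma fail_badc:
  assumes "r \<in> V" "u \<in> mem g w r" "col2 g w u = None" "1 \<le> dg g"
  shows "sct g w r u \<in> badc w r u"
proof (rule ccontr)
  assume n: "sct g w r u \<notin> badc w r u"
  let ?x = "sct g w r u"
  have u: "u \<in> V" "u \<in> clu g r" using assms clu_V mem_clu by blast+
  have inj: "inj_on (sct g w r) (mem g w r)" and P: "?x \<in> av1 g w r"
    using sct_injs[OF assms(1), of w] assms(2) by (auto simp: injs_def)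
  have "col1 g w u = None" using assms(2) by (simp add: mem_def)
  moreover have "?x \<in> av1 g w u" using n P by (auto simp: badc_def)
  ultimately obtain z where z: "z \<in> nb g u" "asg g w z = Some ?x"
    using assms(3) asg_eq[OF assms(1,2,4)] by (auto simp: col2_def split: if_splits)
  then have "z \<in> clu g r" using n by (auto simp: badc_def)
  moreover obtain r' where r': "r' \<in> V" "z \<in> mem g w r'" "?x = sct g w r' z"
    using asg_SomeD[of z w ?x] z u assms by auto
  ultimately have "r' = r" using clu_unique[of r' r z] mem_clu assms by blast
  then have "z = u" using inj r' assms by (auto simp: inj_on_def)
  then show False using z nb_irr u by auto
qed

end

section \<open>Random injections\<close>

lemma injs_insert:
  assumes "u \<notin> A"
  shows "inj_on (\<lambda>f. (f u, restrict f A)) (injs (insert u A) P)"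
    and "(\<lambda>f. (f u, restrict f A)) ` injs (insert u A) P = (SIGMA p:P. injs A (P - {p}))"
proof -
  show "inj_on (\<lambda>f. (f u, restrict f A)) (injs (insert u A) P)"
  proof (rule inj_onI)
    fix f h assume f: "f \<in> injs (insert u A) P" "h \<in> injs (insert u A) P"
      and e: "(f u, restrict f A) = (h u, restrict h A)"
    then have "f \<in> extensional (insert u A)" "h \<in> extensional (insert u A)" by (auto simp: injs_def PiE_def)
    moreover have "f x = h x" if "x \<in> insert u A" for x
      using e that by (auto simp: restrict_def fun_eq_iff split: if_splits)
    ultimately show "f = h" by (rule extensionalityI)
  qed
  show "(\<lambda>f. (f u, restrict f A)) ` injs (insert u A) P = (SIGMA p:P. injs A (P - {p}))"
  proof (intro equalityI subsetI)
    fix y assume "y \<in> (\<lambda>f. (f u, restrict f A)) ` injs (insert u A) P"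
    then obtain f where f: "f \<in> injs (insert u A) P" "y = (f u, restrict f A)" by auto
    then have fi: "inj_on f (insert u A)" "\<And>x. x \<in> insert u A \<Longrightarrow> f x \<in> P" by (auto simp: injs_def)
    have "f x \<noteq> f u" if "x \<in> A" for x using fi(1) that assms by (auto simp: inj_on_def)
    moreover have "inj_on (restrict f A) A" using fi(1) by (auto simp: inj_on_def)
    ultimately show "y \<in> (SIGMA p:P. injs A (P - {p}))" using f(2) fi(2) by (auto simp: injs_def)
  next
    fix y assume "y \<in> (SIGMA p:P. injs A (P - {p}))"
    then obtain p h where y: "y = (p, h)" "p \<in> P" "h \<in> injs A (P - {p})" by auto
    define f where "f = h(u := p)"
    have h: "h \<in> A \<rightarrow>\<^sub>E P - {p}" "inj_on h A" using y by (auto simp: injs_def)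
    have "f \<in> injs (insert u A) P"
    proof -
      have "f \<in> insert u A \<rightarrow>\<^sub>E P" using h y(2) by (auto simp: f_def PiE_def Pi_def extensional_def)
      moreover have "inj_on f (insert u A)" using h assms by (auto simp: f_def inj_on_def)
      ultimately show ?thesis by (simp add: injs_def)
    qed
    moreover have "restrict f A = h"
      using h assms by (auto simp: f_def restrict_def fun_eq_iff PiE_def extensional_def)
    then have "y = (f u, restrict f A)" using y by (simp add: f_def)
    ultimately show "y \<in> (\<lambda>f. (f u, restrict f A)) ` injs (insert u A) P" by blast
  qed
qed

lemma injs_fin: "finite A \<Longrightarrow> finite P \<Longrightarrow> finite (injs A P)"
  unfolding injs_def using finite_PiE[of A "\<lambda>_. P"] by (auto intro: finite_subset[of _ "A \<rightarrow>\<^sub>E P"])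

lemma injs_card:
  assumes "finite A" "finite P" "card A \<le> card P"
  shows "card (injs A P) * fact (card P - card A) = fact (card P)"
  using assms
proof (induction A arbitrary: P rule: finite_induct)
  case empty
  have "injs {} P = {\<lambda>_. undefined}" by (auto simp: injs_def)
  then show ?case by simp
next
  case (insert u A)
  have s: "0 < card P" "card A \<le> card P - 1" using insert by auto
  have "card (injs (insert u A) P) = card (SIGMA p:P. injs A (P - {p}))"
    using card_image[OF injs_insert(1)[OF insert(2)], of P] injs_insert(2)[OF insert(2), of P] by simp
  also have "\<dots> = (\<Sum>p\<in>P. card (injs A (P - {p})))"
    using insert injs_fin by (intro card_SigmaI) auto
  finally have "card (injs (insert u A) P) * fact (card P - card (insert u A)) =
    (\<Sum>p\<in>P. card (injs A (P - {p})) * fact (card (P - {p}) - card A))"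
    using insert by (simp add: sum_distrib_right)
  also have "\<dots> = (\<Sum>p\<in>P. fact (card P - 1))"
  proof (intro sum.cong refl)
    fix p assume "p \<in> P"
    then have "card (P - {p}) = card P - 1" using insert by simp
    then show "card (injs A (P - {p})) * fact (card (P - {p}) - card A) = fact (card P - 1)"
      using insert.IH[of "P - {p}"] insert.prems s by simp
  qed
  also have "\<dots> = fact (card P)" using s by (simp add: fact_reduce)
  finally show ?case .
qed

text \<open>The induction fixes the value at one element of \<open>K\<close> and removes it from
  \<open>P\<close>. The factorials avoid division: combined with \<open>injs_card\<close>, they say
  that a random injection hits all the sets \<open>C u\<close> with probability at most the product
  of the \<open>c u\<close> over a falling factorial.\<close>

lemma injs_card_bad:
  assumes "finite A" "finite P" "card A \<le> card P" "K \<subseteq> A" "\<And>u. u \<in> K \<Longrightarrow> finite (C u) \<and> card (C u) \<le> c u"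
  shows "card {f \<in> injs A P. \<forall>u\<in>K. f u \<in> C u} * fact (card P - card A) \<le> (\<Prod>u\<in>K. c u) * fact (card P - card K)"
proof -
  have "finite K" using assms finite_subset by blast
  then show ?thesis using assms
  proof (induction K arbitrary: A P rule: finite_induct)
    case empty
    then show ?case using injs_card[of A P] by simp
  next
    case (insert u K)
    define A' where "A' = A - {u}"
    have A': "A = insert u A'" "u \<notin> A'" "finite A'" "K \<subseteq> A'" using insert by (auto simp: A'_def)
    have s: "0 < card P" "card A' \<le> card P - 1" using insert A' by auto
    let ?R = "\<lambda>f. (f u, restrict f A')"
    let ?G = "{f \<in> injs A P. \<forall>x\<in>insert u K. f x \<in> C x}"
    let ?H = "\<lambda>p. {f \<in> injs A' (P - {p}). \<forall>x\<in>K. f x \<in> C x}"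
    have "inj_on ?R ?G" using injs_insert(1)[OF A'(2), of P] unfolding A'(1) by (rule inj_on_subset) auto
    then have "card ?G = card (?R ` ?G)" by (rule card_image[symmetric])
    also have "\<dots> \<le> card (SIGMA p:P \<inter> C u. ?H p)"
    proof (rule card_mono)
      show "finite (SIGMA p:P \<inter> C u. ?H p)" using insert A' injs_fin by (intro finite_SigmaI) auto
      show "?R ` ?G \<subseteq> (SIGMA p:P \<inter> C u. ?H p)"
      proof (rule image_subsetI)
        fix f assume f: "f \<in> ?G"
        then have "?R f \<in> (SIGMA p:P. injs A' (P - {p}))"
          using injs_insert(2)[OF A'(2), of P] unfolding A'(1) by blast
        then show "?R f \<in> (SIGMA p:P \<inter> C u. ?H p)" using f A'(4) by auto
      qed
    qed
    also have "\<dots> = (\<Sum>p\<in>P \<inter> C u. card (?H p))"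
      using insert A' injs_fin by (intro card_SigmaI) auto
    finally have "card ?G * fact (card P - card A) \<le> (\<Sum>p\<in>P \<inter> C u. card (?H p)) * fact (card P - card A)"
      by (rule mult_le_mono1)
    also have "\<dots> = (\<Sum>p\<in>P \<inter> C u. card (?H p) * fact (card (P - {p}) - card A'))"
      using A' s insert by (simp add: sum_distrib_right)
    also have "\<dots> \<le> (\<Sum>p\<in>P \<inter> C u. (\<Prod>x\<in>K. c x) * fact (card (P - {p}) - card K))"
      using insert A' s by (intro sum_mono insert.IH) auto
    also have "\<dots> = card (P \<inter> C u) * ((\<Prod>x\<in>K. c x) * fact (card P - card (insert u K)))"
      using insert by simp
    also have "\<dots> \<le> c u * ((\<Prod>x\<in>K. c x) * fact (card P - card (insert u K)))"
    proof (rule mult_le_mono1)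
      have "card (P \<inter> C u) \<le> card (C u)" using insert by (intro card_mono) auto
      then show "card (P \<inter> C u) \<le> c u" using insert.prems(5)[of u] by simp
    qed
    also have "\<dots> = (\<Prod>x\<in>insert u K. c x) * fact (card P - card (insert u K))"
      using insert by simp
    finally show ?case .
  qed
qed

lemma fact_ge_pow: "real k ^ k \<le> 3 ^ k * fact k"
proof (induction k)
  case (Suc k)
  show ?case
  proof (cases "k = 0")
    case False
    have "(1 + 1 / real k) ^ k \<le> exp (1 / real k) ^ k"
      by (intro power_mono exp_ge_add_one_self) auto
    also have "\<dots> = exp 1" using False by (simp flip: exp_of_nat_mult)
    also have "\<dots> \<le> 3" by (rule exp_le)
    finally have "(1 + 1 / real k) ^ k * real k ^ k \<le> 3 * real k ^ k" by (intro mult_right_mono) auto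
    moreover have "(1 + 1 / real k) * real k = real (Suc k)" using False by (simp add: field_simps)
    ultimately have "real (Suc k) ^ k \<le> 3 * real k ^ k" by (simp only: power_mult_distrib[symmetric])
    then have "real (Suc k) * real (Suc k) ^ k \<le> real (Suc k) * (3 * (3 ^ k * fact k))"
      using Suc by (intro mult_left_mono) auto
    then show ?thesis by (simp add: algebra_simps)
  qed simp
qed simp

lemma ln2_ge_half: "1 / 2 \<le> ln (2 :: real)"
proof -
  have "exp (1 / 2 :: real) \<le> 2" using exp_bound[of "1 / 2"] by (simp add: power2_eq_square)
  then show ?thesis by (simp only: ln_ge_iff zero_less_numeral)
qed

text \<open>The falling factorial of \<open>s\<close> of length \<open>k\<close> is at least (s /
  3)^k: it is k! times a binomial coefficient, which is at least (s / k)^k, and k^k is at most 3^k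
  k!.\<close>

lemma fact_ratio:
  assumes "k \<le> s" "0 < s"
  shows "fact (s - k) * real s ^ k \<le> 3 ^ k * fact s"
proof (cases "k = 0")
  case False
  have "(real s / real k) ^ k * real k ^ k \<le> real (s choose k) * (3 ^ k * fact k)"
    using binomial_ge_n_over_k_pow_k[OF assms(1), where 'a = real] fact_ge_pow[of k] by (intro mult_mono) auto
  then have "real s ^ k \<le> real (s choose k) * (3 ^ k * fact k)"
    using False by (simp add: power_mult_distrib[symmetric])
  then have "fact (s - k) * real s ^ k \<le> fact (s - k) * (real (s choose k) * (3 ^ k * fact k))"
    by (intro mult_left_mono) auto
  also have "\<dots> = 3 ^ k * real (fact k * fact (s - k) * (s choose k))" by simp
  also have "\<dots> = 3 ^ k * fact s" unfolding binomial_fact_lemma[OF assms(1)] by simp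
  finally show ?thesis .
qed simp

text \<open>The power of two counts subsets of hit elements. Expanding over subsets \<open>K\<close>
  only needs the joint probabilities, which are bounded by products of 3 c / s; the factor 3 pays
  for sampling without replacement and replaces an argument by negative association.\<close>

lemma injs_exp:
  assumes "finite A" "finite P" "card A \<le> card P" "0 < card P" "\<And>u. u \<in> A \<Longrightarrow> finite (C u) \<and> card (C u) \<le> c u"
  shows "(\<Sum>f\<in>injs A P. 2 ^ card {u \<in> A. f u \<in> C u}) \<le>
    real (card (injs A P)) * exp (3 * (\<Sum>u\<in>A. real (c u)) / real (card P))"
proof -
  let ?s = "card P"
  have pow: "2 ^ card {u \<in> A. f u \<in> C u} = (\<Sum>K\<in>Pow A. of_bool (\<forall>u\<in>K. f u \<in> C u) :: real)" for f
  proof -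
    have "(2::real) ^ card {u \<in> A. f u \<in> C u} = (\<Prod>u\<in>A. of_bool (f u \<in> C u) + 1)"
    proof -
      have "(\<Prod>u\<in>A. of_bool (f u \<in> C u) + (1::real)) = (\<Prod>u\<in>A. if f u \<in> C u then 2 else 1)"
        by (intro prod.cong) auto
      also have "\<dots> = 2 ^ card {u \<in> A. f u \<in> C u}"
        using assms(1) by (simp add: prod.If_cases Int_def)
      finally show ?thesis by simp
    qed
    also have "\<dots> = (\<Sum>K\<in>Pow A. (\<Prod>u\<in>K. of_bool (f u \<in> C u)))"
      by (subst prod_add[OF assms(1)]) simp
    also have "\<dots> = (\<Sum>K\<in>Pow A. of_bool (\<forall>u\<in>K. f u \<in> C u))"
    proof (intro sum.cong refl)
      fix K assume "K \<in> Pow A"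
      then have "finite K" using assms(1) finite_subset by auto
      then show "(\<Prod>u\<in>K. of_bool (f u \<in> C u) :: real) = of_bool (\<forall>u\<in>K. f u \<in> C u)"
        by (induction K rule: finite_induct) auto
    qed
    finally show ?thesis .
  qed
  have K: "(\<Sum>f\<in>injs A P. of_bool (\<forall>u\<in>K. f u \<in> C u)) \<le> real (card (injs A P)) * (\<Prod>u\<in>K. 3 * real (c u) / real ?s)"
    if "K \<in> Pow A" for K
  proof -
    let ?N = "card {f \<in> injs A P. \<forall>u\<in>K. f u \<in> C u}"
    have fK: "finite K" "K \<subseteq> A" "card K \<le> ?s" using that assms(1,3) card_mono[of A K] finite_subset by auto
    have 1: "real ?N * fact (?s - card A) \<le> (\<Prod>u\<in>K. real (c u)) * fact (?s - card K)"
    proof -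
      have "real (?N * fact (?s - card A)) \<le> real ((\<Prod>u\<in>K. c u) * fact (?s - card K))"
        using fK assms by (intro of_nat_mono injs_card_bad) auto
      then show ?thesis by simp
    qed
    have N: "real (card (injs A P)) * fact (?s - card A) = fact ?s"
      using injs_card[OF assms(1-3)] by (metis of_nat_fact of_nat_mult)
    have "real ?N * fact (?s - card A) * real ?s ^ card K \<le> (\<Prod>u\<in>K. real (c u)) * fact (?s - card K) * real ?s ^ card K"
      using 1 by (intro mult_right_mono) auto
    also have "\<dots> = (\<Prod>u\<in>K. real (c u)) * (fact (?s - card K) * real ?s ^ card K)" by simp
    also have "\<dots> \<le> (\<Prod>u\<in>K. real (c u)) * (3 ^ card K * fact ?s)"
      using fact_ratio[OF fK(3) assms(4)] by (intro mult_left_mono prod_nonneg) auto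
    also have "\<dots> = (\<Prod>u\<in>K. real (c u)) * 3 ^ card K * real (card (injs A P)) * fact (?s - card A)"
      unfolding N[symmetric] by simp
    finally have "real ?N * real ?s ^ card K \<le> (\<Prod>u\<in>K. real (c u)) * 3 ^ card K * real (card (injs A P))"
      by (simp add: mult.commute mult.left_commute)
    then have "real ?N \<le> real (card (injs A P)) * ((\<Prod>u\<in>K. real (c u)) * 3 ^ card K / real ?s ^ card K)"
      using assms(4) by (simp add: field_simps)
    also have "(\<Prod>u\<in>K. real (c u)) * 3 ^ card K / real ?s ^ card K = (\<Prod>u\<in>K. 3 * real (c u) / real ?s)"
      by (simp add: prod.distrib prod_dividef mult.commute)
    finally have *: "real ?N \<le> real (card (injs A P)) * (\<Prod>u\<in>K. 3 * real (c u) / real ?s)" .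
    have "(\<Sum>f\<in>injs A P. of_bool (\<forall>u\<in>K. f u \<in> C u)) = real ?N"
      using injs_fin[OF assms(1,2)] by (rule card_filter_sum)
    with * show ?thesis by linarith
  qed
  have "(\<Sum>f\<in>injs A P. 2 ^ card {u \<in> A. f u \<in> C u}) = (\<Sum>K\<in>Pow A. \<Sum>f\<in>injs A P. of_bool (\<forall>u\<in>K. f u \<in> C u) :: real)"
    unfolding pow by (rule sum.swap)
  also have "\<dots> \<le> (\<Sum>K\<in>Pow A. real (card (injs A P)) * (\<Prod>u\<in>K. 3 * real (c u) / real ?s))"
    by (rule sum_mono[OF K])
  also have "\<dots> = real (card (injs A P)) * (\<Prod>u\<in>A. 3 * real (c u) / real ?s + 1)"
    by (simp add: prod_add[OF assms(1)] sum_distrib_left)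
  also have "\<dots> \<le> real (card (injs A P)) * (\<Prod>u\<in>A. exp (3 * real (c u) / real ?s))"
    using exp_ge_add_one_self by (intro mult_left_mono prod_mono) (auto simp: add.commute add_nonneg_nonneg)
  also have "\<dots> = real (card (injs A P)) * exp (3 * (\<Sum>u\<in>A. real (c u)) / real ?s)"
    using assms(1) by (simp add: exp_sum[symmetric] sum_distrib_left sum_divide_distrib)
  finally show ?thesis .
qed

text \<open>Each residue occurs at most \<open>M div N + 1\<close> times, which is at most twice M /
  N.\<close>

lemma sum_mod_le:
  fixes G :: "nat \<Rightarrow> real"
  assumes "0 < N" "N \<le> M" "\<And>i. 0 \<le> G i"
  shows "(\<Sum>x<M. G (x mod N)) / real M \<le> 2 * (\<Sum>i<N. G i) / real N"
proof -
  let ?q = "M div N + 1"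
  have M: "M \<le> ?q * N" using assms(1) dividend_less_div_times[of N M] by (simp add: algebra_simps)
  have "(\<Sum>x<M. G (x mod N)) \<le> (\<Sum>x<?q * N. G (x mod N))"
    using M assms(3) by (intro sum_mono2) auto
  also have "\<dots> = real ?q * (\<Sum>i<N. G i)"
  proof -
    have "(\<Sum>x<q * N. G (x mod N)) = real q * (\<Sum>i<N. G i)" for q
    proof (induction q)
      case (Suc q)
      have "(\<Sum>x<Suc q * N. G (x mod N)) = (\<Sum>x<q * N. G (x mod N)) + (\<Sum>x=q * N..<q * N + N. G (x mod N))"
        by (simp add: lessThan_atLeast0 sum.atLeastLessThan_concat add.commute)
      also have "(\<Sum>x=q * N..<q * N + N. G (x mod N)) = (\<Sum>x<N. G ((x + q * N) mod N))"
        using sum.shift_bounds_nat_ivl[of "\<lambda>x. G (x mod N)" 0 "q * N" N] by (simp add: lessThan_atLeast0 add.commute)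
      finally show ?case using Suc by (simp add: algebra_simps)
    qed simp
    then show ?thesis .
  qed
  finally have 1: "(\<Sum>x<M. G (x mod N)) \<le> real ?q * (\<Sum>i<N. G i)" .
  have "?q * N = M div N * N + N" by (simp only: add_mult_distrib mult_1)
  also have "\<dots> \<le> M + M" using assms(2) by (intro add_mono div_times_less_eq_dividend)
  finally have "?q * N \<le> 2 * M" by simp
  then have "real ?q * real N \<le> 2 * real M" by (metis of_nat_le_iff of_nat_mult of_nat_numeral)
  then have "real ?q \<le> 2 * real M / real N" using assms(1) by (simp add: field_simps)
  then have "real ?q * (\<Sum>i<N. G i) \<le> 2 * real M / real N * (\<Sum>i<N. G i)"
    using assms(3) by (intro mult_right_mono sum_nonneg) auto
  then have "(\<Sum>x<M. G (x mod N)) \<le> 2 * real M / real N * (\<Sum>i<N. G i)" using 1 by linarith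
  then show ?thesis using assms(1,2) by (simp add: field_simps)
qed

section \<open>Number of failing members of a cluster\<close>

context gph_big
begin

definition fails :: "seeds \<Rightarrow> nat \<Rightarrow> nat" where
  "fails w r = card {u \<in> mem g w r. col2 g w u = None}"

lemma coord2:
  assumes "r \<in> V"
  shows "att g (w((r, 2) := x)) = att g w" "col1 g (w((r, 2) := x)) = col1 g w"
    "av1 g (w((r, 2) := x)) = av1 g w" "ps g (w((r, 2) := x)) = ps g w" "mem g (w((r, 2) := x)) = mem g w"
proof -
  show a: "att g (w((r, 2) := x)) = att g w" by (auto simp: att_def)
  show c: "col1 g (w((r, 2) := x)) = col1 g w" unfolding col1_def[abs_def] a ..
  show "av1 g (w((r, 2) := x)) = av1 g w" unfolding av1_def[abs_def] c ..
  have s: "smp g (w((r, 2) := x)) = smp g w" by (auto simp: smp_def)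
  have d: "cand g (w((r, 2) := x)) = cand g w" unfolding cand_def[abs_def] a s ..
  have q: "qs g (w((r, 2) := x)) = qs g w" unfolding qs_def[abs_def] d ..
  show p: "ps g (w((r, 2) := x)) = ps g w" unfolding ps_def[abs_def] d q ..
  show "mem g (w((r, 2) := x)) = mem g w" unfolding mem_def[abs_def] c p ..
qed

text \<open>The bad colors of a vertex depend on the injections of other clusters only. They can be
  fixed first, and then a failure means that a fresh random injection hits a fixed set.\<close>

lemma badc_coord2:
  assumes "r \<in> V" "u \<in> V"
  shows "badc (w((r, 2) := x)) r u = badc w r u"
proof -
  have "asg g (w((r, 2) := x)) z = asg g w z" if z: "z \<in> nb g u - clu g r" for z
  proof -
    let ?R = "\<lambda>r'. r' \<in> insert z (nb g z) \<and> z \<in> mem g w r'"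
    have 1: "sct g (w((r, 2) := x)) (SOME r'. ?R r') = sct g w (SOME r'. ?R r')" if "\<exists>r'. ?R r'"
    proof -
      have "?R (SOME r'. ?R r')" using that by (rule someI_ex)
      then have "(SOME r'. ?R r') \<noteq> r" using z mem_clu by blast
      then show ?thesis by (simp add: sct_def coord2[OF assms(1)])
    qed
    show ?thesis unfolding asg_def coord2[OF assms(1)]
    proof (rule if_cong[OF refl _ refl])
      assume "\<exists>r'\<in>insert z (nb g z). z \<in> mem g w r'"
      then have "\<exists>r'. ?R r'" by blast
      from 1[OF this] show "Some (sct g (w((r, 2) := x)) (SOME r'. ?R r') z) = Some (sct g w (SOME r'. ?R r') z)"
        by simp
    qed
  qed
  then show ?thesis unfolding badc_def coord2[OF assms(1)] by auto
qed

lemma fails_step: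
  assumes r: "r \<in> V" "leader g r" and D: "100 \<le> dg g" and q: "8 * actn w r \<le> dg g"
    and B: "card (injs (mem g w r) (av1 g w r)) \<le> 2 ^ b"
  shows "(\<Sum>x<2 ^ b. 2 ^ fails (w((r, 2) := x)) r) / 2 ^ b \<le> 2 * exp (79 * real (spars g r) / real (dg g) + 11)"
proof -
  let ?A = "mem g w r" and ?P = "av1 g w r" and ?N = "card (injs (mem g w r) (av1 g w r))"
  have N: "0 < ?N" using injs_ne[OF mem_fin av1_fin mem_le_av1] r by (simp add: card_gt_0_iff)
  have uV: "u \<in> V" if "u \<in> ?A" for u using that mem_clu clu_V r by blast
  define G where "G i = (2::real) ^ card {u \<in> ?A. from_nat_into (injs ?A ?P) i u \<in> badc w r u}" for i
  have le: "(2::real) ^ fails (w((r, 2) := x)) r \<le> G (x mod ?N)" for x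
  proof -
    have "{u \<in> mem g (w((r, 2) := x)) r. col2 g (w((r, 2) := x)) u = None} \<subseteq>
      {u \<in> ?A. from_nat_into (injs ?A ?P) (x mod ?N) u \<in> badc w r u}"
    proof
      fix u assume u: "u \<in> {u \<in> mem g (w((r, 2) := x)) r. col2 g (w((r, 2) := x)) u = None}"
      then have "sct g (w((r, 2) := x)) r u \<in> badc (w((r, 2) := x)) r u"
        using r dg_pos by (intro fail_badc) auto
      moreover have uA: "u \<in> ?A" using u coord2[OF r(1)] by simp
      moreover have "sct g (w((r, 2) := x)) r = from_nat_into (injs ?A ?P) (x mod ?N)"
        by (simp add: sct_def coord2[OF r(1)])
      ultimately show "u \<in> {u \<in> ?A. from_nat_into (injs ?A ?P) (x mod ?N) u \<in> badc w r u}"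
        using badc_coord2[OF r(1) uV[OF uA]] by simp
    qed
    then have "fails (w((r, 2) := x)) r \<le> card {u \<in> ?A. from_nat_into (injs ?A ?P) (x mod ?N) u \<in> badc w r u}"
      unfolding fails_def using mem_fin[OF r(1)] by (intro card_mono) auto
    then show ?thesis unfolding G_def by (intro power_increasing) auto
  qed
  have bf: "finite (badc w r u)" if "u \<in> V" for u
  proof -
    have "{x. \<exists>z\<in>nb g u - clu g r. asg g w z = Some x} \<subseteq> (\<lambda>z. the (asg g w z)) ` (nb g u - clu g r)"
      by (force intro: rev_image_eqI)
    then show ?thesis unfolding badc_def using that r av1_fin by (auto intro: finite_subset)
  qed
  have cP: "7 * dg g \<le> 8 * card ?P"
  proof -
    have "pal g r - {c. \<exists>z\<in>nb g r. att g w z = Some c} \<subseteq> ?P"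
      by (auto simp: av1_def col1_def split: if_splits)
    then have "card (pal g r - {c. \<exists>z\<in>nb g r. att g w z = Some c}) \<le> card ?P" using r av1_fin by (intro card_mono) auto
    moreover have "card (pal g r) - card {c. \<exists>z\<in>nb g r. att g w z = Some c} \<le> card (pal g r - {c. \<exists>z\<in>nb g r. att g w z = Some c})"
      using actn_colors(2)[OF r(1)] by (intro diff_card_le_card_Diff) auto
    ultimately show ?thesis using actn_colors(1)[OF r(1), of w] q pal_card[OF r(1)] by linarith
  qed
  then have P0: "0 < card ?P" using D by linarith
  have "(\<Sum>x<2 ^ b. 2 ^ fails (w((r, 2) := x)) r) / 2 ^ b \<le> (\<Sum>x<2 ^ b. G (x mod ?N)) / real (2 ^ b)"
    by (simp add: divide_right_mono sum_mono le)
  also have "\<dots> \<le> 2 * (\<Sum>i<?N. G i) / real ?N"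
    using N B by (intro sum_mod_le) (auto simp: G_def)
  also have "(\<Sum>i<?N. G i) = (\<Sum>f\<in>injs ?A ?P. 2 ^ card {u \<in> ?A. f u \<in> badc w r u})"
    unfolding G_def
    using sum.reindex_bij_betw[OF bij_betw_from_nat_into_finite[OF injs_fin[OF mem_fin av1_fin]], OF r(1) r(1),
        of "\<lambda>f. 2 ^ card {u \<in> ?A. f u \<in> badc w r u}" w w] by simp
  also have "2 * \<dots> / real ?N \<le> 2 * (real ?N * exp (3 * (\<Sum>u\<in>?A. real (bsum w r u)) / real (card ?P))) / real ?N"
    using badc_card[OF r(1) uV] bf uV
    by (intro divide_right_mono mult_left_mono injs_exp mem_fin av1_fin mem_le_av1 r P0) auto
  also have "\<dots> = 2 * exp (3 * (\<Sum>u\<in>?A. real (bsum w r u)) / real (card ?P))" using N by simp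
  also have "\<dots> \<le> 2 * exp (79 * real (spars g r) / real (dg g) + 11)"
  proof -
    let ?D = "real (dg g)" and ?Z = "real (spars g r)"
    have D0: "?D > 0" using D by simp
    have "(\<Sum>u\<in>?A. bsum w r u) \<le> (\<Sum>u\<in>clu g r. bsum w r u)"
      using clu_V[OF r(1)] finV mem_clu by (intro sum_mono2) (auto intro: finite_subset)
    then have "(\<Sum>u\<in>?A. bsum w r u) \<le> 23 * spars g r + 3 * dg g" using bsum_sum[OF r D, of w] by linarith
    then have "real (\<Sum>u\<in>?A. bsum w r u) \<le> real (23 * spars g r + 3 * dg g)" by (rule of_nat_mono)
    then have s: "(\<Sum>u\<in>?A. real (bsum w r u)) \<le> 23 * ?Z + 3 * ?D" by simp
    have p: "7 / 8 * ?D \<le> real (card ?P)" using cP by linarith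
    \<comment> \<open>79 and 11 round up 23 * 24 / 7 and 3 * 24 / 7.\<close>
    have "3 * (\<Sum>u\<in>?A. real (bsum w r u)) / real (card ?P) \<le> 3 * (23 * ?Z + 3 * ?D) / (7 / 8 * ?D)"
      using s p D0 by (intro frac_le mult_left_mono) auto
    also have "\<dots> \<le> 79 * ?Z / ?D + 11" using D0 by (simp add: field_simps)
    finally show ?thesis by simp
  qed
  finally show ?thesis .
qed

text \<open>Averages over the single seed \<open>(r, 2)\<close> with all others fixed; there are at
  most \<open>(dg g + 1) ^ (dg g + 1)\<close> injections, so the bits suffice. The moment has base 2
  and ln 2 is at least 1/2, so half of the 200 covers the 79 of \<open>fails_step\<close> and half
  of \<open>2 * l\<close> remains.\<close>

lemma fails_tail:
  assumes r: "r \<in> V" "leader g r" and D: "100 \<le> dg g" and L: "2 \<in> C" "finite C"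
    and B: "(dg g + 1) ^ (dg g + 1) \<le> 2 ^ b"
    and t: "200 * (real (spars g r) / real (dg g)) + 2 * l \<le> t" "0 \<le> l"
  shows "prb (2 ^ b) (V \<times> C) (\<lambda>w. 8 * actn w r \<le> dg g \<and> t \<le> real (fails w r)) \<le> 2 * exp (11 - l)"
proof -
  let ?J = "V \<times> C - {(r, 2)}"
  let ?E = "exp (79 * real (spars g r) / real (dg g) + 11)"
  have J: "V \<times> C = insert (r, 2) ?J" using r L by auto
  have fin: "finite ?J" using finV L by auto
  have Bw: "card (injs (mem g w r) (av1 g w r)) \<le> 2 ^ b" for w
  proof -
    have "card (injs (mem g w r) (av1 g w r)) \<le> card (mem g w r \<rightarrow>\<^sub>E av1 g w r)"
      unfolding injs_def using mem_fin av1_fin r by (intro card_mono finite_PiE) auto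
    also have "\<dots> = card (av1 g w r) ^ card (mem g w r)" using mem_fin[OF r(1)] by (simp add: card_PiE)
    also have "\<dots> \<le> (dg g + 1) ^ card (mem g w r)"
      using card_mono[of "pal g r" "av1 g w r"] pal_card[OF r(1)] r by (intro power_mono) (auto simp: av1_def)
    also have "\<dots> \<le> (dg g + 1) ^ (dg g + 1)"
    proof (intro power_increasing)
      have "card (mem g w r) \<le> card (av1 g w r)" by (rule mem_le_av1[OF r(1)])
      also have "\<dots> \<le> card (pal g r)" using r by (intro card_mono) (auto simp: av1_def)
      finally show "card (mem g w r) \<le> dg g + 1" using pal_card[OF r(1)] by simp
    qed simp
    finally show ?thesis using B by linarith
  qed
  have act: "actn (w((r, 2) := x)) r = actn w r" for w x by (simp add: actn_def coord2[OF r(1)])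
  have "prb (2 ^ b) (V \<times> C) (\<lambda>w. 8 * actn w r \<le> dg g \<and> t \<le> real (fails w r)) =
    avg (2 ^ b) ?J (\<lambda>w. (\<Sum>x<2 ^ b. of_bool (8 * actn w r \<le> dg g \<and> t \<le> real (fails (w((r, 2) := x)) r))) / 2 ^ b)"
    using fin by (subst J, subst avg_insert) (auto simp: act)
  also have "\<dots> \<le> avg (2 ^ b) ?J (\<lambda>w. 2 * exp (11 - l))"
  proof (rule avg_mono)
    fix w
    show "(\<Sum>x<2 ^ b. of_bool (8 * actn w r \<le> dg g \<and> t \<le> real (fails (w((r, 2) := x)) r))) / 2 ^ b \<le> 2 * exp (11 - l)"
    proof (cases "8 * actn w r \<le> dg g")
      case True
      have "of_bool (8 * actn w r \<le> dg g \<and> t \<le> real (fails (w((r, 2) := x)) r)) \<le>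
        exp (- t * ln 2) * 2 ^ fails (w((r, 2) := x)) r" for x
      proof (cases "t \<le> real (fails (w((r, 2) := x)) r)")
        case True
        have "exp (t * ln 2) \<le> exp (real (fails (w((r, 2) := x)) r) * ln 2)" using True by simp
        also have "\<dots> = 2 ^ fails (w((r, 2) := x)) r" by (simp add: exp_of_nat_mult)
        finally show ?thesis by (auto simp: exp_minus field_simps)
      qed simp
      then have "(\<Sum>x<2 ^ b. of_bool (8 * actn w r \<le> dg g \<and> t \<le> real (fails (w((r, 2) := x)) r)) :: real)
        \<le> (\<Sum>x<2 ^ b. exp (- t * ln 2) * 2 ^ fails (w((r, 2) := x)) r)" by (rule sum_mono)
      then have "(\<Sum>x<2 ^ b. of_bool (8 * actn w r \<le> dg g \<and> t \<le> real (fails (w((r, 2) := x)) r))) / 2 ^ b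
        \<le> exp (- t * ln 2) * ((\<Sum>x<2 ^ b. 2 ^ fails (w((r, 2) := x)) r) / 2 ^ b)"
        by (simp add: sum_distrib_left divide_right_mono)
      also have "\<dots> \<le> exp (- t * ln 2) * (2 * ?E)"
        using fails_step[OF r D True Bw] by (intro mult_left_mono) auto
      also have "\<dots> = 2 * exp (79 * real (spars g r) / real (dg g) + 11 - t * ln 2)"
        by (simp add: exp_diff exp_minus field_simps)
      also have "\<dots> \<le> 2 * exp (11 - l)"
      proof -
        have "t * (1 / 2) \<le> t * ln 2" using t ln2_ge_half by (intro mult_left_mono) (auto intro: order_trans[of 0 "200 * (real (spars g r) / real (dg g)) + 2 * l"])
        moreover have "0 \<le> real (spars g r) / real (dg g)" by simp
        ultimately have "79 * (real (spars g r) / real (dg g)) + l \<le> t * ln 2" using t by linarith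
        then show ?thesis by simp
      qed
      finally show ?thesis .
    qed simp
  qed
  also have "\<dots> = 2 * exp (11 - l)" using fin by (intro avg_const) auto
  finally show ?thesis .
qed

section \<open>Vertices that are put aside\<close>

abbreviation jq :: nat where "jq \<equiv> LEAST j. dg g \<le> 4 ^ j"

definition \<rho> :: real where "\<rho> = 1 / 2 ^ jq"

lemma dg_le_4: "dg g \<le> 4 ^ b"
proof -
  have "dg g \<le> 2048 * (dg g + 1)" by simp
  also have "\<dots> \<le> 2 ^ kk (2048 * (dg g + 1))" by (rule kk_ge)
  also have "\<dots> \<le> (2::nat) ^ b" using b_ge by (intro power_increasing) auto
  also have "\<dots> \<le> 4 ^ b" by (intro power_mono) auto
  finally show ?thesis .
qed

lemma jq_le: "jq \<le> b"
  using dg_le_4 by (rule Least_le)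

lemma \<rho>_bounds: "1 / (2 * sqrt (real (dg g))) \<le> \<rho>" "\<rho> \<le> 1 / sqrt (real (dg g))" "0 < \<rho>"
proof -
  have D: "0 < sqrt (real (dg g))" using dg_pos by simp
  have pow: "(4::real) ^ j = (2 ^ j)\<^sup>2" for j :: nat
    by (simp add: power2_eq_square flip: power_mult_distrib)
  have "dg g \<le> 4 ^ jq" using dg_le_4 by (rule LeastI)
  then have "real (dg g) \<le> 4 ^ jq" by (metis of_nat_le_iff of_nat_numeral of_nat_power)
  then have 1: "sqrt (real (dg g)) \<le> 2 ^ jq" unfolding pow by (intro real_le_lsqrt) auto
  then show "\<rho> \<le> 1 / sqrt (real (dg g))" unfolding \<rho>_def using D by (intro divide_left_mono) auto
  have "2 ^ jq \<le> 2 * sqrt (real (dg g))"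
  proof (cases jq)
    case 0
    have "sqrt 1 \<le> sqrt (real (dg g))" using dg_pos by (intro real_sqrt_le_mono) simp
    then have "1 \<le> sqrt (real (dg g))" by (simp only: real_sqrt_one)
    then show ?thesis unfolding 0 power_0 by linarith
  next
    case (Suc i)
    then have "\<not> dg g \<le> 4 ^ i" by (intro not_less_Least) auto
    then have "(4::real) ^ i \<le> real (dg g)"
      by (metis linorder_not_le less_imp_le of_nat_le_iff of_nat_numeral of_nat_power)
    then have "2 ^ i \<le> sqrt (real (dg g))" unfolding pow by (rule real_le_rsqrt)
    then show ?thesis using Suc by simp
  qed
  then show "1 / (2 * sqrt (real (dg g))) \<le> \<rho>" unfolding \<rho>_def using D by (intro divide_left_mono) auto
  show "0 < \<rho>" by (simp add: \<rho>_def)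
qed

lemma smp_step:
  "(\<Sum>x<2 ^ b. exp (if smp g (t((z, 1) := x)) z then h else 0)) / 2 ^ b \<le> exp (\<rho> * (exp h - 1))"
proof -
  have "(\<Sum>x<2 ^ b. exp (if smp g (t((z, 1) := x)) z then h else 0)) / 2 ^ b =
    (\<Sum>i<(2::nat) ^ jq. exp (if i = 0 then h else 0)) / 2 ^ jq"
    using sum_mod_pow2[OF jq_le, of "\<lambda>i. exp (if i = 0 then h else 0)"] by (simp add: smp_def)
  also have "(\<Sum>i<(2::nat) ^ jq. exp (if i = 0 then h else 0)) = (\<Sum>i<(2::nat) ^ jq. 1 + (if i = 0 then exp h - 1 else 0))"
    by (intro sum.cong) auto
  also have "\<dots> = 2 ^ jq + (exp h - 1)" by (simp add: sum.distrib)
  also have "\<dots> / 2 ^ jq = 1 + \<rho> * (exp h - 1)" by (simp add: \<rho>_def field_simps)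
  also have "\<dots> \<le> exp (\<rho> * (exp h - 1))" by (rule exp_ge_add_one_self)
  finally show ?thesis .
qed

text \<open>Analogue of \<open>trial_exp\<close> in which the order of revelation is a parameter:
  \<open>aside_step\<close> has to reveal the cluster in question last.\<close>

lemma smp_exp:
  fixes key :: "nat \<Rightarrow> nat"
  assumes key: "inj_on key V"
    and d: "\<And>z. z \<in> V \<Longrightarrow> dep (h z) {j \<in> V \<times> {1}. key (fst j) < key z}"
    and c: "\<And>z t. z \<in> V \<Longrightarrow> exp (h z t) - 1 \<le> k * h z t"
  shows "avg (2 ^ b) (V \<times> {1}) (\<lambda>t. exp (\<Sum>z\<in>V. (if smp g t z then h z t else 0) - \<rho> * k * h z t)) \<le> 1"
proof -
  define \<phi> where "\<phi> j t = (if smp g t (fst j) then h (fst j) t else 0) - \<rho> * k * h (fst j) t" for j :: "nat \<times> nat" and t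
  have sum: "(\<Sum>j\<in>V \<times> {1}. \<phi> j t) = (\<Sum>z\<in>V. (if smp g t z then h z t else 0) - \<rho> * k * h z t)" for t
    unfolding \<phi>_def by (rule sum.reindex_bij_witness[of _ "\<lambda>u. (u, 1)" fst]) auto
  have "avg (2 ^ b) (V \<times> {1}) (\<lambda>t. exp (\<Sum>j\<in>V \<times> {1}. \<phi> j t)) \<le> 1"
  proof (rule avg_exp_seq[where key = "\<lambda>j. key (fst j)"])
    show "inj_on (\<lambda>j. key (fst j)) (V \<times> {1})" using key by (auto simp: inj_on_def)
    show "dep (\<phi> j) {i \<in> V \<times> {1}. key (fst i) \<le> key (fst j)}" if j: "j \<in> V \<times> {1}" for j
      unfolding dep_def
    proof (intro allI impI)
      fix s t :: seeds assume st: "\<forall>i\<in>{i \<in> V \<times> {1}. key (fst i) \<le> key (fst j)}. s i = t i"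
      have "h (fst j) s = h (fst j) t" using j st by (intro depD[OF d]) auto
      moreover have "smp g s (fst j) = smp g t (fst j)" using j st by (auto simp: smp_def)
      ultimately show "\<phi> j s = \<phi> j t" by (simp add: \<phi>_def)
    qed
    show "(\<Sum>x<2 ^ b. exp (\<phi> j (t(j := x)))) / real (2 ^ b) \<le> 1" if j: "j \<in> V \<times> {1}" for j t
    proof -
      obtain z where z: "j = (z, 1)" "z \<in> V" using j by auto
      have hu: "h z (t((z, 1) := x)) = h z t" for x by (intro depD[OF d[OF z(2)]]) auto
      let ?C = "\<rho> * k * h z t"
      have "(\<Sum>x<2 ^ b. exp (\<phi> j (t(j := x)))) / real (2 ^ b) =
        exp (- ?C) * ((\<Sum>x<2 ^ b. exp (if smp g (t((z, 1) := x)) z then h z t else 0)) / 2 ^ b)"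
        unfolding z \<phi>_def fst_conv hu diff_conv_add_uminus exp_add
        by (simp add: sum_distrib_left mult.commute)
      also have "\<dots> \<le> exp (- ?C) * exp (\<rho> * (exp (h z t) - 1))"
        by (intro mult_left_mono smp_step) auto
      also have "\<dots> \<le> exp (- ?C) * exp ?C"
        unfolding mult.assoc using \<rho>_bounds(3) c[OF z(2)] by (intro mult_left_mono exp_le_cancel_iff[THEN iffD2]) auto
      also have "\<dots> = 1" by (simp flip: exp_add)
      finally show ?thesis .
    qed
  qed (use finV in auto)
  then show ?thesis unfolding sum .
qed

lemma coord1:
  assumes "\<And>u. w (u, 0) = s (u, 0)"
  shows "att g w = att g s"
  using assms by (auto simp: att_def)

text \<open>\<open>U\<close> holds at least D / 2 neighbors of \<open>v\<close> in the cluster that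
  become candidates if sampled. Sampled vertices of other clusters spoil at most L^2 of them each
  and at most 26 L^3 in the mean, against D / 4 = L^4 / 4. The unspoiled rest is sampled afterwards,
  with probability at least 1 / (2 L^2) each, so that at least L^2 / 32 of them are put
  aside.\<close>

lemma aside_step:
  fixes L :: real
  assumes v: "v \<in> V" "dense g v" and r: "r \<in> cls g v" "leader g r" "spars g r \<le> spars g v"
    and L: "real (dg g) = L ^ 4" "200 \<le> L" "real (spars g v) \<le> real (dg g) * L"
    and q: "quiet s v"
  shows "prb (2 ^ b) (V \<times> {1}) (\<lambda>t. real (card {u \<in> nb g v. ps g (override_on s t (V \<times> {1})) u}) < L\<^sup>2 / 32)
    \<le> exp (- (L\<^sup>2 / 32)) + exp (- (L\<^sup>2 / 4 - 52 * L))"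
proof -
  let ?D = "real (dg g)" and ?w = "\<lambda>t. override_on s t (V \<times> {1})"
  have D4: "?D = L\<^sup>2 * L\<^sup>2" using L(1) by (simp add: power2_eq_square power4_eq_xxxx)
  have sq: "sqrt ?D = L\<^sup>2" unfolding D4 real_sqrt_abs2 by simp
  have L2: "200 * L \<le> L\<^sup>2" using mult_right_mono[OF L(2), of L] L(2) by (simp add: power2_eq_square)
  then have L2b: "40000 \<le> L\<^sup>2" using L(2) by linarith
  have D200: "200 * (L\<^sup>2 * L) \<le> ?D" unfolding D4 using mult_left_mono[OF L2, of "L\<^sup>2"] by (simp add: mult_ac)
  have Dbig: "40000 * L\<^sup>2 \<le> ?D" unfolding D4 using L2b by (intro mult_right_mono) auto
  then have "100 \<le> ?D" using L2b by linarith
  then have D100: "100 \<le> dg g" by simp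
  have rV: "r \<in> V" using r v dg_pos cls_iff by blast
  let ?e = "\<lambda>u. card (nb g u - clu g r)"
  define U where "U = {u \<in> nb g v \<inter> clu g r. att g s u = None \<and> (?e u)\<^sup>2 \<le> dg g}"
  have UV: "U \<subseteq> V" using v by (auto simp: U_def)
  have Ufin: "finite U" using UV finV finite_subset by blast
  \<comment> \<open>All vertices outside the cluster that become candidates if sampled; fixed before
    any sampling.\<close>
  define Q where "Q = {z \<in> V. z \<notin> clu g r \<and> (\<exists>r'\<in>insert z (nb g z). z \<in> clu g r' \<and> att g s z = None \<and> (card (nb g z - clu g r'))\<^sup>2 \<le> dg g)}"
  define wt where "wt z = real (card (nb g z \<inter> U))" for z
  have esum: "(\<Sum>u\<in>clu g r. real (?e u)) \<le> 26 * (?D * L)"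
  proof -
    have "(\<Sum>u\<in>clu g r. ?e u) \<le> (\<Sum>u\<in>clu g r. bsum s r u)" by (intro sum_mono) (simp add: bsum_def)
    also have "\<dots> \<le> 23 * spars g v + 3 * dg g" using bsum_sum[OF rV r(2) D100, of s] r(3) by linarith
    finally have "real (\<Sum>u\<in>clu g r. ?e u) \<le> real (23 * spars g v + 3 * dg g)" by (rule of_nat_mono)
    then have "(\<Sum>u\<in>clu g r. real (?e u)) \<le> 23 * (?D * L) + 3 * ?D" using L(3) by simp
    moreover have "?D * 1 \<le> ?D * L" using L(2) by (intro mult_left_mono) auto
    ultimately show ?thesis by simp
  qed
  have cfin: "finite (clu g r)" using clu_V[OF rV] finV finite_subset by blast
  have Ucard: "?D / 2 \<le> real (card U)"
  proof -
    let ?X = "{u \<in> clu g r. dg g < (?e u)\<^sup>2}"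
    have "nb g v \<subseteq> U \<union> (nb g v - clu g r) \<union> {u \<in> nb g v. att g s u \<noteq> None} \<union> ?X" by (auto simp: U_def)
    then have "card (nb g v) \<le> card (U \<union> (nb g v - clu g r) \<union> {u \<in> nb g v. att g s u \<noteq> None} \<union> ?X)"
      using v Ufin cfin by (intro card_mono) auto
    also have "\<dots> \<le> card U + card (nb g v - clu g r) + actn s v + card ?X"
      unfolding actn_def using card_Un_le[of "U \<union> (nb g v - clu g r) \<union> {u \<in> nb g v. att g s u \<noteq> None}" ?X]
        card_Un_le[of "U \<union> (nb g v - clu g r)" "{u \<in> nb g v. att g s u \<noteq> None}"] card_Un_le[of U "nb g v - clu g r"] by linarith
    finally have 1: "real (card (nb g v)) \<le> real (card U) + real (card (nb g v - clu g r)) + real (actn s v) + real (card ?X)"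
      by linarith
    have 2: "99 / 100 * ?D \<le> real (card (nb g v))" using dense_deg[OF v] by linarith
    have "real (dg g * card (nb g v - clu g r)) \<le> real (20 * spars g v)"
      using nonclu[OF v r D100] by (rule of_nat_mono)
    then have "?D * real (card (nb g v - clu g r)) \<le> ?D * (20 * L)" using L(3) by simp
    then have 3: "real (card (nb g v - clu g r)) \<le> 20 * L" using dg_pos by (simp add: mult_le_cancel_left)
    have 4: "real (actn s v) \<le> ?D / 8" using q by (auto simp: quiet_def)
    have "real (card ?X) * L\<^sup>2 = (\<Sum>u\<in>?X. L\<^sup>2)" by simp
    also have "\<dots> \<le> (\<Sum>u\<in>?X. real (?e u))"
    proof (rule sum_mono)
      fix u assume "u \<in> ?X"
      then have "?D \<le> real ((?e u)\<^sup>2)" by (intro of_nat_mono) auto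
      then have "(L\<^sup>2)\<^sup>2 \<le> (real (?e u))\<^sup>2" using D4 by (simp add: power2_eq_square)
      then show "L\<^sup>2 \<le> real (?e u)" by (rule power2_le_imp_le) auto
    qed
    also have "\<dots> \<le> (\<Sum>u\<in>clu g r. real (?e u))" using cfin by (intro sum_mono2) auto
    also have "\<dots> \<le> (26 * (L\<^sup>2 * L)) * L\<^sup>2" using esum by (simp add: D4 mult_ac)
    finally have "real (card ?X) * L\<^sup>2 \<le> (26 * (L\<^sup>2 * L)) * L\<^sup>2" .
    then have 5: "real (card ?X) \<le> 26 * (L\<^sup>2 * L)"
      by (rule mult_right_le_imp_le) (use L2b in linarith)
    have "1 * L \<le> L\<^sup>2 * L" using L2b L(2) by (intro mult_right_mono) auto
    then show ?thesis using 1 2 3 4 5 D200 by linarith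
  qed
  have wt_le: "wt z \<le> L\<^sup>2" if z: "z \<in> Q" for z
  proof -
    obtain r' where r': "r' \<in> insert z (nb g z)" "z \<in> clu g r'" "(card (nb g z - clu g r'))\<^sup>2 \<le> dg g" and zV: "z \<in> V" "z \<notin> clu g r"
      using z by (auto simp: Q_def)
    have r'V: "r' \<in> V" "r' \<noteq> r" using r' zV by auto
    have "clu g r \<inter> clu g r' = {}" using clu_unique[OF rV r'V(1)] r'V(2) dg_pos by blast
    then have "nb g z \<inter> U \<subseteq> nb g z - clu g r'" by (auto simp: U_def)
    then have "card (nb g z \<inter> U) \<le> card (nb g z - clu g r')" using zV by (intro card_mono) auto
    then have "(card (nb g z \<inter> U))\<^sup>2 \<le> (card (nb g z - clu g r'))\<^sup>2" by (rule power_mono) auto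
    then have "real ((card (nb g z \<inter> U))\<^sup>2) \<le> real (dg g)" using r'(3) by (intro of_nat_mono) linarith
    then have "(wt z)\<^sup>2 \<le> (L\<^sup>2)\<^sup>2" using D4 by (simp add: wt_def power2_eq_square)
    then show ?thesis by (rule power2_le_imp_le) auto
  qed
  have QV: "Q \<subseteq> V" by (auto simp: Q_def)
  then have Qfin: "finite Q" using finV finite_subset by blast
  have wt_sum: "(\<Sum>z\<in>Q. wt z) \<le> 26 * (?D * L)"
  proof -
    have "(\<Sum>z\<in>Q. card {u \<in> U. u \<in> nb g z}) = (\<Sum>u\<in>U. card {z \<in> Q. u \<in> nb g z})"
      using Qfin Ufin by (intro sum_multicount_gen) auto
    also have "\<dots> \<le> (\<Sum>u\<in>U. ?e u)"
    proof (intro sum_mono card_mono)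
      fix u assume "u \<in> U"
      then show "finite (nb g u - clu g r)" using UV by auto
      show "{z \<in> Q. u \<in> nb g z} \<subseteq> nb g u - clu g r" using nb_sym QV by (auto simp: Q_def)
    qed
    also have "\<dots> \<le> (\<Sum>u\<in>clu g r. ?e u)" using cfin by (intro sum_mono2) (auto simp: U_def)
    finally have "real (\<Sum>z\<in>Q. card {u \<in> U. u \<in> nb g z}) \<le> real (\<Sum>u\<in>clu g r. ?e u)" by (rule of_nat_mono)
    moreover have "{u \<in> U. u \<in> nb g z} = nb g z \<inter> U" for z by auto
    ultimately show ?thesis using esum by (simp add: wt_def)
  qed
  define spoil where "spoil t = (\<Sum>z\<in>Q. if smp g t z then wt z else 0)" for t
  define U' where "U' t = {u \<in> U. \<forall>z\<in>nb g u \<inter> Q. \<not> smp g t z}" for t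
  have U'fin: "finite (U' t)" for t using Ufin by (simp add: U'_def)
  have smp_w: "smp g (?w t) z = smp g t z" if "z \<in> V" for t z using that by (simp add: smp_def)
  have att_w: "att g (?w t) = att g s" for t by (intro coord1) (auto simp: override_on_def)
  note att_w' = att_w[unfolded One_nat_def]
  have psU: "{u \<in> U' t. smp g t u} \<subseteq> {u \<in> nb g v. ps g (?w t) u}" for t
  proof
    fix u assume u: "u \<in> {u \<in> U' t. smp g t u}"
    then have uU: "u \<in> U" "u \<in> V" using UV by (auto simp: U'_def)
    have ru: "r \<in> insert u (nb g u)" using uU(1) nb_sym[OF rV] by (auto simp: U_def clu_def)
    have "cand g (?w t) r u" using u uU smp_w[OF uU(2)] by (auto simp: cand_def att_w att_w' U_def)
    moreover have "\<not> qs g (?w t) z" if z: "z \<in> nb g u - clu g r" for z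
    proof
      assume "qs g (?w t) z"
      moreover have zV: "z \<in> V" using z uU(2) by auto
      ultimately have "z \<in> Q" "smp g t z" using z smp_w[OF zV] by (auto simp: qs_def cand_def att_w att_w' Q_def)
      then show False using u z by (auto simp: U'_def)
    qed
    ultimately have "ps g (?w t) u" using ru by (auto simp: ps_def)
    then show "u \<in> {u \<in> nb g v. ps g (?w t) u}" using uU by (auto simp: U_def)
  qed
  have spoilU: "real (card U) \<le> real (card (U' t)) + spoil t" for t
  proof -
    let ?S = "{z \<in> Q. smp g t z}"
    have "U \<subseteq> U' t \<union> (\<Union>z\<in>?S. nb g z \<inter> U)" using nb_sym UV by (auto simp: U'_def)
    then have "card U \<le> card (U' t \<union> (\<Union>z\<in>?S. nb g z \<inter> U))"
      using U'fin Qfin Ufin by (intro card_mono) auto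
    also have "\<dots> \<le> card (U' t) + card (\<Union>z\<in>?S. nb g z \<inter> U)" by (rule card_Un_le)
    also have "card (\<Union>z\<in>?S. nb g z \<inter> U) \<le> (\<Sum>z\<in>?S. card (nb g z \<inter> U))" using Qfin by (intro card_UN_le) auto
    finally have "card U \<le> card (U' t) + (\<Sum>z\<in>?S. card (nb g z \<inter> U))" by simp
    then have "real (card U) \<le> real (card (U' t) + (\<Sum>z\<in>?S. card (nb g z \<inter> U)))" by (rule of_nat_mono)
    moreover have "spoil t = (\<Sum>z\<in>?S. wt z)"
      unfolding spoil_def using Qfin by (rule sum.inter_filter[symmetric])
    ultimately show ?thesis by (simp add: wt_def)
  qed
  have exps: "L\<^sup>2 > 0" using L2b by linarith
  have calc: "x * x / 4 / x = x / 4" "1 / x * 2 * (26 * (x * x * l) / x) = 52 * l" "1 / (2 * x) / 2 * (x * x / 4) = x / 16"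
    if "x > 0" for x l :: real
    using that by auto
  have A: "prb (2 ^ b) (V \<times> {1}) (\<lambda>t. spoil t > ?D / 4) \<le> exp (- (L\<^sup>2 / 4 - 52 * L))"
  proof -
    define h where "h z t = (if z \<in> Q then wt z / L\<^sup>2 else 0)" for z and t :: seeds
    have "avg (2 ^ b) (V \<times> {1}) (\<lambda>t. exp (\<Sum>z\<in>V. (if smp g t z then h z t else 0) - \<rho> * 2 * h z t)) \<le> 1"
    proof (rule smp_exp[where key = id])
      show "exp (h z t) - 1 \<le> 2 * h z t" for z t
        using wt_le[of z] exps by (intro exp_le_1_2) (auto simp: h_def wt_def)
    qed (auto simp: dep_def h_def)
    then show ?thesis
    proof (rule prb_exp_le)
      fix t assume sp: "spoil t > ?D / 4"
      have "(\<Sum>z\<in>V. (if smp g t z then h z t else 0) - \<rho> * 2 * h z t) = (\<Sum>z\<in>V. if z \<in> Q then (if smp g t z then wt z else 0) / L\<^sup>2 - \<rho> * 2 * (wt z / L\<^sup>2) else 0)"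
        by (intro sum.cong) (auto simp: h_def)
      also have "\<dots> = (\<Sum>z\<in>Q. (if smp g t z then wt z else 0) / L\<^sup>2 - \<rho> * 2 * (wt z / L\<^sup>2))"
        using finV QV by (simp add: sum.If_cases Int_absorb1)
      also have "\<dots> = spoil t / L\<^sup>2 - \<rho> * 2 * ((\<Sum>z\<in>Q. wt z) / L\<^sup>2)"
        by (simp add: sum_subtractf spoil_def sum_divide_distrib sum_distrib_left)
      finally have e: "(\<Sum>z\<in>V. (if smp g t z then h z t else 0) - \<rho> * 2 * h z t) = spoil t / L\<^sup>2 - \<rho> * 2 * ((\<Sum>z\<in>Q. wt z) / L\<^sup>2)" .
      have "?D / 4 / L\<^sup>2 \<le> spoil t / L\<^sup>2" using sp exps by (intro divide_right_mono) auto
      then have 1: "L\<^sup>2 / 4 \<le> spoil t / L\<^sup>2" unfolding D4 calc(1)[OF exps] .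
      have "\<rho> * 2 * ((\<Sum>z\<in>Q. wt z) / L\<^sup>2) \<le> 1 / L\<^sup>2 * 2 * (26 * (?D * L) / L\<^sup>2)"
        using \<rho>_bounds exps wt_sum unfolding sq by (intro mult_mono divide_right_mono divide_nonneg_nonneg sum_nonneg) (auto simp: wt_def)
      also have "\<dots> = 52 * L" unfolding D4 by (rule calc(2)[OF exps])
      finally show "L\<^sup>2 / 4 - 52 * L \<le> (\<Sum>z\<in>V. (if smp g t z then h z t else 0) - \<rho> * 2 * h z t)"
        unfolding e using 1 by linarith
    qed
  qed
  have B: "prb (2 ^ b) (V \<times> {1}) (\<lambda>t. spoil t \<le> ?D / 4 \<and> real (card {u \<in> U' t. smp g t u}) < L\<^sup>2 / 32) \<le> exp (- (L\<^sup>2 / 32))"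
  proof -
    define M where "M = Suc (Max (insert 0 V))"
    have M: "z < M" if "z \<in> V" for z using that finV by (simp add: M_def less_Suc_eq_le)
    \<comment> \<open>Adding \<open>M\<close> puts the cluster behind all other vertices, so that
      \<open>U'\<close> is determined before any of its elements is sampled.\<close>
    define key where "key z = (if z \<in> clu g r then z + M else z)" for z
    have keyin: "inj_on key V"
    proof (rule inj_onI)
      fix x y assume "x \<in> V" "y \<in> V" "key x = key y"
      then show "x = y" using M[of x] M[of y] by (auto simp: key_def split: if_splits)
    qed
    define h :: "nat \<Rightarrow> seeds \<Rightarrow> real" where "h z t = - of_bool (z \<in> U' t)" for z t
    have "avg (2 ^ b) (V \<times> {1}) (\<lambda>t. exp (\<Sum>z\<in>V. (if smp g t z then h z t else 0) - \<rho> * (1 / 2) * h z t)) \<le> 1"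
    proof (rule smp_exp[OF keyin])
      show "exp (h z t) - 1 \<le> 1 / 2 * h z t" for z t
        using exp_minus_le[of "of_bool (z \<in> U' t)"] by (simp add: h_def)
      show "dep (h z) {j \<in> V \<times> {1}. key (fst j) < key z}" if z: "z \<in> V" for z
        unfolding dep_def
      proof (intro allI impI)
        fix t t' :: seeds assume tt: "\<forall>i\<in>{j \<in> V \<times> {1}. key (fst j) < key z}. t i = t' i"
        have "smp g t y = smp g t' y" if "y \<in> Q" "z \<in> U" for y
        proof -
          have "y \<in> V" "key y < key z" using that QV M[of y] by (auto simp: Q_def U_def key_def)
          then show ?thesis using tt by (simp add: smp_def)
        qed
        then show "h z t = h z t'" by (auto simp: h_def U'_def)
      qed
    qed
    then show ?thesis
    proof (rule prb_exp_le)
      fix t assume t: "spoil t \<le> ?D / 4 \<and> real (card {u \<in> U' t. smp g t u}) < L\<^sup>2 / 32"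
      have "(\<Sum>z\<in>V. (if smp g t z then h z t else 0) - \<rho> * (1 / 2) * h z t) =
        \<rho> / 2 * (\<Sum>z\<in>V. of_bool (z \<in> U' t)) - (\<Sum>z\<in>V. of_bool (z \<in> U' t \<and> smp g t z))"
        unfolding sum_distrib_left sum_subtractf[symmetric] by (intro sum.cong) (auto simp: h_def)
      also have "\<dots> = \<rho> / 2 * real (card (U' t)) - real (card {u \<in> U' t. smp g t u})"
      proof -
        have "{z \<in> V. z \<in> U' t} = U' t" "{z \<in> V. z \<in> U' t \<and> smp g t z} = {u \<in> U' t. smp g t u}"
          using UV by (auto simp: U'_def)
        then show ?thesis by (simp only: card_filter_sum[OF finV])
      qed
      finally have e: "(\<Sum>z\<in>V. (if smp g t z then h z t else 0) - \<rho> * (1 / 2) * h z t) =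
        \<rho> / 2 * real (card (U' t)) - real (card {u \<in> U' t. smp g t u})" .
      have "?D / 4 \<le> real (card (U' t))" using spoilU[of t] t Ucard by linarith
      then have le: "1 / (2 * L\<^sup>2) / 2 * (?D / 4) \<le> \<rho> / 2 * real (card (U' t))"
        using \<rho>_bounds unfolding sq by (intro mult_mono divide_right_mono) auto
      have "1 / (2 * L\<^sup>2) / 2 * (?D / 4) = L\<^sup>2 / 16" unfolding D4 by (rule calc(3)[OF exps])
      with le have "L\<^sup>2 / 16 \<le> \<rho> / 2 * real (card (U' t))" by (simp only:)
      then show "L\<^sup>2 / 32 \<le> (\<Sum>z\<in>V. (if smp g t z then h z t else 0) - \<rho> * (1 / 2) * h z t)"
        unfolding e using t by linarith
    qed
  qed
  have "prb (2 ^ b) (V \<times> {1}) (\<lambda>t. real (card {u \<in> nb g v. ps g (?w t) u}) < L\<^sup>2 / 32) \<le>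
    prb (2 ^ b) (V \<times> {1}) (\<lambda>t. spoil t \<le> ?D / 4 \<and> real (card {u \<in> U' t. smp g t u}) < L\<^sup>2 / 32) +
    prb (2 ^ b) (V \<times> {1}) (\<lambda>t. spoil t > ?D / 4)"
  proof (rule prb_disj)
    fix t assume "real (card {u \<in> nb g v. ps g (?w t) u}) < L\<^sup>2 / 32"
    moreover have "card {u \<in> U' t. smp g t u} \<le> card {u \<in> nb g v. ps g (?w t) u}"
      using psU v by (intro card_mono) auto
    ultimately show "(spoil t \<le> ?D / 4 \<and> real (card {u \<in> U' t. smp g t u}) < L\<^sup>2 / 32) \<or> spoil t > ?D / 4" by linarith
  qed
  then show ?thesis using A B by linarith
qed

end

section \<open>The state after the second stage\<close>

definition prebad :: "gr \<Rightarrow> seeds \<Rightarrow> nat \<Rightarrow> bool" where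
  "prebad g w v \<longleftrightarrow> col2 g w v = None \<and> \<not> ps g w v \<and> \<not> act g w v"

text \<open>The summands are the probabilities that too many colors are tried near the vertex or its
  leader, that the gain is too small, that too many members fail, and that too few vertices are put
  aside.\<close>

definition perr :: "nat \<Rightarrow> real" where
  "perr D = (let L = sqrt (sqrt (real D)) in (real D + 2) * exp (- real D / 16) + 5 * exp (- (L / 2 ^ 35))
     + 2 * exp (11 - L) + (exp (- (L\<^sup>2 / 32)) + exp (- (L\<^sup>2 / 4 - 52 * L))))"

context gph_big
begin

lemma ps_uncol:
  assumes "z \<in> V" "ps g w z"
  shows "col2 g w z = None"
proof -
  have "att g w z = None" using assms by (auto simp: ps_def cand_def)
  then have "col1 g w z = None" by (simp add: col1_def)
  moreover have "asg g w z = None"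
    using assms asg_SomeD[of z w] dg_pos by (cases "asg g w z") (auto simp: mem_def)
  ultimately show ?thesis by (simp add: col2_def)
qed

text \<open>A colored neighbor costs at most one color, a neighbor put aside costs none and is not
  counted in \<open>unc\<close>, and every missing neighbor adds one. Stage two loses at most one
  color per newly colored neighbor, so the gain of stage one persists.\<close>

lemma slack2:
  assumes v: "v \<in> V"
  shows "card (unc g w v) + card {z \<in> nb g v. ps g w z} + (dg g - card (nb g v)) + 1 + gain w v \<le> card (av2 g w v)"
proof -
  let ?C1 = "{z \<in> nb g v. col1 g w z \<noteq> None}" and ?C2 = "{z \<in> nb g v. col2 g w z \<noteq> None}"
  let ?N = "{z \<in> nb g v. col1 g w z = None \<and> col2 g w z \<noteq> None}"
  have sub: "?C1 \<subseteq> ?C2" by (auto simp: col2_def)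
  have "?C2 = ?C1 \<union> ?N" using sub by auto
  then have "card ?C2 = card (?C1 \<union> ?N)" by simp
  also have "\<dots> = card ?C1 + card ?N" using v by (intro card_Un_disjoint) auto
  finally have c2: "card ?C2 = card ?C1 + card ?N" .
  have "av1 g w v \<subseteq> av2 g w v \<union> (\<lambda>z. the (col2 g w z)) ` ?N"
  proof
    fix x assume x: "x \<in> av1 g w v"
    show "x \<in> av2 g w v \<union> (\<lambda>z. the (col2 g w z)) ` ?N"
    proof (cases "x \<in> av2 g w v")
      case False
      then obtain z where z: "z \<in> nb g v" "col2 g w z = Some x" using x by (auto simp: av1_def av2_def)
      moreover have "col1 g w z = None"
        using x z by (cases "col1 g w z") (auto simp: av1_def col2_def)
      ultimately show ?thesis by (intro UnI2 rev_image_eqI[of z]) auto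
    qed simp
  qed
  then have "card (av1 g w v) \<le> card (av2 g w v \<union> (\<lambda>z. the (col2 g w z)) ` ?N)"
    using v by (intro card_mono) (auto simp: av2_def)
  also have "\<dots> \<le> card (av2 g w v) + card ?N"
    using v by (intro card_Un_le[THEN order_trans] add_mono card_image_le) auto
  finally have a: "card (av1 g w v) \<le> card (av2 g w v) + card ?N" .
  have "nb g v = (?C2 \<union> unc g w v) \<union> {z \<in> nb g v. ps g w z}" by (auto simp: unc_def)
  then have "card (nb g v) = card ((?C2 \<union> unc g w v) \<union> {z \<in> nb g v. ps g w z})" by simp
  also have "\<dots> = card (?C2 \<union> unc g w v) + card {z \<in> nb g v. ps g w z}"
    using v ps_uncol[of _ w] by (intro card_Un_disjoint) (auto simp: unc_def)
  also have "card (?C2 \<union> unc g w v) = card ?C2 + card (unc g w v)"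
    using v by (intro card_Un_disjoint) (auto simp: unc_def)
  finally have "card (nb g v) = card ?C2 + card (unc g w v) + card {z \<in> nb g v. ps g w z}" .
  then show ?thesis using gain_slack[OF v, of w] a c2 nb_deg[OF v] by linarith
qed

lemma unc_bound:
  assumes v: "v \<in> V" and r: "r \<in> V"
  shows "card (unc g w v) \<le> card (nb g v - clu g r) + fails w r"
proof -
  have "unc g w v \<subseteq> (nb g v - clu g r) \<union> {u \<in> mem g w r. col2 g w u = None}"
    by (auto simp: unc_def mem_def col2_def split: option.splits)
  then have "card (unc g w v) \<le> card ((nb g v - clu g r) \<union> {u \<in> mem g w r. col2 g w u = None})"
    using v mem_fin[OF r] by (intro card_mono) auto
  then show ?thesis unfolding fails_def using card_Un_le order_trans by blast
qed

text \<open>Below the threshold D L the vertex is dense, at most 222 L neighbors compete, and the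
  vertices put aside give slack L^2 / 32, which is at least L. Above it the gain or the missing
  degree gives slack of at least spars / (2^35 D), and at most 50000 spars / D neighbors
  compete.\<close>

lemma prebad_cases:
  fixes L :: real
  assumes v: "v \<in> V" and H: "2 ^ 52 \<le> hh g" and L: "real (dg g) = L ^ 4" "200 \<le> L"
    and r: "dense g v \<Longrightarrow> r \<in> cls g v \<and> leader g r \<and> spars g r \<le> spars g v"
    and q: "quiet w v"
    and gn: "L / 2 ^ 35 \<le> real (mism g v + nonadj g v) / (2 ^ 34 * real (dg g)) \<Longrightarrow>
      real (mism g v + nonadj g v) / (2 ^ 34 * real (dg g)) < real (gain w v)"
    and fl: "dense g v \<Longrightarrow> real (fails w r) < 200 * (real (spars g r) / real (dg g)) + 2 * L"
    and pc: "dense g v \<Longrightarrow> real (spars g v) \<le> real (dg g) * L \<Longrightarrow> L\<^sup>2 / 32 \<le> real (card {u \<in> nb g v. ps g w u})"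
  shows "\<not> prebad g w v"
proof -
  let ?D = "real (dg g)" and ?Z = "real (spars g v)"
  define sl where "sl = real (card (av2 g w v)) - real (card (unc g w v))"
  have D4: "?D = L\<^sup>2 * L\<^sup>2" using L(1) by (simp add: power2_eq_square power4_eq_xxxx)
  have L2: "200 * L \<le> L\<^sup>2" using mult_right_mono[OF L(2), of L] L(2) by (simp add: power2_eq_square)
  then have L2b: "40000 \<le> L\<^sup>2" using L(2) by linarith
  have "40000 * L\<^sup>2 \<le> ?D" unfolding D4 using L2b by (intro mult_right_mono) auto
  then have Dk: "1000 \<le> ?D" "40000 * 200 * L \<le> ?D" using L2 L2b by linarith+
  have D1000: "1000 \<le> dg g" using Dk(1) by simp
  have D0: "?D > 0" using Dk by linarith
  have rV: "r \<in> V" if "dense g v" using r[OF that] v dg_pos cls_iff by blast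
  have sl: "real (card {z \<in> nb g v. ps g w z}) + real (dg g - card (nb g v)) + real (gain w v) + 1 \<le> sl"
    using slack2[OF v, of w] unfolding sl_def by linarith
  have und: "real (card (unc g w v)) \<le> 220 * (?Z / ?D) + 2 * L" if d: "dense g v"
  proof -
    have "real (dg g * card (nb g v - clu g r)) \<le> real (20 * spars g v)"
      using nonclu[OF v d] r[OF d] D1000 by (intro of_nat_mono) auto
    then have "real (card (nb g v - clu g r)) \<le> 20 * (?Z / ?D)" using D0 by (simp add: field_simps)
    moreover have "200 * (real (spars g r) / ?D) \<le> 200 * (?Z / ?D)"
      using r[OF d] D0 by (intro mult_left_mono divide_right_mono) auto
    ultimately show ?thesis using unc_bound[OF v rV[OF d], of w] fl[OF d] by linarith
  qed
  have nd: "?D * ?D \<le> 50000 * ?Z" if "\<not> dense g v"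
  proof -
    have "real (dg g * dg g) \<le> real (50000 * spars g v)"
      using nondense_spars[OF v that D1000] by (rule of_nat_mono)
    then show ?thesis by simp
  qed
  have "real (card (unc g w v)) \<le> 2 ^ 51 * sl \<and> 0 < sl"
  proof (cases "?Z \<le> ?D * L")
    case True
    have d: "dense g v"
    proof (rule ccontr)
      assume "\<not> dense g v"
      then have "?D * ?D \<le> ?D * (50000 * L)" using nd True by simp
      then show False using Dk(2) D0 L(2) by (simp add: mult_le_cancel_left)
    qed
    have "?Z / ?D \<le> L" using True D0 by (simp add: field_simps)
    then have "real (card (unc g w v)) \<le> 222 * L" using und[OF d] by linarith
    moreover have "L \<le> sl" using sl pc[OF d True] L2 L(2) by linarith
    moreover have "222 * sl \<le> 2 ^ 51 * sl" if "0 \<le> sl" using that by (intro mult_right_mono) auto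
    ultimately show ?thesis using L(2) by auto
  next
    case False
    have zl: "L < ?Z / ?D" using False D0 by (simp add: field_simps)
    have s: "?Z / ?D \<le> 2 ^ 35 * sl"
    proof (cases "spars g v \<le> 2 * (mism g v + nonadj g v)")
      case True
      then have "?Z \<le> 2 * real (mism g v + nonadj g v)" by linarith
      then have "?Z / ?D / 2 ^ 35 \<le> real (mism g v + nonadj g v) / (2 ^ 34 * ?D)" using D0 by (simp add: field_simps)
      moreover have "L / 2 ^ 35 \<le> ?Z / ?D / 2 ^ 35" using zl by (intro divide_right_mono) auto
      ultimately have "?Z / ?D / 2 ^ 35 \<le> sl" using gn sl by linarith
      then show ?thesis by simp
    next
      case False
      then have "spars g v \<le> 2 * (dg g * (dg g - card (nb g v)))" by (simp add: spars_def)
      then have "?Z \<le> real (2 * (dg g * (dg g - card (nb g v))))" by (rule of_nat_mono)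
      then have "?Z / ?D \<le> 2 * real (dg g - card (nb g v))" using D0 by (simp add: field_simps)
      moreover have "2 * real (dg g - card (nb g v)) \<le> 2 * sl" using sl by linarith
      moreover have "2 * sl \<le> 2 ^ 35 * sl" using sl by (intro mult_right_mono) auto
      ultimately show ?thesis by linarith
    qed
    have "real (card (unc g w v)) \<le> 50000 * (?Z / ?D)"
    proof (cases "dense g v")
      case True
      then show ?thesis using und[OF True] zl L(2) by linarith
    next
      case False
      have "unc g w v \<subseteq> nb g v" by (auto simp: unc_def)
      then have "card (unc g w v) \<le> card (nb g v)" using v by (intro card_mono) auto
      then have "real (card (unc g w v)) \<le> ?D" using nb_deg[OF v] by linarith
      moreover have "?D \<le> 50000 * (?Z / ?D)" using nd[OF False] D0 by (simp add: field_simps)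
      ultimately show ?thesis by linarith
    qed
    moreover have "0 < 2 ^ 35 * sl" using s zl L(2) by linarith
    then have "0 < sl" by (simp add: zero_less_mult_iff)
    moreover have "50000 * (?Z / ?D) \<le> 50000 * (2 ^ 35 * sl)" using s by (intro mult_left_mono) auto
    \<comment> \<open>50000 < 2^16 leads to 2^51. Adding the slack itself gives 2^51 + 1, whence the
      requirement of 2^52 for \<open>hh g\<close>.\<close>
    moreover have "(50000 * 2 ^ 35) * sl \<le> 2 ^ 51 * sl" using \<open>0 < sl\<close> by (intro mult_right_mono) auto
    ultimately show ?thesis by auto
  qed
  then have "real (card (av2 g w v)) \<le> (2 ^ 51 + 1) * sl" "0 < sl" unfolding sl_def by auto
  moreover have "(2 ^ 51 + 1) * sl \<le> real (hh g) * sl"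
  proof (rule mult_right_mono)
    have "(2::real) ^ 52 \<le> real (hh g)" using H by (metis of_nat_le_iff of_nat_numeral of_nat_power)
    then show "2 ^ 51 + 1 \<le> real (hh g)" by simp
  qed (use \<open>0 < sl\<close> in simp)
  ultimately have "real (card (av2 g w v)) \<le> real (hh g * (card (av2 g w v) - card (unc g w v)))"
    unfolding sl_def by (simp add: of_nat_diff)
  then have "card (av2 g w v) \<le> hh g * (card (av2 g w v) - card (unc g w v))" by (simp only: of_nat_le_iff)
  moreover have "0 < card (av2 g w v)" using \<open>0 < sl\<close> unfolding sl_def by linarith
  ultimately show ?thesis unfolding prebad_def act_def by blast
qed

lemma trial_dep:
  assumes "u \<in> V" "\<forall>i\<in>J0. s i = t i"
  shows "att g s u = att g t u" "actn s u = actn t u" "quiet s u = quiet t u" "gain s u = gain t u"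
proof -
  have a: "att g s z = att g t z" if "z \<in> V" for z using assms that by (simp add: att_def)
  show "att g s u = att g t u" using a assms by simp
  have ac: "actn s y = actn t y" if y: "y \<in> V" for y
  proof -
    have "{z \<in> nb g y. att g s z \<noteq> None} = {z \<in> nb g y. att g t z \<noteq> None}" using a nb_in[OF y] by auto
    then show ?thesis by (simp add: actn_def)
  qed
  show "actn s u = actn t u" using ac assms by simp
  show "quiet s u = quiet t u" unfolding quiet_def using ac assms(1) by auto
  have "gset s u x = gset t u x" if "x \<in> nb g u" for x
    using assms nb_in[OF assms(1) that] by (intro gset_dep) auto
  then have "{x \<in> nb g u. \<exists>c. att g s x = Some c \<and> c \<in> gset s u x} = {x \<in> nb g u. \<exists>c. att g t x = Some c \<and> c \<in> gset t u x}"
    using a nb_in[OF assms(1)] by auto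
  then show "gain s u = gain t u" by (simp add: gain_def)
qed

lemma aside_tail:
  fixes L :: real
  assumes v: "v \<in> V" "dense g v" and r: "r \<in> cls g v" "leader g r" "spars g r \<le> spars g v"
    and L: "real (dg g) = L ^ 4" "200 \<le> L" "real (spars g v) \<le> real (dg g) * L"
    and C: "finite C" "1 \<in> C"
  shows "prb (2 ^ b) (V \<times> C) (\<lambda>w. quiet w v \<and> real (card {u \<in> nb g v. ps g w u}) < L\<^sup>2 / 32)
    \<le> exp (- (L\<^sup>2 / 32)) + exp (- (L\<^sup>2 / 4 - 52 * L))"
proof -
  have J: "V \<times> C = V \<times> (C - {1}) \<union> V \<times> {1}" using C by auto
  have "prb (2 ^ b) (V \<times> C) (\<lambda>w. quiet w v \<and> real (card {u \<in> nb g v. ps g w u}) < L\<^sup>2 / 32) =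
    avg (2 ^ b) (V \<times> (C - {1})) (\<lambda>s. prb (2 ^ b) (V \<times> {1}) (\<lambda>t. quiet (override_on s t (V \<times> {1})) v \<and>
      real (card {u \<in> nb g v. ps g (override_on s t (V \<times> {1})) u}) < L\<^sup>2 / 32))"
    unfolding J using finV C by (intro avg_union) auto
  also have "\<dots> \<le> avg (2 ^ b) (V \<times> (C - {1})) (\<lambda>s. exp (- (L\<^sup>2 / 32)) + exp (- (L\<^sup>2 / 4 - 52 * L)))"
  proof (rule avg_mono)
    fix s
    have q: "quiet (override_on s t (V \<times> {1})) v = quiet s v" for t
      using v by (intro trial_dep) (auto simp: override_on_def)
    show "prb (2 ^ b) (V \<times> {1}) (\<lambda>t. quiet (override_on s t (V \<times> {1})) v \<and>
      real (card {u \<in> nb g v. ps g (override_on s t (V \<times> {1})) u}) < L\<^sup>2 / 32)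
      \<le> exp (- (L\<^sup>2 / 32)) + exp (- (L\<^sup>2 / 4 - 52 * L))"
    proof (cases "quiet s v")
      case True
      then show ?thesis unfolding q using aside_step[OF v r L True] True by simp
    next
      case False
      then show ?thesis unfolding q using finV by (simp add: avg_const add_nonneg_nonneg)
    qed
  qed
  also have "\<dots> = exp (- (L\<^sup>2 / 32)) + exp (- (L\<^sup>2 / 4 - 52 * L))"
    using finV C by (intro avg_const) auto
  finally show ?thesis .
qed

lemma prebad_prob:
  assumes v: "v \<in> V" and H: "2 ^ 52 \<le> hh g" and D: "200 ^ 4 \<le> dg g"
    and B: "(dg g + 1) ^ (dg g + 1) \<le> 2 ^ b" and C: "finite C" "{0, 1, 2} \<subseteq> C"
  shows "prb (2 ^ b) (V \<times> C) (\<lambda>w. prebad g w v) \<le> perr (dg g)"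
proof -
  define L where "L = sqrt (sqrt (real (dg g)))"
  have L4: "real (dg g) = L ^ 4"
  proof -
    have "L ^ 4 = (L\<^sup>2)\<^sup>2" by simp
    then show ?thesis by (simp add: L_def)
  qed
  have L200: "200 \<le> L"
  proof -
    have "real (200 ^ 4) \<le> real (dg g)" using D by (rule of_nat_mono)
    then have "200 ^ 4 \<le> L ^ 4" using L4 by simp
    moreover have "0 \<le> L" by (simp add: L_def)
    ultimately show ?thesis by (simp only: power_mono_iff[of 200 L 4] zero_le_numeral zero_less_numeral)
  qed
  define W where "W = real (mism g v + nonadj g v) / (2 ^ 34 * real (dg g))"
  let ?P = "\<lambda>X. prb (2 ^ b) (V \<times> C) X"
  have finJ: "finite (V \<times> C)" using finV C by simp
  have J0: "J0 \<subseteq> V \<times> C" using C by auto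
  \<comment> \<open>A vertex that is not dense has no leader; \<open>v\<close> then serves as a
    dummy, and the events on failures and on vertices put aside are void.\<close>
  define r where "r = (if dense g v then (SOME r. r \<in> V \<and> r \<in> cls g v \<and> leader g r \<and> spars g r \<le> spars g v) else v)"
  have r: "dense g v \<Longrightarrow> r \<in> V \<and> r \<in> cls g v \<and> leader g r \<and> spars g r \<le> spars g v"
  proof -
    assume d: "dense g v"
    obtain r0 where "r0 \<in> V" "r0 \<in> cls g v" "leader g r0" "spars g r0 \<le> spars g v"
      using leader_ex[OF v dg_pos d big] .
    then have "\<exists>r. r \<in> V \<and> r \<in> cls g v \<and> leader g r \<and> spars g r \<le> spars g v" by blast
    from someI_ex[OF this] show ?thesis using d by (simp add: r_def)
  qed
  have rV: "r \<in> V" using r v by (cases "dense g v") (auto simp: r_def)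
  let ?A = "insert r (insert v (nb g v))"
  let ?E1 = "\<lambda>w. \<exists>y\<in>?A. 8 * actn w y > dg g"
  let ?E2 = "\<lambda>w. L / 2 ^ 35 \<le> W \<and> quiet w v \<and> real (gain w v) \<le> W"
  let ?E3 = "\<lambda>w. dense g v \<and> 8 * actn w r \<le> dg g \<and> 200 * (real (spars g r) / real (dg g)) + 2 * L \<le> real (fails w r)"
  let ?E4 = "\<lambda>w. dense g v \<and> real (spars g v) \<le> real (dg g) * L \<and> quiet w v \<and> real (card {u \<in> nb g v. ps g w u}) < L\<^sup>2 / 32"
  have 1: "?P (\<lambda>w. prebad g w v) \<le> ?P ?E1 + ?P (\<lambda>w. ?E2 w \<or> ?E3 w \<or> ?E4 w)"
  proof (rule prb_disj)
    fix w assume pb: "prebad g w v"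
    show "?E1 w \<or> (?E2 w \<or> ?E3 w \<or> ?E4 w)"
    proof (rule ccontr)
      assume n: "\<not> (?E1 w \<or> (?E2 w \<or> ?E3 w \<or> ?E4 w))"
      then have q: "quiet w v" by (auto simp: quiet_def linorder_not_less)
      have "\<not> prebad g w v"
        by (rule prebad_cases[OF v H L4 L200 _ q]) (use r n q in \<open>auto simp: W_def linorder_not_less linorder_not_le\<close>)
      then show False using pb by simp
    qed
  qed
  have 2: "?P (\<lambda>w. ?E2 w \<or> ?E3 w \<or> ?E4 w) \<le> ?P ?E2 + ?P (\<lambda>w. ?E3 w \<or> ?E4 w)"
    by (rule prb_disj) auto
  have 3: "?P (\<lambda>w. ?E3 w \<or> ?E4 w) \<le> ?P ?E3 + ?P ?E4" by (rule prb_disj) auto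
  have e1: "?P ?E1 \<le> (real (dg g) + 2) * exp (- real (dg g) / 16)"
  proof -
    have AV: "?A \<subseteq> V" "finite ?A" using v rV by auto
    have "?P ?E1 \<le> (\<Sum>y\<in>?A. ?P (\<lambda>w. 8 * actn w y > dg g))"
      using AV by (intro prb_union_bound) auto
    also have "\<dots> \<le> (\<Sum>y\<in>?A. exp (- real (dg g) / 16))"
    proof (rule sum_mono)
      fix y assume "y \<in> ?A"
      then have y: "y \<in> V" using AV by auto
      have "dep (\<lambda>w. of_bool (8 * actn w y > dg g) :: real) J0"
        unfolding dep_def
      proof (intro allI impI)
        fix s t :: seeds assume "\<forall>i\<in>J0. s i = t i"
        from trial_dep(2)[OF y this] show "(of_bool (8 * actn s y > dg g) :: real) = of_bool (8 * actn t y > dg g)" by simp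
      qed
      then have "?P (\<lambda>w. 8 * actn w y > dg g) = prb (2 ^ b) J0 (\<lambda>w. 8 * actn w y > dg g)"
        using finJ J0 by (intro avg_marginal) auto
      then show "?P (\<lambda>w. 8 * actn w y > dg g) \<le> exp (- real (dg g) / 16)" using actn_tail[OF y] by simp
    qed
    also have "\<dots> = real (card ?A) * exp (- real (dg g) / 16)" by simp
    also have "\<dots> \<le> (real (dg g) + 2) * exp (- real (dg g) / 16)"
    proof (rule mult_right_mono)
      have "card ?A \<le> Suc (Suc (card (nb g v)))" using v by (simp add: card_insert_if)
      then show "real (card ?A) \<le> real (dg g) + 2" using nb_deg[OF v] by linarith
    qed auto
    finally show ?thesis .
  qed
  have e2: "?P ?E2 \<le> 5 * exp (- (L / 2 ^ 35))"
  proof (cases "L / 2 ^ 35 \<le> W")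
    case True
    have "dep (\<lambda>w. of_bool (quiet w v \<and> real (gain w v) \<le> W) :: real) J0"
      unfolding dep_def
    proof (intro allI impI)
      fix s t :: seeds assume st: "\<forall>i\<in>J0. s i = t i"
      from trial_dep(3)[OF v st] trial_dep(4)[OF v st]
      show "(of_bool (quiet s v \<and> real (gain s v) \<le> W) :: real) = of_bool (quiet t v \<and> real (gain t v) \<le> W)" by simp
    qed
    then have "?P (\<lambda>w. quiet w v \<and> real (gain w v) \<le> W) = prb (2 ^ b) J0 (\<lambda>w. quiet w v \<and> real (gain w v) \<le> W)"
      using finJ J0 by (intro avg_marginal) auto
    also have "\<dots> \<le> 5 * exp (- W)" unfolding W_def by (rule gain_tail[OF v])
    also have "\<dots> \<le> 5 * exp (- (L / 2 ^ 35))" using True by simp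
    finally show ?thesis using True by simp
  next
    case False
    then show ?thesis using finJ by (simp add: avg_const)
  qed
  have e3: "?P ?E3 \<le> 2 * exp (11 - L)"
  proof (cases "dense g v")
    case True
    have "?P (\<lambda>w. 8 * actn w r \<le> dg g \<and> 200 * (real (spars g r) / real (dg g)) + 2 * L \<le> real (fails w r)) \<le> 2 * exp (11 - L)"
      using r[OF True] C D B L200 by (intro fails_tail) auto
    then show ?thesis using True by simp
  next
    case False
    then show ?thesis using finJ by (simp add: avg_const)
  qed
  have e4: "?P ?E4 \<le> exp (- (L\<^sup>2 / 32)) + exp (- (L\<^sup>2 / 4 - 52 * L))"
  proof (cases "dense g v \<and> real (spars g v) \<le> real (dg g) * L")
    case True
    have "?P (\<lambda>w. quiet w v \<and> real (card {u \<in> nb g v. ps g w u}) < L\<^sup>2 / 32) \<le> exp (- (L\<^sup>2 / 32)) + exp (- (L\<^sup>2 / 4 - 52 * L))"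
      using True r C L4 L200 v by (intro aside_tail[of v r]) auto
    then show ?thesis using True by simp
  next
    case False
    then have "?P ?E4 = ?P (\<lambda>w. False)" by (intro avg_cong) auto
    then show ?thesis using finJ by (simp add: avg_const add_nonneg_nonneg)
  qed
  show ?thesis unfolding perr_def Let_def L_def[symmetric] using 1 2 3 e1 e2 e3 e4 by linarith
qed

end

section \<open>The rounds of the third stage\<close>

lemma avg_empty: "avg B {} h = h (\<lambda>_. undefined)"
  by (simp add: avg_def)

text \<open>The first two stages read the seeds 0, 1 and 2 only. Fixing these fixes activity and
  available colors for all rounds.\<close>

lemma pre_cong:
  assumes "\<And>u c. c < 3 \<Longrightarrow> w (u, c) = w' (u, c)"
  shows "col2 g w = col2 g w'" "ps g w = ps g w'" "av2 g w = av2 g w'" "unc g w = unc g w'"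
    "act g w = act g w'" "prebad g w = prebad g w'"
proof -
  have 0: "w (u, 0) = w' (u, 0)" "w (u, 1) = w' (u, 1)" "w (u, 2) = w' (u, 2)" for u using assms by simp_all
  have a: "att g w = att g w'" unfolding att_def[abs_def] 0 ..
  have c: "col1 g w = col1 g w'" unfolding col1_def[abs_def] a ..
  have v: "av1 g w = av1 g w'" unfolding av1_def[abs_def] c ..
  have s: "smp g w = smp g w'" unfolding smp_def[abs_def] 0 ..
  have d: "cand g w = cand g w'" unfolding cand_def[abs_def] a s ..
  have q: "qs g w = qs g w'" unfolding qs_def[abs_def] d ..
  show p: "ps g w = ps g w'" unfolding ps_def[abs_def] d q ..
  have m: "mem g w = mem g w'" unfolding mem_def[abs_def] c p ..
  have t: "sct g w = sct g w'" unfolding sct_def[abs_def] m v 0 ..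
  have g: "asg g w = asg g w'" unfolding asg_def[abs_def] m t ..
  show c2: "col2 g w = col2 g w'" unfolding col2_def[abs_def] c g v ..
  show a2: "av2 g w = av2 g w'" unfolding av2_def[abs_def] c2 ..
  show u: "unc g w = unc g w'" unfolding unc_def[abs_def] c2 p ..
  show x: "act g w = act g w'" unfolding act_def[abs_def] c2 p a2 u ..
  show "prebad g w = prebad g w'" unfolding prebad_def[abs_def] c2 p x ..
qed

lemma chi_cong:
  assumes "\<And>u c. c < 3 + i \<Longrightarrow> w (u, c) = w' (u, c)"
  shows "chi g w i = chi g w' i"
  using assms
proof (induction i)
  case (Suc i)
  have "act g w = act g w'" "av2 g w = av2 g w'" using Suc.prems by (intro pre_cong; simp)+
  then have "att3 g w i = att3 g w' i" using Suc.prems[of "3 + i"] by (simp add: att3_def[abs_def] fun_eq_iff)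
  moreover have "chi g w i = chi g w' i" using Suc by simp
  ultimately show ?case by (intro ext) (simp only: chi.simps)
qed (simp add: fun_eq_iff)

lemma att3_act: "att3 g w i u = Some y \<Longrightarrow> act g w u"
  by (auto simp: att3_def split: if_splits)

lemma chi_mono: "chi g w i u = Some y \<Longrightarrow> i \<le> j \<Longrightarrow> chi g w j u = Some y"
proof (induction j)
  case (Suc j)
  then show ?case by (cases "i = Suc j") auto
qed auto

section \<open>Properness for all seeds\<close>

context gph
begin

lemma av2_fin [simp]: "u \<in> V \<Longrightarrow> finite (av2 g w u)"
  by (simp add: av2_def)

lemma att3_av2: "u \<in> V \<Longrightarrow> att3 g w i u = Some y \<Longrightarrow> y \<in> av2 g w u"
  by (auto simp: att3_def split: if_splits intro: pick_in)

lemma chi_av2: "u \<in> V \<Longrightarrow> chi g w i u = Some y \<Longrightarrow> act g w u \<and> y \<in> av2 g w u"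
  by (induction i) (auto split: option.splits if_splits dest: att3_act att3_av2)

lemma chi_proper:
  assumes "u \<in> V" "z \<in> nb g u" "chi g w i u = Some y"
  shows "chi g w i z \<noteq> Some y"
  using assms
proof (induction i arbitrary: u z)
  case (Suc i)
  have zV: "z \<in> V" "u \<in> nb g z" using Suc.prems nb_sym[of u z] by auto
  show ?case
  proof (cases "chi g w i u")
    case (Some x)
    then have "chi g w i u = Some y" using Suc.prems by simp
    then show ?thesis using Suc.IH[OF Suc.prems(1,2)] zV
      by (auto split: option.splits if_splits)
  next
    case None
    then have u: "att3 g w i u = Some y" "\<forall>z\<in>nb g u. chi g w i z \<noteq> Some y \<and> att3 g w i z \<noteq> Some y"
      using Suc.prems by (auto split: option.splits if_splits)
    then show ?thesis using Suc.prems(2) by (auto split: option.splits if_splits)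
  qed
qed simp

lemma col2_pal: "u \<in> V \<Longrightarrow> col2 g w u = Some x \<Longrightarrow> x \<in> pal g u"
  by (auto simp: col2_def col1_def av1_def split: option.splits if_splits intro: att_pal)

lemma col2_proper:
  assumes u: "u \<in> V" "z \<in> nb g u" "col2 g w u = Some x"
  shows "col2 g w z \<noteq> Some x"
proof
  assume z: "col2 g w z = Some x"
  have zV: "z \<in> V" "u \<in> nb g z" "u \<noteq> z" using u nb_sym[of u z] nb_irr by auto
  have no: False if a: "a \<in> V" "b \<in> nb g a" "a \<in> nb g b" "col1 g w a = Some x" "col2 g w b = Some x" "col1 g w b = None" for a b
    using that by (auto simp: col2_def av1_def split: option.splits if_splits)
  show False
  proof (cases "col1 g w u"; cases "col1 g w z")
    fix a c assume "col1 g w u = Some a" "col1 g w z = Some c"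
    then have "col1 g w u = Some x" "col1 g w z = Some x" using u z by (auto simp: col2_def)
    then have "att g w u = Some x" "att g w z = Some x" "\<not> z < u" "\<not> u < z"
      using u(2) zV by (auto simp: col1_def split: if_splits)
    then show False using zV by simp
  next
    fix a assume "col1 g w u = Some a" "col1 g w z = None"
    then show False using no[of u z] u z zV by (auto simp: col2_def)
  next
    fix a assume "col1 g w u = None" "col1 g w z = Some a"
    then show False using no[of z u] u z zV by (auto simp: col2_def)
  next
    assume "col1 g w u = None" "col1 g w z = None"
    then show False using u z zV by (auto simp: col2_def split: option.splits if_splits)
  qed
qed

lemma tot_pal: "u \<in> V \<Longrightarrow> tot g w T u = Some x \<Longrightarrow> x \<in> pal g u"
  using chi_av2[of u w T x] col2_pal[of u w x] by (auto simp: tot_def av2_def split: option.splits)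

lemma tot_proper:
  assumes u: "u \<in> V" "z \<in> nb g u" "tot g w T u = Some x"
  shows "tot g w T z \<noteq> Some x"
proof
  assume z: "tot g w T z = Some x"
  have zV: "z \<in> V" "u \<in> nb g z" using u nb_sym[of u z] by auto
  have no: False if "a \<in> V" "b \<in> V" "a \<in> nb g b" "col2 g w a = Some x" "chi g w T b = Some x" for a b
    using chi_av2[OF that(2,5)] that by (auto simp: av2_def)
  show False
    using u z zV col2_proper[of u z w x] chi_proper[of u z w T x] no[of u z] no[of z u]
    by (auto simp: tot_def split: option.splits)
qed

text \<open>The neighbors hold at most \<open>dg g\<close> of the \<open>dg g + 1\<close> palette
  colors, so the \<open>LEAST\<close> in \<open>final\<close> is attained.\<close>

lemma final_None:
  assumes u: "u \<in> V" "tot g w T u = None"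
  shows "final g w T u \<in> pal g u" "\<And>z. z \<in> nb g u \<Longrightarrow> tot g w T z \<noteq> Some (final g w T u)"
    "\<And>z. z \<in> nb g u \<Longrightarrow> z < u \<Longrightarrow> tot g w T z = None \<Longrightarrow> final g w T z \<noteq> final g w T u"
proof -
  let ?P = "\<lambda>x. x \<in> pal g u \<and> (\<forall>z\<in>nb g u. tot g w T z \<noteq> Some x) \<and>
        x \<notin> (\<lambda>z. final g w T z) ` {z \<in> nb g u. z < u \<and> tot g w T z = None}"
  let ?U = "(\<lambda>z. case tot g w T z of Some x \<Rightarrow> x | None \<Rightarrow> final g w T z) ` nb g u"
  have "card ?U \<le> card (nb g u)" using u by (intro card_image_le) simp
  then have "card ?U < card (pal g u)" using nb_deg[OF u(1)] pal_card[OF u(1)] by simp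
  then have "\<not> pal g u \<subseteq> ?U" using u card_mono[of ?U "pal g u"] by fastforce
  then obtain x where x: "x \<in> pal g u" "x \<notin> ?U" by blast
  have "?P x"
  proof (intro conjI ballI notI)
    fix z assume "z \<in> nb g u" "tot g w T z = Some x"
    then have "x \<in> ?U" by (intro rev_image_eqI[of z]) auto
    then show False using x by simp
  next
    assume "x \<in> (\<lambda>z. final g w T z) ` {z \<in> nb g u. z < u \<and> tot g w T z = None}"
    then obtain z where "z \<in> nb g u" "tot g w T z = None" "x = final g w T z" by auto
    then have "x \<in> ?U" by (intro rev_image_eqI[of z]) auto
    then show False using x by simp
  qed (rule x)
  then have "?P (LEAST x. ?P x)" by (rule LeastI)
  moreover have "final g w T u = (LEAST x. ?P x)" using u by (subst final.simps) simp
  ultimately have P: "?P (final g w T u)" by simp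
  show "final g w T u \<in> pal g u" using P by blast
  show "tot g w T z \<noteq> Some (final g w T u)" if "z \<in> nb g u" for z using P that by blast
  show "final g w T z \<noteq> final g w T u" if z: "z \<in> nb g u" "z < u" "tot g w T z = None" for z
  proof
    assume "final g w T z = final g w T u"
    then have "final g w T u \<in> (\<lambda>z. final g w T z) ` {z \<in> nb g u. z < u \<and> tot g w T z = None}"
      using z by (intro rev_image_eqI[of z]) auto
    then show False using P by blast
  qed
qed

lemma final_Some: "tot g w T u = Some x \<Longrightarrow> final g w T u = x"
  by (subst final.simps) simp

lemma final_pal: "u \<in> V \<Longrightarrow> final g w T u \<in> pal g u"
  using final_None(1)[of u w T] tot_pal[of u w T] by (cases "tot g w T u") (auto simp: final_Some)

text \<open>Of two adjacent left-over vertices the one with the larger ID avoids the other, and a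
  left-over vertex avoids all colored neighbors. No event of small probability has to be
  excluded.\<close>

lemma final_proper:
  assumes u: "u \<in> V" "z \<in> nb g u"
  shows "final g w T u \<noteq> final g w T z"
proof -
  have zV: "z \<in> V" "u \<in> nb g z" "u \<noteq> z" using u nb_sym[of u z] nb_irr by auto
  show ?thesis
  proof (cases "tot g w T u"; cases "tot g w T z")
    fix x y assume "tot g w T u = Some x" "tot g w T z = Some y"
    then show ?thesis using tot_proper[of u z w T x] u by (auto simp: final_Some)
  next
    fix x assume "tot g w T u = Some x" "tot g w T z = None"
    then show ?thesis using final_None(2)[of z w T u] zV by (auto simp: final_Some)
  next
    fix x assume "tot g w T u = None" "tot g w T z = Some x"
    then show ?thesis using final_None(2)[of u w T z] u by (auto simp: final_Some)
  next
    assume n: "tot g w T u = None" "tot g w T z = None"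
    show ?thesis
    proof (cases "z < u")
      case True
      then show ?thesis using final_None(3)[of u w T z] u n by auto
    next
      case False
      then show ?thesis using final_None(3)[of z w T u] zV n by auto
    qed
  qed
qed

end

section \<open>Success probability of a round\<close>

locale gph_rounds = gph +
  fixes b :: nat
  assumes hh_pos: "1 \<le> hh g" and b_kk: "4 * hh g * (dg g + 1) \<le> b"
begin

abbreviation pp :: "seeds \<Rightarrow> nat \<Rightarrow> nat" where "pp w u \<equiv> card (av2 g w u)"

definition \<tau>3 :: "seeds \<Rightarrow> nat \<Rightarrow> real" where "\<tau>3 w u = 1 / 2 ^ kk (2 * hh g * pp w u)"

lemma pp_le: "u \<in> V \<Longrightarrow> pp w u \<le> dg g + 1"
  using card_mono[of "pal g u" "av2 g w u"] pal_card[of u] by (auto simp: av2_def)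

lemma pp_kk: "u \<in> V \<Longrightarrow> kk (2 * hh g * pp w u) \<le> b"
proof -
  assume "u \<in> V"
  then have "2 * hh g * pp w u \<le> 2 * hh g * (dg g + 1)" using pp_le by (intro mult_le_mono) auto
  then show ?thesis using kk_le[of "2 * hh g * pp w u"] b_kk by linarith
qed

lemma \<tau>3_bounds:
  assumes "u \<in> V" "act g w u"
  shows "\<tau>3 w u * real (pp w u) \<le> 1 / (2 * real (hh g))" "1 / (4 * real (hh g)) \<le> \<tau>3 w u * real (pp w u)"
    "0 < \<tau>3 w u" "real (pp w u) \<ge> 1" "\<tau>3 w u * (real (pp w u) + 1) \<le> 1"
proof -
  have p: "0 < pp w u" using assms by (simp add: act_def)
  have H: "0 < real (hh g)" using hh_pos by simp
  have pos: "0 < 2 * hh g * pp w u" using p hh_pos by simp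
  have "real (2 * hh g * pp w u) \<le> real (2 ^ kk (2 * hh g * pp w u))" by (intro of_nat_mono kk_ge)
  then have 1: "2 * real (hh g) * real (pp w u) \<le> 2 ^ kk (2 * hh g * pp w u)" by simp
  have "real (2 ^ kk (2 * hh g * pp w u)) \<le> real (2 * (2 * hh g * pp w u))"
    using kk_less[OF pos] by (intro of_nat_mono less_imp_le)
  then have 2: "2 ^ kk (2 * hh g * pp w u) \<le> 4 * real (hh g) * real (pp w u)" by simp
  show t1: "\<tau>3 w u * real (pp w u) \<le> 1 / (2 * real (hh g))"
    using 1 H by (simp add: \<tau>3_def field_simps)
  show "1 / (4 * real (hh g)) \<le> \<tau>3 w u * real (pp w u)"
    using 2 H by (simp add: \<tau>3_def field_simps)
  show "0 < \<tau>3 w u" by (simp add: \<tau>3_def)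
  then have "\<tau>3 w u * 1 \<le> \<tau>3 w u * real (pp w u)" using p by (intro mult_left_mono) auto
  moreover have "1 / (2 * real (hh g)) \<le> 1 / 2" using hh_pos by (simp add: field_simps)
  ultimately show "\<tau>3 w u * (real (pp w u) + 1) \<le> 1" using t1 by (simp add: distrib_left)
  show "real (pp w u) \<ge> 1" using p by simp
qed

lemma att3_sum:
  fixes F :: "nat option \<Rightarrow> real"
  assumes "u \<in> V" "act g w u"
    and "\<And>x. act g (f x) u" "\<And>x. av2 g (f x) u = av2 g w u" "\<And>x. f x (u, 3 + i) = x"
  shows "(\<Sum>x<2 ^ b. F (att3 g (f x) i u)) / 2 ^ b =
    \<tau>3 w u * (\<Sum>c\<in>av2 g w u. F (Some c)) + (1 - \<tau>3 w u * real (pp w u)) * F None"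
proof -
  let ?k = "kk (2 * hh g * pp w u)"
  have "pp w u \<le> 2 * hh g * pp w u" using hh_pos by simp
  then have "card (av2 g w u) \<le> 2 ^ ?k" using kk_ge order_trans by blast
  from sum_pick[OF av2_fin[OF assms(1)] this pp_kk[OF assms(1)], of F]
  have "(\<Sum>x<2 ^ b. F (att3 g (f x) i u)) / 2 ^ b =
    ((\<Sum>c\<in>av2 g w u. F (Some c)) + (2 ^ ?k - real (pp w u)) * F None) / 2 ^ ?k"
    by (simp add: att3_def assms(3-5))
  then show ?thesis by (simp add: \<tau>3_def field_simps)
qed

abbreviation Ji :: "nat \<Rightarrow> (nat \<times> nat) set" where "Ji i \<equiv> V \<times> {3 + i}"

lemma ov_act:
  "act g (override_on w t (Ji i)) = act g w" "av2 g (override_on w t (Ji i)) = av2 g w"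
  "chi g (override_on w t (Ji i)) i = chi g w i"
  by (intro pre_cong chi_cong; auto simp: override_on_def)+

lemma att3_dep: "dep (\<lambda>t. F (att3 g (override_on w t (Ji i)) i u)) {(u, 3 + i)}"
  unfolding dep_def att3_def ov_act by (auto simp: override_on_def)

lemma att3_avg:
  fixes F :: "nat option \<Rightarrow> real"
  assumes "u \<in> V" "act g w u"
  shows "avg (2 ^ b) (Ji i) (\<lambda>t. F (att3 g (override_on w t (Ji i)) i u)) =
    \<tau>3 w u * (\<Sum>c\<in>av2 g w u. F (Some c)) + (1 - \<tau>3 w u * real (pp w u)) * F None"
proof -
  have fin: "finite (Ji i)" using finV by simp
  have "avg (2 ^ b) (Ji i) (\<lambda>t. F (att3 g (override_on w t (Ji i)) i u)) =
    avg (2 ^ b) (insert (u, 3 + i) {}) (\<lambda>t. F (att3 g (override_on w t (Ji i)) i u))"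
    using fin assms by (intro avg_marginal att3_dep) auto
  also have "\<dots> = (\<Sum>x<2 ^ b. F (att3 g (override_on w ((\<lambda>_. undefined)((u, 3 + i) := x)) (Ji i)) i u)) / 2 ^ b"
    by (subst avg_insert) (simp_all add: avg_empty)
  also have "\<dots> = \<tau>3 w u * (\<Sum>c\<in>av2 g w u. F (Some c)) + (1 - \<tau>3 w u * real (pp w u)) * F None"
    by (intro att3_sum assms) (simp_all add: ov_act assms)
  finally show ?thesis .
qed

lemma att3_prob:
  assumes "u \<in> V" "act g w u"
  shows "avg (2 ^ b) (Ji i) (\<lambda>t. of_bool (att3 g (override_on w t (Ji i)) i u = Some y)) = \<tau>3 w u * of_bool (y \<in> av2 g w u)"
  unfolding att3_avg[OF assms, where F = "\<lambda>a. of_bool (a = Some y)"]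
  using assms by (simp add: of_bool_def)

text \<open>A Bonferroni bound over the free colors: the chance that \<open>v\<close> tries one,
  minus the chance that an active neighbor tries it too. At least pp / H colors are free, and the
  competition costs at most pp / (2 H) of them. The remaining pp / (2 H) colors are tried with
  probability \<tau>3 each, and \<tau>3 pp is at least 1 / (4 H).\<close>

lemma round_success:
  assumes v: "v \<in> V" "act g w v" "chi g w i v = None"
  shows "prb (2 ^ b) (Ji i) (\<lambda>t. chi g (override_on w t (Ji i)) (Suc i) v = None) \<le> 1 - 1 / (8 * (real (hh g))\<^sup>2)"
proof -
  let ?w = "\<lambda>t. override_on w t (Ji i)"
  let ?H = "real (hh g)"
  have H: "1 \<le> ?H" using hh_pos by simp
  have fin: "finite (Ji i)" using finV by simp
  define free where "free = {y \<in> av2 g w v. \<forall>z\<in>nb g v. chi g w i z \<noteq> Some y}"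
  define N where "N = {z \<in> nb g v. act g w z}"
  have freefin: "finite free" using v by (simp add: free_def)
  have Nfin: "finite N" using v by (simp add: N_def)
  have Nunc: "N \<subseteq> unc g w v" by (auto simp: N_def unc_def act_def)
  have uncfin: "finite (unc g w v)" using v by (simp add: unc_def)
  let ?A = "\<lambda>t y. of_bool (att3 g (?w t) i v = Some y) :: real"
  let ?B = "\<lambda>t z y. of_bool (att3 g (?w t) i z = Some y) :: real"
  have pw: "of_bool (chi g (?w t) (Suc i) v = None) \<le> 1 - ((\<Sum>y\<in>free. ?A t y) - (\<Sum>y\<in>free. \<Sum>z\<in>N. ?A t y * ?B t z y))" for t
  proof (cases "att3 g (?w t) i v")
    case None
    then show ?thesis by simp
  next
    case (Some y)
    have A: "(\<Sum>y'\<in>free. ?A t y' * f y') = of_bool (y \<in> free) * f y" for f :: "nat \<Rightarrow> real"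
    proof -
      have "(\<Sum>y'\<in>free. ?A t y' * f y') = (\<Sum>y'\<in>free. if y = y' then f y' else 0)"
        by (intro sum.cong) (auto simp: Some)
      then show ?thesis using freefin by simp
    qed
    have S: "(\<Sum>y\<in>free. ?A t y) - (\<Sum>y\<in>free. \<Sum>z\<in>N. ?A t y * ?B t z y) = of_bool (y \<in> free) * (1 - (\<Sum>z\<in>N. ?B t z y))"
      using A[of "\<lambda>_. 1"] A[of "\<lambda>y. \<Sum>z\<in>N. ?B t z y"] by (simp add: sum_distrib_left right_diff_distrib)
    have nn: "0 \<le> (\<Sum>z\<in>N. ?B t z y)" by (intro sum_nonneg) auto
    show ?thesis
    proof (cases "chi g (?w t) (Suc i) v = None")
      case True
      show ?thesis
      proof (cases "y \<in> free")
        case yf: True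
        have "\<exists>z\<in>nb g v. chi g w i z = Some y \<or> att3 g (?w t) i z = Some y"
          using True Some v(3) by (auto simp: ov_act split: if_splits)
        then obtain z where z: "z \<in> nb g v" "att3 g (?w t) i z = Some y" using yf by (auto simp: free_def)
        then have "z \<in> N" using att3_act[of g "?w t" i z y] by (auto simp: N_def ov_act)
        then have "?B t z y \<le> (\<Sum>z\<in>N. ?B t z y)" using Nfin by (intro member_le_sum) auto
        then show ?thesis using z True yf unfolding S by simp
      qed (use S in simp)
    next
      case False
      then show ?thesis unfolding S using nn by (cases "y \<in> free") auto
    qed
  qed
  have prod: "avg (2 ^ b) (Ji i) (\<lambda>t. ?A t y * ?B t z y) = (\<tau>3 w v * of_bool (y \<in> av2 g w v)) * (\<tau>3 w z * of_bool (y \<in> av2 g w z))"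
    if "z \<in> N" for z y
  proof -
    have z: "z \<in> V" "z \<noteq> v" "act g w z" using that v nb_irr by (auto simp: N_def)
    have "avg (2 ^ b) (Ji i) (\<lambda>t. ?A t y * ?B t z y) = avg (2 ^ b) (Ji i) (\<lambda>t. ?A t y) * avg (2 ^ b) (Ji i) (\<lambda>t. ?B t z y)"
      using fin v z by (intro avg_indep2[where A = "{(v, 3 + i)}" and C = "{(z, 3 + i)}"]
        att3_dep[where F = "\<lambda>a. of_bool (a = Some y)"]) auto
    then show ?thesis using att3_prob v z by simp
  qed
  have "prb (2 ^ b) (Ji i) (\<lambda>t. chi g (?w t) (Suc i) v = None) \<le>
    avg (2 ^ b) (Ji i) (\<lambda>t. 1 - ((\<Sum>y\<in>free. ?A t y) - (\<Sum>y\<in>free. \<Sum>z\<in>N. ?A t y * ?B t z y)))"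
    using pw by (intro avg_mono)
  also have "\<dots> = avg (2 ^ b) (Ji i) (\<lambda>t. 1 + ((- 1) * (\<Sum>y\<in>free. ?A t y) + (\<Sum>y\<in>free. \<Sum>z\<in>N. ?A t y * ?B t z y)))"
    by (intro avg_cong) simp
  also have "\<dots> = 1 + ((- 1) * (\<Sum>y\<in>free. avg (2 ^ b) (Ji i) (\<lambda>t. ?A t y)) +
      (\<Sum>y\<in>free. \<Sum>z\<in>N. avg (2 ^ b) (Ji i) (\<lambda>t. ?A t y * ?B t z y)))"
    using fin by (simp only: avg_add avg_cmult avg_sum avg_const zero_less_power zero_less_numeral)
  also have "(\<Sum>y\<in>free. avg (2 ^ b) (Ji i) (\<lambda>t. ?A t y)) = \<tau>3 w v * real (card free)"
    using att3_prob[OF v(1,2)] by (simp add: free_def sum_distrib_left[symmetric])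
  also have "(\<Sum>y\<in>free. \<Sum>z\<in>N. avg (2 ^ b) (Ji i) (\<lambda>t. ?A t y * ?B t z y)) \<le> \<tau>3 w v * (real (card N) * (1 / (2 * ?H)))"
  proof -
    have "(\<Sum>y\<in>free. \<Sum>z\<in>N. avg (2 ^ b) (Ji i) (\<lambda>t. ?A t y * ?B t z y)) =
      (\<Sum>y\<in>free. \<Sum>z\<in>N. \<tau>3 w v * (\<tau>3 w z * of_bool (y \<in> av2 g w z)))"
      by (intro sum.cong refl) (simp add: prod free_def)
    also have "\<dots> = \<tau>3 w v * (\<Sum>z\<in>N. \<tau>3 w z * (\<Sum>y\<in>free. of_bool (y \<in> av2 g w z)))"
      by (subst sum.swap) (simp only: sum_distrib_left)
    also have "\<dots> \<le> \<tau>3 w v * (\<Sum>z\<in>N. 1 / (2 * ?H))"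
    proof (intro mult_left_mono sum_mono)
      fix z assume "z \<in> N"
      then have z: "z \<in> V" "act g w z" using v by (auto simp: N_def)
      have "card {y \<in> free. y \<in> av2 g w z} \<le> pp w z" using z by (intro card_mono) auto
      then have "\<tau>3 w z * (\<Sum>y\<in>free. of_bool (y \<in> av2 g w z)) \<le> \<tau>3 w z * real (pp w z)"
        unfolding card_filter_sum[OF freefin] using \<tau>3_bounds(3)[OF z] by (intro mult_left_mono) auto
      then show "\<tau>3 w z * (\<Sum>y\<in>free. of_bool (y \<in> av2 g w z)) \<le> 1 / (2 * ?H)" using \<tau>3_bounds(1)[OF z] by linarith
    qed (use \<tau>3_bounds(3)[OF v(1,2)] in simp)
    finally show ?thesis by simp
  qed
  finally have 1: "prb (2 ^ b) (Ji i) (\<lambda>t. chi g (?w t) (Suc i) v = None) \<le>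
    1 - \<tau>3 w v * (real (card free) - real (card N) / (2 * ?H))" by (simp add: algebra_simps)
  have "pp w v \<le> hh g * (pp w v - card (unc g w v))" "0 < pp w v" using v(2) by (auto simp: act_def)
  then have pos: "card (unc g w v) < pp w v" by (metis diff_is_0_eq' le_zero_eq linorder_not_less mult_0_right)
  have "real (pp w v) \<le> real (hh g * (pp w v - card (unc g w v)))" using v(2) by (intro of_nat_mono) (simp add: act_def)
  then have pH: "real (pp w v) / ?H \<le> real (pp w v) - real (card (unc g w v))" using pos H by (simp add: field_simps of_nat_diff)
  have Nu: "card N \<le> card (unc g w v)" using Nunc uncfin by (rule card_mono[rotated])
  have "av2 g w v - (\<lambda>z. the (chi g w i z)) ` N \<subseteq> free"
  proof
    fix y assume y: "y \<in> av2 g w v - (\<lambda>z. the (chi g w i z)) ` N"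
    have "chi g w i z \<noteq> Some y" if z: "z \<in> nb g v" for z
    proof
      assume c: "chi g w i z = Some y"
      then have "act g w z" using chi_av2 z v(1) nb_in by blast
      then show False using y c z by (force simp: N_def intro: rev_image_eqI)
    qed
    then show "y \<in> free" using y by (simp add: free_def)
  qed
  then have "card (av2 g w v - (\<lambda>z. the (chi g w i z)) ` N) \<le> card free" using freefin by (intro card_mono)
  moreover have "pp w v - card ((\<lambda>z. the (chi g w i z)) ` N) \<le> card (av2 g w v - (\<lambda>z. the (chi g w i z)) ` N)"
    using Nfin by (intro diff_card_le_card_Diff) auto
  moreover have "card ((\<lambda>z. the (chi g w i z)) ` N) \<le> card N" using Nfin by (rule card_image_le)
  ultimately have "real (pp w v) - real (card (unc g w v)) \<le> real (card free)" using Nu by linarith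
  moreover have "real (card N) / (2 * ?H) \<le> real (pp w v) / (2 * ?H)"
    using Nu pos H by (intro divide_right_mono) auto
  moreover have "real (pp w v) / ?H = real (pp w v) / (2 * ?H) + real (pp w v) / (2 * ?H)" by simp
  ultimately have "real (pp w v) / (2 * ?H) \<le> real (card free) - real (card N) / (2 * ?H)" using pH by linarith
  then have "\<tau>3 w v * (real (pp w v) / (2 * ?H)) \<le> \<tau>3 w v * (real (card free) - real (card N) / (2 * ?H))"
    using \<tau>3_bounds(3)[OF v(1,2)] by (intro mult_left_mono) auto
  moreover have "1 / (4 * ?H) * (1 / (2 * ?H)) \<le> \<tau>3 w v * real (pp w v) * (1 / (2 * ?H))"
    using \<tau>3_bounds(2)[OF v(1,2)] H by (intro mult_right_mono) auto
  moreover have "1 / (4 * ?H) * (1 / (2 * ?H)) = 1 / (8 * ?H\<^sup>2)" by (simp add: power2_eq_square)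
  ultimately show ?thesis using 1 by simp
qed

text \<open>Given the previous rounds, a round at \<open>v\<close> only depends on the attempts in
  the closed neighborhood of \<open>v\<close>; these neighborhoods are disjoint within
  \<open>S\<close>. The event \<open>A\<close> is carried along because \<open>separated_bad\<close>
  combines failures in the rounds with failures of the first two stages at other vertices.\<close>

lemma rounds_fail:
  assumes S: "finite S" "S \<subseteq> V"
    and disj: "\<And>v z. v \<in> S \<Longrightarrow> z \<in> S \<Longrightarrow> v \<noteq> z \<Longrightarrow> insert v (nb g v) \<inter> insert z (nb g z) = {}"
    and A: "\<And>w w'. (\<And>u c. c < 3 \<Longrightarrow> w (u, c) = w' (u, c)) \<Longrightarrow> A w = A w'"
  shows "prb (2 ^ b) (V \<times> {..<3 + T}) (\<lambda>w. A w \<and> (\<forall>v\<in>S. act g w v \<and> chi g w T v = None))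
    \<le> (1 - 1 / (8 * (real (hh g))\<^sup>2)) ^ (T * card S) * prb (2 ^ b) (V \<times> {..<3}) A"
proof (induction T)
  case 0
  have "prb (2 ^ b) (V \<times> {..<3}) (\<lambda>w. A w \<and> (\<forall>v\<in>S. act g w v \<and> chi g w 0 v = None)) \<le> prb (2 ^ b) (V \<times> {..<3}) A"
    by (rule prb_mono) simp
  then show ?case by simp
next
  case (Suc i)
  let ?q = "1 - 1 / (8 * (real (hh g))\<^sup>2)"
  have q0: "0 \<le> ?q"
  proof -
    have "1 \<le> (real (hh g))\<^sup>2" using hh_pos by (simp add: one_le_power)
    then have "1 \<le> 8 * (real (hh g))\<^sup>2" by linarith
    then show ?thesis by (auto simp: divide_le_eq_1)
  qed
  have fin: "finite (Ji i)" using finV by simp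
  let ?w = "\<lambda>w t. override_on w t (Ji i)"
  have J: "V \<times> {..<3 + Suc i} = V \<times> {..<3 + i} \<union> Ji i" by auto
  have "prb (2 ^ b) (V \<times> {..<3 + Suc i}) (\<lambda>w. A w \<and> (\<forall>v\<in>S. act g w v \<and> chi g w (Suc i) v = None)) =
    avg (2 ^ b) (V \<times> {..<3 + i}) (\<lambda>w. prb (2 ^ b) (Ji i) (\<lambda>t. A (?w w t) \<and> (\<forall>v\<in>S. act g (?w w t) v \<and> chi g (?w w t) (Suc i) v = None)))"
    unfolding J using finV by (intro avg_union) auto
  also have "\<dots> \<le> avg (2 ^ b) (V \<times> {..<3 + i}) (\<lambda>w. ?q ^ card S * of_bool (A w \<and> (\<forall>v\<in>S. act g w v \<and> chi g w i v = None)))"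
  proof (rule avg_mono)
    fix w
    have Aw: "A (?w w t) = A w" for t by (rule A) (auto simp: override_on_def)
    show "prb (2 ^ b) (Ji i) (\<lambda>t. A (?w w t) \<and> (\<forall>v\<in>S. act g (?w w t) v \<and> chi g (?w w t) (Suc i) v = None))
      \<le> ?q ^ card S * of_bool (A w \<and> (\<forall>v\<in>S. act g w v \<and> chi g w i v = None))"
    proof (cases "A w \<and> (\<forall>v\<in>S. act g w v \<and> chi g w i v = None)")
      case True
      let ?f = "\<lambda>v t. of_bool (chi g (?w w t) (Suc i) v = None) :: real"
      have "prb (2 ^ b) (Ji i) (\<lambda>t. A (?w w t) \<and> (\<forall>v\<in>S. act g (?w w t) v \<and> chi g (?w w t) (Suc i) v = None)) \<le>
        avg (2 ^ b) (Ji i) (\<lambda>t. \<Prod>v\<in>S. ?f v t)"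
      proof (rule avg_mono)
        fix t
        show "of_bool (A (?w w t) \<and> (\<forall>v\<in>S. act g (?w w t) v \<and> chi g (?w w t) (Suc i) v = None)) \<le> (\<Prod>v\<in>S. ?f v t)"
        proof (cases "\<forall>v\<in>S. chi g (?w w t) (Suc i) v = None")
          case True
          then have "(\<Prod>v\<in>S. ?f v t) = (\<Prod>v\<in>S. 1)" by (intro prod.cong) auto
          then show ?thesis by simp
        next
          case False
          then have "\<not> (A (?w w t) \<and> (\<forall>v\<in>S. act g (?w w t) v \<and> chi g (?w w t) (Suc i) v = None))" by blast
          then show ?thesis by (simp only: of_bool_eq(1) prod_nonneg of_bool_def if_False) (intro prod_nonneg, auto)
        qed
      qed
      also have "\<dots> = (\<Prod>v\<in>S. avg (2 ^ b) (Ji i) (?f v))"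
      proof (rule avg_indep[where K = "\<lambda>v. insert v (nb g v) \<times> {3 + i}"])
        fix v assume v: "v \<in> S"
        show "dep (?f v) (insert v (nb g v) \<times> {3 + i})"
          unfolding dep_def
        proof (intro allI impI)
          fix s t :: seeds assume st: "\<forall>j\<in>insert v (nb g v) \<times> {3 + i}. s j = t j"
          have "att3 g (?w w s) i z = att3 g (?w w t) i z" if "z \<in> insert v (nb g v)" for z
          proof -
            have "s (z, 3 + i) = t (z, 3 + i)" using st that by blast
            then show ?thesis unfolding att3_def ov_act by (simp add: override_on_def)
          qed
          then have "chi g (?w w s) (Suc i) v = chi g (?w w t) (Suc i) v"
            by (auto simp: ov_act split: option.splits)
          then show "?f v s = ?f v t" by simp
        qed
        show "insert v (nb g v) \<times> {3 + i} \<subseteq> Ji i" using v S by auto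
      qed (use fin S disj in auto)
      also have "\<dots> \<le> (\<Prod>v\<in>S. ?q)"
        using True S by (intro prod_mono conjI avg_nonneg round_success) auto
      finally show ?thesis using True by simp
    next
      case False
      have "\<not> (A (?w w t) \<and> (\<forall>v\<in>S. act g (?w w t) v \<and> chi g (?w w t) (Suc i) v = None))" for t
      proof
        assume a: "A (?w w t) \<and> (\<forall>v\<in>S. act g (?w w t) v \<and> chi g (?w w t) (Suc i) v = None)"
        have "chi g w i v = None" if v: "v \<in> S" for v
        proof (rule ccontr)
          assume "chi g w i v \<noteq> None"
          then obtain y where "chi g (?w w t) i v = Some y" by (auto simp: ov_act)
          then have "chi g (?w w t) (Suc i) v = Some y" by (rule chi_mono) simp
          then show False using a v by simp
        qed
        then show False using False a Aw by (simp add: ov_act)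
      qed
      then have e: "prb (2 ^ b) (Ji i) (\<lambda>t. A (?w w t) \<and> (\<forall>v\<in>S. act g (?w w t) v \<and> chi g (?w w t) (Suc i) v = None)) = prb (2 ^ b) (Ji i) (\<lambda>t. False)"
        by (intro avg_cong) (simp only:)
      have "prb (2 ^ b) (Ji i) (\<lambda>t. False) = 0" using fin by (simp add: avg_const)
      moreover have "0 \<le> ?q ^ card S * of_bool (A w \<and> (\<forall>v\<in>S. act g w v \<and> chi g w i v = None))"
        by (intro mult_nonneg_nonneg zero_le_power q0) simp
      ultimately show ?thesis unfolding e by linarith
    qed
  qed
  also have "\<dots> = ?q ^ card S * prb (2 ^ b) (V \<times> {..<3 + i}) (\<lambda>w. A w \<and> (\<forall>v\<in>S. act g w v \<and> chi g w i v = None))"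
    by (rule avg_cmult)
  also have "\<dots> \<le> ?q ^ card S * (?q ^ (i * card S) * prb (2 ^ b) (V \<times> {..<3}) A)"
    using Suc q0 by (intro mult_left_mono) auto
  finally show ?case by (simp add: power_add mult.assoc)
qed

end

section \<open>Dependencies between the rounds\<close>

text \<open>An item \<open>(v, None)\<close> asks for the color of \<open>v\<close>, an item \<open>(v, Some y)\<close> whether some
  neighbor of \<open>v\<close> has color \<open>y\<close>. Answering the items in \<open>Q\<close> after round \<open>i\<close> only requires
  answers to \<open>step g w i Q\<close> before it.\<close>

definition step :: "gr \<Rightarrow> seeds \<Rightarrow> nat \<Rightarrow> (nat \<times> nat option) set \<Rightarrow> (nat \<times> nat option) set" where
  "step g w i Q = Q \<union> {(u, Some y) | u y. (u, None) \<in> Q \<and> att3 g w i u = Some y} \<union>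
     {(u, a) | u a y v. (v, Some y) \<in> Q \<and> u \<in> nb g v \<and> att3 g w i u = Some y \<and> (a = None \<or> a = Some y)}"

text \<open>Unfolds backwards in time: the last round is treated with its own attempts, and the
  enlarged set is passed to the earlier rounds. Apart from the seeds of the first two stages, every
  level reads a seed that the levels below do not read.\<close>

primrec items :: "gr \<Rightarrow> seeds \<Rightarrow> nat \<Rightarrow> (nat \<times> nat option) set \<Rightarrow> (nat \<times> nat option) set" where
  "items g w 0 Q = Q"
| "items g w (Suc i) Q = items g w i (step g w i Q)"

definition held :: "gr \<Rightarrow> seeds \<Rightarrow> nat \<Rightarrow> nat \<Rightarrow> nat \<Rightarrow> bool" where
  "held g w i v y \<longleftrightarrow> (\<exists>z\<in>nb g v. chi g w i z = Some y)"

lemma step_mono: "Q \<subseteq> Q' \<Longrightarrow> step g w i Q \<subseteq> step g w i Q'"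
  unfolding step_def by blast

lemma step_ext: "Q \<subseteq> step g w i Q"
  unfolding step_def by blast

lemma items_mono: "Q \<subseteq> Q' \<Longrightarrow> items g w i Q \<subseteq> items g w i Q'"
  by (induction i arbitrary: Q Q') (auto dest: step_mono)

lemma items_ext: "Q \<subseteq> items g w i Q"
proof (induction i arbitrary: Q)
  case (Suc i)
  then show ?case using step_ext by (metis items.simps(2) subset_trans)
qed simp

lemma step_loc:
  assumes "\<And>x. x \<in> fst ` Q \<Longrightarrow> agr 10 g w g' w' x"
  shows "step g w i Q = step g' w' i Q"
proof -
  have a: "att3 g w i u = att3 g' w' i u" if "(u, a) \<in> Q" for u a
    using assms[of u] that agr_le[of 10 g w g' w' u 9] by (intro att3_loc) force
  have n: "nb g v = nb g' v" if "(v, a) \<in> Q" for v a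
    using assms[of v] that sameD(1)[of 10 g w g' w' v] by force
  have b: "att3 g w i u = att3 g' w' i u" if "(v, a) \<in> Q" "u \<in> nb g v" for u v a
  proof -
    have "agr (Suc 9) g w g' w' v" using assms[of v] that by (force simp: eval_nat_numeral)
    then have "agr 9 g w g' w' u" using that agr_nb by blast
    then show ?thesis by (rule att3_loc)
  qed
  have 1: "{(u, Some y) | u y. (u, None) \<in> Q \<and> att3 g w i u = Some y} = {(u, Some y) | u y. (u, None) \<in> Q \<and> att3 g' w' i u = Some y}"
    using a by force
  have "((v, Some y) \<in> Q \<and> u \<in> nb g v \<and> att3 g w i u = Some y) = ((v, Some y) \<in> Q \<and> u \<in> nb g' v \<and> att3 g' w' i u = Some y)" for u v y
    using b[of v "Some y" u] n[of v "Some y"] by auto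
  then have 2: "{(u, a) | u a y v. (v, Some y) \<in> Q \<and> u \<in> nb g v \<and> att3 g w i u = Some y \<and> (a = None \<or> a = Some y)} =
    {(u, a) | u a y v. (v, Some y) \<in> Q \<and> u \<in> nb g' v \<and> att3 g' w' i u = Some y \<and> (a = None \<or> a = Some y)}"
    by (simp only: conj_assoc[symmetric])
  show ?thesis unfolding step_def 1 2 ..
qed

lemma chi_Suc_iff:
  "chi g w (Suc i) v = Some y \<longleftrightarrow> chi g w i v = Some y \<or>
     chi g w i v = None \<and> att3 g w i v = Some y \<and> \<not> held g w i v y \<and> (\<forall>z\<in>nb g v. att3 g w i z \<noteq> Some y)"
  by (auto simp: held_def split: option.splits)

lemma held_Suc_iff:
  "held g w (Suc i) v y \<longleftrightarrow> held g w i v y \<or>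
     (\<exists>u\<in>nb g v. att3 g w i u = Some y \<and> chi g w i u = None \<and> \<not> held g w i u y \<and> (\<forall>z\<in>nb g u. att3 g w i z \<noteq> Some y))"
  unfolding held_def[of g w "Suc i"] chi_Suc_iff by (auto simp: held_def)

text \<open>Whether \<open>v\<close> gets a color in a round depends on its own attempt, on its
  previous color, and on whether a neighbor holds just the tried color. Whether a neighbor holds
  \<open>y\<close> only changes through neighbors that try \<open>y\<close>. \<open>step\<close>
  adds an item for each of these earlier questions, and attempts are local with radius 9.\<close>

lemma items_loc:
  assumes "\<And>x. x \<in> fst ` items g w t Q \<Longrightarrow> agr 10 g w g' w' x"
  shows "items g w t Q = items g' w' t Q \<and> (\<forall>v. (v, None) \<in> Q \<longrightarrow> chi g w t v = chi g' w' t v) \<and>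
    (\<forall>v y. (v, Some y) \<in> Q \<longrightarrow> held g w t v y = held g' w' t v y)"
  using assms
proof (induction t arbitrary: Q)
  case 0
  have "nb g v = nb g' v" if "(v, a) \<in> Q" for v a
    using 0[of v] that sameD(1)[of 10 g w g' w' v] by force
  then show ?case by (auto simp: held_def)
next
  case (Suc i)
  let ?Q = "step g w i Q"
  have sub: "Q \<subseteq> items g w (Suc i) Q" "?Q \<subseteq> items g w (Suc i) Q" using items_ext[of Q g w "Suc i"] items_ext[of ?Q] by auto
  have agQ: "agr 10 g w g' w' x" if "x \<in> fst ` ?Q" for x using Suc.prems that sub by blast
  have eq: "?Q = step g' w' i Q" using agQ step_ext by (intro step_loc) blast
  have IH: "items g w i ?Q = items g' w' i ?Q" "\<And>v. (v, None) \<in> ?Q \<Longrightarrow> chi g w i v = chi g' w' i v"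
    "\<And>v y. (v, Some y) \<in> ?Q \<Longrightarrow> held g w i v y = held g' w' i v y"
    using Suc.IH[of ?Q] Suc.prems by auto
  have ag: "agr 10 g w g' w' v" if "(v, a) \<in> ?Q" for v a using agQ that by force
  have nbe: "nb g v = nb g' v" if "(v, a) \<in> ?Q" for v a using sameD(1)[OF ag[OF that]] .
  have at: "att3 g w i u = att3 g' w' i u" if "(v, a) \<in> ?Q" "u \<in> insert v (nb g v)" for u v a
  proof -
    have "agr (Suc 9) g w g' w' v" using ag[OF that(1)] by (simp add: eval_nat_numeral)
    then have "agr 9 g w g' w' u" using that agr_nb by blast
    then show ?thesis by (rule att3_loc)
  qed
  have ball: "(\<forall>z\<in>nb g v. att3 g w i z \<noteq> Some y) = (\<forall>z\<in>nb g' v. att3 g' w' i z \<noteq> Some y)" if "(v, a) \<in> ?Q" for v a y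
    using nbe[OF that] at[OF that] by auto
  have chi: "chi g w (Suc i) v = chi g' w' (Suc i) v" if v: "(v, None) \<in> Q" for v
  proof -
    have vQ: "(v, None) \<in> ?Q" using v step_ext by blast
    have "(chi g w (Suc i) v = Some y) = (chi g' w' (Suc i) v = Some y)" for y
    proof (cases "att3 g w i v = Some y")
      case True
      then have "(v, Some y) \<in> ?Q" using v unfolding step_def by blast
      then show ?thesis unfolding chi_Suc_iff using IH(2)[OF vQ] IH(3) at[OF vQ] ball[OF vQ] by simp
    next
      case False
      then show ?thesis unfolding chi_Suc_iff using IH(2)[OF vQ] at[OF vQ, of v] by simp
    qed
    then show ?thesis by (metis not_None_eq)
  qed
  have held: "held g w (Suc i) v y = held g' w' (Suc i) v y" if v: "(v, Some y) \<in> Q" for v y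
  proof -
    have vQ: "(v, Some y) \<in> ?Q" using v step_ext by blast
    have "(u \<in> nb g v \<and> att3 g w i u = Some y \<and> chi g w i u = None \<and> \<not> held g w i u y \<and> (\<forall>z\<in>nb g u. att3 g w i z \<noteq> Some y)) =
      (u \<in> nb g' v \<and> att3 g' w' i u = Some y \<and> chi g' w' i u = None \<and> \<not> held g' w' i u y \<and> (\<forall>z\<in>nb g' u. att3 g' w' i z \<noteq> Some y))" for u
    proof (cases "u \<in> nb g v \<and> att3 g w i u = Some y")
      case True
      then have u: "(u, None) \<in> ?Q" "(u, Some y) \<in> ?Q" using v unfolding step_def by blast+
      show ?thesis
        unfolding ball[OF u(1)] IH(2)[OF u(1)] IH(3)[OF u(2)] using at[OF vQ, of u] nbe[OF vQ] True by simp
    next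
      case False
      then show ?thesis using at[OF vQ, of u] nbe[OF vQ] by auto
    qed
    then show ?thesis unfolding held_Suc_iff Bex_def IH(3)[OF vQ] by presburger
  qed
  show ?case using chi held IH(1) eq by auto
qed

lemma items_cong:
  assumes "\<And>u c. c < 3 + i \<Longrightarrow> w (u, c) = w' (u, c)"
  shows "items g w i Q = items g w' i Q"
  using assms
proof (induction i arbitrary: Q)
  case (Suc i)
  have "act g w = act g w'" "av2 g w = av2 g w'" using Suc.prems by (intro pre_cong; simp)+
  then have "att3 g w i = att3 g w' i" using Suc.prems[of "3 + i"] by (simp add: att3_def[abs_def] fun_eq_iff)
  then have "step g w i Q = step g w' i Q" by (simp add: step_def)
  then show ?case using Suc by simp
qed simp

section \<open>Exponential moment of the number of items\<close>

context gph_rounds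
begin

text \<open>Color items occur only at active vertices. Such a vertex has fewer active neighbors than
  available colors (\<open>unc_less\<close>), which bounds the expected number of vertices to look
  at next.\<close>

definition okq :: "seeds \<Rightarrow> (nat \<times> nat option) set \<Rightarrow> bool" where
  "okq w Q \<longleftrightarrow> finite Q \<and> fst ` Q \<subseteq> V \<and> (\<forall>v y. (v, Some y) \<in> Q \<longrightarrow> act g w v)"

text \<open>The weight of \<open>u\<close> cancels the probability \<open>\<tau>3 w u\<close>, of order \<open>1 / pp w u\<close>, that \<open>u\<close> tries
  a given color and has to be looked at.\<close>

definition wt :: "seeds \<Rightarrow> (nat \<times> nat option) set \<Rightarrow> real" where
  "wt w Q = (\<Sum>q\<in>Q. real (pp w (fst q)) + 1)"

lemma step_sub:
  assumes "fst ` Q \<subseteq> V"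
  shows "step g w i Q \<subseteq> Q \<union> (\<Union>u\<in>V. {(u, a) | a. a \<in> {None, att3 g w i u}})"
  using assms unfolding step_def by (force dest: nb_in)

lemma step_okq:
  assumes "okq w Q"
  shows "okq w (step g w i Q)"
proof -
  have f: "fst ` Q \<subseteq> V" "finite Q" using assms by (auto simp: okq_def)
  have "finite (step g w i Q)"
    using f finV by (intro finite_subset[OF step_sub[OF f(1)]]) auto
  moreover have "fst ` step g w i Q \<subseteq> V" using step_sub[OF f(1), of w i] f(1) by force
  moreover have "act g w v" if "(v, Some y) \<in> step g w i Q" for v y
    using that assms att3_act[of g w i v] unfolding step_def okq_def by fastforce
  ultimately show ?thesis by (auto simp: okq_def)
qed

lemma step_wt:
  assumes Q: "okq w Q"
  shows "wt w (step g w i Q) \<le> wt w Q + (\<Sum>u\<in>V. (real (pp w u) + 1) *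
    (case att3 g w i u of None \<Rightarrow> 0 | Some y \<Rightarrow> of_bool ((u, None) \<in> Q) + 2 * of_bool (\<exists>v. (v, Some y) \<in> Q \<and> u \<in> nb g v)))"
proof -
  have f: "fst ` Q \<subseteq> V" "finite Q" using Q by (auto simp: okq_def)
  define N where "N u = (case att3 g w i u of None \<Rightarrow> {} | Some y \<Rightarrow>
    (if (u, None) \<in> Q then {(u, Some y)} else {}) \<union> (if \<exists>v. (v, Some y) \<in> Q \<and> u \<in> nb g v then {(u, Some y), (u, None)} else {}))" for u
  have Nfin: "finite (N u)" for u by (auto simp: N_def split: option.splits)
  have "step g w i Q \<subseteq> Q \<union> (\<Union>u\<in>V. N u)"
  proof
    fix q assume q: "q \<in> step g w i Q"
    then consider "q \<in> Q" | u y where "q = (u, Some y)" "(u, None) \<in> Q" "att3 g w i u = Some y"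
      | u a y v where "q = (u, a)" "(v, Some y) \<in> Q" "u \<in> nb g v" "att3 g w i u = Some y" "a = None \<or> a = Some y"
      unfolding step_def by blast
    then show "q \<in> Q \<union> (\<Union>u\<in>V. N u)"
    proof cases
      case (2 u y)
      then have "u \<in> V" "q \<in> N u" using f by (force, simp add: N_def)
      then show ?thesis by blast
    next
      case (3 u a y v)
      then have "v \<in> V" using f by force
      then have "u \<in> V" using 3 by simp
      moreover have "q \<in> N u" using 3 by (auto simp: N_def)
      ultimately show ?thesis by blast
    qed simp
  qed
  then have "wt w (step g w i Q) \<le> wt w (Q \<union> (\<Union>u\<in>V. N u))"
    unfolding wt_def using f finV Nfin by (intro sum_mono2) auto
  also have "\<dots> \<le> wt w Q + wt w (\<Union>u\<in>V. N u)"
    unfolding wt_def using f finV Nfin by (subst sum_Un) (auto intro!: sum_nonneg)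
  also have "wt w (\<Union>u\<in>V. N u) \<le> (\<Sum>u\<in>V. wt w (N u))"
    unfolding wt_def using finV Nfin
    by (subst sum.UNION_disjoint) (auto simp: N_def split: option.splits if_splits)
  also have "(\<Sum>u\<in>V. wt w (N u)) \<le> (\<Sum>u\<in>V. (real (pp w u) + 1) *
    (case att3 g w i u of None \<Rightarrow> 0 | Some y \<Rightarrow> of_bool ((u, None) \<in> Q) + 2 * of_bool (\<exists>v. (v, Some y) \<in> Q \<and> u \<in> nb g v)))"
    by (intro sum_mono) (auto simp: wt_def N_def split: option.splits)
  finally show ?thesis by simp
qed

lemma wt_ov: "wt (override_on w t (Ji i)) = wt w"
  by (simp add: wt_def[abs_def] ov_act)

lemma unc_less: "act g w v \<Longrightarrow> card (unc g w v) < pp w v"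
  unfolding act_def by (metis diff_is_0_eq' le_zero_eq linorder_not_less mult_0_right)

text \<open>A color in \<open>Y\<close> is tried with probability \<tau>3 and adds two items, whose
  weight \<open>pp w u + 1\<close> is cancelled by \<tau>3. The bound on \<theta> keeps exponents in
  [0, 1], where \<open>exp x - 1\<close> is at most 2 x; hence 4 = 2 * 2.\<close>

lemma step_vertex_exp:
  assumes u: "u \<in> V" "act g w u" and th: "0 \<le> \<theta>" "\<theta> * (real (dg g) + 2) \<le> 1 / 4" and Y: "finite Y"
  shows "avg (2 ^ b) (Ji i) (\<lambda>t. exp (\<theta> * ((real (pp w u) + 1) * (case att3 g (override_on w t (Ji i)) i u of None \<Rightarrow> 0
      | Some y \<Rightarrow> of_bool n0 + 2 * of_bool (y \<in> Y)))))
    \<le> exp (\<theta> * (real (pp w u) + 1) * of_bool n0 + 4 * \<theta> * real (card Y))"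
proof -
  let ?p = "real (pp w u)" and ?\<tau> = "\<tau>3 w u"
  let ?E = "exp (\<theta> * (?p + 1) * of_bool n0)"
  define F where "F a = exp (\<theta> * ((?p + 1) * (case a of None \<Rightarrow> 0 | Some y \<Rightarrow> of_bool n0 + 2 * of_bool (y \<in> Y))))" for a :: "nat option"
  have E1: "1 \<le> ?E" using th by simp
  have p1: "2 * (\<theta> * (?p + 1)) \<le> 1"
  proof -
    have "\<theta> * (?p + 1) \<le> \<theta> * (real (dg g) + 2)" using pp_le[OF u(1), of w] th by (intro mult_left_mono) auto
    then show ?thesis using th by linarith
  qed
  have Fc: "F (Some c) \<le> ?E * (1 + 4 * \<theta> * (?p + 1) * of_bool (c \<in> Y))" for c
  proof (cases "c \<in> Y")
    case True
    have "F (Some c) = ?E * exp (2 * (\<theta> * (?p + 1)))"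
      unfolding F_def exp_add[symmetric] using True by (simp add: algebra_simps)
    also have "\<dots> \<le> ?E * (1 + 2 * (2 * (\<theta> * (?p + 1))))"
      using exp_le_1_2[OF _ p1] th by (intro mult_left_mono) (auto simp: add_nonneg_nonneg)
    finally show ?thesis using True by (simp add: algebra_simps)
  next
    case False
    then show ?thesis by (simp add: F_def mult.assoc)
  qed
  have FN: "F None \<le> ?E" using E1 by (simp add: F_def)
  have "avg (2 ^ b) (Ji i) (\<lambda>t. F (att3 g (override_on w t (Ji i)) i u)) =
    ?\<tau> * (\<Sum>c\<in>av2 g w u. F (Some c)) + (1 - ?\<tau> * ?p) * F None"
    by (rule att3_avg[OF u])
  also have "\<dots> \<le> ?\<tau> * (\<Sum>c\<in>av2 g w u. ?E * (1 + 4 * \<theta> * (?p + 1) * of_bool (c \<in> Y))) + (1 - ?\<tau> * ?p) * ?E"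
  proof (intro add_mono mult_left_mono sum_mono Fc FN)
    show "0 \<le> 1 - ?\<tau> * ?p" using \<tau>3_bounds(3,5)[OF u] by (simp add: distrib_left)
  qed (use \<tau>3_bounds(3)[OF u] in simp)
  also have "\<dots> = ?E * (1 + 4 * \<theta> * (?\<tau> * (?p + 1)) * (\<Sum>c\<in>av2 g w u. of_bool (c \<in> Y)))"
    by (simp only: sum.distrib sum_distrib_left[symmetric] sum_constant mult_1_right) (simp add: algebra_simps)
  also have "\<dots> \<le> ?E * (1 + 4 * \<theta> * 1 * real (card Y))"
  proof (intro mult_left_mono add_left_mono mult_mono)
    have "card {c \<in> av2 g w u. c \<in> Y} \<le> card Y" using Y by (intro card_mono) auto
    then show "(\<Sum>c\<in>av2 g w u. of_bool (c \<in> Y)) \<le> real (card Y)"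
      unfolding card_filter_sum[OF av2_fin[OF u(1)]] by simp
  qed (use th \<tau>3_bounds(3,5)[OF u] in \<open>auto intro!: sum_nonneg\<close>)
  also have "\<dots> \<le> ?E * exp (4 * \<theta> * real (card Y))"
    using exp_ge_add_one_self[of "4 * \<theta> * real (card Y)"] by (intro mult_left_mono) auto
  finally show ?thesis unfolding F_def by (simp add: exp_add)
qed

text \<open>6 = 1 + 1 + 4: the old items, the color items created by questions about the color of a
  vertex, and the items at neighbors. For the latter, each color item is charged once per active
  neighbor, which is less than its own weight.\<close>

lemma step_exp:
  assumes Q: "okq w Q" and th: "0 \<le> \<theta>" "\<theta> * (real (dg g) + 2) \<le> 1 / 4"
  shows "avg (2 ^ b) (Ji i) (\<lambda>t. exp (\<theta> * wt w (step g (override_on w t (Ji i)) i Q))) \<le> exp (6 * \<theta> * wt w Q)"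
proof -
  have f: "fst ` Q \<subseteq> V" "finite Q" using Q by (auto simp: okq_def)
  have fin: "finite (Ji i)" using finV by simp
  define Y where "Y u = {c. \<exists>v. (v, Some c) \<in> Q \<and> u \<in> nb g v}" for u
  define X where "X u a = (real (pp w u) + 1) * (case a of None \<Rightarrow> 0 | Some y \<Rightarrow> of_bool ((u, None) \<in> Q) + 2 * of_bool (y \<in> Y u))" for u and a :: "nat option"
  define S where "S u = {q \<in> Q. snd q \<noteq> None \<and> u \<in> nb g (fst q)}" for u
  have Ysub: "Y u \<subseteq> (\<lambda>q. the (snd q)) ` S u" for u
  proof
    fix c assume "c \<in> Y u"
    then obtain v where "(v, Some c) \<in> S u" by (auto simp: Y_def S_def)
    then show "c \<in> (\<lambda>q. the (snd q)) ` S u" by (intro rev_image_eqI[of "(v, Some c)"]) auto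
  qed
  have Sfin: "finite (S u)" for u using f by (simp add: S_def)
  have Yfin: "finite (Y u)" for u using finite_subset[OF Ysub[of u] finite_imageI[OF Sfin[of u], of "\<lambda>q. the (snd q)"]] .
  have Yc: "card (Y u) \<le> card (S u)" for u using surj_card_le[OF Sfin[of u] Ysub[of u]] .
  let ?w = "\<lambda>t. override_on w t (Ji i)"
  have "avg (2 ^ b) (Ji i) (\<lambda>t. exp (\<theta> * wt w (step g (?w t) i Q))) \<le>
    avg (2 ^ b) (Ji i) (\<lambda>t. exp (\<theta> * wt w Q) * (\<Prod>u\<in>V. exp (\<theta> * X u (att3 g (?w t) i u))))"
  proof (rule avg_mono)
    fix t
    have "okq (?w t) Q" using Q by (simp add: okq_def ov_act)
    from step_wt[OF this, of i]
    have "wt w (step g (?w t) i Q) \<le> wt w Q + (\<Sum>u\<in>V. X u (att3 g (?w t) i u))"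
      unfolding X_def Y_def mem_Collect_eq by (simp add: wt_ov ov_act)
    then have "\<theta> * wt w (step g (?w t) i Q) \<le> \<theta> * (wt w Q + (\<Sum>u\<in>V. X u (att3 g (?w t) i u)))"
      using th by (intro mult_left_mono)
    then have "exp (\<theta> * wt w (step g (?w t) i Q)) \<le> exp (\<theta> * wt w Q + (\<Sum>u\<in>V. \<theta> * X u (att3 g (?w t) i u)))"
      by (simp add: distrib_left sum_distrib_left)
    then show "exp (\<theta> * wt w (step g (?w t) i Q)) \<le> exp (\<theta> * wt w Q) * (\<Prod>u\<in>V. exp (\<theta> * X u (att3 g (?w t) i u)))"
      using finV by (simp only: exp_add exp_sum)
  qed
  also have "\<dots> = exp (\<theta> * wt w Q) * (\<Prod>u\<in>V. avg (2 ^ b) (Ji i) (\<lambda>t. exp (\<theta> * X u (att3 g (?w t) i u))))"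
    unfolding avg_cmult
    by (subst avg_indep[where K = "\<lambda>u. {(u, 3 + i)}"])
      (use fin finV att3_dep[where F = "\<lambda>a. exp (\<theta> * X _ a)"] in auto)
  also have "\<dots> \<le> exp (\<theta> * wt w Q) * (\<Prod>u\<in>V. exp (\<theta> * (real (pp w u) + 1) * of_bool ((u, None) \<in> Q) + 4 * \<theta> * (of_bool (act g w u) * real (card (S u)))))"
  proof (intro mult_left_mono prod_mono conjI avg_nonneg)
    fix u assume u: "u \<in> V"
    show "avg (2 ^ b) (Ji i) (\<lambda>t. exp (\<theta> * X u (att3 g (?w t) i u))) \<le>
      exp (\<theta> * (real (pp w u) + 1) * of_bool ((u, None) \<in> Q) + 4 * \<theta> * (of_bool (act g w u) * real (card (S u))))"
    proof (cases "act g w u")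
      case True
      have "avg (2 ^ b) (Ji i) (\<lambda>t. exp (\<theta> * X u (att3 g (?w t) i u))) \<le> exp (\<theta> * (real (pp w u) + 1) * of_bool ((u, None) \<in> Q) + 4 * \<theta> * real (card (Y u)))"
        unfolding X_def by (rule step_vertex_exp[OF u True th Yfin])
      also have "\<dots> \<le> exp (\<theta> * (real (pp w u) + 1) * of_bool ((u, None) \<in> Q) + 4 * \<theta> * real (card (S u)))"
        using th Yc by (simp add: mult_left_mono)
      finally show ?thesis using True by simp
    next
      case False
      have "att3 g (?w t) i u = None" for t using False by (simp add: att3_def ov_act)
      then have "avg (2 ^ b) (Ji i) (\<lambda>t. exp (\<theta> * X u (att3 g (?w t) i u))) = 1"
        using fin by (simp add: X_def avg_const)
      then show ?thesis using False th by (simp only:) (simp add: mult_nonneg_nonneg)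
    qed
  qed auto
  also have "\<dots> = exp (\<theta> * wt w Q + (\<theta> * (\<Sum>u\<in>V. (real (pp w u) + 1) * of_bool ((u, None) \<in> Q)) + 4 * \<theta> * (\<Sum>u\<in>V. of_bool (act g w u) * real (card (S u)))))"
    by (simp only: exp_sum[OF finV, symmetric] exp_add[symmetric] sum.distrib sum_distrib_left mult.assoc)
  also have "\<dots> \<le> exp (\<theta> * wt w Q + (\<theta> * wt w Q + 4 * \<theta> * wt w Q))"
  proof (intro exp_le_cancel_iff[THEN iffD2] add_mono mult_left_mono order_refl)
    have "(\<Sum>u\<in>V. (real (pp w u) + 1) * of_bool ((u, None) \<in> Q)) = (\<Sum>u\<in>{u \<in> V. (u, None) \<in> Q}. real (pp w u) + 1)"
      unfolding sum.inter_filter[OF finV] by (intro sum.cong) auto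
    also have "\<dots> = (\<Sum>q\<in>(\<lambda>u. (u, None :: nat option)) ` {u \<in> V. (u, None) \<in> Q}. real (pp w (fst q)) + 1)"
      by (subst sum.reindex) (auto simp: inj_on_def)
    also have "\<dots> \<le> wt w Q" unfolding wt_def using f by (intro sum_mono2) auto
    finally show "(\<Sum>u\<in>V. (real (pp w u) + 1) * of_bool ((u, None) \<in> Q)) \<le> wt w Q" .
    let ?V = "{u \<in> V. act g w u}"
    have "(\<Sum>u\<in>V. of_bool (act g w u) * real (card (S u))) = (\<Sum>u\<in>?V. real (card (S u)))"
      unfolding sum.inter_filter[OF finV] by (intro sum.cong) auto
    also have "\<dots> = real (\<Sum>u\<in>?V. card {q \<in> {q \<in> Q. snd q \<noteq> None}. u \<in> nb g (fst q)})"
      by (simp add: S_def conj_assoc)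
    also have "(\<Sum>u\<in>?V. card {q \<in> {q \<in> Q. snd q \<noteq> None}. u \<in> nb g (fst q)}) =
      (\<Sum>q\<in>{q \<in> Q. snd q \<noteq> None}. card {u \<in> ?V. u \<in> nb g (fst q)})"
      using finV f by (intro sum_multicount_gen) auto
    also have "real \<dots> \<le> (\<Sum>q\<in>{q \<in> Q. snd q \<noteq> None}. real (pp w (fst q)) + 1)"
      unfolding of_nat_sum
    proof (rule sum_mono)
      fix q assume q: "q \<in> {q \<in> Q. snd q \<noteq> None}"
      then obtain v y where v: "q = (v, Some y)" by (cases q) auto
      then have va: "act g w v" "v \<in> V" using q Q f by (auto simp: okq_def)
      have "{u \<in> ?V. u \<in> nb g v} \<subseteq> unc g w v" by (auto simp: unc_def act_def)
      then have "card {u \<in> ?V. u \<in> nb g v} \<le> card (unc g w v)" using va by (intro card_mono) (auto simp: unc_def)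
      then show "real (card {u \<in> ?V. u \<in> nb g (fst q)}) \<le> real (pp w (fst q)) + 1"
        using unc_less[OF va(1)] v by simp
    qed
    also have "\<dots> \<le> wt w Q" unfolding wt_def using f by (intro sum_mono2) auto
    finally show "(\<Sum>u\<in>V. of_bool (act g w u) * real (card (S u))) \<le> wt w Q" .
  qed (use th in auto)
  finally show ?thesis by (simp add: algebra_simps)
qed

lemma items_exp:
  assumes "okq w Q" "0 \<le> \<theta>" "6 ^ T * \<theta> * (real (dg g) + 2) \<le> 1 / 4"
  shows "avg (2 ^ b) (V \<times> {3..<3 + T}) (\<lambda>t. exp (\<theta> * wt w (items g (override_on w t (V \<times> {3..<3 + T})) T Q)))
    \<le> exp (6 ^ T * \<theta> * wt w Q)"
  using assms
proof (induction T arbitrary: w Q)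
  case 0
  then show ?case by (simp add: avg_empty)
next
  case (Suc T)
  let ?C = "V \<times> {3..<3 + T}"
  have J: "V \<times> {3..<3 + Suc T} = Ji T \<union> ?C" by auto
  have th: "6 ^ T * \<theta> * (real (dg g) + 2) \<le> 1 / 4" "0 \<le> 6 ^ T * \<theta>"
  proof -
    have "6 ^ T * \<theta> * (real (dg g) + 2) \<le> 6 * (6 ^ T * \<theta> * (real (dg g) + 2))" using Suc.prems(2) by simp
    then show "6 ^ T * \<theta> * (real (dg g) + 2) \<le> 1 / 4" using Suc.prems(3) by simp
    show "0 \<le> 6 ^ T * \<theta>" using Suc.prems(2) by simp
  qed
  have "avg (2 ^ b) (V \<times> {3..<3 + Suc T}) (\<lambda>t. exp (\<theta> * wt w (items g (override_on w t (V \<times> {3..<3 + Suc T})) (Suc T) Q))) =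
    avg (2 ^ b) (Ji T) (\<lambda>s. avg (2 ^ b) ?C (\<lambda>t. exp (\<theta> * wt w (items g (override_on w (override_on s t ?C) (Ji T \<union> ?C)) (Suc T) Q))))"
    unfolding J using finV by (intro avg_union) auto
  also have "\<dots> \<le> avg (2 ^ b) (Ji T) (\<lambda>s. exp (6 ^ T * \<theta> * wt w (step g (override_on w s (Ji T)) T Q)))"
  proof (rule avg_mono)
    fix s
    let ?w = "override_on w s (Ji T)"
    have ov: "override_on w (override_on s t ?C) (Ji T \<union> ?C) = override_on ?w t ?C" for t
      by (auto simp: override_on_def fun_eq_iff)
    have "step g (override_on ?w t ?C) T Q = step g ?w T Q" for t
    proof -
      have "act g (override_on ?w t ?C) = act g ?w" "av2 g (override_on ?w t ?C) = av2 g ?w"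
        by (intro pre_cong; simp add: override_on_def)+
      then have "att3 g (override_on ?w t ?C) T = att3 g ?w T" by (auto simp: att3_def[abs_def] override_on_def fun_eq_iff)
      then show ?thesis by (simp add: step_def)
    qed
    moreover have "okq ?w (step g ?w T Q)" using Suc.prems(1) by (intro step_okq) (simp add: okq_def ov_act)
    ultimately show "avg (2 ^ b) ?C (\<lambda>t. exp (\<theta> * wt w (items g (override_on w (override_on s t ?C) (Ji T \<union> ?C)) (Suc T) Q)))
      \<le> exp (6 ^ T * \<theta> * wt w (step g ?w T Q))"
      unfolding ov items.simps using Suc.IH[of ?w "step g ?w T Q"] Suc.prems(2) th by (simp add: wt_ov)
  qed
  also have "\<dots> \<le> exp (6 * (6 ^ T * \<theta>) * wt w Q)" by (rule step_exp[OF Suc.prems(1) th(2,1)])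
  finally show ?case by (simp only: power_Suc mult.assoc)
qed

text \<open>\<theta> is the largest value that \<open>items_exp\<close> admits for \<open>T\<close>
  rounds. The start \<open>X\<close> is a fixed set; \<open>need_prob\<close> takes a union bound to
  apply this to random components.\<close>

lemma items_tail:
  assumes X: "X \<subseteq> V"
  shows "prb (2 ^ b) (V \<times> {..<3 + T}) (\<lambda>w. real (card (items g w T (X \<times> {None}))) > l)
    \<le> exp (real (card X) / 4 - l / (4 * 6 ^ T * (real (dg g) + 2)))"
proof -
  define \<theta> where "\<theta> = 1 / (4 * 6 ^ T * (real (dg g) + 2))"
  have "a * (1 / (4 * a * c)) * c = 1 / 4" if "a > 0" "c > 0" for a c :: real using that by simp
  then have th: "0 \<le> \<theta>" "6 ^ T * \<theta> * (real (dg g) + 2) = 1 / 4" by (auto simp: \<theta>_def)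
  let ?A = "V \<times> {..<3::nat}" and ?C = "V \<times> {3..<3 + T}"
  have J: "V \<times> {..<3 + T} = ?A \<union> ?C" by auto
  have Xf: "finite X" using X finV finite_subset by blast
  have "prb (2 ^ b) (V \<times> {..<3 + T}) (\<lambda>w. real (card (items g w T (X \<times> {None}))) > l) =
    avg (2 ^ b) ?A (\<lambda>s. prb (2 ^ b) ?C (\<lambda>t. real (card (items g (override_on s t ?C) T (X \<times> {None}))) > l))"
    unfolding J using finV by (intro avg_union) auto
  also have "\<dots> \<le> avg (2 ^ b) ?A (\<lambda>s. exp (real (card X) / 4 - l * \<theta>))"
  proof (rule avg_mono)
    fix s
    let ?I = "\<lambda>t. items g (override_on s t ?C) T (X \<times> {None})"
    have ok: "okq s (X \<times> {None})" using X Xf by (auto simp: okq_def)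
    have wX: "wt s (X \<times> {None}) \<le> real (card X) * (real (dg g) + 2)"
    proof -
      have "wt s (X \<times> {None}) \<le> (\<Sum>q\<in>X \<times> {None :: nat option}. real (dg g) + 2)"
        unfolding wt_def
      proof (rule sum_mono)
        fix q assume "q \<in> X \<times> {None :: nat option}"
        then have "fst q \<in> V" using X by auto
        from pp_le[OF this, of s] show "real (pp s (fst q)) + 1 \<le> real (dg g) + 2" by linarith
      qed
      then show ?thesis by (simp add: card_cartesian_product)
    qed
    have fin: "finite (?I t)" for t
    proof -
      have "okq w' (items g w' i Q)" if "okq w' Q" for w' i Q
        using that by (induction i arbitrary: Q) (auto dest: step_okq)
      moreover have "okq (override_on s t ?C) (X \<times> {None})" using X Xf by (auto simp: okq_def)
      ultimately show ?thesis by (auto simp: okq_def)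
    qed
    have cw: "real (card (?I t)) \<le> wt s (?I t)" for t
      unfolding wt_def using sum_mono[of "?I t" "\<lambda>_. 1" "\<lambda>q. real (pp s (fst q)) + 1"] by simp
    have "prb (2 ^ b) ?C (\<lambda>t. real (card (?I t)) > l) \<le> avg (2 ^ b) ?C (\<lambda>t. exp (- (l * \<theta>)) * exp (\<theta> * wt s (?I t)))"
    proof (rule avg_mono)
      fix t
      show "of_bool (real (card (?I t)) > l) \<le> exp (- (l * \<theta>)) * exp (\<theta> * wt s (?I t))"
      proof (cases "real (card (?I t)) > l")
        case True
        then have "\<theta> * l \<le> \<theta> * wt s (?I t)" using cw[of t] th by (intro mult_left_mono) auto
        then show ?thesis using True by (simp flip: exp_add add: mult.commute)
      qed simp
    qed
    also have "\<dots> = exp (- (l * \<theta>)) * avg (2 ^ b) ?C (\<lambda>t. exp (\<theta> * wt s (?I t)))" by (rule avg_cmult)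
    also have "\<dots> \<le> exp (- (l * \<theta>)) * exp (6 ^ T * \<theta> * wt s (X \<times> {None}))"
      using items_exp[OF ok th(1)] th(2) by (intro mult_left_mono) auto
    also have "\<dots> \<le> exp (- (l * \<theta>)) * exp (real (card X) / 4)"
    proof -
      have "6 ^ T * \<theta> * wt s (X \<times> {None}) \<le> 6 ^ T * \<theta> * (real (card X) * (real (dg g) + 2))"
        using wX th by (intro mult_left_mono) auto
      also have "\<dots> = real (card X) * (6 ^ T * \<theta> * (real (dg g) + 2))" by (simp only: mult_ac)
      also have "\<dots> = real (card X) / 4" unfolding th(2) by simp
      finally show ?thesis by simp
    qed
    also have "\<dots> = exp (real (card X) / 4 - l * \<theta>)" by (simp flip: exp_add)
    finally show "prb (2 ^ b) ?C (\<lambda>t. real (card (?I t)) > l) \<le> exp (real (card X) / 4 - l * \<theta>)" .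
  qed
  also have "\<dots> = exp (real (card X) / 4 - l * \<theta>)" using finV by (intro avg_const) auto
  finally show ?thesis by (simp add: \<theta>_def)
qed

end

section \<open>The local computation\<close>

text \<open>\<open>comp\<close> also contains the colored vertices next to the component. The vertices in
  \<open>need\<close> determine the color of \<open>v\<close>.\<close>

inductive_set comp :: "gr \<Rightarrow> seeds \<Rightarrow> nat \<Rightarrow> nat \<Rightarrow> nat set" for g w T v where
  comp_self: "v \<in> comp g w T v"
| comp_step: "y \<in> comp g w T v \<Longrightarrow> tot g w T y = None \<Longrightarrow> z \<in> nb g y \<Longrightarrow> z \<in> comp g w T v"

definition need :: "gr \<Rightarrow> seeds \<Rightarrow> nat \<Rightarrow> nat \<Rightarrow> nat set" where
  "need g w T v = (\<Union>y\<in>comp g w T v. \<Union>x\<in>fst ` items g w T {(y, None)}. bll g 10 x)"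

definition eqv :: "nat set \<Rightarrow> gr \<Rightarrow> seeds \<Rightarrow> gr \<Rightarrow> seeds \<Rightarrow> bool" where
  "eqv E g w g' w' \<longleftrightarrow> dg g = dg g' \<and> hh g = hh g' \<and> big g = big g' \<and> (\<forall>u\<in>E. same g w g' w' u)"

text \<open>Nothing is assumed to be known about vertices outside \<open>E\<close>; that \<open>E\<close> contains every vertex
  needed under all completions already makes all completions agree.\<close>

context
  fixes E :: "nat set" and g :: gr and w :: seeds and T v :: nat
  assumes forced: "\<And>u. (\<And>g' w'. eqv E g w g' w' \<Longrightarrow> u \<in> need g' w' T v) \<Longrightarrow> u \<in> E"
begin

text \<open>Induction outwards. \<open>x\<close> is needed in all completions, so it lies in
  \<open>E\<close> and all completions have the same neighbors there; these are then needed in all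
  completions as well.\<close>

lemma forced_bll:
  assumes "\<And>g' w'. eqv E g w g' w' \<Longrightarrow> bll g' k x \<subseteq> need g' w' T v"
  shows "bll g k x \<subseteq> E \<and> (\<forall>g' w'. eqv E g w g' w' \<longrightarrow> agr k g w g' w' x)"
  using assms
proof (induction k arbitrary: x)
  case 0
  then have "x \<in> E" by (intro forced) auto
  then show ?case by (auto simp: eqv_def agr.simps)
next
  case (Suc k)
  have x: "x \<in> E" using Suc.prems by (intro forced) auto
  then have sx: "same g w g' w' x" if "eqv E g w g' w'" for g' w' using that by (auto simp: eqv_def)
  have "bll g k z \<subseteq> E \<and> (\<forall>g' w'. eqv E g w g' w' \<longrightarrow> agr k g w g' w' z)" if z: "z \<in> nb g x" for z
  proof (rule Suc.IH)
    fix g' w' assume e: "eqv E g w g' w'"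
    then have "z \<in> nb g' x" using z sx[OF e] by (simp add: same_def)
    then show "bll g' k z \<subseteq> need g' w' T v" using Suc.prems[OF e] by auto
  qed
  then show ?case using x sx by (auto simp: agr.simps)
qed

lemma forced_items:
  assumes "\<And>g' w' x. eqv E g w g' w' \<Longrightarrow> x \<in> fst ` items g' w' t Q \<Longrightarrow> bll g' 10 x \<subseteq> need g' w' T v"
    and "x \<in> fst ` items g w t Q"
  shows "bll g 10 x \<subseteq> E \<and> (\<forall>g' w'. eqv E g w g' w' \<longrightarrow> agr 10 g w g' w' x)"
  using assms
proof (induction t arbitrary: Q)
  case 0
  show ?case by (rule forced_bll) (use 0 in auto)
next
  case (Suc i)
  have Q: "agr 10 g w g' w' x" if x: "x \<in> fst ` Q" and e: "eqv E g w g' w'" for x g' w'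
  proof -
    have "bll g 10 x \<subseteq> E \<and> (\<forall>g' w'. eqv E g w g' w' \<longrightarrow> agr 10 g w g' w' x)"
    proof (rule forced_bll)
      fix g' w' assume e: "eqv E g w g' w'"
      have "x \<in> fst ` items g' w' (Suc i) Q" using x items_ext by blast
      then show "bll g' 10 x \<subseteq> need g' w' T v" by (rule Suc.prems(1)[OF e])
    qed
    then show ?thesis using e by blast
  qed
  have st: "step g w i Q = step g' w' i Q" if "eqv E g w g' w'" for g' w'
    using Q that by (intro step_loc) blast
  show ?case
  proof (rule Suc.IH[of "step g w i Q"])
    fix g' w' x assume e: "eqv E g w g' w'" and "x \<in> fst ` items g' w' i (step g w i Q)"
    then show "bll g' 10 x \<subseteq> need g' w' T v" using Suc.prems(1)[OF e] st[OF e] by simp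
  qed (use Suc.prems(2) in simp)
qed

text \<open>Once all completions agree on whether \<open>y\<close> is colored, they agree on whether
  the component continues through \<open>y\<close>; then its neighbors belong to the component in
  all of them.\<close>

lemma forced_comp:
  assumes "y \<in> comp g w T v" "eqv E g w g' w'"
  shows "y \<in> comp g' w' T v \<and> (\<forall>x\<in>fst ` items g w T {(y, None)}. bll g 10 x \<subseteq> E) \<and>
    tot g w T y = tot g' w' T y \<and> nb g y = nb g' y \<and> pal g y = pal g' y"
  using assms
proof (induction arbitrary: g' w' rule: comp.induct)
  have main: "(\<forall>x\<in>fst ` items g w T {(y, None)}. bll g 10 x \<subseteq> E) \<and>
    tot g w T y = tot g' w' T y \<and> nb g y = nb g' y \<and> pal g y = pal g' y"
    if y: "\<And>g' w'. eqv E g w g' w' \<Longrightarrow> y \<in> comp g' w' T v" and e: "eqv E g w g' w'" for y g' w'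
  proof -
    have it: "bll g 10 x \<subseteq> E \<and> (\<forall>g' w'. eqv E g w g' w' \<longrightarrow> agr 10 g w g' w' x)" if "x \<in> fst ` items g w T {(y, None)}" for x
      by (rule forced_items[OF _ that]) (use y in \<open>auto simp: need_def\<close>)
    then have ag: "agr 10 g w g' w' x" if "x \<in> fst ` items g w T {(y, None)}" for x using that e by blast
    have yi: "y \<in> fst ` items g w T {(y, None)}" using items_ext[of "{(y, None)}" g w T] by force
    have "chi g w T y = chi g' w' T y" using items_loc[of g w T "{(y, None)}" g' w'] ag by auto
    moreover have "col2 g w y = col2 g' w' y" using agr_le[OF ag[OF yi], of 8] by (intro col2_loc) simp
    ultimately have "tot g w T y = tot g' w' T y" unfolding tot_def by (simp only:)
    then show ?thesis using it sameD[OF ag[OF yi]] by blast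
  qed
  {
    case (comp_self g' w')
    then show ?case using main[of v g' w'] comp.comp_self by blast
  next
    case (comp_step y z g' w')
    have "z \<in> comp g'' w'' T v" if e: "eqv E g w g'' w''" for g'' w''
    proof -
      have "y \<in> comp g'' w'' T v" "tot g'' w'' T y = None" "z \<in> nb g'' y"
        using comp_step.IH[OF e] comp_step.hyps by auto
      then show ?thesis by (rule comp.comp_step)
    qed
    then show ?case using main[of z g' w'] comp_step.prems by blast
  }
qed

lemma forced_final:
  assumes e: "eqv E g w g' w'"
  shows "final g w T v = final g' w' T v"
proof -
  have "final g w T y = final g' w' T y" if "y \<in> comp g w T v" for y
    using that
  proof (induction y rule: less_induct)
    case (less y)
    note y = forced_comp[OF less.prems e]
    show ?case
    proof (cases "tot g w T y")
      case (Some x)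
      then show ?thesis using y by (subst (1 2) final.simps) simp
    next
      case None
      have z: "tot g w T z = tot g' w' T z" "z \<in> comp g w T v" if "z \<in> nb g y" for z
        using forced_comp[OF comp.comp_step[OF less.prems None that] e] comp.comp_step[OF less.prems None that] by auto
      have "(\<lambda>z. final g w T z) ` {z \<in> nb g y. z < y \<and> tot g w T z = None} = (\<lambda>z. final g' w' T z) ` {z \<in> nb g' y. z < y \<and> tot g' w' T z = None}"
        using y z less.IH by (intro image_cong) auto
      moreover have "(\<forall>z\<in>nb g y. tot g w T z \<noteq> Some x) = (\<forall>z\<in>nb g' y. tot g' w' T z \<noteq> Some x)" for x
        using y z by auto
      ultimately show ?thesis using y None by (subst (1 2) final.simps) simp
    qed
  qed
  then show ?thesis using comp.comp_self by blast
qed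

end

section \<open>The algorithm as a decision tree\<close>

type_synonym info = "nat set \<times> nat set \<times> (nat \<Rightarrow> bool)"

text \<open>Block \<open>c\<close> of \<open>b\<close> bits of the random string, in binary, is the
  seed of stage \<open>c\<close>.\<close>

definition dec :: "nat \<Rightarrow> (nat \<Rightarrow> bool) \<Rightarrow> nat \<Rightarrow> nat" where
  "dec b f c = (\<Sum>j<b. of_bool (f (c * b + j)) * 2 ^ j)"

record par = p_dg :: nat p_hh :: nat p_big :: bool p_T :: nat p_b :: nat

definition cons :: "par \<Rightarrow> (nat \<Rightarrow> info option) \<Rightarrow> gr \<Rightarrow> seeds \<Rightarrow> bool" where
  "cons p K g w \<longleftrightarrow> dg g = p_dg p \<and> hh g = p_hh p \<and> big g = p_big p \<and>
     (\<forall>u N P f. K u = Some (N, P, f) \<longrightarrow> nb g u = N \<and> pal g u = P \<and> (\<forall>c. w (u, c) = dec (p_b p) f c))"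

text \<open>Any vertex that is needed under every input consistent with the knowledge \<open>K\<close> is needed
  under the true one, so it may be read. When no such vertex is left, all consistent inputs give
  \<open>v\<close> the same color.\<close>

definition nxt :: "par \<Rightarrow> nat \<Rightarrow> (nat \<Rightarrow> info option) \<Rightarrow> nat option" where
  "nxt p v K = (let P = (\<lambda>u. K u = None \<and> (\<forall>g w. cons p K g w \<longrightarrow> u \<in> need g w (p_T p) v))
     in if \<exists>u. P u then Some (SOME u. P u) else None)"

definition outp :: "par \<Rightarrow> nat \<Rightarrow> (nat \<Rightarrow> info option) \<Rightarrow> nat" where
  "outp p v K = (let (g, w) = (SOME (g, w). cons p K g w) in final g w (p_T p) v)"

primrec qnb :: "nat \<Rightarrow> nat \<Rightarrow> (nat set \<Rightarrow> lca) \<Rightarrow> lca" where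
  "qnb u 0 F = F {}"
| "qnb u (Suc i) F = Neighbor_Query u (Suc i) (\<lambda>a. qnb u i (\<lambda>S. F (case a of None \<Rightarrow> S | Some x \<Rightarrow> insert x S)))"

primrec qbits :: "nat \<Rightarrow> nat \<Rightarrow> ((nat \<Rightarrow> bool) \<Rightarrow> lca) \<Rightarrow> lca" where
  "qbits u 0 F = F (\<lambda>_. False)"
| "qbits u (Suc j) F = Read_Bit u j (\<lambda>x. qbits u j (\<lambda>f. F (f(j := x))))"

text \<open>The counter bounds the number of vertices read, so that the query bound holds in every
  run; the output 0 on exhaustion is arbitrary. A vertex costs \<open>p_dg p\<close> neighbor
  queries, its list and bits being free.\<close>

primrec lp :: "par \<Rightarrow> nat \<Rightarrow> nat \<Rightarrow> (nat \<Rightarrow> info option) \<Rightarrow> lca" where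
  "lp p v 0 K = Output 0"
| "lp p v (Suc n) K = (case nxt p v K of None \<Rightarrow> Output (outp p v K) | Some u \<Rightarrow>
     qnb u (p_dg p) (\<lambda>N. Read_List u (\<lambda>P. qbits u (p_b p * (3 + p_T p)) (\<lambda>f. lp p v n (K(u \<mapsto> (N, P, f)))))))"

lemma qnb_sem:
  "run I r (qnb u k F) = run I r (F (set (take k (nbrs I u))))"
  "queries I r (qnb u k F) = k + queries I r (F (set (take k (nbrs I u))))"
  "u \<in> verts I \<Longrightarrow> k \<le> max_degree I \<Longrightarrow> legal_run I r (qnb u k F) = legal_run I r (F (set (take k (nbrs I u))))"
proof -
  have *: "(case neighbor_answer I u (Suc i) of None \<Rightarrow> set (take i (nbrs I u)) | Some x \<Rightarrow> insert x (set (take i (nbrs I u))))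
    = set (take (Suc i) (nbrs I u))" for i
    by (auto simp: neighbor_answer_def take_Suc_conv_app_nth)
  show "run I r (qnb u k F) = run I r (F (set (take k (nbrs I u))))"
    by (induction k arbitrary: F) (simp_all add: *)
  show "queries I r (qnb u k F) = k + queries I r (F (set (take k (nbrs I u))))"
    by (induction k arbitrary: F) (simp_all add: *)
  show "u \<in> verts I \<Longrightarrow> k \<le> max_degree I \<Longrightarrow> legal_run I r (qnb u k F) = legal_run I r (F (set (take k (nbrs I u))))"
    by (induction k arbitrary: F) (simp_all add: *)
qed

definition bitsof :: "nat \<Rightarrow> (nat \<Rightarrow> bool) \<Rightarrow> nat \<Rightarrow> bool" where
  "bitsof m f j \<longleftrightarrow> j < m \<and> f j"

lemma qbits_sem:
  "run I r (qbits u k F) = run I r (F (bitsof k (r u)))"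
  "queries I r (qbits u k F) = queries I r (F (bitsof k (r u)))"
  "u \<in> verts I \<Longrightarrow> legal_run I r (qbits u k F) = legal_run I r (F (bitsof k (r u)))"
proof -
  have 0: "bitsof 0 (r u) = (\<lambda>_. False)" by (auto simp: bitsof_def)
  have *: "(bitsof i (r u))(i := r u i) = bitsof (Suc i) (r u)" for i
    by (auto simp: bitsof_def fun_eq_iff less_Suc_eq)
  show "run I r (qbits u k F) = run I r (F (bitsof k (r u)))"
    by (induction k arbitrary: F) (simp_all add: * 0)
  show "queries I r (qbits u k F) = queries I r (F (bitsof k (r u)))"
    by (induction k arbitrary: F) (simp_all add: * 0)
  show "u \<in> verts I \<Longrightarrow> legal_run I r (qbits u k F) = legal_run I r (F (bitsof k (r u)))"
    by (induction k arbitrary: F) (simp_all add: * 0)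
qed

definition gr_of :: "par \<Rightarrow> input \<Rightarrow> gr" where
  "gr_of p I = \<lparr>nb = (\<lambda>u. if u \<in> verts I then set (nbrs I u) else {}), pal = palette I,
     dg = p_dg p, hh = p_hh p, big = p_big p\<rparr>"

text \<open>Truncated to the bits that are read, so that the information on a vertex describes its
  seeds for every \<open>c\<close>; those beyond the last round are 0.\<close>

definition seeds_of :: "par \<Rightarrow> (nat \<Rightarrow> nat \<Rightarrow> bool) \<Rightarrow> seeds" where
  "seeds_of p r = (\<lambda>(u, c). dec (p_b p) (bitsof (p_b p * (3 + p_T p)) (r u)) c)"

definition info_of :: "par \<Rightarrow> input \<Rightarrow> (nat \<Rightarrow> nat \<Rightarrow> bool) \<Rightarrow> nat \<Rightarrow> info" where
  "info_of p I r u = (set (nbrs I u), palette I u, bitsof (p_b p * (3 + p_T p)) (r u))"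

lemma gph_of:
  assumes "list_coloring_input I" "p_dg p = max_degree I"
  shows "gph (gr_of p I) (verts I)"
proof -
  have I: "simple_graph I" "\<And>v. v \<in> verts I \<Longrightarrow> distinct (nbrs I v) \<and> set (nbrs I v) = {u \<in> verts I. adj I v u}"
    "\<And>v. v \<in> verts I \<Longrightarrow> card (palette I v) = max_degree I + 1"
    using assms(1) by (auto simp: list_coloring_input_def)
  show ?thesis
  proof
    fix u assume u: "u \<in> verts I"
    have "degree I u \<le> max_degree I"
      unfolding max_degree_def using I(1) u by (intro Max_ge) (auto simp: simple_graph_def)
    then show "card (nb (gr_of p I) u) \<le> dg (gr_of p I)"
      using I(2)[OF u] u assms(2) by (simp add: gr_of_def degree_def)
  qed (use I assms in \<open>auto simp: gr_of_def simple_graph_def\<close>)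
qed

lemma (in gph) bll_V: "u \<in> V \<Longrightarrow> bll g k u \<subseteq> V"
proof (induction k arbitrary: u)
  case (Suc k)
  have "bll g k z \<subseteq> V" if "z \<in> nb g u" for z using Suc that nb_in by blast
  then show ?case using Suc.prems by auto
qed auto

lemma (in gph) items_V:
  assumes "fst ` Q \<subseteq> V"
  shows "fst ` items g w i Q \<subseteq> V"
  using assms
proof (induction i arbitrary: Q)
  case (Suc i)
  have "fst ` step g w i Q \<subseteq> V" using Suc.prems unfolding step_def by force
  then show ?case using Suc.IH by simp
qed simp

lemma (in gph) comp_V:
  assumes "v \<in> V"
  shows "comp g w T v \<subseteq> V"
proof
  fix y assume "y \<in> comp g w T v"
  then show "y \<in> V" using assms by induction auto
qed

lemma (in gph) need_V: "v \<in> V \<Longrightarrow> need g w T v \<subseteq> V"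
proof -
  assume v: "v \<in> V"
  have "bll g 10 x \<subseteq> V" if y: "y \<in> comp g w T v" and x: "x \<in> fst ` items g w T {(y, None)}" for x y
  proof -
    have "y \<in> V" using comp_V[OF v] y by blast
    then have "fst ` items g w T {(y, None)} \<subseteq> V" by (intro items_V) simp
    then show ?thesis using x by (intro bll_V) blast
  qed
  then show ?thesis unfolding need_def by blast
qed

lemma cons_eqv:
  assumes "cons p K g w"
  shows "cons p K g' w' \<longleftrightarrow> eqv (dom K) g w g' w'"
proof
  assume c: "cons p K g' w'"
  have "same g w g' w' u" if "u \<in> dom K" for u
  proof -
    define i where "i = the (K u)"
    have K: "K u = Some (fst i, fst (snd i), snd (snd i))" using that by (cases "K u") (auto simp: i_def dom_def)
    have "nb g u = fst i \<and> pal g u = fst (snd i) \<and> (\<forall>c. w (u, c) = dec (p_b p) (snd (snd i)) c)"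
      using assms K unfolding cons_def by blast
    moreover have "nb g' u = fst i \<and> pal g' u = fst (snd i) \<and> (\<forall>c. w' (u, c) = dec (p_b p) (snd (snd i)) c)"
      using c K unfolding cons_def by blast
    ultimately show ?thesis using assms c by (simp add: cons_def same_def)
  qed
  then show "eqv (dom K) g w g' w'" using assms c by (simp add: eqv_def cons_def)
next
  assume e: "eqv (dom K) g w g' w'"
  show "cons p K g' w'"
    unfolding cons_def
  proof (intro conjI allI impI)
    fix u N P f assume K: "K u = Some (N, P, f)"
    then have "same g w g' w' u" using e by (auto simp: eqv_def)
    then show "nb g' u = N" "pal g' u = P" "w' (u, c) = dec (p_b p) f c" for c
      using assms K by (auto simp: cons_def same_def)
  qed (use e assms in \<open>auto simp: eqv_def cons_def\<close>)
qed

lemma nxt_Some: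
  assumes "cons p K g w" "nxt p v K = Some u"
  shows "K u = None" "u \<in> need g w (p_T p) v"
proof -
  let ?P = "\<lambda>u. K u = None \<and> (\<forall>g w. cons p K g w \<longrightarrow> u \<in> need g w (p_T p) v)"
  have "\<exists>u. ?P u" "u = (SOME u. ?P u)" using assms(2) by (auto simp: nxt_def Let_def split: if_splits)
  then have "?P u" using someI_ex[of ?P] by simp
  then show "K u = None" "u \<in> need g w (p_T p) v" using assms(1) by auto
qed

lemma nxt_None:
  assumes c: "cons p K g w" and n: "nxt p v K = None"
  shows "outp p v K = final g w (p_T p) v"
proof -
  have forced: "u \<in> dom K" if "\<And>g' w'. eqv (dom K) g w g' w' \<Longrightarrow> u \<in> need g' w' (p_T p) v" for u
  proof (rule ccontr)
    assume "u \<notin> dom K"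
    then have "\<exists>u. K u = None \<and> (\<forall>g w. cons p K g w \<longrightarrow> u \<in> need g w (p_T p) v)"
      using that cons_eqv[OF c] unfolding domIff by metis
    then show False using n by (simp add: nxt_def Let_def split: if_splits)
  qed
  have "case (SOME (g, w). cons p K g w) of (g, w) \<Rightarrow> cons p K g w"
    by (rule someI_ex) (use c in auto)
  then obtain g' w' where s: "(SOME (g, w). cons p K g w) = (g', w')" "cons p K g' w'" by (cases "SOME (g, w). cons p K g w") auto
  have "final g w (p_T p) v = final g' w' (p_T p) v"
    using forced_final[OF forced] cons_eqv[OF c] s(2) by blast
  then show ?thesis by (simp add: outp_def s(1))
qed

text \<open>Invariant: all that is known is true and concerns vertices needed under the true input.
  Hence only vertices are addressed, and every vertex read shrinks the set of needed but unknown
  ones, so a counter above its size is never exhausted.\<close>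

lemma lp_correct:
  assumes I: "list_coloring_input I" "p_dg p = max_degree I" and v: "v \<in> verts I"
    and K: "\<And>u i. K u = Some i \<Longrightarrow> u \<in> need (gr_of p I) (seeds_of p r) (p_T p) v \<and> i = info_of p I r u"
  shows "legal_run I r (lp p v n K)" "queries I r (lp p v n K) \<le> n * p_dg p"
    "card (need (gr_of p I) (seeds_of p r) (p_T p) v - dom K) < n \<Longrightarrow>
      run I r (lp p v n K) = final (gr_of p I) (seeds_of p r) (p_T p) v"
proof -
  let ?g = "gr_of p I" and ?w = "seeds_of p r"
  let ?N = "need ?g ?w (p_T p) v"
  note G = gph_of[OF I]
  have NV: "?N \<subseteq> verts I" by (rule gph.need_V[OF G v])
  have finV: "finite (verts I)" by (rule gph.finV[OF G])
  have "legal_run I r (lp p v n K) \<and> queries I r (lp p v n K) \<le> n * p_dg p \<and>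
    (card (?N - dom K) < n \<longrightarrow> run I r (lp p v n K) = final ?g ?w (p_T p) v)"
    using K
  proof (induction n arbitrary: K)
    case (Suc n)
    have c: "cons p K ?g ?w"
      unfolding cons_def
    proof (intro conjI allI impI)
      fix u A B f assume "K u = Some (A, B, f)"
      from Suc.prems[OF this] have "u \<in> verts I" "(A, B, f) = info_of p I r u" using NV by blast+
      then have i: "u \<in> verts I" "A = set (nbrs I u)" "B = palette I u" "f = bitsof (p_b p * (3 + p_T p)) (r u)"
        unfolding info_of_def by blast+
      show "nb ?g u = A" "pal ?g u = B" unfolding i(2,3) gr_of_def using i(1) by simp_all
      show "?w (u, c) = dec (p_b p) f c" for c unfolding i(4) seeds_of_def by simp
    qed (auto simp: gr_of_def)
    show ?case
    proof (cases "nxt p v K")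
      case None
      then show ?thesis using nxt_None[OF c None] by simp
    next
      case (Some u)
      note u = nxt_Some[OF c Some]
      have uV: "u \<in> verts I" using u NV by blast
      let ?K = "K(u \<mapsto> info_of p I r u)"
      have "card (nb ?g u) \<le> p_dg p" using gph.nb_deg[OF G uV] uV by (simp add: gr_of_def)
      then have "length (nbrs I u) \<le> p_dg p"
        using I uV distinct_card[of "nbrs I u"] by (simp add: gr_of_def list_coloring_input_def)
      then have t: "set (take (p_dg p) (nbrs I u)) = set (nbrs I u)" by simp
      have IH: "legal_run I r (lp p v n ?K) \<and> queries I r (lp p v n ?K) \<le> n * p_dg p \<and>
        (card (?N - dom ?K) < n \<longrightarrow> run I r (lp p v n ?K) = final ?g ?w (p_T p) v)"
      proof (rule Suc.IH)
        fix x i assume "?K x = Some i"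
        then show "x \<in> ?N \<and> i = info_of p I r x" using Suc.prems[of x i] u by (auto split: if_splits)
      qed
      have "card (?N - dom ?K) < n" if "card (?N - dom K) < Suc n"
      proof -
        have "?N - dom ?K = (?N - dom K) - {u}" by auto
        moreover have "u \<in> ?N - dom K" using u by auto
        moreover have "finite (?N - dom K)" using finite_subset[OF NV finV] by simp
        ultimately have "card (?N - dom ?K) = card (?N - dom K) - 1" "0 < card (?N - dom K)"
          by (auto simp: card_gt_0_iff)
        then show ?thesis using that by linarith
      qed
      then show ?thesis using IH Some uV I(2)
        by (simp add: qnb_sem qbits_sem t[unfolded I(2)] info_of_def[symmetric])
    qed
  qed simp
  then show "legal_run I r (lp p v n K)" "queries I r (lp p v n K) \<le> n * p_dg p"
    "card (?N - dom K) < n \<Longrightarrow> run I r (lp p v n K) = final ?g ?w (p_T p) v" by auto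
qed

section \<open>Random strings\<close>

lemma binary_sum_iff:
  fixes x :: nat
  assumes "x < 2 ^ b"
  shows "(\<Sum>j<b. of_bool (f j) * 2 ^ j) = x \<longleftrightarrow> (\<forall>j<b. f j = bit x j)"
proof -
  have S: "(\<Sum>j<b. of_bool (f j) * 2 ^ j) = (horner_sum of_bool 2 (map f [0..<b]) :: nat)"
    by (simp add: horner_sum_eq_sum atLeast0LessThan)
  have "take_bit b x = x" using assms by (simp add: take_bit_nat_eq_self)
  then have x: "bit x j \<Longrightarrow> j < b" for j by (metis bit_take_bit_iff)
  have "bit (horner_sum of_bool 2 (map f [0..<b]) :: nat) j \<longleftrightarrow> j < b \<and> f j" for j
    by (auto simp: bit_horner_sum_bit_iff)
  then show ?thesis unfolding S bit_eq_iff[of _ x] using x by fastforce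
qed

lemma dec_less: "dec b f c < 2 ^ b"
proof -
  have "dec b f c = horner_sum of_bool 2 (map (\<lambda>j. f (c * b + j)) [0..<b])"
    by (simp add: dec_def horner_sum_eq_sum atLeast0LessThan)
  also have "\<dots> = take_bit b (horner_sum of_bool 2 (map (\<lambda>j. f (c * b + j)) [0..<b]))"
    by (simp add: take_bit_horner_sum_bit_eq)
  finally show ?thesis using take_bit_nat_less_exp by metis
qed

abbreviation bit_strings :: "(nat \<Rightarrow> bool) measure" where
  "bit_strings \<equiv> \<Pi>\<^sub>M j\<in>(UNIV :: nat set). measure_pmf (bernoulli_pmf (1 / 2))"

lemma bit_strings_cylinder:
  assumes "finite K"
  shows "emeasure bit_strings {f \<in> space bit_strings. \<forall>j\<in>K. f j \<in> {x j}} = ennreal ((1 / 2) ^ card K)"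
    "{f \<in> space bit_strings. \<forall>j\<in>K. f j \<in> {x j}} \<in> sets bit_strings"
proof -
  interpret product_prob_space "\<lambda>_ :: nat. measure_pmf (bernoulli_pmf (1 / 2))" UNIV
    by (intro product_prob_spaceI prob_space_measure_pmf)
  have "emeasure bit_strings {f \<in> space bit_strings. \<forall>j\<in>K. f j \<in> {x j}} = (\<Prod>j\<in>K. ennreal (1 / 2))"
    using assms by (subst emeasure_PiM_Collect) (auto simp: emeasure_pmf_single intro!: prod.cong)
  also have "\<dots> = ennreal (\<Prod>j\<in>K. 1 / 2)" by (rule prod_ennreal) simp
  finally show "emeasure bit_strings {f \<in> space bit_strings. \<forall>j\<in>K. f j \<in> {x j}} = ennreal ((1 / 2) ^ card K)"
    by (simp only: prod_constant)
  show "{f \<in> space bit_strings. \<forall>j\<in>K. f j \<in> {x j}} \<in> sets bit_strings"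
    using assms by (intro sets.sets_Collect_finite_All measurable_sets_Collect[OF measurable_component_singleton]) auto
qed

lemma prob_space_random_strings: "prob_space (random_strings I)"
  unfolding random_strings_def by (intro prob_space_PiM prob_space_measure_pmf)

lemma random_strings_cylinder:
  assumes V: "finite (verts I)"
  shows "emeasure (random_strings I) {r \<in> space (random_strings I). \<forall>u\<in>verts I. \<forall>j<m. r u j = x u j} = ennreal ((1 / 2) ^ (m * card (verts I)))"
    "{r \<in> space (random_strings I). \<forall>u\<in>verts I. \<forall>j<m. r u j = x u j} \<in> sets (random_strings I)"
proof -
  let ?E = "\<lambda>u. {f \<in> space bit_strings. \<forall>j\<in>{..<m}. f j \<in> {x u j}}"
  interpret product_prob_space "\<lambda>_ :: nat. bit_strings" "verts I"
    by (intro product_prob_spaceI prob_space_PiM prob_space_measure_pmf)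
  have eq: "{r \<in> space (random_strings I). \<forall>u\<in>verts I. \<forall>j<m. r u j = x u j} = {r \<in> space (random_strings I). \<forall>u\<in>verts I. r u \<in> ?E u}"
    by (auto simp: space_PiM)
  have E: "?E u \<in> sets bit_strings" for u by (rule bit_strings_cylinder) simp
  have "emeasure (random_strings I) {r \<in> space (random_strings I). \<forall>u\<in>verts I. r u \<in> ?E u} = (\<Prod>u\<in>verts I. emeasure bit_strings (?E u))"
    unfolding random_strings_def by (rule emeasure_PiM_Collect[OF order_refl V E])
  also have "\<dots> = (\<Prod>u\<in>verts I. ennreal ((1 / 2) ^ m))"
    using bit_strings_cylinder(1)[of "{..<m}"] by (intro prod.cong) auto
  also have "\<dots> = ennreal (\<Prod>u\<in>verts I. (1 / 2) ^ m)" by (rule prod_ennreal) simp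
  also have "\<dots> = ennreal ((1 / 2) ^ (m * card (verts I)))" by (simp only: prod_constant power_mult)
  finally show "emeasure (random_strings I) {r \<in> space (random_strings I). \<forall>u\<in>verts I. \<forall>j<m. r u j = x u j} = ennreal ((1 / 2) ^ (m * card (verts I)))"
    unfolding eq .
  show "{r \<in> space (random_strings I). \<forall>u\<in>verts I. \<forall>j<m. r u j = x u j} \<in> sets (random_strings I)"
    unfolding eq
  proof (rule sets.sets_Collect_finite_All[OF _ V])
    fix u assume u: "u \<in> verts I"
    have "{f \<in> space bit_strings. f \<in> ?E u} = ?E u" by (simp only: mem_Collect_eq conj.left_idem)
    then have "{f \<in> space bit_strings. f \<in> ?E u} \<in> sets bit_strings" using E[of u] by (simp only:)
    then show "{r \<in> space (random_strings I). r u \<in> ?E u} \<in> sets (random_strings I)"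
      unfolding random_strings_def by (rule measurable_sets_Collect[OF measurable_component_singleton[OF u]])
  qed
qed

text \<open>Passage from the product measure to finite averages. An outcome of the seeds is a
  cylinder fixing the first bits of every vertex; all these cylinders have equal measure, and the
  event is a finite disjoint union of them.\<close>

lemma random_strings_seeds:
  assumes V: "finite (verts I)" and J: "J = verts I \<times> {..<3 + p_T p}"
  shows "measure (random_strings I) {r \<in> space (random_strings I). G (restrict (seeds_of p r) J)} = prb (2 ^ p_b p) J G"
    "{r \<in> space (random_strings I). G (restrict (seeds_of p r) J)} \<in> sets (random_strings I)"
proof -
  let ?N = "random_strings I" and ?b = "p_b p" and ?L = "3 + p_T p"
  interpret prob_space ?N by (rule prob_space_random_strings)
  let ?m = "?b * ?L"
  define Q where "Q = {s \<in> PiE J (\<lambda>_. {..<2 ^ ?b :: nat}). G s}"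
  define cyl where "cyl s = {r \<in> space ?N. \<forall>u\<in>verts I. \<forall>j<?m. r u j = bit (s (u, j div ?b)) (j mod ?b)}" for s :: seeds
  have finJ: "finite J" using V J by simp
  then have finQ: "finite Q" unfolding Q_def by (intro finite_subset[OF Collect_subset]) (auto simp: Q_def intro!: finite_PiE)
  have cyl: "r \<in> cyl s \<longleftrightarrow> r \<in> space ?N \<and> restrict (seeds_of p r) J = s" if s: "s \<in> PiE J (\<lambda>_. {..<2 ^ ?b :: nat})" for r s
  proof -
    have "restrict (seeds_of p r) J = s \<longleftrightarrow> (\<forall>q\<in>J. seeds_of p r q = s q)"
    proof
      assume "\<forall>q\<in>J. seeds_of p r q = s q"
      then show "restrict (seeds_of p r) J = s" using s by (intro ext) (auto simp: restrict_def PiE_def extensional_def)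
    qed (auto simp: restrict_def fun_eq_iff split: if_splits)
    also have "\<dots> \<longleftrightarrow> (\<forall>u\<in>verts I. \<forall>c<?L. \<forall>j<?b. bitsof ?m (r u) (c * ?b + j) = bit (s (u, c)) j)"
    proof -
      have "(seeds_of p r (u, c) = s (u, c)) = (\<forall>j<?b. bitsof ?m (r u) (c * ?b + j) = bit (s (u, c)) j)"
        if "u \<in> verts I" "c < ?L" for u c
      proof -
        have "s (u, c) < 2 ^ ?b" using s that by (auto simp: J)
        from binary_sum_iff[OF this] show ?thesis by (simp add: seeds_of_def dec_def)
      qed
      then show ?thesis by (auto simp: J)
    qed
    also have "\<dots> \<longleftrightarrow> (\<forall>u\<in>verts I. \<forall>i<?m. r u i = bit (s (u, i div ?b)) (i mod ?b))"
    proof (intro ball_cong refl, rule iffI; intro allI impI)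
      fix u i assume a: "\<forall>c<?L. \<forall>j<?b. bitsof ?m (r u) (c * ?b + j) = bit (s (u, c)) j" and i: "i < ?m"
      then have "0 < ?b" by (cases "?b = 0") auto
      moreover have "i div ?b < ?L" using i by (simp add: less_mult_imp_div_less mult.commute)
      ultimately have "bitsof ?m (r u) (i div ?b * ?b + i mod ?b) = bit (s (u, i div ?b)) (i mod ?b)"
        using a mod_less_divisor by blast
      then show "r u i = bit (s (u, i div ?b)) (i mod ?b)" using i by (simp add: bitsof_def)
    next
      fix u c j assume a: "\<forall>i<?m. r u i = bit (s (u, i div ?b)) (i mod ?b)" and c: "c < ?L" and j: "j < ?b"
      have "c * ?b + j < Suc c * ?b" using j by simp
      also have "\<dots> \<le> ?L * ?b" using c by (intro mult_le_mono1) simp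
      finally have "c * ?b + j < ?m" by (simp add: mult.commute)
      moreover have "(c * ?b + j) div ?b = c" "(c * ?b + j) mod ?b = j" using j by simp_all
      ultimately show "bitsof ?m (r u) (c * ?b + j) = bit (s (u, c)) j" using a by (simp add: bitsof_def)
    qed
    finally show ?thesis unfolding cyl_def by blast
  qed
  have in_PiE: "restrict (seeds_of p r) J \<in> PiE J (\<lambda>_. {..<2 ^ ?b :: nat})" for r
    using dec_less by (auto simp: seeds_of_def)
  have U: "{r \<in> space ?N. G (restrict (seeds_of p r) J)} = (\<Union>s\<in>Q. cyl s)"
    using cyl in_PiE unfolding Q_def by auto
  have cs: "cyl s \<in> sets ?N" for s unfolding cyl_def by (rule random_strings_cylinder(2)[OF V])
  show "{r \<in> space ?N. G (restrict (seeds_of p r) J)} \<in> sets ?N" unfolding U using finQ cs by auto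
  have "measure ?N (\<Union>s\<in>Q. cyl s) = (\<Sum>s\<in>Q. measure ?N (cyl s))"
  proof (rule finite_measure_finite_Union[OF finQ])
    show "disjoint_family_on cyl Q"
      unfolding disjoint_family_on_def
    proof (intro ballI impI)
      fix s s' assume "s \<in> Q" "s' \<in> Q" and ne: "s \<noteq> s'"
      then have "s \<in> PiE J (\<lambda>_. {..<2 ^ ?b})" "s' \<in> PiE J (\<lambda>_. {..<2 ^ ?b})" unfolding Q_def by blast+
      then have "r \<notin> cyl s \<or> r \<notin> cyl s'" for r using cyl[of s r] cyl[of s' r] ne by metis
      then show "cyl s \<inter> cyl s' = {}" by blast
    qed
  qed (use cs in auto)
  also have "\<dots> = (\<Sum>s\<in>Q. (1 / 2) ^ (?m * card (verts I)))"
    unfolding cyl_def measure_def random_strings_cylinder(1)[OF V] by simp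
  also have "\<dots> = (\<Sum>s\<in>PiE J (\<lambda>_. {..<2 ^ ?b}). of_bool (G s) * (1 / 2) ^ (?m * card (verts I)))"
    unfolding Q_def using finJ by (subst sum.inter_filter) (auto intro!: sum.cong finite_PiE)
  also have "\<dots> = prb (2 ^ ?b) J G"
  proof -
    have "real (2 ^ ?b) ^ card J = 2 ^ (?m * card (verts I))"
      by (simp add: J card_cartesian_product power_mult[symmetric] ac_simps)
    then show ?thesis unfolding avg_def sum_distrib_right[symmetric] by (simp add: power_one_over divide_simps)
  qed
  finally show "measure ?N {r \<in> space ?N. G (restrict (seeds_of p r) J)} = prb (2 ^ ?b) J G" unfolding U .
qed

text \<open>Induction on the decision tree. Legality belongs to the event because the bits of
  \<open>v\<close> are coordinates of the product space only if \<open>v\<close> is a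
  vertex.\<close>

lemma run_event: "{r \<in> space (random_strings I). legal_run I r t \<and> run I r t = c} \<in> sets (random_strings I)"
proof (induction t)
  case (Output x)
  then show ?case by (cases "x = c") auto
next
  case (Degree_Query v f)
  have "{r \<in> space (random_strings I). legal_run I r (Degree_Query v f) \<and> run I r (Degree_Query v f) = c} =
    (if v \<in> verts I then {r \<in> space (random_strings I). legal_run I r (f (degree I v)) \<and> run I r (f (degree I v)) = c} else {})" by auto
  then show ?case using Degree_Query[of "f (degree I v)"] by simp
next
  case (Neighbor_Query v i f)
  have "{r \<in> space (random_strings I). legal_run I r (Neighbor_Query v i f) \<and> run I r (Neighbor_Query v i f) = c} =
    (if v \<in> verts I \<and> 1 \<le> i \<and> i \<le> max_degree I then {r \<in> space (random_strings I). legal_run I r (f (neighbor_answer I v i)) \<and> run I r (f (neighbor_answer I v i)) = c} else {})" by auto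
  then show ?case using Neighbor_Query[of "f (neighbor_answer I v i)"] by simp
next
  case (Read_List v f)
  have "{r \<in> space (random_strings I). legal_run I r (Read_List v f) \<and> run I r (Read_List v f) = c} =
    (if v \<in> verts I then {r \<in> space (random_strings I). legal_run I r (f (palette I v)) \<and> run I r (f (palette I v)) = c} else {})" by auto
  then show ?case using Read_List[of "f (palette I v)"] by simp
next
  case (Read_Bit v j f)
  let ?N = "random_strings I"
  let ?R = "\<lambda>x. {r \<in> space ?N. legal_run I r (f x) \<and> run I r (f x) = c}"
  show ?case
  proof (cases "v \<in> verts I")
    case True
    have "(\<lambda>r. r v) \<in> measurable ?N bit_strings"
      unfolding random_strings_def using True by (rule measurable_component_singleton)
    moreover have "(\<lambda>f. f j) \<in> measurable bit_strings (measure_pmf (bernoulli_pmf (1 / 2)))"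
      by (rule measurable_component_singleton) simp
    ultimately have "(\<lambda>r. r v j) \<in> measurable ?N (measure_pmf (bernoulli_pmf (1 / 2)))"
      by (rule measurable_compose)
    then have B: "{r \<in> space ?N. r v j \<in> {x}} \<in> sets ?N" for x
      by (rule measurable_sets_Collect) simp
    have "{r \<in> space ?N. legal_run I r (Read_Bit v j f) \<and> run I r (Read_Bit v j f) = c} =
      ({r \<in> space ?N. r v j \<in> {True}} \<inter> ?R True) \<union> ({r \<in> space ?N. r v j \<in> {False}} \<inter> ?R False)"
    proof (intro set_eqI)
      fix r show "r \<in> {r \<in> space ?N. legal_run I r (Read_Bit v j f) \<and> run I r (Read_Bit v j f) = c} \<longleftrightarrow>
        r \<in> ({r \<in> space ?N. r v j \<in> {True}} \<inter> ?R True) \<union> ({r \<in> space ?N. r v j \<in> {False}} \<inter> ?R False)"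
        using True by (cases "r v j") auto
    qed
    moreover have "?R x \<in> sets ?N" for x by (rule Read_Bit) simp
    ultimately show ?thesis using B by (simp only: sets.Un sets.Int)
  qed simp
qed

lemma proper_event:
  assumes "finite (verts I)" "\<And>v r. v \<in> verts I \<Longrightarrow> legal_run I r (t v)"
  shows "{r \<in> space (random_strings I). proper_list_coloring I (\<lambda>v. run I r (t v))} \<in> sets (random_strings I)"
proof -
  let ?N = "random_strings I"
  have E: "{r \<in> space ?N. run I r (t v) = c} \<in> sets ?N" if "v \<in> verts I" for v c
    using run_event[of I "t v" c] assms(2)[OF that] by simp
  have P: "{r \<in> space ?N. run I r (t v) \<in> palette I v} \<in> sets ?N" if "v \<in> verts I" for v
  proof -
    have "{r \<in> space ?N. run I r (t v) \<in> palette I v} = (\<Union>c\<in>palette I v. {r \<in> space ?N. run I r (t v) = c})" by auto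
    then show ?thesis using E[OF that] by (auto intro!: sets.countable_UN'[OF countableI_type])
  qed
  have D: "{r \<in> space ?N. adj I u v \<longrightarrow> run I r (t u) \<noteq> run I r (t v)} \<in> sets ?N" if "u \<in> verts I" "v \<in> verts I" for u v
  proof (cases "adj I u v")
    case True
    then have "{r \<in> space ?N. adj I u v \<longrightarrow> run I r (t u) \<noteq> run I r (t v)} =
      space ?N - (\<Union>c. {r \<in> space ?N. run I r (t u) = c} \<inter> {r \<in> space ?N. run I r (t v) = c})" by auto
    moreover have "(\<Union>c. {r \<in> space ?N. run I r (t u) = c} \<inter> {r \<in> space ?N. run I r (t v) = c}) \<in> sets ?N"
      by (rule sets.countable_UN) (use E that in blast)
    ultimately show ?thesis by simp
  qed simp
  show ?thesis unfolding proper_list_coloring_def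
    using assms(1) P D by (intro sets.sets_Collect_conj sets.sets_Collect_finite_All) auto
qed

section \<open>Shattering\<close>

lemma bll_Suc: "bll g k u \<subseteq> bll g (Suc k) u"
proof (induction k arbitrary: u)
  case (Suc k)
  then have "bll g k z \<subseteq> bll g (Suc k) z" for z .
  then show ?case by fastforce
qed simp

lemma bll_mono: "j \<le> k \<Longrightarrow> bll g j u \<subseteq> bll g k u"
  using lift_Suc_mono_le[of "\<lambda>k. bll g k u" j k] bll_Suc by blast

lemma bll_trans: "y \<in> bll g j x \<Longrightarrow> z \<in> bll g k y \<Longrightarrow> z \<in> bll g (j + k) x"
proof (induction j arbitrary: x)
  case (Suc j)
  show ?case
  proof (cases "y = x")
    case True
    then show ?thesis using Suc.prems(2) bll_mono[of k "Suc j + k" g x] by auto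
  next
    case False
    then obtain u where "u \<in> nb g x" "y \<in> bll g j u" using Suc.prems(1) by auto
    then show ?thesis using Suc by auto
  qed
qed simp

lemma bll_trans': "y \<in> bll g j x \<Longrightarrow> z \<in> bll g k y \<Longrightarrow> j + k = l \<Longrightarrow> z \<in> bll g l x"
  using bll_trans by blast

lemma bll_nb: "z \<in> insert x (nb g x) \<Longrightarrow> z \<in> bll g (Suc 0) x"
  by auto

definition bad :: "gr \<Rightarrow> seeds \<Rightarrow> nat \<Rightarrow> nat \<Rightarrow> bool" where
  "bad g w T v \<longleftrightarrow> tot g w T v = None \<and> \<not> ps g w v"

text \<open>Radius 10 covers both the radius 9 that determines \<open>prebad\<close> and the closed
  neighborhoods on which the rounds depend.\<close>

definition separated :: "gr \<Rightarrow> nat set \<Rightarrow> bool" where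
  "separated g S \<longleftrightarrow> (\<forall>x\<in>S. \<forall>y\<in>S. x \<noteq> y \<longrightarrow> bll g 10 x \<inter> bll g 10 y = {})"

text \<open>Two bad vertices that are joined by vertices put aside are at distance at most 4, because
  adjacent vertices that are put aside share their cluster.\<close>

inductive_set spread :: "gr \<Rightarrow> seeds \<Rightarrow> nat \<Rightarrow> nat \<Rightarrow> nat set" for g w T v where
  spread_self: "v \<in> spread g w T v"
| spread_step: "x \<in> spread g w T v \<Longrightarrow> y \<in> bll g 4 x \<Longrightarrow> bad g w T y \<Longrightarrow> y \<in> spread g w T v"

primrec walks :: "gr \<Rightarrow> nat \<Rightarrow> nat \<Rightarrow> nat \<Rightarrow> nat list set" where
  "walks g d 0 x = {[x]}"
| "walks g d (Suc k) x = (\<Union>z\<in>bll g d x. (#) x ` walks g d k z)"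

lemma walks_iff:
  "ws \<in> walks g d k x \<longleftrightarrow> length ws = Suc k \<and> hd ws = x \<and> successively (\<lambda>x y. y \<in> bll g d x) ws"
proof (induction k arbitrary: ws x)
  case 0
  show ?case by (cases ws) auto
next
  case (Suc k)
  show ?case
  proof (cases ws)
    case (Cons y ys)
    then show ?thesis using Suc[of ys] by (cases ys) auto
  qed auto
qed

lemma walks_pad: "ws \<in> walks g d k x \<Longrightarrow> k \<le> l \<Longrightarrow> \<exists>ws'\<in>walks g d l x. set ws' = set ws"
proof (induction l)
  case (Suc l)
  show ?case
  proof (cases "k = Suc l")
    case False
    then obtain ws' where "ws' \<in> walks g d l x" "set ws' = set ws" using Suc by auto
    moreover from this have "x \<in> set ws" by (cases ws') (auto simp: walks_iff)
    ultimately show ?thesis by (intro bexI[of _ "x # ws'"]) auto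
  qed (use Suc.prems in blast)
qed auto

text \<open>A detour from \<open>x\<close> to \<open>s\<close> and back. Growing a tree costs two
  steps per vertex, so counting walks replaces counting trees.\<close>

lemma walk_insert:
  assumes ws: "ws \<in> walks g d k v" and x: "x \<in> set ws" "s \<in> bll g d x" "x \<in> bll g d s"
  shows "\<exists>ws'\<in>walks g d (k + 2) v. set ws' = insert s (set ws)"
proof -
  obtain xs ys where xy: "ws = xs @ x # ys" using x(1) by (metis split_list)
  let ?ws = "xs @ x # s # x # ys"
  have "hd ?ws = v" using ws xy by (cases xs) (auto simp: walks_iff)
  moreover have "successively (\<lambda>x y. y \<in> bll g d x) ?ws"
    using ws x by (simp add: walks_iff xy successively_append_iff)
  ultimately have "?ws \<in> walks g d (k + 2) v" using ws xy unfolding walks_iff by simp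
  then show ?thesis by (rule bexI[rotated]) (auto simp: xy)
qed

section \<open>Walks through many separated left-over vertices\<close>

context gph
begin

lemma bll_sym: "x \<in> V \<Longrightarrow> z \<in> bll g k x \<Longrightarrow> x \<in> bll g k z"
proof (induction k arbitrary: x)
  case (Suc k)
  show ?case
  proof (cases "z = x")
    case False
    then obtain y where y: "y \<in> nb g x" "z \<in> bll g k y" using Suc.prems by auto
    have yV: "y \<in> V" using y Suc.prems nbV by blast
    have "y \<in> bll g k z" using Suc.IH[OF yV y(2)] .
    moreover have "x \<in> bll g (Suc 0) y" using nb_sym[OF Suc.prems(1) y(1)] by simp
    ultimately show ?thesis using bll_trans[of y g k z x "Suc 0"] by simp
  qed simp
qed simp

lemma bll_fin: "x \<in> V \<Longrightarrow> finite (bll g k x)"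
  using bll_V finV finite_subset by blast

lemma bll_card: "x \<in> V \<Longrightarrow> card (bll g k x) \<le> (dg g + 1) ^ k"
proof (induction k arbitrary: x)
  case (Suc k)
  have "card (bll g (Suc k) x) \<le> Suc (card (\<Union>z\<in>nb g x. bll g k z))" by (simp add: card_insert_le_m1 card_insert_if)
  also have "card (\<Union>z\<in>nb g x. bll g k z) \<le> (\<Sum>z\<in>nb g x. card (bll g k z))"
    using Suc.prems by (intro card_UN_le) simp
  also have "\<dots> \<le> (\<Sum>z\<in>nb g x. (dg g + 1) ^ k)" using Suc nbV by (intro sum_mono) blast
  also have "\<dots> \<le> dg g * (dg g + 1) ^ k" using nb_deg[OF Suc.prems] by (simp only: sum_constant of_nat_id mult_le_mono1)
  also have "Suc (dg g * (dg g + 1) ^ k) \<le> (dg g + 1) ^ Suc k" by simp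
  finally show ?case by simp
qed simp

lemma UN_bll_card:
  assumes "X \<subseteq> V"
  shows "card (\<Union>x\<in>X. bll g k x) \<le> card X * (dg g + 1) ^ k"
proof -
  have "card (\<Union>x\<in>X. bll g k x) \<le> (\<Sum>x\<in>X. card (bll g k x))"
    using finite_subset[OF assms finV] by (rule card_UN_le)
  also have "\<dots> \<le> (\<Sum>x\<in>X. (dg g + 1) ^ k)" using assms bll_card by (intro sum_mono) blast
  finally show ?thesis by simp
qed

lemma walks_card: "x \<in> V \<Longrightarrow> finite (walks g d k x) \<and> card (walks g d k x) \<le> ((dg g + 1) ^ d) ^ k"
proof (induction k arbitrary: x)
  case (Suc k)
  have zV: "z \<in> V" if "z \<in> bll g d x" for z using that bll_V[OF Suc.prems] by blast
  have "card (walks g d (Suc k) x) \<le> (\<Sum>z\<in>bll g d x. card ((#) x ` walks g d k z))"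
    using bll_fin[OF Suc.prems] unfolding walks.simps by (rule card_UN_le)
  also have "\<dots> \<le> (\<Sum>z\<in>bll g d x. ((dg g + 1) ^ d) ^ k)"
    using Suc.IH[OF zV] by (intro sum_mono order_trans[OF card_image_le]) blast+
  also have "\<dots> \<le> (dg g + 1) ^ d * ((dg g + 1) ^ d) ^ k"
    using bll_card[OF Suc.prems, of d] by (simp only: sum_constant of_nat_id mult_le_mono1)
  finally show ?case using bll_fin[OF Suc.prems] Suc.IH[OF zV] by simp
qed simp

lemma walks_V:
  assumes "x \<in> V" "ws \<in> walks g d k x"
  shows "set ws \<subseteq> V"
  using assms
proof (induction k arbitrary: x ws)
  case (Suc k)
  then obtain z ys where z: "z \<in> bll g d x" "ys \<in> walks g d k z" "ws = x # ys" by auto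
  then have "z \<in> V" using bll_V[OF Suc.prems(1)] by blast
  then show ?case using Suc.IH[of z ys] Suc.prems z by simp
qed auto

text \<open>A vertex put aside has no candidate neighbor outside its cluster. So an adjacent
  candidate lies in the same cluster, and clusters are disjoint.\<close>

lemma ps_leader_unique:
  assumes u: "u \<in> V" "z \<in> nb g u"
    and r: "r \<in> insert u (nb g u)" "cand g w r u" "\<forall>z\<in>nb g u - clu g r. \<not> qs g w z"
    and r': "r' \<in> insert z (nb g z)" "cand g w r' z"
  shows "r' = r"
proof -
  have z: "z \<in> V" using u nbV by blast
  have "qs g w z" using r' unfolding qs_def by blast
  then have zr: "z \<in> clu g r" using r(3) u(2) by blast
  have zr': "z \<in> clu g r'" using r'(2) by (simp add: cand_def)
  have V: "r \<in> V" "r' \<in> V" using u(1) z r(1) r'(1) nbV by blast+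
  have "0 < card (nb g u)" using u nb_fin[OF u(1)] by (auto simp: card_gt_0_iff)
  then have "1 \<le> dg g" using nb_deg[OF u(1)] by linarith
  then show ?thesis using clu_unique[OF V(2,1) zr' zr] by simp
qed

text \<open>A stretch of vertices put aside stays within one cluster. The induction therefore
  carries along that the leader is at distance at most 2 from \<open>spread\<close>; its members are
  then within 3, and their neighbors within 4.\<close>

lemma comp_spread:
  assumes v: "v \<in> V" and y: "y \<in> comp g w T v"
  shows "(bad g w T y \<longrightarrow> y \<in> spread g w T v) \<and>
    (\<forall>r. r \<in> insert y (nb g y) \<and> cand g w r y \<longrightarrow> (\<exists>x\<in>spread g w T v. r \<in> bll g 2 x)) \<and>
    (\<exists>x\<in>spread g w T v. y \<in> bll g 4 x)"
  using y
proof induction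
  case comp_self
  have "r \<in> bll g 2 v" if "r \<in> insert v (nb g v)" for r
    using bll_nb[OF that] bll_mono[of "Suc 0" 2 g v] by auto
  then show ?case using spread.spread_self[of v g w T] self_in_bll by blast
next
  case (comp_step y z)
  have yV: "y \<in> V" using comp_V[OF v] comp_step.hyps(1) by blast
  have z1: "z \<in> bll g (Suc 0) y" using bll_nb comp_step.hyps(3) by blast
  show ?case
  proof (cases "ps g w y")
    case False
    then have ys: "y \<in> spread g w T v" using comp_step by (simp add: bad_def)
    have z4: "z \<in> bll g 4 y" using z1 bll_mono[of "Suc 0" 4 g y] by auto
    have "r \<in> bll g 2 y" if "r \<in> insert z (nb g z)" for r
      by (rule bll_trans'[OF z1 bll_nb[OF that]]) simp
    then show ?thesis using ys z4 spread.spread_step[OF ys z4] by blast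
  next
    case True
    then obtain r where r: "r \<in> insert y (nb g y)" "cand g w r y" "\<forall>z\<in>nb g y - clu g r. \<not> qs g w z"
      unfolding ps_def by blast
    then obtain x where x: "x \<in> spread g w T v" "r \<in> bll g 2 x" using comp_step.IH by blast
    have "y \<in> insert r (nb g r)" using r(2) by (auto simp: cand_def clu_def)
    from bll_trans[OF x(2) bll_nb[OF this]] have "y \<in> bll g (2 + Suc 0) x" .
    then have z4: "z \<in> bll g 4 x" by (rule bll_trans'[OF _ z1]) simp
    have "r' = r" if "r' \<in> insert z (nb g z)" "cand g w r' z" for r'
      using ps_leader_unique[OF yV comp_step.hyps(3) r that] .
    then show ?thesis using x z4 spread.spread_step[OF x(1) z4] by blast
  qed
qed

lemma spread_V:
  assumes "v \<in> V"
  shows "spread g w T v \<subseteq> V"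
proof
  fix y assume "y \<in> spread g w T v"
  then show "y \<in> V" using assms bll_V by induction blast+
qed

lemma comp_le_spread:
  assumes "v \<in> V"
  shows "card (comp g w T v) \<le> card (spread g w T v) * (dg g + 1) ^ 4"
proof -
  have "comp g w T v \<subseteq> (\<Union>x\<in>spread g w T v. bll g 4 x)" using comp_spread[OF assms] by blast
  moreover have "finite (\<Union>x\<in>spread g w T v. bll g 4 x)"
    using spread_V[OF assms] finite_subset[OF spread_V[OF assms] finV] bll_fin by blast
  ultimately show ?thesis using UN_bll_card[OF spread_V[OF assms], of 4] card_mono order_trans by meson
qed

text \<open>By their size, the balls of radius 20 around the walk do not cover
  \<open>spread\<close>, so one of its steps leaves them. The new vertex is within 24 of the walk,
  and its ball of radius 10 meets none of the others. The start \<open>v\<close> is left out because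
  it need not be bad.\<close>

lemma separated_walk:
  assumes v: "v \<in> V" and big: "m * (dg g + 1) ^ 20 < card (spread g w T v)" and "i \<le> m"
  shows "\<exists>ws\<in>walks g 24 (2 * i) v. card (set ws - {v}) = i \<and> (\<forall>x\<in>set ws - {v}. bad g w T x) \<and> separated g (set ws - {v})"
  using assms(3)
proof (induction i)
  case 0
  show ?case by (intro bexI[of _ "[v]"]) (auto simp: separated_def)
next
  case (Suc i)
  then obtain ws where ws: "ws \<in> walks g 24 (2 * i) v" "card (set ws - {v}) = i"
    "\<forall>x\<in>set ws - {v}. bad g w T x" "separated g (set ws - {v})" by auto
  have wsV: "set ws \<subseteq> V" by (rule walks_V[OF v ws(1)])
  have vws: "v \<in> set ws" using ws(1) by (cases ws) (auto simp: walks_iff)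
  define K where "K = (\<Union>x\<in>set ws. bll g 20 x)"
  have "card (set ws) = Suc i" using ws(2) vws by (simp add: card_Diff_singleton_if) (metis Suc_pred card_gt_0_iff List.finite_set empty_iff)
  then have "card K \<le> Suc i * (dg g + 1) ^ 20" using UN_bll_card[OF wsV, of 20] by (simp add: K_def)
  also have "\<dots> \<le> m * (dg g + 1) ^ 20" using Suc.prems by (rule mult_le_mono1)
  finally have "card K < card (spread g w T v)" using big by linarith
  moreover have "finite K" unfolding K_def using wsV bll_fin by blast
  ultimately have nK: "\<not> spread g w T v \<subseteq> K" using card_mono by (metis not_le)
  have "\<exists>y'\<in>K. \<exists>y. y \<in> bll g 4 y' \<and> bad g w T y \<and> y \<notin> K"
  proof (rule ccontr)
    assume *: "\<not> ?thesis"
    have "y \<in> K" if "y \<in> spread g w T v" for y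
      using that
    proof induction
      case spread_self
      show ?case unfolding K_def using vws self_in_bll by blast
    qed (use * in blast)
    then show False using nK by blast
  qed
  then obtain y' y x where y: "y \<in> bll g 4 y'" "bad g w T y" "y \<notin> K" and x: "x \<in> set ws" "y' \<in> bll g 20 x"
    unfolding K_def by blast
  have yx: "y \<in> bll g 24 x" using bll_trans[OF x(2) y(1)] by simp
  have xV: "x \<in> V" using x wsV by blast
  obtain ws' where ws': "ws' \<in> walks g 24 (2 * i + 2) v" "set ws' = insert y (set ws)"
    using walk_insert[OF ws(1) x(1) yx bll_sym[OF xV yx]] by blast
  have yn: "y \<notin> bll g 20 s" if "s \<in> set ws" for s using y(3) that unfolding K_def by blast
  then have yw: "y \<notin> set ws" using self_in_bll by blast
  then have S: "set ws' - {v} = insert y (set ws - {v})" using ws'(2) vws by auto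
  have yV: "y \<in> V" using bll_V[OF xV] yx by blast
  have dj: "bll g 10 y \<inter> bll g 10 s = {}" if s: "s \<in> set ws" for s
  proof (rule ccontr)
    assume "bll g 10 y \<inter> bll g 10 s \<noteq> {}"
    then obtain z where z: "z \<in> bll g 10 y" "z \<in> bll g 10 s" by blast
    have "y \<in> bll g (10 + 10) s" using bll_trans[OF z(2) bll_sym[OF yV z(1)]] .
    then show False using yn[OF s] by simp
  qed
  have "separated g (set ws' - {v})"
    unfolding S separated_def
  proof (intro ballI impI)
    fix a c assume "a \<in> insert y (set ws - {v})" "c \<in> insert y (set ws - {v})" "a \<noteq> c"
    then consider "a = y" "c \<in> set ws" | "c = y" "a \<in> set ws" | "a \<in> set ws - {v}" "c \<in> set ws - {v}" by blast
    then show "bll g 10 a \<inter> bll g 10 c = {}"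
    proof cases
      case 3
      then show ?thesis using ws(4) \<open>a \<noteq> c\<close> unfolding separated_def by blast
    qed (use dj in blast)+
  qed
  moreover have "card (set ws' - {v}) = Suc i" unfolding S using ws(2) yw by simp
  moreover have "\<forall>x\<in>set ws' - {v}. bad g w T x" unfolding S using ws(3) y(2) by blast
  ultimately show ?case using ws'(1) by (intro bexI[of _ ws']) auto
qed

lemma comp_walk:
  assumes v: "v \<in> V" and "i < card (comp g w T v)"
  shows "\<exists>ws\<in>walks g (Suc 0) (2 * i) v. set ws \<subseteq> comp g w T v \<and> card (set ws) = Suc i"
  using assms(2)
proof (induction i)
  case 0
  show ?case by (intro bexI[of _ "[v]"]) (auto intro: comp.comp_self)
next
  case (Suc i)
  then obtain ws where ws: "ws \<in> walks g (Suc 0) (2 * i) v" "set ws \<subseteq> comp g w T v" "card (set ws) = Suc i" by auto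
  have "\<not> comp g w T v \<subseteq> set ws" using Suc.prems ws(3) card_mono[of "set ws" "comp g w T v"] by fastforce
  have vws: "v \<in> set ws" using ws(1) by (cases ws) (auto simp: walks_iff)
  have "\<exists>y\<in>set ws. tot g w T y = None \<and> (\<exists>z\<in>nb g y. z \<notin> set ws)"
  proof (rule ccontr)
    assume *: "\<not> ?thesis"
    have "y \<in> set ws" if "y \<in> comp g w T v" for y using that by induction (use vws * in blast)+
    then show False using \<open>\<not> comp g w T v \<subseteq> set ws\<close> by blast
  qed
  then obtain y z where y: "y \<in> set ws" "tot g w T y = None" "z \<in> nb g y" "z \<notin> set ws" by blast
  have yc: "y \<in> comp g w T v" using y ws by blast
  have yV: "y \<in> V" using comp_V[OF v] yc by blast
  have z1: "z \<in> bll g (Suc 0) y" using y(3) bll_nb by blast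
  obtain ws' where ws': "ws' \<in> walks g (Suc 0) (2 * i + 2) v" "set ws' = insert z (set ws)"
    using walk_insert[OF ws(1) y(1) z1 bll_sym[OF yV z1]] by blast
  then show ?case using ws y(4) comp.comp_step[OF yc y(2,3)] by (intro bexI[of _ ws']) auto
qed

end

section \<open>Tail bounds for components and for needed vertices\<close>

context gph_rounds
begin

text \<open>\<open>agr\<close> compares all seeds of a vertex, whereas only those below 3 agree;
  \<open>cut\<close> sets the others to 0, to which \<open>prebad\<close> is insensitive.\<close>

lemma prebad_dep: "dep (\<lambda>w. prebad g w v) (bll g 9 v \<times> {..<3})"
  unfolding dep_def
proof (intro allI impI)
  fix s t :: seeds assume st: "\<forall>q\<in>bll g 9 v \<times> {..<3}. s q = t q"
  define cut where "cut f = (\<lambda>(u, c). if c < 3 then f (u, c) else 0)" for f :: seeds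
  have cut: "prebad g f v = prebad g (cut f) v" for f
    using pre_cong(6)[of f "cut f" g] by (simp add: cut_def)
  have a: "agr 9 g (cut s) g (cut t) v"
    by (rule agr_bll) (use st in \<open>auto simp: same_def cut_def\<close>)
  have "prebad g (cut s) v = prebad g (cut t) v"
    using act_loc(1)[OF a] col2_loc[OF agr_le[OF a, of 8]] ps_loc[OF agr_le[OF a, of 5]] by (simp add: prebad_def)
  then show "prebad g s v = prebad g t v" using cut by simp
qed

lemma bad_cases: "bad g w T v \<Longrightarrow> prebad g w v \<or> act g w v \<and> chi g w T v = None"
  by (auto simp: bad_def prebad_def tot_def split: option.splits)

text \<open>A union bound over the subset of vertices that fail by the end of stage two, the others
  being active and failing in all rounds. Either failure costs \<delta> per vertex, and the 2 ^ card
  S subsets give the factor 2.\<close>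

lemma separated_bad:
  assumes S: "S \<subseteq> V" "separated g S"
    and d0: "\<And>v. v \<in> V \<Longrightarrow> prb (2 ^ b) (V \<times> {..<3}) (\<lambda>w. prebad g w v) \<le> \<delta>"
    and d1: "(1 - 1 / (8 * (real (hh g))\<^sup>2)) ^ T \<le> \<delta>"
  shows "prb (2 ^ b) (V \<times> {..<3 + T}) (\<lambda>w. \<forall>v\<in>S. bad g w T v) \<le> (2 * \<delta>) ^ card S"
proof -
  let ?J = "V \<times> {..<3::nat}" and ?q = "1 - 1 / (8 * (real (hh g))\<^sup>2)"
  have Sfin: "finite S" using S finV finite_subset by blast
  have q0: "0 \<le> ?q"
  proof -
    have "1 \<le> (real (hh g))\<^sup>2" using hh_pos by (simp add: one_le_power)
    then have "1 \<le> 8 * (real (hh g))\<^sup>2" by linarith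
    then show ?thesis by (auto simp: divide_le_eq_1)
  qed
  have sub: "prb (2 ^ b) (V \<times> {..<3 + T}) (\<lambda>w. (\<forall>v\<in>S'. prebad g w v) \<and> (\<forall>v\<in>S - S'. act g w v \<and> chi g w T v = None)) \<le> \<delta> ^ card S"
    if S': "S' \<subseteq> S" for S'
  proof -
    have S'fin: "finite S'" using S' Sfin finite_subset by blast
    have pre: "prb (2 ^ b) ?J (\<lambda>w. \<forall>v\<in>S'. prebad g w v) \<le> \<delta> ^ card S'"
    proof -
      have "of_bool (\<forall>v\<in>S'. prebad g w v) = (\<Prod>v\<in>S'. of_bool (prebad g w v) :: real)" for w
        using S'fin by (induction S' rule: finite_induct) auto
      then have "prb (2 ^ b) ?J (\<lambda>w. \<forall>v\<in>S'. prebad g w v) = avg (2 ^ b) ?J (\<lambda>w. \<Prod>v\<in>S'. of_bool (prebad g w v))" by simp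
      also have "\<dots> = (\<Prod>v\<in>S'. prb (2 ^ b) ?J (\<lambda>w. prebad g w v))"
      proof (rule avg_indep[where K = "\<lambda>v. bll g 9 v \<times> {..<3}"])
        show "dep (\<lambda>w. of_bool (prebad g w v) :: real) (bll g 9 v \<times> {..<3})" for v
          using prebad_dep[of v] unfolding dep_def by (intro allI impI arg_cong[where f = of_bool]) blast
        show "bll g 9 v \<times> {..<3} \<subseteq> ?J" if "v \<in> S'" for v using bll_V[of v 9] that S S' by blast
        fix x y assume "x \<in> S'" "y \<in> S'" "x \<noteq> y"
        then have "bll g 10 x \<inter> bll g 10 y = {}" using S S' unfolding separated_def by blast
        then show "bll g 9 x \<times> {..<3::nat} \<inter> bll g 9 y \<times> {..<3} = {}"
          using bll_mono[of 9 10 g x] bll_mono[of 9 10 g y] by fastforce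
      qed (use finV S'fin in auto)
      also have "\<dots> \<le> (\<Prod>v\<in>S'. \<delta>)"
        using d0 S S' by (intro prod_mono conjI avg_nonneg) auto
      finally show ?thesis by simp
    qed
    have "prb (2 ^ b) (V \<times> {..<3 + T}) (\<lambda>w. (\<forall>v\<in>S'. prebad g w v) \<and> (\<forall>v\<in>S - S'. act g w v \<and> chi g w T v = None))
      \<le> ?q ^ (T * card (S - S')) * prb (2 ^ b) ?J (\<lambda>w. \<forall>v\<in>S'. prebad g w v)"
    proof (rule rounds_fail)
      fix x y assume "x \<in> S - S'" "y \<in> S - S'" "x \<noteq> y"
      then have "bll g 10 x \<inter> bll g 10 y = {}" using S unfolding separated_def by blast
      moreover have "insert x (nb g x) \<subseteq> bll g 10 x" for x using bll_nb[of _ x g] bll_mono[of "Suc 0" 10 g x] by auto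
      ultimately show "insert x (nb g x) \<inter> insert y (nb g y) = {}" by blast
    next
      fix w w' :: seeds assume "\<And>u c. c < 3 \<Longrightarrow> w (u, c) = w' (u, c)"
      then have "prebad g w = prebad g w'" by (rule pre_cong)
      then show "(\<forall>v\<in>S'. prebad g w v) = (\<forall>v\<in>S'. prebad g w' v)" by simp
    qed (use S Sfin in auto)
    also have "\<dots> \<le> \<delta> ^ card (S - S') * \<delta> ^ card S'"
    proof (rule mult_mono[OF _ pre])
      show "?q ^ (T * card (S - S')) \<le> \<delta> ^ card (S - S')"
        unfolding power_mult using d1 q0 by (intro power_mono) auto
      show "0 \<le> \<delta> ^ card (S - S')" using order_trans[OF _ d1, of 0] q0 by simp
    qed (intro avg_nonneg, simp)
    also have "\<dots> = \<delta> ^ card S"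
      using S' S'fin Sfin card_mono[OF Sfin S'] by (simp add: power_add[symmetric] card_Diff_subset)
    finally show ?thesis .
  qed
  have "prb (2 ^ b) (V \<times> {..<3 + T}) (\<lambda>w. \<forall>v\<in>S. bad g w T v) \<le>
    (\<Sum>S'\<in>Pow S. prb (2 ^ b) (V \<times> {..<3 + T}) (\<lambda>w. (\<forall>v\<in>S'. prebad g w v) \<and> (\<forall>v\<in>S - S'. act g w v \<and> chi g w T v = None)))"
  proof (rule prb_union_bound)
    fix w assume a: "\<forall>v\<in>S. bad g w T v"
    show "\<exists>S'\<in>Pow S. (\<forall>v\<in>S'. prebad g w v) \<and> (\<forall>v\<in>S - S'. act g w v \<and> chi g w T v = None)"
    proof (intro bexI[of _ "{v \<in> S. prebad g w v}"] conjI ballI)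
      fix v assume "v \<in> S - {v \<in> S. prebad g w v}"
      then have "bad g w T v" "\<not> prebad g w v" using a by blast+
      then show "act g w v" "chi g w T v = None" using bad_cases by blast+
    qed auto
  qed (use Sfin in simp)
  also have "\<dots> \<le> (\<Sum>S'\<in>Pow S. \<delta> ^ card S)" using sub by (intro sum_mono) blast
  also have "\<dots> = (2 * \<delta>) ^ card S" using Sfin by (simp add: card_Pow power_mult_distrib)
  finally show ?thesis .
qed

text \<open>In the threshold, 24 = 20 + 4 combines the balls of \<open>separated_walk\<close> with
  those of \<open>comp_le_spread\<close>. In the bound, 48 = 2 * 24 stems from two steps of length
  at most 24 per bad vertex.\<close>

lemma comp_prob:
  assumes v: "v \<in> V"
    and d0: "\<And>v. v \<in> V \<Longrightarrow> prb (2 ^ b) (V \<times> {..<3}) (\<lambda>w. prebad g w v) \<le> \<delta>"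
    and d1: "(1 - 1 / (8 * (real (hh g))\<^sup>2)) ^ T \<le> \<delta>" and d: "0 \<le> \<delta>"
  shows "prb (2 ^ b) (V \<times> {..<3 + T}) (\<lambda>w. card (comp g w T v) > m * (dg g + 1) ^ 24) \<le> ((real (dg g) + 1) ^ 48 * (2 * \<delta>)) ^ m"
proof -
  let ?W = "walks g 24 (2 * m) v"
  let ?S = "\<lambda>ws. set ws - {v}"
  have W: "finite ?W" "card ?W \<le> ((dg g + 1) ^ 24) ^ (2 * m)" using walks_card[OF v] by blast+
  have "prb (2 ^ b) (V \<times> {..<3 + T}) (\<lambda>w. card (comp g w T v) > m * (dg g + 1) ^ 24) \<le>
    (\<Sum>ws\<in>?W. prb (2 ^ b) (V \<times> {..<3 + T}) (\<lambda>w. card (?S ws) = m \<and> separated g (?S ws) \<and> (\<forall>x\<in>?S ws. bad g w T x)))"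
  proof (rule prb_union_bound[OF _ W(1)])
    fix w assume "card (comp g w T v) > m * (dg g + 1) ^ 24"
    then have "m * (dg g + 1) ^ 24 < card (spread g w T v) * (dg g + 1) ^ 4"
      using comp_le_spread[OF v, of w T] by linarith
    moreover have "(dg g + 1) ^ 24 = (dg g + 1) ^ 20 * (dg g + 1) ^ 4" unfolding power_add[symmetric] by simp
    ultimately have "m * (dg g + 1) ^ 20 < card (spread g w T v)" by (simp only: mult.assoc[symmetric] mult_less_cancel2)
    from separated_walk[OF v this order_refl]
    show "\<exists>ws\<in>?W. card (?S ws) = m \<and> separated g (?S ws) \<and> (\<forall>x\<in>?S ws. bad g w T x)" by blast
  qed
  also have "\<dots> \<le> (\<Sum>ws\<in>?W. (2 * \<delta>) ^ m)"
  proof (rule sum_mono)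
    fix ws assume ws: "ws \<in> ?W"
    have SV: "?S ws \<subseteq> V" using walks_V[OF v ws] by blast
    show "prb (2 ^ b) (V \<times> {..<3 + T}) (\<lambda>w. card (?S ws) = m \<and> separated g (?S ws) \<and> (\<forall>x\<in>?S ws. bad g w T x)) \<le> (2 * \<delta>) ^ m"
    proof (cases "card (?S ws) = m \<and> separated g (?S ws)")
      case True
      then show ?thesis using separated_bad[OF SV _ d0 d1] by simp
    next
      case False
      then have "prb (2 ^ b) (V \<times> {..<3 + T}) (\<lambda>w. card (?S ws) = m \<and> separated g (?S ws) \<and> (\<forall>x\<in>?S ws. bad g w T x)) = avg (2 ^ b) (V \<times> {..<3 + T}) (\<lambda>_. 0)"
        by (intro arg_cong[where f = "avg _ _"] ext) auto
      also have "\<dots> = 0" by (simp add: avg_def)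
      finally show ?thesis using d by simp
    qed
  qed
  also have "\<dots> = real (card ?W) * (2 * \<delta>) ^ m" by simp
  also have "\<dots> \<le> real (((dg g + 1) ^ 24) ^ (2 * m)) * (2 * \<delta>) ^ m"
    using d by (intro mult_right_mono of_nat_mono W(2)) auto
  also have "\<dots> = ((real (dg g) + 1) ^ 48 * (2 * \<delta>)) ^ m"
    by (simp add: power_mult_distrib power_mult[symmetric] add.commute mult.commute)
  finally show ?thesis .
qed

text \<open>The component is random, so \<open>items_tail\<close> does not apply to it directly. But
  a component of at most \<open>N\<close> vertices is the vertex set of a walk of 2 N steps, and
  there are at most (D + 1)^(2 N) of these. The tail for a fixed walk has to beat this
  number.\<close>

lemma need_prob:
  assumes d0: "\<And>v. v \<in> V \<Longrightarrow> prb (2 ^ b) (V \<times> {..<3}) (\<lambda>w. prebad g w v) \<le> \<delta>"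
    and d1: "(1 - 1 / (8 * (real (hh g))\<^sup>2)) ^ T \<le> \<delta>" and d: "0 \<le> \<delta>" and m: "1 \<le> m"
    and N: "N = m * (dg g + 1) ^ 24"
  shows "prb (2 ^ b) (V \<times> {..<3 + T}) (\<lambda>w. \<exists>v\<in>V. real (card (need g w T v)) > l * (real (dg g) + 1) ^ 10)
    \<le> real (card V) * (((real (dg g) + 1) ^ 48 * (2 * \<delta>)) ^ m +
      (real (dg g) + 1) ^ (2 * N) * exp (real N - l / (4 * 6 ^ T * (real (dg g) + 2))))"
proof -
  let ?P = "\<lambda>E. prb (2 ^ b) (V \<times> {..<3 + T}) E"
  let ?a = "((real (dg g) + 1) ^ 48 * (2 * \<delta>)) ^ m" and ?e = "exp (real N - l / (4 * 6 ^ T * (real (dg g) + 2)))"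
  have N1: "1 \<le> N" unfolding N using m by simp
  have one: "?P (\<lambda>w. real (card (need g w T v)) > l * (real (dg g) + 1) ^ 10) \<le> ?a + (real (dg g) + 1) ^ (2 * N) * ?e"
    if v: "v \<in> V" for v
  proof -
    let ?W = "walks g (Suc 0) (2 * N) v"
    have W: "finite ?W" "card ?W \<le> ((dg g + 1) ^ Suc 0) ^ (2 * N)" using walks_card[OF v] by blast+
    have "?P (\<lambda>w. real (card (need g w T v)) > l * (real (dg g) + 1) ^ 10) \<le>
      ?P (\<lambda>w. card (comp g w T v) > m * (dg g + 1) ^ 24) + ?P (\<lambda>w. \<exists>ws\<in>?W. real (card (items g w T (set ws \<times> {None}))) > l)"
    proof (rule prb_disj)
      fix w assume big: "real (card (need g w T v)) > l * (real (dg g) + 1) ^ 10"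
      show "card (comp g w T v) > m * (dg g + 1) ^ 24 \<or> (\<exists>ws\<in>?W. real (card (items g w T (set ws \<times> {None}))) > l)"
      proof (cases "card (comp g w T v) > m * (dg g + 1) ^ 24")
        case False
        then have cN: "card (comp g w T v) \<le> N" by (simp add: N)
        have cfin: "finite (comp g w T v)" using comp_V[OF v] finV finite_subset by blast
        have c0: "0 < card (comp g w T v)" using cfin comp.comp_self[of v g w T] by (auto simp: card_gt_0_iff)
        then have c1: "card (comp g w T v) - 1 < card (comp g w T v)" by simp
        from comp_walk[OF v c1] obtain ws where ws: "ws \<in> walks g (Suc 0) (2 * (card (comp g w T v) - 1)) v"
          "set ws \<subseteq> comp g w T v" "card (set ws) = Suc (card (comp g w T v) - 1)" by blast
        have "set ws = comp g w T v" using ws c0 by (intro card_subset_eq[OF cfin]) auto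
        moreover have "2 * (card (comp g w T v) - 1) \<le> 2 * N" using cN by simp
        ultimately obtain ws' where ws': "ws' \<in> ?W" "set ws' = comp g w T v" using walks_pad[OF ws(1)] by metis
        let ?I = "items g w T (comp g w T v \<times> {None})"
        have IV: "fst ` ?I \<subseteq> V" using comp_V[OF v] by (intro items_V) auto
        have "okq w' (items g w' i Q)" if "okq w' Q" for w' i Q
          using that by (induction i arbitrary: Q) (auto dest: step_okq)
        moreover have "okq w (comp g w T v \<times> {None})" using comp_V[OF v] cfin by (auto simp: okq_def)
        ultimately have Ifin: "finite ?I" by (auto simp: okq_def)
        have "need g w T v \<subseteq> (\<Union>x\<in>fst ` ?I. bll g 10 x)"
        proof
          fix z assume "z \<in> need g w T v"
          then obtain y x where y: "y \<in> comp g w T v" "x \<in> fst ` items g w T {(y, None)}" "z \<in> bll g 10 x"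
            unfolding need_def by blast
          moreover have "items g w T {(y, None)} \<subseteq> ?I" by (rule items_mono) (use y in auto)
          ultimately show "z \<in> (\<Union>x\<in>fst ` ?I. bll g 10 x)" by blast
        qed
        moreover have "finite (\<Union>x\<in>fst ` ?I. bll g 10 x)" using Ifin IV bll_fin by blast
        ultimately have "card (need g w T v) \<le> card (fst ` ?I) * (dg g + 1) ^ 10"
          using UN_bll_card[OF IV, of 10] card_mono order_trans by meson
        also have "\<dots> \<le> card ?I * (dg g + 1) ^ 10" by (intro mult_le_mono1 card_image_le Ifin)
        finally have "real (card (need g w T v)) \<le> real (card ?I * (dg g + 1) ^ 10)" by (rule of_nat_mono)
        moreover have "real (card ?I * (dg g + 1) ^ 10) = real (card ?I) * (real (dg g) + 1) ^ 10" by (simp add: add.commute)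
        ultimately have "l * (real (dg g) + 1) ^ 10 < real (card ?I) * (real (dg g) + 1) ^ 10" using big by linarith
        then have "l < real (card ?I)" by (rule mult_right_less_imp_less) simp
        then have "l < real (card (items g w T (set ws' \<times> {None})))" unfolding ws'(2) .
        then show ?thesis using ws'(1) by blast
      qed simp
    qed
    also have "?P (\<lambda>w. card (comp g w T v) > m * (dg g + 1) ^ 24) \<le> ?a" by (rule comp_prob[OF v d0 d1 d])
    also have "?P (\<lambda>w. \<exists>ws\<in>?W. real (card (items g w T (set ws \<times> {None}))) > l) \<le>
      (\<Sum>ws\<in>?W. ?P (\<lambda>w. real (card (items g w T (set ws \<times> {None}))) > l))"
      by (rule prb_union_bound[OF _ W(1)])
    also have "\<dots> \<le> (\<Sum>ws\<in>?W. ?e)"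
    proof (rule sum_mono)
      fix ws assume ws: "ws \<in> ?W"
      have "card (set ws) \<le> Suc (2 * N)" using ws card_length[of ws] by (simp add: walks_iff)
      then have "real (card (set ws)) / 4 \<le> real N" using N1 by linarith
      then show "?P (\<lambda>w. real (card (items g w T (set ws \<times> {None}))) > l) \<le> ?e"
        by (intro order_trans[OF items_tail[OF walks_V[OF v ws]]]) simp
    qed
    also have "\<dots> = real (card ?W) * ?e" by simp
    also have "\<dots> \<le> real (((dg g + 1) ^ Suc 0) ^ (2 * N)) * ?e" by (intro mult_right_mono of_nat_mono W(2)) simp
    finally show ?thesis by (simp add: add.commute)
  qed
  have "?P (\<lambda>w. \<exists>v\<in>V. real (card (need g w T v)) > l * (real (dg g) + 1) ^ 10) \<le>
    (\<Sum>v\<in>V. ?P (\<lambda>w. real (card (need g w T v)) > l * (real (dg g) + 1) ^ 10))"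
    by (rule prb_union_bound[OF _ finV])
  also have "\<dots> \<le> (\<Sum>v\<in>V. ?a + (real (dg g) + 1) ^ (2 * N) * ?e)" using one by (intro sum_mono) blast
  finally show ?thesis by simp
qed

end

section \<open>Choice of parameters\<close>

text \<open>Without the first two stages every vertex keeps its palette, which has one color more
  than there can be neighbors. This single spare color is the fraction that activity asks for when
  \<open>hh g\<close> exceeds the degree.\<close>

lemma (in gph) prebad_small:
  assumes "\<not> big g" "dg g + 1 \<le> hh g" "v \<in> V"
  shows "\<not> prebad g w v"
proof -
  have clu: "clu g r = {}" for r using assms(1) by (auto simp: clu_def leader_def)
  then have ps: "\<not> ps g w u" for u by (auto simp: ps_def cand_def)
  have att: "att g w u = None" for u using assms(1) by (simp add: att_def)
  then have c1: "col1 g w u = None" for u by (simp add: col1_def)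
  have asg: "asg g w u = None" for u by (simp add: asg_def mem_def clu)
  have c2: "col2 g w u = None" for u by (simp add: col2_def c1 asg)
  have a2: "card (av2 g w v) = Suc (dg g)" using pal_card[OF assms(3)] by (simp add: av2_def c2)
  have "unc g w v = nb g v" by (auto simp: unc_def c2 ps)
  then have "1 \<le> card (av2 g w v) - card (unc g w v)" using a2 nb_deg[OF assms(3)] by simp
  then have "hh g * 1 \<le> hh g * (card (av2 g w v) - card (unc g w v))" by (rule mult_le_mono2)
  then have "card (av2 g w v) \<le> hh g * (card (av2 g w v) - card (unc g w v))" using a2 assms(2) by linarith
  then have "act g w v" unfolding act_def using a2 c2 ps by simp
  then show ?thesis by (simp add: prebad_def)
qed

text \<open>The exponent beats the number \<open>(D + 1) ^ (24 * (2 * m))\<close> of walks that visit \<open>m\<close> separated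
  vertices in \<open>2 m\<close> steps of length 24.\<close>

definition delt :: "nat \<Rightarrow> real" where
  "delt D = 1 / (6 * (real D + 1) ^ 48)"

lemma perr_small: "\<exists>D0. \<forall>D\<ge>D0. perr D \<le> delt D"
proof -
  have "((\<lambda>x :: real. ((x + 2) * exp (- x / 16) + 5 * exp (- (sqrt (sqrt x) / 2 ^ 35)) + 2 * exp (11 - sqrt (sqrt x))
    + (exp (- ((sqrt (sqrt x))\<^sup>2 / 32)) + exp (- ((sqrt (sqrt x))\<^sup>2 / 4 - 52 * sqrt (sqrt x))))) * (6 * (x + 1) ^ 48)) \<longlongrightarrow> 0) at_top"
    by real_asymp
  from filterlim_compose[OF this filterlim_real_sequentially]
  have "(\<lambda>D. perr D * (6 * (real D + 1) ^ 48)) \<longlonglongrightarrow> 0" unfolding perr_def Let_def .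
  then have "eventually (\<lambda>D. perr D * (6 * (real D + 1) ^ 48) < 1) sequentially"
    by (rule order_tendstoD) simp
  then obtain D0 where D0: "\<forall>D\<ge>D0. perr D * (6 * (real D + 1) ^ 48) < 1" by (auto simp: eventually_sequentially)
  have "perr D \<le> delt D" if "D \<ge> D0" for D
  proof -
    have "0 < 6 * (real D + 1) ^ 48" by (intro mult_pos_pos zero_less_power) auto
    then show ?thesis unfolding delt_def using D0[rule_format, OF that] by (simp only: pos_le_divide_eq)
  qed
  then show ?thesis by blast
qed

text \<open>Shows that 6^T is polynomial in the degree, T being a multiple of log D: 6 is at most
  2^3, and 1152 = 3 * 8 * 48.\<close>

lemma six_pow: "(6 :: real) ^ (8 * h * (2 + 48 * t)) \<le> 6 ^ (16 * h) * (2 ^ t) ^ (1152 * h)"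
proof -
  have "(6 :: real) ^ (8 * h * (2 + 48 * t)) = 6 ^ (16 * h) * 6 ^ (384 * h * t)"
    unfolding power_add[symmetric] by (rule arg_cong[where f = "\<lambda>x. 6 ^ x"]) (simp add: algebra_simps)
  also have "(6 :: real) ^ (384 * h * t) \<le> (2 ^ 3) ^ (384 * h * t)" by (rule power_mono) auto
  also have "((2 :: real) ^ 3) ^ (384 * h * t) = (2 ^ t) ^ (1152 * h)"
    unfolding power_mult[symmetric] by (rule arg_cong[where f = "\<lambda>x. 2 ^ x"]) simp
  finally show ?thesis by simp
qed

text \<open>8 H^2 rounds reduce the failure probability by a factor e, so it ends below exp (- 2 -
  48 t). The two units give the 6 of \<open>delt\<close>, as exp 2 is at least 6, and the others its
  power 48.\<close>

lemma delt_pow: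
  assumes "1 \<le> H" and t: "real D + 1 \<le> 2 ^ t"
  shows "(1 - 1 / (8 * (real H)\<^sup>2)) ^ (8 * H\<^sup>2 * (2 + 48 * t)) \<le> delt D"
proof -
  have H: "1 \<le> (real H)\<^sup>2" using assms(1) by (simp add: one_le_power)
  let ?q = "1 - 1 / (8 * (real H)\<^sup>2)"
  have "0 \<le> ?q" using H by (auto simp: divide_le_eq_1)
  moreover have "?q \<le> exp (- (1 / (8 * (real H)\<^sup>2)))"
    using exp_ge_add_one_self[of "- (1 / (8 * (real H)\<^sup>2))"] by simp
  ultimately have "?q ^ (8 * H\<^sup>2 * (2 + 48 * t)) \<le> exp (- (1 / (8 * (real H)\<^sup>2))) ^ (8 * H\<^sup>2 * (2 + 48 * t))"
    by (intro power_mono)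
  also have "\<dots> = exp (- (2 + 48 * real t))"
  proof -
    have "real (8 * H\<^sup>2 * (2 + 48 * t)) * (- (1 / (8 * (real H)\<^sup>2))) = - (2 + 48 * real t)"
    proof -
      have "a * (2 + 48 * real t) * (- (1 / a)) = - (2 + 48 * real t)" if "a \<noteq> 0" for a :: real using that by simp
      from this[of "8 * (real H)\<^sup>2"] have "8 * (real H)\<^sup>2 * (2 + 48 * real t) * (- (1 / (8 * (real H)\<^sup>2))) = - (2 + 48 * real t)"
        using H by (metis mult_eq_0_iff not_one_le_zero zero_neq_numeral)
      moreover have "real (8 * H\<^sup>2 * (2 + 48 * t)) = 8 * (real H)\<^sup>2 * (2 + 48 * real t)" by (simp add: algebra_simps)
      ultimately show ?thesis by (simp only:)
    qed
    then show ?thesis unfolding exp_of_nat_mult[symmetric] by (simp only:)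
  qed
  also have "\<dots> = 1 / (exp 2 * exp (real t) ^ 48)"
    unfolding exp_of_nat_mult[symmetric] exp_add[symmetric] exp_minus inverse_eq_divide by (simp only: of_nat_numeral)
  also have "\<dots> \<le> 1 / (6 * (real D + 1) ^ 48)"
  proof (intro divide_left_mono mult_mono power_mono)
    have "5 / 2 \<le> exp (1 :: real)" using exp_lower_Taylor_quadratic[of 1] by simp
    then have "(5 / 2) * (5 / 2) \<le> exp 1 * exp (1 :: real)" by (intro mult_mono) auto
    then show "6 \<le> exp (2 :: real)" unfolding exp_add[symmetric] by simp
    have "(2 :: real) ^ t \<le> exp 1 ^ t" using exp_ge_add_one_self[of 1] by (intro power_mono) auto
    then show "real D + 1 \<le> exp (real t)" using t unfolding exp_of_nat_mult[symmetric] by simp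
  qed auto
  finally show ?thesis by (simp add: delt_def)
qed

lemma exp_neg_ln:
  assumes "0 < n"
  shows "exp (- (real j * ln (real n))) = 1 / real n ^ j"
  using assms by (simp add: exp_minus exp_of_nat_mult inverse_eq_divide)

text \<open>Both summands are at most 1 / n^(k + 2): the first because 1/3 is below 1/e, the second
  by the choice of \<open>l\<close>. One factor n goes to the union bound over the vertices, the
  other absorbs the factor 2.\<close>

lemma union_calc:
  fixes x \<delta> l :: real
  assumes n: "2 \<le> n" and x: "0 < x" "x ^ 48 * (2 * \<delta>) = 1 / 3"
    and m: "real (k + 2) * ln (real n) \<le> real m"
    and l: "l = real N + 2 * real N * ln x + real (k + 2) * ln (real n)"
  shows "real n * ((x ^ 48 * (2 * \<delta>)) ^ m + x ^ (2 * N) * exp (real N - l)) \<le> 1 / real n ^ k"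
proof -
  have n0: "0 < n" using n by simp
  let ?e = "1 / real n ^ (k + 2)"
  have "(x ^ 48 * (2 * \<delta>)) ^ m \<le> exp (- 1) ^ m"
    unfolding x(2) using exp_le by (intro power_mono) (simp_all add: exp_minus field_simps)
  also have "\<dots> = exp (- real m)" unfolding exp_of_nat_mult[symmetric] by simp
  also have "\<dots> \<le> exp (- (real (k + 2) * ln (real n)))" using m by simp
  also have "\<dots> = ?e" by (rule exp_neg_ln[OF n0])
  finally have 1: "(x ^ 48 * (2 * \<delta>)) ^ m \<le> ?e" .
  have "x ^ (2 * N) = exp (real (2 * N) * ln x)" using x(1) by (simp only: exp_of_nat_mult exp_ln)
  then have "x ^ (2 * N) * exp (real N - l) = exp (- (real (k + 2) * ln (real n)))"
    unfolding l by (simp only: exp_add[symmetric]) (simp add: algebra_simps)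
  also have "\<dots> = ?e" by (rule exp_neg_ln[OF n0])
  finally have 2: "x ^ (2 * N) * exp (real N - l) = ?e" .
  have "real n * ((x ^ 48 * (2 * \<delta>)) ^ m + x ^ (2 * N) * exp (real N - l)) \<le> real n * (?e + ?e)"
    using add_mono[OF 1 eq_refl[OF 2]] by (rule mult_left_mono) simp
  also have "\<dots> = (2 / real n) * (1 / real n ^ k)" using n0 by (simp add: divide_simps)
  also have "\<dots> \<le> 1 * (1 / real n ^ k)" using n by (intro mult_right_mono) auto
  finally show ?thesis by simp
qed

lemma fuel_calc:
  fixes x y l P L :: real
  assumes x: "2 \<le> x" and L: "1 / 2 \<le> L" and P: "1 \<le> P" and y: "0 \<le> y" "y \<le> x"
    and m: "real m \<le> real (k + 2) * L + 1" and N: "real N = real m * x ^ 24"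
    and l: "l = 4 * P * (x + 1) * (real N + 2 * real N * y + real (k + 2) * L)"
  shows "l * x ^ 10 + 1 \<le> 34 * real (k + 4) * P * L * x ^ 36"
proof -
  let ?K = "real (k + 4) * L"
  have K: "2 \<le> ?K"
  proof -
    have "4 * (1 / 2) \<le> ?K" using L by (intro mult_mono) auto
    then show ?thesis by simp
  qed
  have x1: "1 \<le> x ^ j" for j using x by (simp add: one_le_power)
  have "real (k + 2) * L + 1 \<le> ?K" using L by (simp add: algebra_simps)
  then have mK: "real m \<le> ?K" using m by linarith
  have NK: "real N \<le> ?K * x ^ 24" unfolding N using mK x1[of 24] by (intro mult_right_mono) auto
  have K2: "real (k + 2) * L \<le> ?K * x ^ 24"
  proof -
    have "real (k + 2) * L \<le> ?K * 1" using L by simp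
    also have "\<dots> \<le> ?K * x ^ 24" using K x1 by (intro mult_left_mono) auto
    finally show ?thesis .
  qed
  have "real N * y \<le> (?K * x ^ 24) * x" using NK y x1[of 24] K x by (intro mult_mono) auto
  then have "real N + 2 * real N * y + real (k + 2) * L \<le> ?K * x ^ 24 * (2 + 2 * x)"
    using NK K2 by (simp add: algebra_simps)
  also have "\<dots> \<le> ?K * x ^ 24 * (4 * x)"
    using x L x1[of 24] by (intro mult_left_mono mult_nonneg_nonneg) auto
  finally have s: "real N + 2 * real N * y + real (k + 2) * L \<le> ?K * x ^ 24 * (4 * x)" .
  have "l \<le> 4 * P * (2 * x) * (?K * x ^ 24 * (4 * x))"
    unfolding l using s P x L y by (intro mult_mono) auto
  also have "\<dots> = 32 * P * ?K * x ^ 26" by (simp add: power_numeral_reduce)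
  finally have "l * x ^ 10 \<le> 32 * P * ?K * x ^ 26 * x ^ 10" using x1[of 10] by (intro mult_right_mono) auto
  also have "\<dots> = 32 * (P * ?K * x ^ 36)" by (simp add: power_add[symmetric])
  finally have a: "l * x ^ 10 \<le> 32 * (P * ?K * x ^ 36)" .
  have "1 * 2 * 1 \<le> P * ?K * x ^ 36" using P K x1 by (intro mult_mono) auto
  then have "l * x ^ 10 + 1 \<le> 34 * (P * ?K * x ^ 36)" using a by linarith
  then show ?thesis by (simp only: mult_ac)
qed

text \<open>Replaces D + 1 by 2 D, since the bound sought is a power of the degree itself. In 37 =
  36 + 1 the last factor is the number of queries per vertex.\<close>

lemma degree_calc:
  fixes P Q L d :: real
  assumes d: "1 \<le> d" and x: "x = d + 1" and P: "0 \<le> P" "P \<le> Q * (2 * x) ^ c" and Q: "0 \<le> Q" and L: "0 \<le> L"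
  shows "34 * real k * P * L * x ^ 36 * d \<le> d ^ (c + 37) * (34 * real k * Q * 4 ^ c * 2 ^ 36 * L)"
proof -
  have "(2 * x) ^ c \<le> (4 * d) ^ c" by (rule power_mono) (use d x in auto)
  moreover have "x ^ 36 \<le> (2 * d) ^ 36" by (rule power_mono) (use d x in auto)
  ultimately have "P \<le> Q * (4 * d) ^ c" using P(2) Q mult_left_mono order_trans by blast
  then have "34 * real k * P * L * x ^ 36 * d \<le> 34 * real k * (Q * (4 * d) ^ c) * L * (2 * d) ^ 36 * d"
    using d x Q L P(1) \<open>x ^ 36 \<le> (2 * d) ^ 36\<close> by (intro mult_mono mult_nonneg_nonneg) auto
  also have "\<dots> = d ^ (c + 37) * (34 * real k * Q * 4 ^ c * 2 ^ 36 * L)"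
    unfolding power_mult_distrib power_add by (simp only: eval_nat_numeral power_Suc power_0) (simp only: mult_ac mult_1_right)
  finally show ?thesis .
qed

section \<open>The algorithm succeeds\<close>

lemma comp_cong:
  assumes "gph g V" "v \<in> V" and "\<And>y. y \<in> V \<Longrightarrow> tot g w T y = tot g w' T y"
  shows "comp g w T v = comp g w' T v"
proof -
  have "comp g w T v \<subseteq> comp g w' T v" if eq: "\<And>y. y \<in> V \<Longrightarrow> tot g w T y = tot g w' T y" for w w'
  proof
    fix y assume "y \<in> comp g w T v"
    then show "y \<in> comp g w' T v"
    proof induction
      case (comp_step y z)
      have "y \<in> V" using gph.comp_V[OF assms(1,2)] comp_step.hyps(1) by blast
      then have "tot g w' T y = None" using eq comp_step.hyps(2) by simp
      from comp.comp_step[OF comp_step.IH this comp_step.hyps(3)] show ?case .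
    qed (rule comp.comp_self)
  qed
  then show ?thesis using assms(3) by (metis subset_antisym)
qed

text \<open>Makes the success event depend on finitely many seeds. Seeds of late stages are removed
  by the congruence lemmas, those outside the vertex set by locality.\<close>

lemma need_cong:
  assumes G: "gph g V" and v: "v \<in> V" and eq: "\<And>u c. u \<in> V \<Longrightarrow> c < 3 + T \<Longrightarrow> w (u, c) = w' (u, c)"
  shows "need g w T v = need g w' T v"
proof -
  define cut where "cut f = (\<lambda>(u, c). if u \<in> V \<and> c < 3 + T then f (u, c) else 0)" for f :: seeds
  have "need g f T v = need g (cut f) T v" for f
  proof -
    define h where "h = (\<lambda>(u, c). if c < 3 + T then f (u, c) else (0 :: nat))"
    have "need g f T v = need g h T v"
    proof -
      have fh: "c < 3 + T \<Longrightarrow> f (u, c) = h (u, c)" for u c by (simp add: h_def)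
      have "col2 g f = col2 g h" by (rule pre_cong) (simp add: fh)
      moreover have "chi g f T = chi g h T" by (rule chi_cong) (rule fh)
      ultimately have "tot g f T = tot g h T" unfolding tot_def[abs_def] by (simp only:)
      then have "comp g f T v = comp g h T v" by (intro comp_cong[OF G v]) simp
      moreover have "items g f T Q = items g h T Q" for Q by (rule items_cong) (rule fh)
      ultimately show ?thesis unfolding need_def by simp
    qed
    also have "need g h T v = need g (cut f) T v"
    proof -
      have ag: "agr k g h g (cut f) u" if "u \<in> V" for k u
        using gph.bll_V[OF G that] by (intro agr_bll) (auto simp: same_def h_def cut_def)
      have it: "items g h T {(y, None)} = items g (cut f) T {(y, None)} \<and> chi g h T y = chi g (cut f) T y" if y: "y \<in> V" for y
      proof -
        have "fst ` items g h T {(y, None)} \<subseteq> V" using y by (intro gph.items_V[OF G]) simp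
        then have "agr 10 g h g (cut f) x" if "x \<in> fst ` items g h T {(y, None)}" for x using that ag by blast
        from items_loc[OF this] show ?thesis by blast
      qed
      have "tot g h T y = tot g (cut f) T y" if "y \<in> V" for y
        unfolding tot_def using it[OF that] col2_loc[OF ag[OF that]] by (simp only:)
      then have c: "comp g h T v = comp g (cut f) T v" by (rule comp_cong[OF G v])
      have "items g h T {(y, None)} = items g (cut f) T {(y, None)}" if "y \<in> comp g (cut f) T v" for y
        using it gph.comp_V[OF G v] that by blast
      then show ?thesis unfolding need_def c by simp
    qed
    finally show ?thesis .
  qed
  moreover have "cut w = cut w'" using eq by (auto simp: cut_def fun_eq_iff)
  ultimately show ?thesis by metis
qed

text \<open>The number of rounds makes \<open>(1 - 1 / (8 H\<^sup>2)) ^ T\<close> at most \<open>delt D\<close>; the summands of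
  \<open>p_b\<close> give enough bits for a random injection, a late trial, and the first trial.\<close>

definition params :: "nat \<Rightarrow> nat \<Rightarrow> nat \<Rightarrow> par" where
  "params H D0 D = \<lparr>p_dg = D, p_hh = H, p_big = (D0 \<le> D), p_T = 8 * H\<^sup>2 * (2 + 48 * kk (D + 1)),
     p_b = (D + 1) * (D + 1) + 4 * H * (D + 1) + 2048 * (D + 1)\<rparr>"

definition comp_bound :: "nat \<Rightarrow> nat \<Rightarrow> nat \<Rightarrow> nat" where
  "comp_bound k n D = nat \<lceil>real (k + 2) * ln (real n)\<rceil> * (D + 1) ^ 24"

definition item_bound :: "nat \<Rightarrow> nat \<Rightarrow> nat \<Rightarrow> nat \<Rightarrow> nat \<Rightarrow> real" where
  "item_bound k T n N D = 4 * 6 ^ T * (real D + 2) *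
     (real N + 2 * real N * ln (real D + 1) + real (k + 2) * ln (real n))"

text \<open>\<open>D0\<close> marks where \<open>perr\<close> is below \<open>delt\<close>; smaller
  degrees are also smaller than \<open>H\<close> and handled by \<open>prebad_small\<close>. The
  final theorem chooses both independently of the input.\<close>

locale instance_graph =
  fixes k H D0 :: nat and I :: input
  assumes I: "list_coloring_input I"
    and D0: "200 ^ 4 \<le> D0" "\<And>D. D0 \<le> D \<Longrightarrow> perr D \<le> delt D"
    and H: "2 ^ 52 \<le> H" "D0 \<le> H"
begin

abbreviation "D \<equiv> max_degree I"
abbreviation "V \<equiv> verts I"
abbreviation "p \<equiv> params H D0 D"
abbreviation "g \<equiv> gr_of p I"
abbreviation "n \<equiv> card V"
abbreviation "N \<equiv> comp_bound k n D"
abbreviation "l \<equiv> item_bound k (p_T p) n N D"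
abbreviation "J \<equiv> V \<times> {..<3 + p_T p}"

lemma par_sel: "dg g = D" "hh g = H" "big g \<longleftrightarrow> D0 \<le> D" "p_dg p = D"
  by (simp_all add: gr_of_def params_def)

lemma nb_g: "u \<in> V \<Longrightarrow> nb g u = set (nbrs I u)" and pal_g: "palette I v = pal g v"
  by (simp_all add: gr_of_def)

lemma G: "gph g V"
  by (rule gph_of[OF I]) (simp add: params_def)

lemma H1: "1 \<le> H"
  using H(1) by (rule order_trans[rotated]) simp

sublocale gph_rounds g V "p_b p"
proof (rule gph_rounds.intro[OF G])
  show "gph_rounds_axioms g (p_b p)"
  proof
    show "1 \<le> hh g" unfolding par_sel by (rule H1)
    show "4 * hh g * (dg g + 1) \<le> p_b p" unfolding par_sel by (simp add: params_def)
  qed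
qed

lemma prebad_delt:
  assumes v: "v \<in> V"
  shows "prb (2 ^ p_b p) (V \<times> {..<3}) (\<lambda>w. prebad g w v) \<le> delt D"
proof (cases "D0 \<le> D")
  case False
  have "\<not> prebad g w v" for w
    by (rule prebad_small[OF _ _ v]) (use False H in \<open>simp_all add: par_sel\<close>)
  then have "prb (2 ^ p_b p) (V \<times> {..<3}) (\<lambda>w. prebad g w v) = 0" by (simp add: avg_def)
  then show ?thesis by (simp add: delt_def)
next
  case True
  have D1: "200 ^ 4 \<le> D" using True D0 by linarith
  have big: "gph_big g V (p_b p)"
  proof (rule gph_big.intro[OF G], unfold_locales)
    show "big g" using True by (simp add: par_sel)
    show "1 \<le> dg g" using D1 by (simp add: par_sel)
    show "kk (2048 * (dg g + 1)) \<le> p_b p"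
      using kk_le[of "2048 * (D + 1)"] unfolding par_sel(1) by (simp add: params_def)
  qed
  have "(D + 1) ^ (D + 1) \<le> (2 ^ (D + 1)) ^ (D + 1)"
    by (intro power_mono) (use less_exp[of "D + 1"] in linarith, simp)
  also have "\<dots> \<le> 2 ^ p_b p" unfolding power_mult[symmetric] by (intro power_increasing) (simp_all add: params_def)
  finally have "prb (2 ^ p_b p) (V \<times> {..<3}) (\<lambda>w. prebad g w v) \<le> perr (dg g)"
    by (intro gph_big.prebad_prob[OF big v]) (use H D1 in \<open>auto simp: par_sel\<close>)
  then show ?thesis using D0(2)[OF True] by (simp add: par_sel)
qed

lemma need_success:
  assumes n: "2 \<le> n"
  shows "1 - 1 / real n ^ k \<le> prb (2 ^ p_b p) J (\<lambda>w. \<forall>v\<in>V. real (card (need g w (p_T p) v)) \<le> l * (real D + 1) ^ 10)"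
proof -
  let ?E = "\<lambda>w. \<exists>v\<in>V. real (card (need g w (p_T p) v)) > l * (real D + 1) ^ 10"
  define m where "m = nat \<lceil>real (k + 2) * ln (real n)\<rceil>"
  have ln0: "0 < real (k + 2) * ln (real n)" using n by simp
  have m: "real (k + 2) * ln (real n) \<le> real m" unfolding m_def by (rule real_nat_ceiling_ge)
  then have m1: "1 \<le> m" using ln0 by (cases m) auto
  have kk: "real D + 1 \<le> 2 ^ kk (D + 1)"
    using of_nat_mono[OF kk_ge[of "D + 1"], where 'a = real] by simp
  have d1: "(1 - 1 / (8 * (real (hh g))\<^sup>2)) ^ p_T p \<le> delt D"
    using delt_pow[OF H1 kk] by (simp only: par_sel) (simp add: params_def)
  have x0: "0 < (real D + 1) ^ 48" by simp
  have x: "(real D + 1) ^ 48 * (2 * delt D) = 1 / 3"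
  proof -
    have "a * (2 * (1 / (6 * a))) = 1 / 3" if "0 < a" for a :: real using that by simp
    from this[OF x0] show ?thesis unfolding delt_def .
  qed
  have N: "N = m * (dg g + 1) ^ 24" by (simp add: comp_bound_def m_def par_sel)
  have l: "l / (4 * 6 ^ p_T p * (real D + 2)) = real N + 2 * real N * ln (real D + 1) + real (k + 2) * ln (real n)"
  proof -
    have "0 < 4 * 6 ^ p_T p * (real D + 2)" by simp
    then have "4 * 6 ^ p_T p * (real D + 2) \<noteq> 0" by linarith
    then show ?thesis unfolding item_bound_def by (rule nonzero_mult_div_cancel_left)
  qed
  have "prb (2 ^ p_b p) J ?E \<le> real n * (((real D + 1) ^ 48 * (2 * delt D)) ^ m +
      (real D + 1) ^ (2 * N) * exp (real N - l / (4 * 6 ^ p_T p * (real D + 2))))"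
    using need_prob[OF _ d1 _ m1 N, of l] prebad_delt unfolding par_sel(1) by (simp add: delt_def)
  also have "\<dots> \<le> 1 / real n ^ k"
    by (rule union_calc[OF n _ x m l]) simp
  finally have E: "prb (2 ^ p_b p) J ?E \<le> 1 / real n ^ k" .
  have "prb (2 ^ p_b p) J (\<lambda>w. \<not> ?E w) + prb (2 ^ p_b p) J ?E = avg (2 ^ p_b p) J (\<lambda>_. 1)"
    unfolding avg_add[symmetric] by (intro arg_cong[where f = "avg _ _"] ext) simp
  also have "\<dots> = 1" using finV by (intro avg_const) auto
  finally show ?thesis using E by (simp add: not_less)
qed

definition fuel :: nat where
  "fuel = Suc (nat \<lfloor>l * (real D + 1) ^ 10\<rfloor>)"

lemma run_proper:
  assumes "\<forall>v\<in>V. real (card (need g (restrict (seeds_of p r) J) (p_T p) v)) \<le> l * (real D + 1) ^ 10"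
  shows "proper_list_coloring I (\<lambda>v. run I r (lp p v fuel Map.empty))"
proof -
  let ?s = "seeds_of p r"
  have run: "run I r (lp p v fuel Map.empty) = final g ?s (p_T p) v" if v: "v \<in> V" for v
  proof (rule lp_correct(3)[OF I par_sel(4) v])
    have "need g ?s (p_T p) v = need g (restrict ?s J) (p_T p) v"
      by (rule need_cong[OF G v]) simp
    then have "real (card (need g ?s (p_T p) v)) \<le> l * (real D + 1) ^ 10" using assms v by simp
    then have "card (need g ?s (p_T p) v) \<le> nat \<lfloor>l * (real D + 1) ^ 10\<rfloor>" by (simp add: le_nat_floor)
    then show "card (need g ?s (p_T p) v - dom Map.empty) < fuel" by (simp add: fuel_def)
  qed simp
  have nbg: "v \<in> nb g u" if "adj I u v" for u v
  proof -
    have "u \<in> V" "v \<in> V" using that I unfolding list_coloring_input_def simple_graph_def by blast+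
    then have "v \<in> set (nbrs I u)" using that I unfolding list_coloring_input_def by blast
    then show ?thesis using nb_g[OF \<open>u \<in> V\<close>] by blast
  qed
  show ?thesis unfolding proper_list_coloring_def
  proof (intro conjI ballI impI)
    fix v assume "v \<in> V" then show "run I r (lp p v fuel Map.empty) \<in> palette I v"
      using final_pal unfolding pal_g by (simp only: run)
  next
    fix u v assume u: "u \<in> V" "v \<in> V" "adj I u v"
    then show "run I r (lp p u fuel Map.empty) \<noteq> run I r (lp p v fuel Map.empty)"
      using final_proper[OF u(1) nbg[OF u(3)], of ?s "p_T p"] by (simp only: run not_False_eq_True)
  qed
qed

lemma success:
  "1 - 1 / real n ^ k \<le> measure (random_strings I)
     {r \<in> space (random_strings I). proper_list_coloring I (\<lambda>v. run I r (lp p v fuel Map.empty))}"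
proof (cases "2 \<le> n")
  case False
  have "n \<noteq> 0" using I finV by (auto simp: list_coloring_input_def simple_graph_def)
  \<comment> \<open>The claimed bound is then 1 - 1 = 0.\<close>
  then have "n = 1" using False by linarith
  then show ?thesis by simp
next
  case True
  let ?Q = "\<lambda>w. \<forall>v\<in>V. real (card (need g w (p_T p) v)) \<le> l * (real D + 1) ^ 10"
  interpret P: prob_space "random_strings I" by (rule prob_space_random_strings)
  have "1 - 1 / real n ^ k \<le> prb (2 ^ p_b p) J ?Q" by (rule need_success[OF True])
  also have "\<dots> = measure (random_strings I) {r \<in> space (random_strings I). ?Q (restrict (seeds_of p r) J)}"
    by (rule random_strings_seeds(1)[OF finV refl, symmetric])
  also have "\<dots> \<le> measure (random_strings I)
     {r \<in> space (random_strings I). proper_list_coloring I (\<lambda>v. run I r (lp p v fuel Map.empty))}"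
  proof (rule P.finite_measure_mono)
    show "{r \<in> space (random_strings I). proper_list_coloring I (\<lambda>v. run I r (lp p v fuel Map.empty))} \<in> sets (random_strings I)"
      by (rule proper_event[OF finV]) (rule lp_correct(1)[OF I par_sel(4)], auto)
  qed (use run_proper in blast)
  finally show ?thesis .
qed

lemma query_bound:
  assumes v: "v \<in> V"
  shows "real (queries I r (lp p v fuel Map.empty)) \<le> real D ^ (1152 * H\<^sup>2 + 37) *
    ((34 * real (k + 4) * 6 ^ (16 * H\<^sup>2) * 4 ^ (1152 * H\<^sup>2) * 2 ^ 36) * ln (real n))"
proof -
  have "queries I r (lp p v fuel Map.empty) \<le> fuel * p_dg p"
    by (rule lp_correct(2)[OF I par_sel(4) v]) simp
  then have q: "real (queries I r (lp p v fuel Map.empty)) \<le> real fuel * real D"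
    unfolding par_sel(4) of_nat_mult[symmetric] by (rule of_nat_mono)
  have n0: "0 < n" using v finV by (auto simp: card_gt_0_iff)
  show ?thesis
  proof (cases "D = 0")
    \<comment> \<open>For degree 0, reading a vertex takes no query.\<close>
    case True
    then show ?thesis using q n0 by simp
  next
    case False
    \<comment> \<open>A positive maximum degree requires two vertices; then ln n is at least 1/2 and
      absorbs additive constants.\<close>
    have "n \<noteq> 1"
    proof
      assume "n = 1"
      then obtain x where x: "V = {x}" using card_1_singletonE by blast
      have "simple_graph I" using I by (simp add: list_coloring_input_def)
      then have "{u \<in> V. adj I x u} = {}" unfolding simple_graph_def using x by blast
      then have "degree I x = 0" unfolding degree_def by (simp only: card.empty)
      then show False using False x by (simp add: max_degree_def)
    qed
    then have n2: "2 \<le> n" using n0 by linarith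
    let ?L = "ln (real n)" and ?x = "real D + 1"
    have "ln 2 \<le> ?L" using n2 by simp
    then have L: "1 / 2 \<le> ?L" using ln2_ge_half by linarith
    have x2: "2 \<le> ?x" using False by simp
    have P1: "(1 :: real) \<le> 6 ^ p_T p" by (rule one_le_power) simp
    define m where "m = nat \<lceil>real (k + 2) * ?L\<rceil>"
    have m: "real m \<le> real (k + 2) * ?L + 1"
    proof -
      have "0 \<le> real (k + 2) * ?L" using L by simp
      then show ?thesis unfolding m_def using of_int_ceiling_le_add_one[of "real (k + 2) * ?L"] by simp
    qed
    have N: "real N = real m * ?x ^ 24" by (simp add: comp_bound_def m_def add.commute)
    have l: "l = 4 * 6 ^ p_T p * (?x + 1) * (real N + 2 * real N * ln ?x + real (k + 2) * ?L)"
      unfolding item_bound_def by (simp add: add.assoc)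
    have "0 \<le> ln ?x" "ln ?x \<le> ?x" using x2 ln_le_minus_one[of ?x] by auto
    from fuel_calc[OF x2 L P1 this m N l]
    have f: "l * ?x ^ 10 + 1 \<le> 34 * real (k + 4) * 6 ^ p_T p * ?L * ?x ^ 36" .
    have l0: "0 \<le> l * ?x ^ 10"
      unfolding l using x2 L \<open>0 \<le> ln ?x\<close> by (intro mult_nonneg_nonneg add_nonneg_nonneg) auto
    have "real fuel \<le> l * ?x ^ 10 + 1" unfolding fuel_def using l0 by simp
    then have "real fuel * real D \<le> 34 * real (k + 4) * 6 ^ p_T p * ?L * ?x ^ 36 * real D"
      using f by (intro mult_right_mono) auto
    also have "\<dots> \<le> real D ^ (1152 * H\<^sup>2 + 37) * (34 * real (k + 4) * 6 ^ (16 * H\<^sup>2) * 4 ^ (1152 * H\<^sup>2) * 2 ^ 36 * ?L)"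
    proof (rule degree_calc)
      have "(2 :: real) ^ kk (D + 1) \<le> 2 * ?x"
        using of_nat_mono[OF less_imp_le[OF kk_less[of "D + 1"]], where 'a = real] by simp
      then have "((2 :: real) ^ kk (D + 1)) ^ (1152 * H\<^sup>2) \<le> (2 * ?x) ^ (1152 * H\<^sup>2)" by (intro power_mono) auto
      then have "(6 :: real) ^ (16 * H\<^sup>2) * (2 ^ kk (D + 1)) ^ (1152 * H\<^sup>2) \<le> 6 ^ (16 * H\<^sup>2) * (2 * ?x) ^ (1152 * H\<^sup>2)"
        by (intro mult_left_mono) auto
      moreover have "(6 :: real) ^ p_T p \<le> 6 ^ (16 * H\<^sup>2) * (2 ^ kk (D + 1)) ^ (1152 * H\<^sup>2)"
        using six_pow[of "H\<^sup>2" "kk (D + 1)"] by (simp add: params_def)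
      ultimately show "6 ^ p_T p \<le> 6 ^ (16 * H\<^sup>2) * (2 * ?x) ^ (1152 * H\<^sup>2)" using order_trans by blast
    qed (use False L in auto)
    finally show ?thesis using q by simp
  qed
qed

end

theorem theorem1p3:
  fixes k :: nat
  shows "\<exists>(A :: nat \<Rightarrow> nat \<Rightarrow> nat \<Rightarrow> lca) (c :: nat) (C :: real).
    \<forall>(n :: nat) (\<Delta> :: nat) (I :: input).
      list_coloring_input I \<and> card (verts I) = n \<and> max_degree I = \<Delta> \<longrightarrow>
        (\<forall>v \<in> verts I. \<forall>r. legal_run I r (A n \<Delta> v) \<and>
           real (queries I r (A n \<Delta> v)) \<le> real \<Delta> ^ c * (C * ln (real n))) \<and>
        \<P>(r in random_strings I. proper_list_coloring I (\<lambda>v. run I r (A n \<Delta> v)))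
          \<ge> 1 - 1 / real n ^ k"
proof -
  obtain D1 where D1: "\<forall>D\<ge>D1. perr D \<le> delt D" using perr_small by blast
  define D0 where "D0 = max (200 ^ 4) D1"
  define H where "H = max (2 ^ 52) D0"
  have ig: "instance_graph H D0 I" if "list_coloring_input I" for I
  proof
    show "200 ^ 4 \<le> D0" unfolding D0_def by (rule max.cobounded1)
    show "perr D \<le> delt D" if "D0 \<le> D" for D
    proof -
      have "D1 \<le> D0" unfolding D0_def by (rule max.cobounded2)
      then show ?thesis using D1 that order_trans by blast
    qed
    show "2 ^ 52 \<le> H" "D0 \<le> H" unfolding H_def by (rule max.cobounded1, rule max.cobounded2)
  qed (rule that)
  \<comment> \<open>The counter is \<open>fuel\<close> written out, to show that it depends only on
    n and the maximum degree.\<close>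
  define A where "A n D v = lp (params H D0 D) v
    (Suc (nat \<lfloor>item_bound k (p_T (params H D0 D)) n (comp_bound k n D) D * (real D + 1) ^ 10\<rfloor>)) Map.empty" for n D v
  let ?C = "34 * real (k + 4) * 6 ^ (16 * H\<^sup>2) * 4 ^ (1152 * H\<^sup>2) * 2 ^ 36"
  have "(\<forall>v \<in> verts I. \<forall>r. legal_run I r (A (card (verts I)) (max_degree I) v) \<and>
      real (queries I r (A (card (verts I)) (max_degree I) v)) \<le> real (max_degree I) ^ (1152 * H\<^sup>2 + 37) * (?C * ln (real (card (verts I))))) \<and>
      \<P>(r in random_strings I. proper_list_coloring I (\<lambda>v. run I r (A (card (verts I)) (max_degree I) v)))
        \<ge> 1 - 1 / real (card (verts I)) ^ k" if I: "list_coloring_input I" for I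
  proof -
    note ig = ig[OF I]
    have A: "A (card (verts I)) (max_degree I) v = lp (params H D0 (max_degree I)) v (instance_graph.fuel k H D0 I) Map.empty" for v
      unfolding A_def instance_graph.fuel_def[OF ig] ..
    have "legal_run I r (A (card (verts I)) (max_degree I) v)" if "v \<in> verts I" for v r
      unfolding A by (rule lp_correct(1)[OF I instance_graph.par_sel(4)[OF ig] that]) simp
    then show ?thesis
      using instance_graph.query_bound[OF ig] instance_graph.success[OF ig] unfolding A by blast
  qed
  then show ?thesis by (intro exI[of _ A] exI[of _ "1152 * H\<^sup>2 + 37"] exI[of _ ?C]) blast
qed

end
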